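(* Let $\mu$ be a probability measure on $S$ with marginals $\mu_t\in M_t$, and let $h$ be a convex $\mathcal B(S)$-normal integrand on $\mathbb R$ with $h(\cdot,s)$ nondecreasing for every $s$. Let $D(s)=\operatorname{cl}\operatorname{dom}h(\cdot,s)$ and $H(u)=\int_Sh(u(s),s)\,d\mu(s)+\delta_{C(D)}(u)$ for $u\in C$. Assume that $D$ is inner semicontinuous, that $\operatorname{cl}\operatorname{dom}H=C(D)$, that $H$ is finite and continuous at some $u\in C$, that $h^*(v,\cdot)$ is $\mu$-integrable for $v\in\mathbb R$ in a neighborhood of $1$, and that either $\mu=\prod_{t=0}^T\mu_t$ or $T=1$ and $\prod_{t=0}^T\mu_t\ll\mu$. Consider the problems \[ \text{(A)}\quad\text{minimize}\quad H^*(\lambda)\quad\text{over }\lambda\in M\quad\text{subject to}\quad\lambda_t=\mu_t,\ t=0,\dots,T, \] \[ \text{(B)}\quad\text{minimize}\quad\int_S\Big[\sum_{t=0}^Tx_t+h\Big(-\sum_{t=0}^Tx_t\Big)\Big]d\mu\quad\text{over }x\in\Phi . \] Then the optima in (A) and (B) are attained, there is no duality gap (i.e. $\inf(\mathrm B)=-\inf(\mathrm A)$), and feasible solutions $x$ of (B) and $\lambda$ of (A) are optimal if and only if \begin{align*} d\lambda^a/d\mu&\in\partial h\Big(-\sum_{t=0}^Tx_t\Big)\quad\mu\text{-a.e.},\\ d\lambda^s/d|\lambda^s|&\in N_D\Big(-\sum_{t=0}^Tx_t\Big)\quad|\lambda^s|\text{-a.e.} \end{align*} If, in addition, $\mu=\prod_{t=0}^T\mu_t$,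 then $x_t\in\mathcal L^1_t$ for each $t$ and each feasible $x$ in (B).
   Context: $S_0,\dots,S_T$ are Polish spaces, $S=S_0\times\cdots\times S_T$, $\psi_t:S_t\to[1,\infty)$ are continuous, $\psi(s)=\sum_{t=0}^T\psi_t(s_t)$. $C:=\{u\in C(S)\mid u/\psi\text{ bounded}\}$ (real-valued) is a Banach space with norm $\sup|u/\psi|$. $M_t$ (resp. $M$) is the space of finite signed Borel measures on $S_t$ (resp. $S$) under which $\psi_t$ (resp. $\psi$) is integrable; $M\subseteq C^*$ through integration. $H^*$ is the convex conjugate of $H$ on $C^*$; $C(D)=\{u\in C\mid u(s)\in D(s)\ \forall s\}$; $\delta_{A}$ is the indicator function ($0$ on $A$, $+\infty$ off $A$). $\lambda_t$ is the $t$-th marginal of $\lambda$, and $\lambda^a$, $\lambda^s$ are its absolutely continuous and singular parts with respect to $\mu$. A convex $\mathcal B(S)$-normal integrand on $\mathbb R$ is a function $h:\mathbb R\times S\to\mathbb R\cup\{\pm\infty\}$ such that $s\mapsto\{(u,\alpha)\mid h(u,s)\le\alpha\}$ is $\mathcal B(S)$-measurable and closed convex-valued; $h^*(\cdot,s)$ and $\partial h(\cdot,s)$ are the conjugate and subdifferential of $h(\cdot,s)$. Integrals of extended-real-valued functions are $+\infty$ unless the positive part is integrable. $D$ is inner semicontinuous if $\{s\mid D(s)\cap O\neq\emptyset\}$ is open for each open $O$. $N_{D(s)}(u)=\{y\mid(u'-u)y\le0\ \forall u'\in D(s)\}$ if $u\in D(s)$, and $\emptyset$ otherwise. $\mathcal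 L^0_t$ (resp. $\mathcal L^1_t$) is the space of real Borel measurable (resp. $\mu_t$-integrable) functions on $S_t$; $x_t$ is identified with $s\mapsto x_t(s_t)$; and \[ \Phi=\Big\{x\in\prod_{t=0}^T\mathcal L^0_t\ \Big|\ -\sum_{t=0}^Tx_t\in D\quad(\mu_t)_{t=0}^T\text{-a.e.}\Big\}, \] where "$(\mu_t)_{t=0}^T$-a.e." means on a set $\prod_{t=0}^TA_t$ with $A_t\in\mathcal B(S_t)$, $\mu_t(A_t)=1$. "Feasible" means satisfying the constraints with objective value less than $+\infty$. *)

theory Defs
  imports "HOL-Probability.Probability"
begin

section \<open>Polish spaces and their products\<close>

definition polish_topology :: "'a topology \<Rightarrow> bool" where
  "polish_topology X \<longleftrightarrow> completely_metrizable_space X \<and> separable_space X"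

definition borel_of :: "'a topology \<Rightarrow> 'a measure" where
  "borel_of X = sigma (topspace X) {U. openin X U}"

text \<open>
  The factors \<open>S 0, \<dots>, S T\<close> are topologies on possibly different subsets of one carrier type
  (which may be a sum type). A point of the product is a function on \<open>{..T}\<close>, extended by
  \<^const>\<open>undefined\<close>.
\<close>

abbreviation prod_top :: "nat \<Rightarrow> (nat \<Rightarrow> 'a topology) \<Rightarrow> (nat \<Rightarrow> 'a) topology" where
  "prod_top T S \<equiv> product_topology S {..T}"

definition weight :: "nat \<Rightarrow> (nat \<Rightarrow> 'a \<Rightarrow> real) \<Rightarrow> (nat \<Rightarrow> 'a) \<Rightarrow> real" where
  "weight T \<psi> s = (\<Sum>t\<le>T. \<psi> t (s t))"

definition marg :: "(nat \<Rightarrow> 'a topology) \<Rightarrow> (nat \<Rightarrow> 'a) measure \<Rightarrow> nat \<Rightarrow> 'a measure" where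
  "marg S \<mu> t = distr \<mu> (borel_of (S t)) (\<lambda>s. s t)"


section \<open>Weighted spaces of continuous functions\<close>

text \<open>
  Functions on \<open>topspace X\<close> are made unique by taking them \<^const>\<open>extensional\<close>, so that the
  weighted distance separates points. The distance is set to \<open>0\<close> outside the space because
  \<^locale>\<open>Metric_space\<close> requires nonnegativity and symmetry on the whole type.
\<close>

definition wC :: "'b topology \<Rightarrow> ('b \<Rightarrow> real) \<Rightarrow> ('b \<Rightarrow> real) set" where
  "wC X w = {u \<in> extensional (topspace X).
     continuous_map X euclideanreal u \<and> bounded ((\<lambda>s. u s / w s) ` topspace X)}"

definition wdist :: "'b topology \<Rightarrow> ('b \<Rightarrow> real) \<Rightarrow> ('b \<Rightarrow> real) \<Rightarrow> ('b \<Rightarrow> real) \<Rightarrow> real" where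
  "wdist X w u v =
     (if u \<in> wC X w \<and> v \<in> wC X w then SUP s\<in>topspace X. \<bar>(u s - v s) / w s\<bar> else 0)"

lemma Metric_space_wC:
  assumes ne: "topspace X \<noteq> {}" and w: "\<And>s. s \<in> topspace X \<Longrightarrow> 1 \<le> w s"
  shows "Metric_space (wC X w) (wdist X w)"
proof
  have bdd: "bdd_above ((\<lambda>s. \<bar>(u s - v s) / w s\<bar>) ` topspace X)"
    if "u \<in> wC X w" "v \<in> wC X w" for u v
  proof -
    from that obtain a b where ab:
      "\<And>s. s \<in> topspace X \<Longrightarrow> \<bar>u s / w s\<bar> \<le> a" "\<And>s. s \<in> topspace X \<Longrightarrow> \<bar>v s / w s\<bar> \<le> b"
      unfolding wC_def bounded_iff by auto
    have "\<bar>(u s - v s) / w s\<bar> \<le> a + b" if "s \<in> topspace X" for s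
      using ab[OF that] unfolding diff_divide_distrib by linarith
    then show ?thesis by (intro bdd_aboveI2[where M="a + b"]) auto
  qed
  have eq: "wdist X w u v = (SUP s\<in>topspace X. \<bar>(u s - v s) / w s\<bar>)"
    if "u \<in> wC X w" "v \<in> wC X w" for u v
    using that by (simp add: wdist_def)
  have le: "\<bar>(u s - v s) / w s\<bar> \<le> wdist X w u v"
    if "u \<in> wC X w" "v \<in> wC X w" "s \<in> topspace X" for u v s
    unfolding eq[OF that(1,2)] by (rule cSUP_upper[OF that(3) bdd[OF that(1,2)]])
  show "wdist X w u v = wdist X w v u" for u v
    unfolding wdist_def by (simp add: abs_minus_commute abs_divide conj_commute)
  show "0 \<le> wdist X w u v" for u v
  proof (cases "u \<in> wC X w \<and> v \<in> wC X w")
    case True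
    obtain s where "s \<in> topspace X" using ne by (metis equals0I)
    with le[of u v s] True show ?thesis
      by (meson abs_ge_zero order_trans)
  qed (auto simp: wdist_def)
  show "wdist X w u v = 0 \<longleftrightarrow> u = v" if "u \<in> wC X w" "v \<in> wC X w" for u v
  proof
    assume 0: "wdist X w u v = 0"
    show "u = v"
    proof (rule extensionalityI[of _ "topspace X"])
      show "u \<in> extensional (topspace X)" "v \<in> extensional (topspace X)"
        using that by (auto simp: wC_def)
      fix s assume s: "s \<in> topspace X"
      have "\<bar>(u s - v s) / w s\<bar> \<le> 0" using le[OF that s] 0 by simp
      then have "(u s - v s) / w s = 0" by linarith
      with w[OF s] show "u s = v s" by auto
    qed
  qed (use ne in \<open>simp add: wdist_def\<close>)
  show "wdist X w u z \<le> wdist X w u v + wdist X w v z"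
    if "u \<in> wC X w" "v \<in> wC X w" "z \<in> wC X w" for u v z
  proof -
    have "\<bar>(u s - z s) / w s\<bar> \<le> wdist X w u v + wdist X w v z" if s: "s \<in> topspace X" for s
      using le[OF \<open>u \<in> _\<close> \<open>v \<in> _\<close> s] le[OF \<open>v \<in> _\<close> \<open>z \<in> _\<close> s]
      unfolding diff_divide_distrib by linarith
    then show ?thesis unfolding eq[OF that(1,3)] by (intro cSUP_least ne)
  qed
qed

abbreviation wC_top :: "'b topology \<Rightarrow> ('b \<Rightarrow> real) \<Rightarrow> ('b \<Rightarrow> real) topology" where
  "wC_top X w \<equiv> Metric_space.mtopology (wC X w) (wdist X w)"


section \<open>Finite signed measures\<close>

text \<open>
  A finite signed measure on the \<open>\<sigma>\<close>-algebra of \<open>M\<close> is a real-valued countably additive set function,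
  put to \<open>0\<close> on nonmeasurable sets so that equality of set functions is equality of signed
  measures. Only \<^term>\<open>space M\<close> and \<^term>\<open>sets M\<close> matter.
\<close>

definition signed_measure :: "'b measure \<Rightarrow> ('b set \<Rightarrow> real) \<Rightarrow> bool" where
  "signed_measure M \<nu> \<longleftrightarrow>
     \<nu> {} = 0 \<and>
     (\<forall>A. range A \<subseteq> sets M \<longrightarrow> disjoint_family A \<longrightarrow> (\<lambda>i::nat. \<nu> (A i)) sums \<nu> (\<Union>i. A i)) \<and>
     (\<forall>A. A \<notin> sets M \<longrightarrow> \<nu> A = 0)"

text \<open>The Jordan decomposition is \<open>\<nu> = \<nu>\<^sup>+ - \<nu>\<^sup>-\<close> with \<open>\<nu>\<^sup>+ A = sup {\<nu> B | B \<subseteq> A}\<close> and \<open>\<nu>\<^sup>- = (-\<nu>)\<^sup>+\<close>.\<close>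

definition pos_var :: "'b measure \<Rightarrow> ('b set \<Rightarrow> real) \<Rightarrow> 'b measure" where
  "pos_var M \<nu> = measure_of (space M) (sets M) (\<lambda>A. SUP B\<in>{B \<in> sets M. B \<subseteq> A}. ennreal (\<nu> B))"

definition neg_var :: "'b measure \<Rightarrow> ('b set \<Rightarrow> real) \<Rightarrow> 'b measure" where
  "neg_var M \<nu> = pos_var M (\<lambda>A. - \<nu> A)"

definition total_var :: "'b measure \<Rightarrow> ('b set \<Rightarrow> real) \<Rightarrow> 'b measure" where
  "total_var M \<nu> =
     measure_of (space M) (sets M) (\<lambda>A. emeasure (pos_var M \<nu>) A + emeasure (neg_var M \<nu>) A)"

definition signed_integral :: "'b measure \<Rightarrow> ('b set \<Rightarrow> real) \<Rightarrow> ('b \<Rightarrow> real) \<Rightarrow> real" where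
  "signed_integral M \<nu> u = (\<integral>s. u s \<partial>pos_var M \<nu>) - (\<integral>s. u s \<partial>neg_var M \<nu>)"

definition wM :: "'b topology \<Rightarrow> ('b \<Rightarrow> real) \<Rightarrow> ('b set \<Rightarrow> real) set" where
  "wM X w = {\<nu>. signed_measure (borel_of X) \<nu> \<and> integrable (total_var (borel_of X) \<nu>) w}"

definition signed_ac :: "'b measure \<Rightarrow> ('b set \<Rightarrow> real) \<Rightarrow> bool" where
  "signed_ac \<mu> \<nu> \<longleftrightarrow> (\<forall>A\<in>null_sets \<mu>. \<nu> A = 0)"

definition signed_singular :: "'b measure \<Rightarrow> ('b set \<Rightarrow> real) \<Rightarrow> bool" where
  "signed_singular \<mu> \<nu> \<longleftrightarrow> (\<exists>N\<in>null_sets \<mu>. \<forall>A\<in>sets \<mu>. A \<inter> N = {} \<longrightarrow> \<nu> A = 0)"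

definition ac_part :: "'b measure \<Rightarrow> ('b set \<Rightarrow> real) \<Rightarrow> ('b set \<Rightarrow> real)" where
  "ac_part \<mu> \<nu> = (THE \<nu>a. signed_measure \<mu> \<nu>a \<and> signed_ac \<mu> \<nu>a \<and>
                      signed_singular \<mu> (\<lambda>A. \<nu> A - \<nu>a A))"

definition sing_part :: "'b measure \<Rightarrow> ('b set \<Rightarrow> real) \<Rightarrow> ('b set \<Rightarrow> real)" where
  "sing_part \<mu> \<nu> = (\<lambda>A. \<nu> A - ac_part \<mu> \<nu> A)"

text \<open>A version of the Radon--Nikodym density \<open>d\<nu>/d\<mu>\<close>; it is unique \<open>\<mu>\<close>-almost everywhere.\<close>

definition signed_density :: "'b measure \<Rightarrow> ('b set \<Rightarrow> real) \<Rightarrow> 'b \<Rightarrow> real" where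
  "signed_density \<mu> \<nu> =
     (SOME f. integrable \<mu> f \<and> (\<forall>A\<in>sets \<mu>. \<nu> A = (\<integral>s\<in>A. f s \<partial>\<mu>)))"


section \<open>Extended-real integrals and normal integrands\<close>

definition ext_integral :: "'b measure \<Rightarrow> ('b \<Rightarrow> ereal) \<Rightarrow> ereal" where
  "ext_integral M f =
     (if (\<integral>\<^sup>+ s. e2ennreal (f s) \<partial>M) = \<infinity> then \<infinity>
      else enn2ereal (\<integral>\<^sup>+ s. e2ennreal (f s) \<partial>M) - enn2ereal (\<integral>\<^sup>+ s. e2ennreal (- f s) \<partial>M))"

definition ext_integrable :: "'b measure \<Rightarrow> ('b \<Rightarrow> ereal) \<Rightarrow> bool" where
  "ext_integrable M f \<longleftrightarrow>
     f \<in> borel_measurable M \<and> (\<integral>\<^sup>+ s. e2ennreal \<bar>f s\<bar> \<partial>M) < \<infinity>"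

definition indic :: "'b set \<Rightarrow> 'b \<Rightarrow> ereal" where
  "indic A x = (if x \<in> A then 0 else \<infinity>)"

definition epi :: "(real \<Rightarrow> 'b \<Rightarrow> ereal) \<Rightarrow> 'b \<Rightarrow> (real \<times> real) set" where
  "epi h s = {(u, \<alpha>). h u s \<le> ereal \<alpha>}"

definition convex_normal_integrand :: "'b measure \<Rightarrow> (real \<Rightarrow> 'b \<Rightarrow> ereal) \<Rightarrow> bool" where
  "convex_normal_integrand M h \<longleftrightarrow>
     (\<forall>U. open U \<longrightarrow> {s \<in> space M. epi h s \<inter> U \<noteq> {}} \<in> sets M) \<and>
     (\<forall>s\<in>space M. closed (epi h s) \<and> convex (epi h s))"

definition integrand_conj :: "(real \<Rightarrow> 'b \<Rightarrow> ereal) \<Rightarrow> real \<Rightarrow> 'b \<Rightarrow> ereal" where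
  "integrand_conj h v s = (SUP u. ereal (u * v) - h u s)"

definition integrand_subdiff :: "(real \<Rightarrow> 'b \<Rightarrow> ereal) \<Rightarrow> real \<Rightarrow> 'b \<Rightarrow> real set" where
  "integrand_subdiff h u s = {y. \<forall>u'. h u s + ereal (y * (u' - u)) \<le> h u' s}"

definition cl_dom :: "(real \<Rightarrow> 'b \<Rightarrow> ereal) \<Rightarrow> 'b \<Rightarrow> real set" where
  "cl_dom h s = closure {u. h u s < \<infinity>}"

definition inner_semicontinuous :: "'b topology \<Rightarrow> ('b \<Rightarrow> real set) \<Rightarrow> bool" where
  "inner_semicontinuous X D \<longleftrightarrow>
     (\<forall>U. open U \<longrightarrow> openin X {s \<in> topspace X. D s \<inter> U \<noteq> {}})"

definition ncone :: "real set \<Rightarrow> real \<Rightarrow> real set" where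
  "ncone K u = (if u \<in> K then {y. \<forall>u'\<in>K. (u' - u) * y \<le> 0} else {})"

definition wC_sel :: "'b topology \<Rightarrow> ('b \<Rightarrow> real) \<Rightarrow> ('b \<Rightarrow> real set) \<Rightarrow> ('b \<Rightarrow> real) set" where
  "wC_sel X w D = {u \<in> wC X w. \<forall>s\<in>topspace X. u s \<in> D s}"


section \<open>The functional \<open>H\<close> and the two problems\<close>

text \<open>Note \<open>-\<infinity> + \<infinity> = \<infinity>\<close> in \<^typ>\<open>ereal\<close>, so \<open>H\<close> is \<open>\<infinity>\<close> outside \<open>C(D)\<close>.\<close>

definition H_fun ::
  "'b topology \<Rightarrow> ('b \<Rightarrow> real) \<Rightarrow> 'b measure \<Rightarrow> (real \<Rightarrow> 'b \<Rightarrow> ereal) \<Rightarrow> ('b \<Rightarrow> real) \<Rightarrow> ereal" where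
  "H_fun X w \<mu> h u = ext_integral \<mu> (\<lambda>s. h (u s) s) + indic (wC_sel X w (cl_dom h)) u"

text \<open>The conjugate of \<open>H\<close> at a linear functional \<open>l\<close> on the space \<open>C\<close>\<close>

definition functional_conj ::
  "('b \<Rightarrow> real) set \<Rightarrow> (('b \<Rightarrow> real) \<Rightarrow> ereal) \<Rightarrow> (('b \<Rightarrow> real) \<Rightarrow> real) \<Rightarrow> ereal" where
  "functional_conj C H l = (SUP u\<in>C. ereal (l u) - H u)"

definition objA ::
  "'b topology \<Rightarrow> ('b \<Rightarrow> real) \<Rightarrow> 'b measure \<Rightarrow> (real \<Rightarrow> 'b \<Rightarrow> ereal) \<Rightarrow> ('b set \<Rightarrow> real) \<Rightarrow> ereal" where
  "objA X w \<mu> h \<nu> = functional_conj (wC X w) (H_fun X w \<mu> h) (signed_integral (borel_of X) \<nu>)"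

definition constrA ::
  "nat \<Rightarrow> (nat \<Rightarrow> 'a topology) \<Rightarrow> (nat \<Rightarrow> 'a \<Rightarrow> real) \<Rightarrow> (nat \<Rightarrow> 'a) measure
     \<Rightarrow> ((nat \<Rightarrow> 'a) set \<Rightarrow> real) set" where
  "constrA T S \<psi> \<mu> = {\<nu> \<in> wM (prod_top T S) (weight T \<psi>).
     \<forall>t\<le>T. \<forall>B\<in>sets (borel_of (S t)).
       \<nu> {s \<in> topspace (prod_top T S). s t \<in> B} = measure (marg S \<mu> t) B}"

abbreviation path_sum :: "nat \<Rightarrow> (nat \<Rightarrow> 'a \<Rightarrow> real) \<Rightarrow> (nat \<Rightarrow> 'a) \<Rightarrow> real" where
  "path_sum T x s \<equiv> (\<Sum>t\<le>T. x t (s t))"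

definition objB ::
  "nat \<Rightarrow> (nat \<Rightarrow> 'a) measure \<Rightarrow> (real \<Rightarrow> (nat \<Rightarrow> 'a) \<Rightarrow> ereal) \<Rightarrow> (nat \<Rightarrow> 'a \<Rightarrow> real) \<Rightarrow> ereal" where
  "objB T \<mu> h x = ext_integral \<mu> (\<lambda>s. ereal (path_sum T x s) + h (- path_sum T x s) s)"

definition constrB ::
  "nat \<Rightarrow> (nat \<Rightarrow> 'a topology) \<Rightarrow> (nat \<Rightarrow> 'a) measure \<Rightarrow> (real \<Rightarrow> (nat \<Rightarrow> 'a) \<Rightarrow> ereal)
     \<Rightarrow> (nat \<Rightarrow> 'a \<Rightarrow> real) set" where
  "constrB T S \<mu> h = {x.
     (\<forall>t\<le>T. x t \<in> borel_measurable (borel_of (S t))) \<and>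
     (\<exists>A. (\<forall>t\<le>T. A t \<in> sets (borel_of (S t)) \<and> measure (marg S \<mu> t) (A t) = 1) \<and>
          (\<forall>s\<in>PiE {..T} A. - path_sum T x s \<in> cl_dom h s))}"

definition feasible :: "'c set \<Rightarrow> ('c \<Rightarrow> ereal) \<Rightarrow> 'c \<Rightarrow> bool" where
  "feasible F f x \<longleftrightarrow> x \<in> F \<and> f x < \<infinity>"

definition optimal :: "'c set \<Rightarrow> ('c \<Rightarrow> ereal) \<Rightarrow> 'c \<Rightarrow> bool" where
  "optimal F f x \<longleftrightarrow> feasible F f x \<and> (\<forall>y\<in>F. f x \<le> f y)"

end

theory Submission
  imports Defs
begin

text \<open>
  Dual existence: problem (B), restricted to integrable \<open>x\<^sub>t\<close> and with \<open>- \<Sum>\<^sub>t x\<^sub>t\<close> majorized by a continuous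
  \<open>u\<close>, has a value \<open>p0\<close> and, by Hahn--Banach, a positive linear subgradient. On functions of one
  coordinate the subgradient is integration against \<open>\<mu>\<^sub>t\<close>; the marginals being tight, it is
  represented by a measure (Daniell), which is feasible in (A) with value at most \<open>- p0\<close>.

  Primal existence: integrability of \<open>h\<^sup>*(v, \<cdot>)\<close> for \<open>v\<close> near \<open>1\<close> bounds minimizing sequences in
  \<open>L\<^sup>1(\<mu>)\<close>. Minimizing \<open>\<integral> sqrt (1 + (\<Sum>\<^sub>t x\<^sub>t)\<^sup>2) d\<mu>\<close> over the nested sublevel sets selects a
  sequence whose sums converge \<open>\<mu>\<close>-almost everywhere. As \<open>\<Prod>\<^sub>t \<mu>\<^sub>t \<ll> \<mu>\<close>, Fubini's theorem yields
  convergence of the normalized summands, and Fatou's lemma shows that the limit has value at most \<open>p0\<close>.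

  Optimality: every \<open>\<lambda>\<close> feasible in (A) is a nonnegative measure, since \<open>h(\<cdot>, s)\<close> is nondecreasing.
  With \<open>y = d\<lambda>\<^sup>a/d\<mu>\<close> and \<open>d(s) = sup D(s)\<close>, inner semicontinuity of \<open>D\<close> gives
  \<open>H\<^sup>*(\<lambda>) = \<integral> h\<^sup>*(y) d\<mu> + \<integral> d d\<lambda>\<^sup>s\<close>. Since \<open>w = - \<Sum>\<^sub>t x\<^sub>t\<close> has the same integral under \<open>\<lambda>\<close>
  and \<open>\<mu>\<close>, the gap of a feasible pair is \<open>\<integral> (h(w) + h\<^sup>*(y) - w y) d\<mu> + \<integral> (d - w) d\<lambda>\<^sup>s\<close>, with
  nonnegative integrands that vanish exactly under the two stated conditions.
\<close>

section \<open>Borel measures of metrizable spaces\<close>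

text \<open>Monotonicity of \<open>h\<close> turns \<open>D(s)\<close> into the set of reals not
  above \<open>d(s)\<close>, a closed half-line or the whole line. Inner semicontinuity of
  \<open>D\<close> is then lower semicontinuity of \<open>d\<close>, and questions about domains
  become questions about upper bounds. Three obstacles shape the proof. A positive functional on
  \<open>C\<close> need not be a measure; this one is, because it also acts on discontinuous
  functions and can be evaluated at the indicator of the complement of a compact set in one
  coordinate. The summands of a feasible \<open>x\<close> need not be integrable, so equal marginals
  alone do not give equal integrals of the sum: in the product case each summand is integrable after
  all, and for \<open>T = 1\<close> the two summands can be truncated together. Finally,
  \<open>H\<^sup>*\<close> is a supremum over continuous functions, whereas its integral formula
  calls for measurable ones; as the singular part lives on a \<open>\<mu>\<close>-null set, an
  approximating function can be prescribed there independently of its values elsewhere.\<close>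

lemma space_borel_of [simp]: "space (borel_of X) = topspace X"
  unfolding borel_of_def by (intro space_measure_of) (auto dest: openin_subset)

lemma sets_borel_of: "sets (borel_of X) = sigma_sets (topspace X) {U. openin X U}"
  unfolding borel_of_def by (intro sets_measure_of) (auto dest: openin_subset)

lemma openin_borel_of: "openin X U \<Longrightarrow> U \<in> sets (borel_of X)"
  unfolding sets_borel_of by auto

lemma closedin_borel_of: "closedin X U \<Longrightarrow> U \<in> sets (borel_of X)"
proof -
  assume U: "closedin X U"
  have "topspace X - (topspace X - U) \<in> sets (borel_of X)"
    using U openin_borel_of[of X "topspace X - U"] openin_borel_of[of X "topspace X"] by blast
  moreover have "topspace X - (topspace X - U) = U"
    using closedin_subset[OF U] by auto
  ultimately show ?thesis by simp
qed

lemma continuous_map_measurable_borel_of: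
  assumes "continuous_map X Y f"
  shows "f \<in> borel_of X \<rightarrow>\<^sub>M borel_of Y"
  unfolding borel_of_def[of Y]
proof (rule measurable_sigma_sets)
  show "sets (sigma (topspace Y) {U. openin Y U}) = sigma_sets (topspace Y) {U. openin Y U}"
    using sets_borel_of[of Y] by (simp add: borel_of_def)
  show "{U. openin Y U} \<subseteq> Pow (topspace Y)" by (auto dest: openin_subset)
  show "f \<in> space (borel_of X) \<rightarrow> topspace Y"
    using assms by (auto simp: continuous_map_def)
  fix U assume "U \<in> {U. openin Y U}"
  then have "openin X {x \<in> topspace X. f x \<in> U}"
    using assms by (auto simp: continuous_map_def)
  moreover have "{x \<in> topspace X. f x \<in> U} = f -` U \<inter> space (borel_of X)" by auto
  ultimately show "f -` U \<inter> space (borel_of X) \<in> sets (borel_of X)"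
    by (metis openin_borel_of)
qed

lemma continuous_map_borel_measurable:
  fixes f :: "'b \<Rightarrow> real"
  assumes "continuous_map X euclideanreal f"
  shows "f \<in> borel_measurable (borel_of X)"
proof (rule borel_measurableI)
  fix U :: "real set" assume "open U"
  then have "openin X {x \<in> topspace X. f x \<in> U}"
    using assms by (auto simp: continuous_map_def)
  moreover have "{x \<in> topspace X. f x \<in> U} = f -` U \<inter> space (borel_of X)" by auto
  ultimately show "f -` U \<inter> space (borel_of X) \<in> sets (borel_of X)"
    by (metis openin_borel_of)
qed

text \<open>In a metrizable space \<open>U\<close> is an increasing union of closed sets
  \<open>C n\<close>. Urysohn functions equal to 1 on \<open>C n\<close> and to 0 off
  \<open>U\<close> approach the indicator, and their running maxima do so monotonically. At each
  point of \<open>U\<close> the value 1 is attained at a finite stage, which the covering arguments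
  below exploit.\<close>

lemma open_indicator_approx:
  assumes X: "metrizable_space X" and U: "openin X U"
  obtains \<theta> :: "nat \<Rightarrow> 'b \<Rightarrow> real" where
    "\<And>n. continuous_map X euclideanreal (\<theta> n)"
    "\<And>n s. s \<in> topspace X \<Longrightarrow> 0 \<le> \<theta> n s" "\<And>n s. s \<in> topspace X \<Longrightarrow> \<theta> n s \<le> 1"
    "\<And>n s. s \<in> topspace X \<Longrightarrow> s \<notin> U \<Longrightarrow> \<theta> n s = 0"
    "\<And>m n s. s \<in> topspace X \<Longrightarrow> m \<le> n \<Longrightarrow> \<theta> m s \<le> \<theta> n s"
    "\<And>s. s \<in> U \<Longrightarrow> \<exists>n. \<theta> n s = 1"
    "\<And>s. s \<in> topspace X \<Longrightarrow> (\<lambda>n. \<theta> n s) \<longlonglongrightarrow> indicator U s"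
proof -
  have "fsigma_in X U" using X U open_imp_fsigma_in by blast
  then obtain C where C: "\<And>n::nat. closedin X (C n)" "\<And>n. C n \<subseteq> C (Suc n)" "\<Union> (range C) = U"
    unfolding fsigma_in_ascending by blast
  have ex: "\<exists>f. continuous_map X (top_of_set {0..1::real}) f \<and> f ` (topspace X - U) \<subseteq> {0} \<and> f ` C n \<subseteq> {1}" for n
  proof -
    have "disjnt (topspace X - U) (C n)" using C(3) by (auto simp: disjnt_def)
    moreover have "closedin X (topspace X - U)" using U by blast
    ultimately show ?thesis
      using Urysohn_lemma[of X "topspace X - U" "C n" 0 1] metrizable_imp_normal_space[OF X] C(1)[of n]
      by (metis zero_le_one)
  qed
  then obtain f where f: "\<And>n. continuous_map X (top_of_set {0..1::real}) (f n)"
    "\<And>n. f n ` (topspace X - U) \<subseteq> {0}" "\<And>n. f n ` C n \<subseteq> {1}" by metis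
  have fc: "continuous_map X euclideanreal (f n)" for n
    using f(1)[of n] continuous_map_in_subtopology by blast
  have f01: "0 \<le> f n s \<and> f n s \<le> 1" if "s \<in> topspace X" for n s
    using f(1)[of n] that by (auto simp: continuous_map_in_subtopology image_subset_iff)
  define \<theta> where "\<theta> = (\<lambda>n s. Max ((\<lambda>k. f k s) ` {..n}))"
  have Max_Suc: "\<theta> (Suc n) s = max (f (Suc n) s) (\<theta> n s)" for n s
    unfolding \<theta>_def by (simp add: atMost_Suc)
  have z: "\<theta> 0 s = f 0 s" for s unfolding \<theta>_def by simp
  show thesis
  proof
    show c: "continuous_map X euclideanreal (\<theta> n)" for n
    proof (induction n)
      case 0
      have "\<theta> 0 = f 0" using z by auto
      then show ?case using fc[of 0] by simp
    next
      case (Suc n)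
      have "continuous_map X euclideanreal (\<lambda>s. max (f (Suc n) s) (\<theta> n s))"
        using fc Suc by (intro continuous_map_real_max)
      moreover have "\<theta> (Suc n) = (\<lambda>s. max (f (Suc n) s) (\<theta> n s))" using Max_Suc by auto
      ultimately show ?case by simp
    qed
    show p: "0 \<le> \<theta> n s" if "s \<in> topspace X" for n s
      by (induction n) (use f01 that in \<open>auto simp: z Max_Suc le_max_iff_disj\<close>)
    show le: "\<theta> n s \<le> 1" if "s \<in> topspace X" for n s
      by (induction n) (use f01 that in \<open>auto simp: z Max_Suc\<close>)
    show zr: "\<theta> n s = 0" if "s \<in> topspace X" "s \<notin> U" for n s
      by (induction n) (use f(2) that in \<open>auto simp: z Max_Suc image_subset_iff\<close>)
    show mono: "\<theta> m s \<le> \<theta> n s" if "s \<in> topspace X" "m \<le> n" for m n s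
      by (rule lift_Suc_mono_le[of "\<lambda>n. \<theta> n s", OF _ that(2)]) (simp add: Max_Suc)
    show one: "\<exists>n. \<theta> n s = 1" if "s \<in> U" for s
    proof -
      have "s \<in> \<Union> (range C)" using that C(3) by simp
      then obtain n where "s \<in> C n" by blast
      then have "f n s = 1" using f(3) by (auto simp: image_subset_iff)
      moreover have "f n s \<le> \<theta> n s" unfolding \<theta>_def by (intro Max_ge) auto
      moreover have "s \<in> topspace X" using that U openin_subset by blast
      ultimately show ?thesis using le[of s n] by (metis order_antisym)
    qed
    show "(\<lambda>n. \<theta> n s) \<longlonglongrightarrow> indicator U s" if s: "s \<in> topspace X" for s
    proof (cases "s \<in> U")
      case True
      then obtain n where n: "\<theta> n s = 1" using one by blast
      have "\<forall>\<^sub>F k in sequentially. \<theta> k s = 1"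
        unfolding eventually_sequentially using mono[OF s] le[OF s] n by (metis order_antisym)
      then show ?thesis using True by (simp add: tendsto_eventually)
    qed (simp add: zr[OF s])
  qed
qed

section \<open>Bounded continuous functions and their density in \<open>L\<^sup>1\<close>\<close>

definition cfun :: "'b topology \<Rightarrow> ('b \<Rightarrow> real) set" where
  "cfun X = {f. continuous_map X euclideanreal f \<and> (\<exists>c. \<forall>s\<in>topspace X. \<bar>f s\<bar> \<le> c)}"

lemma cfunI: "continuous_map X euclideanreal f \<Longrightarrow> (\<And>s. s \<in> topspace X \<Longrightarrow> \<bar>f s\<bar> \<le> c) \<Longrightarrow> f \<in> cfun X"
  unfolding cfun_def by auto

lemma cfun_add: "f \<in> cfun X \<Longrightarrow> g \<in> cfun X \<Longrightarrow> (\<lambda>s. f s + g s) \<in> cfun X"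
proof -
  assume "f \<in> cfun X" "g \<in> cfun X"
  then obtain a b where *: "continuous_map X euclideanreal f" "continuous_map X euclideanreal g"
    "\<forall>s\<in>topspace X. \<bar>f s\<bar> \<le> a" "\<forall>s\<in>topspace X. \<bar>g s\<bar> \<le> b" unfolding cfun_def by auto
  show ?thesis
    by (rule cfunI[where c="a+b"]) (use * in \<open>auto intro!: continuous_map_add intro: order_trans[OF abs_triangle_ineq] add_mono\<close>)
qed

lemma cfun_cmult: "f \<in> cfun X \<Longrightarrow> (\<lambda>s. c * f s) \<in> cfun X"
proof -
  assume "f \<in> cfun X"
  then obtain a where *: "continuous_map X euclideanreal f" 
    "\<forall>s\<in>topspace X. \<bar>f s\<bar> \<le> a" unfolding cfun_def by auto
  show ?thesis
    by (rule cfunI[where c="\<bar>c\<bar>*a"]) (use * in \<open>auto intro!: continuous_map_real_mult_left simp: abs_mult mult_left_mono\<close>)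
qed

lemma cfun_const [simp]: "(\<lambda>s. c) \<in> cfun X"
  by (rule cfunI[where c="\<bar>c\<bar>"]) auto

lemma cfun_diff: "f \<in> cfun X \<Longrightarrow> g \<in> cfun X \<Longrightarrow> (\<lambda>s. f s - g s) \<in> cfun X"
  using cfun_add[of f X "\<lambda>s. (-1) * g s"] cfun_cmult[of g X "-1"] by simp

lemma cfun_max: "f \<in> cfun X \<Longrightarrow> g \<in> cfun X \<Longrightarrow> (\<lambda>s. max (f s) (g s)) \<in> cfun X"
proof -
  assume "f \<in> cfun X" "g \<in> cfun X"
  then obtain a b where *: "continuous_map X euclideanreal f" "continuous_map X euclideanreal g"
    "\<forall>s\<in>topspace X. \<bar>f s\<bar> \<le> a" "\<forall>s\<in>topspace X. \<bar>g s\<bar> \<le> b" unfolding cfun_def by auto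
  show ?thesis
  proof (rule cfunI[where c="max a b"])
    show "continuous_map X euclideanreal (\<lambda>s. max (f s) (g s))" using * by (intro continuous_map_real_max)
    fix s assume "s \<in> topspace X"
    then have "\<bar>f s\<bar> \<le> a" "\<bar>g s\<bar> \<le> b" using * by auto
    then show "\<bar>max (f s) (g s)\<bar> \<le> max a b" by linarith
  qed
qed

lemma cfun_min: "f \<in> cfun X \<Longrightarrow> g \<in> cfun X \<Longrightarrow> (\<lambda>s. min (f s) (g s)) \<in> cfun X"
proof -
  assume "f \<in> cfun X" "g \<in> cfun X"
  then have "(\<lambda>s. -1 * max (-1 * f s) (-1 * g s)) \<in> cfun X"
    by (intro cfun_cmult cfun_max)
  moreover have "(\<lambda>s. -1 * max (-1 * f s) (-1 * g s)) = (\<lambda>s. min (f s) (g s))" by (auto simp: fun_eq_iff)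
  ultimately show ?thesis by simp
qed

lemma cfun_sum: "(\<And>i. i \<in> I \<Longrightarrow> f i \<in> cfun X) \<Longrightarrow> (\<lambda>s. \<Sum>i\<in>I. f i s) \<in> cfun X"
  by (induction I rule: infinite_finite_induct) (auto intro: cfun_add)

lemma cfun_measurable: "f \<in> cfun X \<Longrightarrow> sets M = sets (borel_of X) \<Longrightarrow> f \<in> borel_measurable M"
  unfolding cfun_def using continuous_map_borel_measurable measurable_cong_sets by blast

lemma cfun_integrable:
  assumes "finite_measure M" "sets M = sets (borel_of X)" "f \<in> cfun X"
  shows "integrable M f"
proof -
  interpret finite_measure M by fact
  obtain c where c: "\<forall>s\<in>topspace X. \<bar>f s\<bar> \<le> c" using assms unfolding cfun_def by auto
  have "space M = topspace X" using sets_eq_imp_space_eq[OF assms(2)] by simp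
  then show ?thesis
    by (intro integrable_const_bound[where B=c]) (use c assms cfun_measurable in auto)
qed

text \<open>Induction over the Borel sets, a countable union being exhausted by finite maxima.\<close>

lemma cfun_dense_indicator:
  assumes X: "metrizable_space X" and M: "finite_measure M" "sets M = sets (borel_of X)"
    and A: "A \<in> sets M" and e: "e > 0"
  shows "\<exists>f\<in>cfun X. (\<forall>s\<in>topspace X. 0 \<le> f s \<and> f s \<le> 1) \<and> (\<integral>s. \<bar>f s - indicator A s\<bar> \<partial>M) < e"
proof -
  interpret finite_measure M by fact
  have sp: "space M = topspace X" using sets_eq_imp_space_eq[OF M(2)] by simp
  have integ: "integrable M (\<lambda>s. \<bar>f s - indicator A s\<bar>)" if "f \<in> cfun X" "A \<in> sets M" for f and A :: "'a set"
    using cfun_integrable[OF M that(1)] that(2)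
    by (intro integrable_abs Bochner_Integration.integrable_diff integrable_real_indicator) (auto simp: emeasure_finite top.not_eq_extremum less_top[symmetric])
  have "A \<in> sigma_sets (topspace X) {U. openin X U}" using A M(2) sets_borel_of by metis
  then show ?thesis using e
  proof (induction arbitrary: e rule: sigma_sets.induct)
    case (Basic U)
    then have U: "openin X U" by simp
    then have Us: "U \<in> sets M" using openin_borel_of M by metis
    obtain \<theta> :: "nat \<Rightarrow> 'a \<Rightarrow> real" where \<theta>: 
      "\<And>n. continuous_map X euclideanreal (\<theta> n)"
      "\<And>n s. s \<in> topspace X \<Longrightarrow> 0 \<le> \<theta> n s" "\<And>n s. s \<in> topspace X \<Longrightarrow> \<theta> n s \<le> 1"
      "\<And>s. s \<in> topspace X \<Longrightarrow> (\<lambda>n. \<theta> n s) \<longlonglongrightarrow> indicator U s"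
      using open_indicator_approx[OF X U] by metis
    have tc: "\<theta> n \<in> cfun X" for n using \<theta>(1-3) by (intro cfunI[where c=1]) auto
    have "(\<lambda>n. \<integral>s. \<bar>\<theta> n s - indicator U s\<bar> \<partial>M) \<longlonglongrightarrow> (\<integral>s. 0 \<partial>M)"
    proof (rule integral_dominated_convergence[where w="\<lambda>_. 2"])
      show "AE x in M. (\<lambda>n. \<bar>\<theta> n x - indicator U x\<bar>) \<longlonglongrightarrow> 0"
      proof (rule AE_I2)
        fix x assume "x \<in> space M"
        then have "(\<lambda>n. \<bar>\<theta> n x - indicator U x\<bar>) \<longlonglongrightarrow> \<bar>indicator U x - indicator U x\<bar>"
          using \<theta>(4)[of x] sp by (intro tendsto_intros) auto
        then show "(\<lambda>n. \<bar>\<theta> n x - indicator U x\<bar>) \<longlonglongrightarrow> 0" by simp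
      qed
      show "AE x in M. norm \<bar>\<theta> n x - indicator U x\<bar> \<le> 2" for n
        using \<theta>(2,3) sp by (intro AE_I2) (auto simp: indicator_def abs_if; smt (verit))
      show "(\<lambda>x. \<bar>\<theta> n x - indicator U x\<bar>) \<in> borel_measurable M" for n
        using integ[OF tc Us] by blast
    qed auto
    then have "\<forall>\<^sub>F n in sequentially. (\<integral>s. \<bar>\<theta> n s - indicator U s\<bar> \<partial>M) < e"
      using order_tendstoD(2)[of _ _ _ e] Basic by simp
    then obtain n where "(\<integral>s. \<bar>\<theta> n s - indicator U s\<bar> \<partial>M) < e"
      using eventually_happens' sequentially_bot by blast
    then show ?case using tc \<theta>(2,3) by blast
  next
    case Empty
    then show ?case by (intro bexI[where x="\<lambda>_. 0"]) auto
  next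
    case (Compl A)
    then obtain f where f: "f \<in> cfun X" "\<forall>s\<in>topspace X. 0 \<le> f s \<and> f s \<le> 1" "(\<integral>s. \<bar>f s - indicator A s\<bar> \<partial>M) < e" by blast
    have "(\<integral>s. \<bar>(1 - f s) - indicator (topspace X - A) s\<bar> \<partial>M) = (\<integral>s. \<bar>f s - indicator A s\<bar> \<partial>M)"
      by (rule Bochner_Integration.integral_cong) (auto simp: sp indicator_def)
    moreover have "(\<lambda>s. 1 - f s) \<in> cfun X" using f by (intro cfun_diff) auto
    ultimately show ?case using f by (intro bexI[where x="\<lambda>s. 1 - f s"]) auto
  next
    case (Union A)
    have As: "A i \<in> sets M" for i using Union M sets_borel_of by metis
    have "(\<lambda>n. measure M (\<Union>i<n. A i)) \<longlonglongrightarrow> measure M (\<Union>n. \<Union>i<n. A i)"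
      by (rule finite_Lim_measure_incseq) (use As in \<open>auto simp: incseq_def\<close>, force)
    moreover have eqU: "(\<Union>n. \<Union>i<n. A i) = (\<Union>i. A i)" by auto
    ultimately have "(\<lambda>n. measure M (\<Union>i<n. A i)) \<longlonglongrightarrow> measure M (\<Union>i. A i)" by simp
    moreover have "measure M (\<Union>i. A i) - e/2 < measure M (\<Union>i. A i)" using Union.prems by simp
    ultimately have "\<forall>\<^sub>F n in sequentially. measure M (\<Union>i<n. A i) > measure M (\<Union>i. A i) - e/2"
      by (rule order_tendstoD(1))
    then obtain n where n: "measure M (\<Union>i<n. A i) > measure M (\<Union>i. A i) - e/2"
      using eventually_happens' sequentially_bot by blast
    define B where "B = (\<Union>i<n. A i)"
    have Bs: "B \<in> sets M" unfolding B_def using As by auto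
    \<comment> \<open>The share \<open>e / (2 * (n + 1))\<close> per set keeps the error of
      \<open>n\<close> successive maxima below \<open>e / 2\<close>; the other half pays for the
      rest of the union.\<close>
    have "\<exists>f\<in>cfun X. (\<forall>s\<in>topspace X. 0 \<le> f s \<and> f s \<le> 1) \<and> (\<integral>s. \<bar>f s - indicator (\<Union>i<m. A i) s\<bar> \<partial>M) \<le> real m * (e / (2 * (real n + 1)))" for m
    proof (induction m)
      case 0 then show ?case by (intro bexI[where x="\<lambda>_. 0"]) auto
    next
      case (Suc m)
      then obtain f where f: "f \<in> cfun X" "\<forall>s\<in>topspace X. 0 \<le> f s \<and> f s \<le> 1"
         "(\<integral>s. \<bar>f s - indicator (\<Union>i<m. A i) s\<bar> \<partial>M) \<le> real m * (e / (2 * (real n + 1)))" by blast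
      obtain g where g: "g \<in> cfun X" "\<forall>s\<in>topspace X. 0 \<le> g s \<and> g s \<le> 1"
         "(\<integral>s. \<bar>g s - indicator (A m) s\<bar> \<partial>M) < e / (2 * (real n + 1))"
        using Union.IH[of "e / (2 * (real n + 1))" m] Union.prems by (auto simp: field_simps)
      have I: "(\<Union>i<m. A i) \<in> sets M" using As by auto
      have "(\<integral>s. \<bar>max (f s) (g s) - indicator (\<Union>i<Suc m. A i) s\<bar> \<partial>M) \<le>
         (\<integral>s. \<bar>f s - indicator (\<Union>i<m. A i) s\<bar> + \<bar>g s - indicator (A m) s\<bar> \<partial>M)"
      proof (rule integral_mono)
        show "integrable M (\<lambda>s. \<bar>max (f s) (g s) - indicator (\<Union>i<Suc m. A i) s\<bar>)"
          using As f g by (intro integ cfun_max) auto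
        show "integrable M (\<lambda>s. \<bar>f s - indicator (\<Union>i<m. A i) s\<bar> + \<bar>g s - indicator (A m) s\<bar>)"
          using I As f g by (intro Bochner_Integration.integrable_add integ) auto
        fix s
        have "indicator (\<Union>i<Suc m. A i) s = max (indicator (\<Union>i<m. A i) s) (indicator (A m) s :: real)"
          by (auto simp: indicator_def less_Suc_eq)
        then show "\<bar>max (f s) (g s) - indicator (\<Union>i<Suc m. A i) s\<bar> \<le> \<bar>f s - indicator (\<Union>i<m. A i) s\<bar> + \<bar>g s - indicator (A m) s\<bar>"
          by (auto simp: max_def abs_if)
      qed
      also have "\<dots> = (\<integral>s. \<bar>f s - indicator (\<Union>i<m. A i) s\<bar> \<partial>M) + (\<integral>s. \<bar>g s - indicator (A m) s\<bar> \<partial>M)"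
        using I As f g by (intro Bochner_Integration.integral_add integ) auto
      also have "\<dots> \<le> real (Suc m) * (e / (2 * (real n + 1)))"
        using f(3) g(3) by (simp add: algebra_simps add_divide_distrib)
      finally show ?case using f g
        by (intro bexI[where x="\<lambda>s. max (f s) (g s)"]) (auto intro: cfun_max simp: le_max_iff_disj)
    qed
    then obtain f where f: "f \<in> cfun X" "\<forall>s\<in>topspace X. 0 \<le> f s \<and> f s \<le> 1"
       "(\<integral>s. \<bar>f s - indicator B s\<bar> \<partial>M) \<le> real n * (e / (2 * (real n + 1)))" unfolding B_def by blast
    have US: "(\<Union>i. A i) \<in> sets M" using As by auto
    have BU: "B \<subseteq> (\<Union>i. A i)" unfolding B_def by auto
    have "(\<integral>s. \<bar>f s - indicator (\<Union>i. A i) s\<bar> \<partial>M) \<le> (\<integral>s. \<bar>f s - indicator B s\<bar> + indicator ((\<Union>i. A i) - B) s \<partial>M)"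
    proof (rule integral_mono)
      show "integrable M (\<lambda>s. \<bar>f s - indicator (\<Union>i. A i) s\<bar>)" using f US by (intro integ)
      show "integrable M (\<lambda>s. \<bar>f s - indicator B s\<bar> + indicator ((\<Union>i. A i) - B) s)"
        using f US Bs by (intro Bochner_Integration.integrable_add integ integrable_real_indicator) (auto simp: less_top[symmetric] emeasure_finite)
      show "\<bar>f s - indicator (\<Union>i. A i) s\<bar> \<le> \<bar>f s - indicator B s\<bar> + indicator ((\<Union>i. A i) - B) s" for s
        using BU by (auto simp: indicator_def)
    qed
    also have "\<dots> = (\<integral>s. \<bar>f s - indicator B s\<bar> \<partial>M) + measure M ((\<Union>i. A i) - B)"
      using f US Bs by (subst Bochner_Integration.integral_add) (auto intro!: integ integrable_real_indicator simp: less_top[symmetric] emeasure_finite sp[symmetric] Int_absorb2 dest: sets.sets_into_space)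
    also have "measure M ((\<Union>i. A i) - B) = measure M (\<Union>i. A i) - measure M B"
      using US Bs BU by (intro finite_measure_Diff) auto
    also have "(\<integral>s. \<bar>f s - indicator B s\<bar> \<partial>M) + (measure M (\<Union>i. A i) - measure M B) < e"
    proof -
      have "real n * (e / (2 * (real n + 1))) \<le> e / 2" using Union.prems by (simp add: field_simps)
      then show ?thesis using f(3) n unfolding B_def by linarith
    qed
    finally show ?case using f by blast
  qed
qed

lemma cfun_dense_L1:
  assumes X: "metrizable_space X" and M: "finite_measure M" "sets M = sets (borel_of X)"
    and f: "integrable M f"
  shows "\<forall>e>0. \<exists>g\<in>cfun X. (\<integral>s. \<bar>f s - g s\<bar> \<partial>M) < e"
  using f
proof (induction rule: integrable_induct)
  case (base A c)
  show ?case
  proof (intro allI impI)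
    fix e :: real assume "e > 0"
    then obtain g where g: "g \<in> cfun X" "(\<integral>s. \<bar>g s - indicator A s\<bar> \<partial>M) < e / (\<bar>c\<bar> + 1)"
      using cfun_dense_indicator[OF X M base(1), of "e / (\<bar>c\<bar> + 1)"] by auto
    have "(\<integral>s. \<bar>indicator A s *\<^sub>R c - c * g s\<bar> \<partial>M) = (\<integral>s. \<bar>c\<bar> * \<bar>g s - indicator A s\<bar> \<partial>M)"
      by (rule Bochner_Integration.integral_cong) (auto simp: abs_mult[symmetric] algebra_simps abs_minus_commute)
    also have "\<dots> = \<bar>c\<bar> * (\<integral>s. \<bar>g s - indicator A s\<bar> \<partial>M)" by simp
    also have "\<dots> \<le> \<bar>c\<bar> * (e / (\<bar>c\<bar> + 1))" using g by (intro mult_left_mono) auto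
    also have "\<dots> < e" using \<open>e > 0\<close> by (simp add: field_simps)
    finally show "\<exists>g\<in>cfun X. (\<integral>s. \<bar>indicator A s *\<^sub>R c - g s\<bar> \<partial>M) < e"
      using g cfun_cmult by (intro bexI[where x="\<lambda>s. c * g s"]) auto
  qed
next
  case (add f g)
  show ?case
  proof (intro allI impI)
    fix e :: real assume "e > 0"
    then obtain f' g' where g: "f' \<in> cfun X" "(\<integral>s. \<bar>f s - f' s\<bar> \<partial>M) < e / 2"
      "g' \<in> cfun X" "(\<integral>s. \<bar>g s - g' s\<bar> \<partial>M) < e / 2"
      using add.IH by (meson half_gt_zero)
    have i: "integrable M f'" "integrable M g'" using g cfun_integrable[OF M] by auto
    have "(\<integral>s. \<bar>f s + g s - (f' s + g' s)\<bar> \<partial>M) \<le> (\<integral>s. \<bar>f s - f' s\<bar> + \<bar>g s - g' s\<bar> \<partial>M)"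
      using i add by (intro integral_mono) auto
    also have "\<dots> = (\<integral>s. \<bar>f s - f' s\<bar> \<partial>M) + (\<integral>s. \<bar>g s - g' s\<bar> \<partial>M)"
      using i add by (intro Bochner_Integration.integral_add) auto
    also have "\<dots> < e" using g by simp
    finally show "\<exists>h\<in>cfun X. (\<integral>s. \<bar>f s + g s - h s\<bar> \<partial>M) < e"
      using cfun_add[OF g(1,3)] by (intro bexI[where x="\<lambda>s. f' s + g' s"])
  qed
next
  case (lim f s)
  show ?case
  proof (intro allI impI)
    fix e :: real assume e: "e > 0"
    have "(\<lambda>n. \<integral>x. \<bar>f x - s n x\<bar> \<partial>M) \<longlonglongrightarrow> (\<integral>x. 0 \<partial>M)"
    proof (rule integral_dominated_convergence[where w="\<lambda>x. 3 * \<bar>f x\<bar>"])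
      show "AE x in M. (\<lambda>n. \<bar>f x - s n x\<bar>) \<longlonglongrightarrow> 0"
      proof (rule AE_I2)
        fix x assume "x \<in> space M"
        then have "(\<lambda>n. s n x) \<longlonglongrightarrow> f x" using lim by blast
        then have "(\<lambda>n. \<bar>f x - s n x\<bar>) \<longlonglongrightarrow> \<bar>f x - f x\<bar>"
          by (intro tendsto_intros)
        then show "(\<lambda>n. \<bar>f x - s n x\<bar>) \<longlonglongrightarrow> 0" by simp
      qed
      show "AE x in M. norm \<bar>f x - s n x\<bar> \<le> 3 * \<bar>f x\<bar>" for n
      proof (rule AE_I2)
        fix x assume "x \<in> space M"
        then have "norm (s n x) \<le> 2 * norm (f x)" using lim by blast
        then show "norm \<bar>f x - s n x\<bar> \<le> 3 * \<bar>f x\<bar>" by simp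
      qed
    qed (use lim in auto)
    then have "(\<lambda>n. \<integral>x. \<bar>f x - s n x\<bar> \<partial>M) \<longlonglongrightarrow> 0" by simp
    moreover have "0 < e/2" using e by simp
    ultimately have "\<forall>\<^sub>F n in sequentially. (\<integral>x. \<bar>f x - s n x\<bar> \<partial>M) < e/2"
      by (rule order_tendstoD(2))
    then obtain n where n: "(\<integral>x. \<bar>f x - s n x\<bar> \<partial>M) < e/2"
      using eventually_happens' sequentially_bot by blast
    obtain g where g: "g \<in> cfun X" "(\<integral>x. \<bar>s n x - g x\<bar> \<partial>M) < e / 2"
      using lim.IH e by (meson half_gt_zero)
    have i: "integrable M g" using g cfun_integrable[OF M] by auto
    have "(\<integral>x. \<bar>f x - g x\<bar> \<partial>M) \<le> (\<integral>x. \<bar>f x - s n x\<bar> + \<bar>s n x - g x\<bar> \<partial>M)"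
      using i lim by (intro integral_mono) auto
    also have "\<dots> = (\<integral>x. \<bar>f x - s n x\<bar> \<partial>M) + (\<integral>x. \<bar>s n x - g x\<bar> \<partial>M)"
      using i lim by (intro Bochner_Integration.integral_add) auto
    also have "\<dots> < e" using g n by simp
    finally show "\<exists>h\<in>cfun X. (\<integral>x. \<bar>f x - h x\<bar> \<partial>M) < e" using g by blast
  qed
qed

text \<open>A sequence whose \<open>L\<^sup>1\<close> errors tend to 0 has a subsequence that
  converges almost everywhere.\<close>

lemma cfun_dense_AE:
  assumes X: "metrizable_space X" and M: "finite_measure M" "sets M = sets (borel_of X)"
    and f: "integrable M f"
  obtains g where "\<And>n::nat. g n \<in> cfun X" "AE s in M. (\<lambda>n. g n s) \<longlonglongrightarrow> f s"
proof -
  have "\<exists>g\<in>cfun X. (\<integral>s. \<bar>f s - g s\<bar> \<partial>M) < 1 / Suc n" for n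
    using cfun_dense_L1[OF X M f] by simp
  then obtain g where g: "\<And>n. g n \<in> cfun X" "\<And>n. (\<integral>s. \<bar>f s - g n s\<bar> \<partial>M) < 1 / Suc n" by metis
  have i: "integrable M (\<lambda>s. g n s - f s)" for n using g(1) cfun_integrable[OF M] f by auto
  have "(\<lambda>n. \<integral>s. norm (g n s - f s) \<partial>M) \<longlonglongrightarrow> 0"
  proof (rule tendsto_sandwich[OF _ _ tendsto_const LIMSEQ_inverse_real_of_nat])
    show "\<forall>\<^sub>F n in sequentially. (\<integral>s. norm (g n s - f s) \<partial>M) \<le> inverse (real (Suc n))"
      using g(2) by (intro always_eventually allI) (simp add: abs_minus_commute inverse_eq_divide less_imp_le)
  qed auto
  then obtain r where "strict_mono r" "AE s in M. (\<lambda>n. g (r n) s - f s) \<longlonglongrightarrow> 0"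
    using tendsto_L1_AE_subseq[of M "\<lambda>n s. g n s - f s", OF i] by blast
  then have "AE s in M. (\<lambda>n. g (r n) s) \<longlonglongrightarrow> f s" by (auto elim!: eventually_mono dest: LIM_zero_cancel)
  then show thesis using that[of "\<lambda>n. g (r n)"] g(1) by blast
qed

section \<open>Sums and comparison of finite measures\<close>

definition msum :: "'b measure \<Rightarrow> 'b measure \<Rightarrow> 'b measure" where
  "msum M N = measure_of (space M) (sets M) (\<lambda>A. emeasure M A + emeasure N A)"

lemma sets_msum [simp]: "sets (msum M N) = sets M"
  unfolding msum_def by (simp add: sets.space_closed)

lemma space_msum [simp]: "space (msum M N) = space M"
  unfolding msum_def by (simp add: sets.space_closed)

lemma emeasure_msum:
  assumes "sets M = sets N" "A \<in> sets M"
  shows "emeasure (msum M N) A = emeasure M A + emeasure N A"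
proof -
  have "positive (sets M) (\<lambda>A. emeasure M A + emeasure N A)" by (simp add: positive_def)
  moreover have "countably_additive (sets M) (\<lambda>A. emeasure M A + emeasure N A)"
  proof (rule countably_additiveI)
    fix A :: "nat \<Rightarrow> 'a set" assume A: "range A \<subseteq> sets M" "disjoint_family A" "(\<Union>i. A i) \<in> sets M"
    have "(\<Sum>i. emeasure M (A i) + emeasure N (A i)) = (\<Sum>i. emeasure M (A i)) + (\<Sum>i. emeasure N (A i))"
      by (rule suminf_add[symmetric]) auto
    also have "\<dots> = emeasure M (\<Union>i. A i) + emeasure N (\<Union>i. A i)"
      using A assms(1) suminf_emeasure[of A M] suminf_emeasure[of A N] by simp
    finally show "(\<Sum>i. emeasure M (A i) + emeasure N (A i)) = emeasure M (\<Union>i. A i) + emeasure N (\<Union>i. A i)" .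
  qed
  ultimately show ?thesis using assms(2) unfolding msum_def
    by (intro emeasure_measure_of_sigma sets.sigma_algebra_axioms)
qed

lemma finite_measure_msum:
  assumes "sets M = sets N" "finite_measure M" "finite_measure N"
  shows "finite_measure (msum M N)"
proof
  have "space M = space N" by (rule sets_eq_imp_space_eq) fact
  then show "emeasure (msum M N) (space (msum M N)) \<noteq> \<infinity>"
    using emeasure_msum[OF assms(1) sets.top] assms(2,3) finite_measure.emeasure_finite[of M "space M"] finite_measure.emeasure_finite[of N "space M"]
    by simp
qed

lemma le_msum:
  assumes "sets M = sets N" "L = M \<or> L = N"
  shows "L \<le> msum M N"
proof -
  have s: "sets L = sets (msum M N)" using assms by auto
  have "emeasure L B \<le> emeasure (msum M N) B" for B
  proof (cases "B \<in> sets M")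
    case True then show ?thesis using emeasure_msum[OF assms(1) True] assms(2) by auto
  next
    case False then show ?thesis using s by (simp add: emeasure_notin_sets)
  qed
  then show ?thesis using s by (subst le_measure) auto
qed

lemma integral_mono_measure_nonneg:
  fixes g :: "'b \<Rightarrow> real"
  assumes "L \<le> K" "sets L = sets K" "integrable K g" "\<And>s. 0 \<le> g s"
  shows "integrable L g" "(\<integral>s. g s \<partial>L) \<le> (\<integral>s. g s \<partial>K)"
proof -
  have m: "g \<in> borel_measurable L" using assms(2,3) borel_measurable_integrable measurable_cong_sets by blast
  have "(\<integral>\<^sup>+s. g s \<partial>L) \<le> (\<integral>\<^sup>+s. g s \<partial>K)"
    by (rule nn_integral_mono_measure) (use assms in auto)
  also have "\<dots> = ennreal (\<integral>s. g s \<partial>K)" by (rule nn_integral_eq_integral) (use assms in auto)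
  finally have le: "(\<integral>\<^sup>+s. g s \<partial>L) \<le> ennreal (\<integral>s. g s \<partial>K)" .
  then show i: "integrable L g" using m assms(4)
    by (intro integrableI_nonneg) (auto intro: le_less_trans)
  have "(\<integral>\<^sup>+s. g s \<partial>L) = ennreal (\<integral>s. g s \<partial>L)" by (rule nn_integral_eq_integral) (use i assms in auto)
  then show "(\<integral>s. g s \<partial>L) \<le> (\<integral>s. g s \<partial>K)"
    using le assms(4) by (simp add: ennreal_le_iff integral_nonneg)
qed

lemma AE_msumD:
  assumes "sets M = sets N" "AE s in msum M N. P s"
  shows "AE s in M. P s" "AE s in N. P s"
proof -
  obtain A where A: "A \<in> null_sets (msum M N)" "{s\<in>space M. \<not> P s} \<subseteq> A"
    using assms(2) unfolding eventually_ae_filter by auto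
  have sp: "space M = space N" using assms sets_eq_imp_space_eq by blast
  have "A \<in> sets M" using A by auto
  with A emeasure_msum[OF assms(1) this] assms(1) have "A \<in> null_sets M" "A \<in> null_sets N" by (auto simp: null_sets_def)
  with A(2) sp show "AE s in M. P s" "AE s in N. P s" unfolding eventually_ae_filter by auto
qed

text \<open>One continuous function approximates the indicator in \<open>L\<^sup>1\<close> of
  \<open>msum M N\<close>, hence under both measures at once, and the inequality passes to the
  limit. This serves to identify marginals and to show that a signed measure is nonnegative.\<close>

lemma measure_le_cfun:
  assumes X: "metrizable_space X" and M: "finite_measure M" "sets M = sets (borel_of X)"
    and N: "finite_measure N" "sets N = sets (borel_of X)"
    and le: "\<And>f. f \<in> cfun X \<Longrightarrow> (\<forall>s\<in>topspace X. 0 \<le> f s \<and> f s \<le> 1) \<Longrightarrow> (\<integral>s. f s \<partial>M) \<le> (\<integral>s. f s \<partial>N)"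
    and A: "A \<in> sets M"
  shows "measure M A \<le> measure N A"
proof (rule field_le_epsilon)
  fix e :: real assume e: "e > 0"
  interpret M: finite_measure M by fact
  interpret N: finite_measure N by fact
  define K where "K = msum M N"
  have MN: "sets M = sets N" using M N by simp
  have sK: "sets K = sets M" unfolding K_def by simp
  have fK: "finite_measure K" unfolding K_def by (rule finite_measure_msum[OF MN M(1) N(1)])
  obtain f where f: "f \<in> cfun X" "\<forall>s\<in>topspace X. 0 \<le> f s \<and> f s \<le> 1" "(\<integral>s. \<bar>f s - indicator A s\<bar> \<partial>K) < e/2"
    using cfun_dense_indicator[OF X fK, of A "e/2"] e A M sK by auto
  have AK: "A \<in> sets K" using A sK by simp
  interpret K: finite_measure K by fact
  have iK: "integrable K (\<lambda>s. \<bar>f s - indicator A s\<bar>)"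
    using cfun_integrable[OF fK _ f(1)] sK M AK
    by (intro integrable_abs Bochner_Integration.integrable_diff integrable_real_indicator) (auto simp: less_top[symmetric] K.emeasure_finite)
  have d: "\<bar>(\<integral>s. f s \<partial>L) - measure L A\<bar> < e/2" if L: "L = M \<or> L = N" for L
  proof -
    have fL: "finite_measure L" "sets L = sets (borel_of X)" "A \<in> sets L" using L M N A by auto
    interpret L: finite_measure L by fact
    have "(\<integral>s. f s \<partial>L) - measure L A = (\<integral>s. f s - indicator A s \<partial>L)"
      using fL cfun_integrable[OF fL(1,2) f(1)]
      by (subst Bochner_Integration.integral_diff) (auto simp: less_top[symmetric] L.emeasure_finite Int_absorb2 dest: sets.sets_into_space)
    also have "\<bar>\<dots>\<bar> \<le> (\<integral>s. \<bar>f s - indicator A s\<bar> \<partial>L)"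
      by (rule integral_abs_bound)
    also have "\<dots> \<le> (\<integral>s. \<bar>f s - indicator A s\<bar> \<partial>K)"
      by (rule integral_mono_measure_nonneg) (use iK L le_msum[OF MN] sK M N K_def in auto)
    also have "\<dots> < e/2" by fact
    finally show ?thesis .
  qed
  show "measure M A \<le> measure N A + e"
    using d[of M, OF disjI1[OF refl]] d[of N, OF disjI2[OF refl]] le[OF f(1,2)] by linarith
qed

section \<open>Representation of positive functionals\<close>

text \<open>\<open>L_cont\<close> stands in for compactness: it is what makes the set function built
  from \<open>L\<close> countably subadditive. The construction follows Riesz: values of open sets,
  an outer measure, then Caratheodory's restriction.\<close>

locale daniell =
  fixes X :: "'b topology" and L :: "('b \<Rightarrow> real) \<Rightarrow> real"
  assumes X: "metrizable_space X"
    and L_add: "f \<in> cfun X \<Longrightarrow> g \<in> cfun X \<Longrightarrow> L (\<lambda>s. f s + g s) = L f + L g"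
    and L_scale: "f \<in> cfun X \<Longrightarrow> L (\<lambda>s. c * f s) = c * L f"
    and L_pos: "f \<in> cfun X \<Longrightarrow> (\<And>s. s \<in> topspace X \<Longrightarrow> 0 \<le> f s) \<Longrightarrow> 0 \<le> L f"
    and L_cont: "(\<And>n::nat. F n \<in> cfun X) \<Longrightarrow>
      (\<And>n s. s \<in> topspace X \<Longrightarrow> F (Suc n) s \<le> F n s) \<Longrightarrow>
      (\<And>s. s \<in> topspace X \<Longrightarrow> (\<lambda>n. F n s) \<longlonglongrightarrow> 0) \<Longrightarrow> (\<lambda>n. L (F n)) \<longlonglongrightarrow> 0"
begin

lemma L_diff: "f \<in> cfun X \<Longrightarrow> g \<in> cfun X \<Longrightarrow> L (\<lambda>s. f s - g s) = L f - L g"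
  using L_add[of f "\<lambda>s. (-1) * g s"] L_scale[of g "-1"] cfun_cmult[of g X "-1"] by simp

lemma L_mono:
  assumes "f \<in> cfun X" "g \<in> cfun X" "\<And>s. s \<in> topspace X \<Longrightarrow> f s \<le> g s"
  shows "L f \<le> L g"
  using L_pos[OF cfun_diff[OF assms(2,1)]] assms L_diff[OF assms(2,1)] by simp

lemma L_sum: "(\<And>i. i \<in> I \<Longrightarrow> f i \<in> cfun X) \<Longrightarrow> L (\<lambda>s. \<Sum>i\<in>I. f i s) = (\<Sum>i\<in>I. L (f i))"
proof (induction I rule: infinite_finite_induct)
  case (insert x F)
  then show ?case using L_add[of "f x" "\<lambda>s. \<Sum>i\<in>F. f i s"] cfun_sum[of F f X] by simp
qed (use L_scale[of "\<lambda>_. 0" 0] in auto)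

definition below :: "'b set \<Rightarrow> ('b \<Rightarrow> real) set" where
  "below U = {f \<in> cfun X. \<forall>s\<in>topspace X. 0 \<le> f s \<and> f s \<le> indicator U s}"

text \<open>The Riesz value of an open set; for other sets \<open>outer_val\<close> takes
  over.\<close>

definition inner_val :: "'b set \<Rightarrow> ennreal" where
  "inner_val U = (SUP f\<in>below U. ennreal (L f))"

definition outer_val :: "'b set \<Rightarrow> ennreal" where
  "outer_val A = (INF U\<in>{U. openin X U \<and> A \<subseteq> U}. inner_val U)"

lemma inner_val_upper: "f \<in> below U \<Longrightarrow> ennreal (L f) \<le> inner_val U"
  unfolding inner_val_def by (rule SUP_upper)

lemma inner_val_mono: "U \<subseteq> V \<Longrightarrow> inner_val U \<le> inner_val V"
  unfolding inner_val_def below_def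
  by (intro SUP_subset_mono) (auto simp: indicator_def split: if_splits)

lemma inner_val_le:
  assumes "g \<in> cfun X" "\<And>s. s \<in> topspace X \<Longrightarrow> indicator U s \<le> g s"
  shows "inner_val U \<le> ennreal (L g)"
  unfolding inner_val_def
proof (rule SUP_least)
  fix f assume f: "f \<in> below U"
  have "L f \<le> L g"
  proof (rule L_mono)
    fix s assume s: "s \<in> topspace X"
    then have "f s \<le> indicator U s" using f by (auto simp: below_def)
    then show "f s \<le> g s" using assms(2)[OF s] by linarith
  qed (use f assms in \<open>auto simp: below_def\<close>)
  then show "ennreal (L f) \<le> ennreal (L g)" by (rule ennreal_leI)
qed

text \<open>A continuous \<open>f\<close> below the union is compared with \<open>p k\<close>, its
  minimum with a sum of \<open>k\<close> approximate indicators. The defects \<open>f - p k\<close>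
  decrease to 0 pointwise, so \<open>L_cont\<close> makes them negligible, while
  \<open>L (p k)\<close> is bounded by finitely many of the values
  \<open>inner_val (U n)\<close>.\<close>

lemma inner_val_countable_subadditive:
  assumes U: "\<And>n::nat. openin X (U n)"
  shows "inner_val (\<Union>n. U n) \<le> (\<Sum>n. inner_val (U n))"
  unfolding inner_val_def[of "\<Union>n. U n"]
proof (rule SUP_least)
  fix f assume "f \<in> below (\<Union>n. U n)"
  then have f: "f \<in> cfun X" "\<And>s. s \<in> topspace X \<Longrightarrow> 0 \<le> f s"
    "\<And>s. s \<in> topspace X \<Longrightarrow> f s \<le> indicator (\<Union>n. U n) s" by (auto simp: below_def)
  have "\<exists>\<theta> :: nat \<Rightarrow> 'b \<Rightarrow> real. (\<forall>k. continuous_map X euclideanreal (\<theta> k)) \<and>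
     (\<forall>k s. s \<in> topspace X \<longrightarrow> 0 \<le> \<theta> k s \<and> \<theta> k s \<le> 1 \<and> (s \<notin> U n \<longrightarrow> \<theta> k s = 0)) \<and>
     (\<forall>m k s. s \<in> topspace X \<longrightarrow> m \<le> k \<longrightarrow> \<theta> m s \<le> \<theta> k s) \<and>
     (\<forall>s\<in>U n. \<exists>k. \<theta> k s = 1)" for n
    by (rule open_indicator_approx[OF X U[of n]]) blast
  then obtain \<theta> :: "nat \<Rightarrow> nat \<Rightarrow> 'b \<Rightarrow> real" where \<theta>:
    "\<And>n k. continuous_map X euclideanreal (\<theta> n k)"
    "\<And>n k s. s \<in> topspace X \<Longrightarrow> 0 \<le> \<theta> n k s \<and> \<theta> n k s \<le> 1 \<and> (s \<notin> U n \<longrightarrow> \<theta> n k s = 0)"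
    "\<And>n m k s. s \<in> topspace X \<Longrightarrow> m \<le> k \<Longrightarrow> \<theta> n m s \<le> \<theta> n k s"
    "\<And>n s. s \<in> U n \<Longrightarrow> \<exists>k. \<theta> n k s = 1"
    by metis
  have tc: "\<theta> n k \<in> cfun X" for n k
    by (rule cfunI[where c=1]) (use \<theta>(1,2) in auto)
  have tb: "\<theta> n k \<in> below (U n)" for n k
    using tc \<theta>(2) by (auto simp: below_def indicator_def)
  \<comment> \<open>The index \<open>k\<close> counts the sets and is also the stage of
    approximation. At a point of \<open>U n\<close> both are large enough from some \<open>k\<close>
    on, and then the sum is at least 1 and dominates \<open>f\<close>.\<close>
  define p where "p = (\<lambda>k s. min (f s) (\<Sum>n<k. \<theta> n k s))"
  have pc: "p k \<in> cfun X" for k unfolding p_def by (intro cfun_min f cfun_sum tc)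
  define g where "g = (\<lambda>k s. f s - p k s)"
  have gc: "g k \<in> cfun X" for k unfolding g_def by (intro cfun_diff f pc)
  have "(\<lambda>k. L (g k)) \<longlonglongrightarrow> 0"
  proof (rule L_cont[OF gc])
    fix k s assume s: "s \<in> topspace X"
    have "(\<Sum>n<k. \<theta> n k s) \<le> (\<Sum>n<k. \<theta> n (Suc k) s)"
      by (intro sum_mono \<theta>(3) s) auto
    also have "\<dots> \<le> (\<Sum>n<Suc k. \<theta> n (Suc k) s)" using \<theta>(2)[OF s] by simp
    finally show "g (Suc k) s \<le> g k s" unfolding g_def p_def by linarith
  next
    fix s assume s: "s \<in> topspace X"
    show "(\<lambda>k. g k s) \<longlonglongrightarrow> 0"
    proof (cases "s \<in> (\<Union>n. U n)")
      case True
      then obtain n where n: "s \<in> U n" by auto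
      then obtain k0 where k0: "\<theta> n k0 s = 1" using \<theta>(4) by blast
      have "g k s = 0" if "k \<ge> max k0 (Suc n)" for k
      proof -
        have "1 \<le> \<theta> n k s" using \<theta>(3)[OF s, of k0 k n] that k0 by simp
        also have "\<dots> \<le> (\<Sum>n<k. \<theta> n k s)"
          using that \<theta>(2)[OF s] by (intro member_le_sum) auto
        finally have "f s \<le> (\<Sum>n<k. \<theta> n k s)"
          using order_trans[OF f(3)[OF s] indicator_le_1] by linarith
        then show ?thesis unfolding g_def p_def by simp
      qed
      then show ?thesis
        by (intro tendsto_eventually eventually_sequentiallyI[of "max k0 (Suc n)"])
    next
      case False
      then have "f s = 0" using f(2,3)[OF s] by simp
      moreover have "0 \<le> (\<Sum>n<k. \<theta> n k s)" for k using \<theta>(2)[OF s] by (intro sum_nonneg) auto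
      ultimately have "g k s = 0" for k unfolding g_def p_def by simp
      then show ?thesis by simp
    qed
  qed
  then have "(\<lambda>k. ennreal (L (g k)) + (\<Sum>n. inner_val (U n))) \<longlonglongrightarrow> ennreal 0 + (\<Sum>n. inner_val (U n))"
    by (intro tendsto_intros)
  then show "ennreal (L f) \<le> (\<Sum>n. inner_val (U n))"
  proof (rule LIMSEQ_le_const[THEN order_trans], intro exI allI impI)
    fix k :: nat
    have "0 \<le> L (g k)"
      by (rule L_pos[OF gc]) (simp add: g_def p_def)
    have "L f = L (g k) + L (p k)" using L_diff[OF f(1) pc[of k]] by (simp add: g_def)
    also have "L (p k) \<le> L (\<lambda>s. \<Sum>n<k. \<theta> n k s)"
      by (intro L_mono pc cfun_sum tc) (simp add: p_def)
    also have "L (\<lambda>s. \<Sum>n<k. \<theta> n k s) = (\<Sum>n<k. L (\<theta> n k))" by (rule L_sum) (rule tc)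
    finally have "ennreal (L f) \<le> ennreal (L (g k) + (\<Sum>n<k. L (\<theta> n k)))" by (simp add: ennreal_leI)
    also have "\<dots> = ennreal (L (g k)) + (\<Sum>n<k. ennreal (L (\<theta> n k)))"
    proof -
      have "0 \<le> L (\<theta> n k)" for n using L_pos[OF tc] \<theta>(2) by simp
      then show ?thesis using \<open>0 \<le> L (g k)\<close> by (simp add: ennreal_plus sum_nonneg sum_ennreal)
    qed
    also have "\<dots> \<le> ennreal (L (g k)) + (\<Sum>n<k. inner_val (U n))"
      by (intro add_left_mono sum_mono inner_val_upper tb)
    also have "\<dots> \<le> ennreal (L (g k)) + (\<Sum>n. inner_val (U n))"
      by (intro add_left_mono sum_le_suminf) auto
    finally show "ennreal (L f) \<le> ennreal (L (g k)) + (\<Sum>n. inner_val (U n))" .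
  qed simp
qed

lemma outer_val_open: "openin X U \<Longrightarrow> outer_val U = inner_val U"
  unfolding outer_val_def by (intro antisym INF_lower INF_greatest inner_val_mono) auto

lemma outer_val_mono: "A \<subseteq> B \<Longrightarrow> outer_val A \<le> outer_val B"
  unfolding outer_val_def by (intro INF_superset_mono) auto

lemma inner_val_empty: "inner_val {} = 0"
  using inner_val_le[of "\<lambda>_. 0" "{}"] L_scale[of "\<lambda>_. 0" 0] by simp

lemma outer_val_lessD: "outer_val A < b \<Longrightarrow> \<exists>U. openin X U \<and> A \<subseteq> U \<and> inner_val U < b"
  unfolding outer_val_def INF_less_iff by auto

lemma outer_val_outer_measure: "outer_measure_space (Pow (topspace X)) outer_val"
  unfolding outer_measure_space_def
proof (intro conjI)
  show "positive (Pow (topspace X)) outer_val"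
    by (simp add: positive_def outer_val_open inner_val_empty)
  show "increasing (Pow (topspace X)) outer_val"
    by (simp add: increasing_def outer_val_mono)
  show "countably_subadditive (Pow (topspace X)) outer_val"
  proof (simp add: countably_subadditive_def, safe)
    fix A :: "nat \<Rightarrow> 'b set" assume A: "range A \<subseteq> Pow (topspace X)"
    show "outer_val (\<Union>i. A i) \<le> (\<Sum>n. outer_val (A n))"
    proof (rule ennreal_le_epsilon)
      fix e :: real assume e: "0 < e" "(\<Sum>n. outer_val (A n)) < top"
      then have "outer_val (A n) < outer_val (A n) + e * (1/2)^Suc n" for n
        by (auto simp add: less_top dest!: ennreal_suminf_lessD)
      from outer_val_lessD[OF this] obtain U where U': "\<And>n. openin X (U n) \<and> A n \<subseteq> U n \<and>
        inner_val (U n) < outer_val (A n) + e * (1/2)^Suc n"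
        by (metis (no_types))
      then have U: "\<And>n. openin X (U n)" "\<And>n. A n \<subseteq> U n"
        "\<And>n. inner_val (U n) \<le> outer_val (A n) + e * (1/2)^Suc n" by (blast intro: less_imp_le)+
      have "outer_val (\<Union>i. A i) \<le> outer_val (\<Union>i. U i)" using U(2) by (intro outer_val_mono) auto
      also have "\<dots> = inner_val (\<Union>i. U i)" using U(1) by (intro outer_val_open) auto
      also have "\<dots> \<le> (\<Sum>n. inner_val (U n))" by (rule inner_val_countable_subadditive) (rule U)
      also have "\<dots> \<le> (\<Sum>n. outer_val (A n) + e * (1/2) ^ Suc n)"
        using U by (intro suminf_le) auto
      also have "\<dots> = (\<Sum>n. outer_val (A n)) + (\<Sum>n. ennreal e * ennreal ((1/2) ^ Suc n))"
        using \<open>0 < e\<close> by (subst suminf_add[symmetric])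
                         (auto simp del: ennreal_suminf_cmult simp add: ennreal_mult[symmetric])
      also have "\<dots> = (\<Sum>n. outer_val (A n)) + e"
        unfolding ennreal_suminf_cmult
        by (subst suminf_ennreal_eq[OF zero_le_power power_half_series]) auto
      finally show "outer_val (\<Union>i. A i) \<le> (\<Sum>n. outer_val (A n)) + e" .
    qed
  qed
qed

text \<open>This is Caratheodory's inequality for an open test set. Lowering \<open>f\<close> by a
  small \<open>d\<close> frees the open set \<open>W\<close> where \<open>f < d\<close>, which
  contains \<open>V - U\<close>. Any \<open>g\<close> below \<open>W\<close> lives where the
  truncation \<open>f'\<close> vanishes, so \<open>f' + g\<close> stays below \<open>V\<close>. The
  truncation costs at most \<open>d * L 1 \<le> e\<close>.\<close>

lemma outer_val_split:
  assumes U: "openin X U" and V: "openin X V"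
  shows "inner_val (U \<inter> V) + outer_val (V - U) \<le> inner_val V"
proof -
  have "ennreal (L f) + outer_val (V - U) \<le> inner_val V + ennreal e" if f: "f \<in> below (U \<inter> V)" and e: "e > 0" for f and e :: real
  proof -
    have fc: "f \<in> cfun X" and f0: "\<And>s. s \<in> topspace X \<Longrightarrow> 0 \<le> f s"
      and f1: "\<And>s. s \<in> topspace X \<Longrightarrow> f s \<le> indicator (U \<inter> V) s" using f by (auto simp: below_def)
    \<comment> \<open>The summand 1 keeps the denominator positive when
      \<open>L (\<lambda>_. 1)\<close> is 0.\<close>
    define d where "d = e / (L (\<lambda>_. 1) + 1)"
    have L1: "0 \<le> L (\<lambda>_. 1)" by (rule L_pos) auto
    have d: "d > 0" "d * L (\<lambda>_. 1) \<le> e" using L1 e unfolding d_def by (auto simp: field_simps)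
    define W where "W = {s \<in> topspace X. f s < d} \<inter> V"
    have "openin X {s \<in> topspace X. f s \<in> {..<d}}"
      using fc by (intro openin_continuous_map_preimage[of X euclideanreal]) (auto simp: cfun_def)
    then have W: "openin X W" unfolding W_def using V by auto
    have sub: "V - U \<subseteq> W"
    proof
      fix s assume s: "s \<in> V - U"
      then have "s \<in> topspace X" using V openin_subset by blast
      then show "s \<in> W" using f1[of s] s d unfolding W_def by auto
    qed
    define f' where "f' = (\<lambda>s. max (f s - d) 0)"
    have f'c: "f' \<in> cfun X" unfolding f'_def by (intro cfun_max cfun_diff fc cfun_const)
    have "L f - d * L (\<lambda>_. 1) = L (\<lambda>s. f s - d * 1)" 
      using L_diff[OF fc cfun_cmult[of "\<lambda>_. 1" X d]] L_scale[of "\<lambda>_. 1" d] by simp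
    also have "\<dots> \<le> L f'"
      by (rule L_mono) (auto simp: f'_def intro!: cfun_diff fc cfun_max)
    finally have Lf: "L f \<le> L f' + e" using d by linarith
    have Lf0: "0 \<le> L f'" by (rule L_pos[OF f'c]) (simp add: f'_def)
    have "ennreal (L f') + inner_val W \<le> inner_val V"
    proof -
      have "ennreal (L f') + ennreal (L g) \<le> inner_val V" if g: "g \<in> below W" for g
      proof -
        have gc: "g \<in> cfun X" and g0: "\<And>s. s \<in> topspace X \<Longrightarrow> 0 \<le> g s"
          and g1: "\<And>s. s \<in> topspace X \<Longrightarrow> g s \<le> indicator W s" using g by (auto simp: below_def)
        have "(\<lambda>s. f' s + g s) \<in> below V"
          unfolding below_def
        proof (intro CollectI conjI ballI)
          fix s assume s: "s \<in> topspace X"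
          show "0 \<le> f' s + g s" using g0[OF s] by (simp add: f'_def)
          show "f' s + g s \<le> indicator V s"
          proof (cases "s \<in> W")
            case True
            then have "f' s = 0" "s \<in> V" unfolding W_def f'_def by auto
            then show ?thesis using g1[OF s] True by simp
          next
            case False
            then have "g s = 0" using g0[OF s] g1[OF s] by simp
            moreover have "f' s \<le> max (f s) 0" using d unfolding f'_def by auto
            moreover have "indicator (U \<inter> V) s \<le> (indicator V s :: real)" by (auto simp: indicator_def)
            ultimately show ?thesis using f1[OF s] f0[OF s] by linarith
          qed
        qed (intro cfun_add f'c gc)
        then have "ennreal (L (\<lambda>s. f' s + g s)) \<le> inner_val V" by (rule inner_val_upper)
        moreover have "L (\<lambda>s. f' s + g s) = L f' + L g" by (rule L_add[OF f'c gc])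
        moreover have "0 \<le> L g" by (rule L_pos[OF gc g0])
        ultimately show ?thesis using Lf0 by (simp add: ennreal_plus)
      qed
      moreover have "below W \<noteq> {}"
        by (auto simp: below_def intro!: exI[of _ "\<lambda>_. 0"])
      ultimately show ?thesis unfolding inner_val_def[of W]
        by (subst ennreal_SUP_add_right) (auto intro!: SUP_least)
    qed
    moreover have "outer_val (V - U) \<le> inner_val W"
      using outer_val_mono[OF sub] outer_val_open[OF W] by simp
    moreover have "ennreal (L f) \<le> ennreal (L f') + ennreal e"
      using Lf Lf0 e by (simp add: ennreal_plus[symmetric] ennreal_leI del: ennreal_plus)
    ultimately have "ennreal (L f) + outer_val (V - U) \<le> (ennreal (L f') + ennreal e) + inner_val W"
      "(ennreal (L f') + inner_val W) + ennreal e \<le> inner_val V + ennreal e"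
      by (auto intro: add_mono)
    moreover have "(ennreal (L f') + ennreal e) + inner_val W = (ennreal (L f') + inner_val W) + ennreal e"
      by (simp add: ac_simps)
    ultimately show ?thesis by (metis order_trans)
  qed
  note eps = this
  have le: "ennreal (L f) + outer_val (V - U) \<le> inner_val V" if f: "f \<in> below (U \<inter> V)" for f
    by (rule ennreal_le_epsilon, rule eps[OF f])
  have "below (U \<inter> V) \<noteq> {}" by (auto simp: below_def intro!: exI[of _ "\<lambda>_. 0"])
  then have "inner_val (U \<inter> V) + outer_val (V - U) = (SUP f\<in>below (U \<inter> V). ennreal (L f) + outer_val (V - U))"
    unfolding inner_val_def[of "U \<inter> V"] by (rule ennreal_SUP_add_left[symmetric])
  also have "\<dots> \<le> inner_val V" by (rule SUP_least) (rule le)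
  finally show ?thesis .
qed

text \<open>Outer regularity reduces an arbitrary test set \<open>A\<close> to the open sets
  \<open>V\<close> around it, where \<open>outer_val_split\<close> applies; the other inequality is
  subadditivity.\<close>

lemma open_in_lambda_system:
  assumes U: "openin X U"
  shows "U \<in> lambda_system (topspace X) (Pow (topspace X)) outer_val"
  unfolding lambda_system_def
proof (intro CollectI conjI ballI)
  show "U \<in> Pow (topspace X)" using U openin_subset by auto
  fix A assume A: "A \<in> Pow (topspace X)"
  show "outer_val (U \<inter> A) + outer_val ((topspace X - U) \<inter> A) = outer_val A"
  proof (rule antisym)
    show "outer_val (U \<inter> A) + outer_val ((topspace X - U) \<inter> A) \<le> outer_val A"
      unfolding outer_val_def[of A]
    proof (rule INF_greatest)
      fix V assume V: "V \<in> {V. openin X V \<and> A \<subseteq> V}"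
      have "outer_val (U \<inter> A) + outer_val ((topspace X - U) \<inter> A) \<le> outer_val (U \<inter> V) + outer_val (V - U)"
        using V by (intro add_mono outer_val_mono) auto
      also have "\<dots> = inner_val (U \<inter> V) + outer_val (V - U)"
        using U V by (simp add: outer_val_open openin_Int)
      also have "\<dots> \<le> inner_val V" using V by (intro outer_val_split U) auto
      finally show "outer_val (U \<inter> A) + outer_val ((topspace X - U) \<inter> A) \<le> inner_val V" .
    qed
    have "subadditive (Pow (topspace X)) outer_val"
    proof -
      interpret sigma_algebra "topspace X" "Pow (topspace X)" by (rule sigma_algebra_Pow)
      show ?thesis using outer_val_outer_measure unfolding outer_measure_space_def
        by (intro countably_subadditive_subadditive) auto
    qed
    then have "outer_val ((U \<inter> A) \<union> ((topspace X - U) \<inter> A)) \<le> outer_val (U \<inter> A) + outer_val ((topspace X - U) \<inter> A)"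
      using A by (intro subadditiveD) auto
    moreover have "(U \<inter> A) \<union> ((topspace X - U) \<inter> A) = A" using A by auto
    ultimately show "outer_val A \<le> outer_val (U \<inter> A) + outer_val ((topspace X - U) \<inter> A)" by simp
  qed
qed

definition repr :: "'b measure" where
  "repr = measure_of (topspace X) (sets (borel_of X)) outer_val"

lemma sets_repr [simp]: "sets repr = sets (borel_of X)"
  unfolding repr_def using sets.space_closed[of "borel_of X"] sets.sigma_sets_eq[of "borel_of X"] by simp

text \<open>The lambda system of the outer measure is a sigma-algebra that contains the open sets,
  hence all Borel sets, and the outer measure is countably additive on it.\<close>

lemma emeasure_repr: "A \<in> sets (borel_of X) \<Longrightarrow> emeasure repr A = outer_val A"
proof -
  assume A: "A \<in> sets (borel_of X)"
  let ?LS = "lambda_system (topspace X) (Pow (topspace X)) outer_val"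
  have ms: "measure_space (topspace X) ?LS outer_val"
    by (rule sigma_algebra.caratheodory_lemma[OF sigma_algebra_Pow outer_val_outer_measure])
  then have sa: "sigma_algebra (topspace X) ?LS" by (simp add: measure_space_def)
  have sub: "sets (borel_of X) \<subseteq> ?LS"
    unfolding sets_borel_of using open_in_lambda_system
    by (intro sigma_algebra.sigma_sets_subset[OF sa]) auto
  have "countably_additive ?LS outer_val" "positive ?LS outer_val" using ms by (auto simp: measure_space_def)
  then have "countably_additive (sets (borel_of X)) outer_val" "positive (sets (borel_of X)) outer_val"
    using sub unfolding countably_additive_def positive_def by (meson subset_trans subsetD, meson)
  moreover have "sigma_algebra (topspace X) (sets (borel_of X))"
    using sets.sigma_algebra_axioms[of "borel_of X"] by simp
  ultimately show ?thesis unfolding repr_def using A by (intro emeasure_measure_of_sigma)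
qed

lemma space_repr: "space repr = topspace X"
  using sets_eq_imp_space_eq[OF sets_repr] by simp

lemma emeasure_repr_space: "emeasure repr (topspace X) = ennreal (L (\<lambda>_. 1))"
proof -
  have "emeasure repr (topspace X) = inner_val (topspace X)"
    using emeasure_repr[of "topspace X"] by (simp add: openin_borel_of outer_val_open)
  moreover have "inner_val (topspace X) \<le> ennreal (L (\<lambda>_. 1))"
    by (rule inner_val_le) auto
  moreover have "ennreal (L (\<lambda>_. 1)) \<le> inner_val (topspace X)"
    by (rule inner_val_upper) (auto simp: below_def)
  ultimately show ?thesis by simp
qed

lemma finite_repr: "finite_measure repr"
  by (rule finite_measureI) (simp add: space_repr emeasure_repr_space)

text \<open>A layer-cake argument: \<open>n f\<close> is the sum of the slices \<open>c k\<close>.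
  The slice \<open>c k\<close> is at most the indicator of \<open>U k\<close>, which in turn is at
  most the preceding slice \<open>c (k - 1)\<close>. Passing from slices to indicators and back
  therefore shifts the index by one and costs \<open>L 1\<close>, which disappears after division by
  \<open>n\<close>.\<close>

lemma L_ge_integral:
  assumes f: "f \<in> cfun X" "\<And>s. s \<in> topspace X \<Longrightarrow> 0 \<le> f s \<and> f s \<le> 1"
  shows "(\<integral>s. f s \<partial>repr) \<le> L f"
proof -
  interpret finite_measure repr by (rule finite_repr)
  have L1: "0 \<le> L (\<lambda>_. 1)" by (rule L_pos) auto
  have main: "real n * (\<integral>s. f s \<partial>repr) \<le> L (\<lambda>_. 1) + real n * L f" for n :: nat
  proof -
    define c where "c = (\<lambda>k s. min 1 (max 0 (real n * f s - real k)))"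
    have cc: "c k \<in> cfun X" for k
      unfolding c_def by (intro cfun_min cfun_max cfun_diff cfun_cmult f cfun_const)
    have c0: "0 \<le> L (c k)" for k by (rule L_pos[OF cc]) (simp add: c_def)
    have clampsum: "(\<Sum>k<m. min 1 (max 0 (t - real k))) = min t (real m)" if "t \<ge> 0" for t :: real and m
      by (induction m) (use that in auto)
    have cs: "(\<Sum>k<n. c k s) = real n * f s" if "s \<in> topspace X" for s
      unfolding c_def using f(2)[OF that] by (subst clampsum) (auto simp: mult_le_cancel_left1 min_def intro: antisym mult_left_le)
    define U where "U = (\<lambda>k::nat. {s \<in> topspace X. real k < real n * f s})"
    have Uo: "openin X (U k)" for k
    proof -
      have "openin X {s \<in> topspace X. real n * f s \<in> {real k<..}}"
        using f(1) by (intro openin_continuous_map_preimage[of X euclideanreal]) (auto simp: cfun_def intro: continuous_map_real_mult_left)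
      then show ?thesis by (simp add: U_def)
    qed
    have Us: "U k \<in> sets repr" for k using openin_borel_of[OF Uo] by simp
    \<comment> \<open>For \<open>k = 0\<close> there is no preceding slice, and the bound is
      \<open>L 1\<close>.\<close>
    have mU: "measure repr (U k) \<le> (case k of 0 \<Rightarrow> L (\<lambda>_. 1) | Suc j \<Rightarrow> L (c j))" for k
    proof -
      have e: "emeasure repr (U k) = inner_val (U k)" using Us Uo by (simp add: emeasure_repr outer_val_open)
      show ?thesis
      proof (cases k)
        case 0
        have "emeasure repr (U k) \<le> ennreal (L (\<lambda>_. 1))"
          unfolding e by (rule inner_val_le) (auto simp: indicator_def)
        then show ?thesis using 0 L1 by (simp add: measure_def enn2real_leI)
      next
        case (Suc j)
        have "emeasure repr (U k) \<le> ennreal (L (c j))"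
          unfolding e by (rule inner_val_le[OF cc]) (auto simp: indicator_def c_def U_def Suc)
        then show ?thesis using Suc c0 by (simp add: measure_def enn2real_leI)
      qed
    qed
    have "real n * (\<integral>s. f s \<partial>repr) = (\<integral>s. real n * f s \<partial>repr)" by simp
    also have "\<dots> \<le> (\<integral>s. (\<Sum>k<n. indicator (U k) s) \<partial>repr)"
    proof (rule integral_mono)
      show "integrable repr (\<lambda>s. real n * f s)"
        using cfun_integrable[OF finite_repr sets_repr f(1)] by simp
      show "integrable repr (\<lambda>s. \<Sum>k<n. indicator (U k) s :: real)"
        using Us by (intro Bochner_Integration.integrable_sum) (auto simp: less_top[symmetric])
      fix s assume "s \<in> space repr"
      then have s: "s \<in> topspace X" by (simp add: space_repr)
      have "real n * f s = (\<Sum>k<n. c k s)" by (simp add: cs s)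
      also have "\<dots> \<le> (\<Sum>k<n. indicator (U k) s)"
        by (rule sum_mono) (auto simp: c_def U_def indicator_def s)
      finally show "real n * f s \<le> (\<Sum>k<n. indicator (U k) s)" .
    qed
    also have "\<dots> = (\<Sum>k<n. measure repr (U k))"
      using Us by (subst Bochner_Integration.integral_sum) (auto simp: less_top[symmetric] Int_absorb2 dest: sets.sets_into_space)
    also have "\<dots> \<le> (\<Sum>k<n. (case k of 0 \<Rightarrow> L (\<lambda>_. 1) | Suc j \<Rightarrow> L (c j)))"
      by (rule sum_mono) (rule mU)
    also have "\<dots> \<le> L (\<lambda>_. 1) + (\<Sum>k<n. L (c k))"
    proof (cases n)
      case 0 then show ?thesis using L1 by simp
    next
      case (Suc m)
      have "(\<Sum>k<Suc m. (case k of 0 \<Rightarrow> L (\<lambda>_. 1) | Suc j \<Rightarrow> L (c j))) = L (\<lambda>_. 1) + (\<Sum>k<m. L (c k))"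
        by (subst sum.lessThan_Suc_shift) simp
      then show ?thesis using Suc c0 by simp
    qed
    also have "(\<Sum>k<n. L (c k)) = L (\<lambda>s. \<Sum>k<n. c k s)" by (rule L_sum[symmetric]) (rule cc)
    also have "\<dots> \<le> L (\<lambda>s. real n * f s)"
      by (intro L_mono cfun_sum cc cfun_cmult f) (simp add: cs)
    also have "\<dots> = real n * L f" by (rule L_scale[OF f(1)])
    finally show ?thesis by simp
  qed
  show ?thesis
  proof (rule ccontr)
    assume "\<not> ?thesis"
    then have "0 < (\<integral>s. f s \<partial>repr) - L f" by simp
    then obtain n :: nat where "L (\<lambda>_. 1) < real n * ((\<integral>s. f s \<partial>repr) - L f)"
      using reals_Archimedean3 by blast
    then show False using main[of n] by (simp add: algebra_simps)
  qed
qed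

text \<open>For values in \<open>[0, 1]\<close>, \<open>L_ge_integral\<close> applies to
  \<open>g\<close> and to \<open>1 - g\<close>, and the total mass is \<open>L 1\<close>, so
  equality holds. An affine change of scale reaches every bounded continuous function.\<close>

theorem L_eq_integral:
  assumes f: "f \<in> cfun X"
  shows "L f = (\<integral>s. f s \<partial>repr)"
proof -
  interpret finite_measure repr by (rule finite_repr)
  have M1: "measure repr (topspace X) = L (\<lambda>_. 1)"
    using L_pos[of "\<lambda>_. 1"] by (simp add: measure_def emeasure_repr_space)
  have eq01: "L g = (\<integral>s. g s \<partial>repr)" if g: "g \<in> cfun X" "\<And>s. s \<in> topspace X \<Longrightarrow> 0 \<le> g s \<and> g s \<le> 1" for g
  proof (rule antisym[OF _ L_ge_integral[OF that]])
    have "(\<integral>s. 1 - g s \<partial>repr) \<le> L (\<lambda>s. 1 - g s)"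
      by (rule L_ge_integral) (use g in \<open>auto intro: cfun_diff\<close>)
    moreover have "(\<integral>s. 1 - g s \<partial>repr) = L (\<lambda>_. 1) - (\<integral>s. g s \<partial>repr)"
      using cfun_integrable[OF finite_repr sets_repr g(1)] M1
      by (subst Bochner_Integration.integral_diff) (auto simp: space_repr)
    moreover have "L (\<lambda>s. 1 - g s) = L (\<lambda>_. 1) - L g" by (rule L_diff) (use g in auto)
    ultimately show "L g \<le> (\<integral>s. g s \<partial>repr)" by simp
  qed
  obtain c where c: "\<And>s. s \<in> topspace X \<Longrightarrow> \<bar>f s\<bar> \<le> c" using f by (auto simp: cfun_def)
  define a where "a = \<bar>c\<bar> + 1"
  have a: "a > 0" "\<And>s. s \<in> topspace X \<Longrightarrow> \<bar>f s\<bar> \<le> a" using c unfolding a_def by (auto, fastforce)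
  define g where "g = (\<lambda>s. (1/(2*a)) * (f s + a))"
  have g: "g \<in> cfun X" unfolding g_def by (intro cfun_cmult cfun_add f cfun_const)
  have g01: "0 \<le> g s \<and> g s \<le> 1" if "s \<in> topspace X" for s
    using a(1) a(2)[OF that] unfolding g_def by (auto simp: field_simps abs_le_iff)
  have fg: "f s = 2 * a * g s - a * 1" for s using a(1) by (simp add: g_def)
  have "L f = L (\<lambda>s. 2 * a * g s - a * 1)" using fg by presburger
  also have "\<dots> = 2 * a * L g - a * L (\<lambda>_. 1)"
    using L_diff[OF cfun_cmult[OF g, of "2*a"] cfun_cmult[of "\<lambda>_. 1" X a]] L_scale[OF g, of "2*a"] L_scale[of "\<lambda>_. 1" a] by simp
  also have "\<dots> = 2 * a * (\<integral>s. g s \<partial>repr) - a * measure repr (topspace X)"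
    by (simp add: eq01[OF g g01] M1)
  also have "\<dots> = (\<integral>s. 2 * a * g s - a * 1 \<partial>repr)"
    using cfun_integrable[OF finite_repr sets_repr g]
    by (subst Bochner_Integration.integral_diff) (auto simp: space_repr)
  also have "\<dots> = (\<integral>s. f s \<partial>repr)" using fg by presburger
  finally show ?thesis .
qed

end

section \<open>Tightness\<close>

text \<open>Ulam's argument: for each radius \<open>1 / (n + 1)\<close>, finitely many closed balls
  around points of a countable dense set leave out less than \<open>e / 2^(n + 2)\<close> of the
  mass. The intersection over \<open>n\<close> is closed and totally bounded for a complete metric,
  hence compact, and the losses add up to at most \<open>e / 2\<close>.\<close>

lemma polish_tight:
  assumes P: "polish_topology X" and M: "finite_measure M" "sets M = sets (borel_of X)" and e: "e > 0"
  shows "\<exists>K. compactin X K \<and> closedin X K \<and> measure M (topspace X - K) < e"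
proof -
  interpret finite_measure M by fact
  have sp: "space M = topspace X" using sets_eq_imp_space_eq[OF M(2)] by simp
  obtain S d where "Metric_space S d" and mc: "Metric_space.mcomplete S d" and Xe: "X = Metric_space.mtopology S d"
    using P unfolding polish_topology_def completely_metrizable_space_def by blast
  interpret Metric_space S d by fact
  have tS: "topspace X = S" by (simp add: Xe)
  obtain C where C: "countable C" "C \<subseteq> S" "X closure_of C = S"
    using P unfolding polish_topology_def separable_space_def by (auto simp: tS)
  have sep: "\<exists>c\<in>C. x \<in> mball c r" if x: "x \<in> S" and r: "r > 0" for x r
  proof -
    have "x \<in> mtopology closure_of C" using x C Xe by simp
    then have "\<forall>r>0. \<exists>y\<in>C. y \<in> mball x r"
      unfolding metric_closure_of by blast
    then obtain y where "y \<in> C" "y \<in> mball x r" using r by blast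
    then show ?thesis by (auto simp: commute)
  qed
  show ?thesis
  proof (cases "C = {}")
    case True
    then have "S = {}" using C by simp
    then show ?thesis using e tS by (intro exI[of _ "{}"]) auto
  next
    case False
    define c where "c = from_nat_into C"
    have cC: "range c = C" unfolding c_def using False C by (intro range_from_nat_into) auto
    define B where "B = (\<lambda>n k. \<Union>i<k. mcball (c i) (1 / Suc n))"
    have Bc: "closedin X (B n k)" for n k
      unfolding B_def Xe by (intro closedin_Union) auto
    have Bs: "B n k \<in> sets M" for n k using closedin_borel_of[OF Bc] M(2) by simp
    have ex: "\<exists>k. measure M (S - B n k) < e / 2 ^ (n + 2)" for n
    proof -
      have "(\<lambda>k. measure M (B n k)) \<longlonglongrightarrow> measure M (\<Union>k. B n k)"
        by (rule finite_Lim_measure_incseq) (use Bs in \<open>auto simp: incseq_def B_def, force\<close>)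
      moreover have "(\<Union>k. B n k) = S"
      proof (intro equalityI subsetI)
        fix x assume x: "x \<in> S"
        then obtain i where "x \<in> mball (c i) (1 / Suc n)" using sep[OF x, of "1 / Suc n"] cC by (metis image_iff of_nat_0_less_iff zero_less_Suc zero_less_divide_1_iff)
        then have "x \<in> B n (Suc i)" unfolding B_def using mball_subset_mcball by (auto intro!: bexI[of _ i])
        then show "x \<in> (\<Union>k. B n k)" by blast
      qed (auto simp: B_def)
      ultimately have "(\<lambda>k. measure M S - measure M (B n k)) \<longlonglongrightarrow> measure M S - measure M S"
        by (intro tendsto_intros) simp
      moreover have "measure M S - measure M (B n k) = measure M (S - B n k)" for k
        using finite_measure_compl[OF Bs[of n k]] sp tS by simp
      ultimately have "(\<lambda>k. measure M (S - B n k)) \<longlonglongrightarrow> 0" by simp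
      moreover have "0 < e / 2 ^ (n + 2)" using e by simp
      ultimately have "\<forall>\<^sub>F k in sequentially. measure M (S - B n k) < e / 2 ^ (n + 2)"
        by (rule order_tendstoD(2))
      then show ?thesis using eventually_happens' sequentially_bot by blast
    qed
    then obtain k where k: "\<And>n. measure M (S - B n (k n)) < e / 2 ^ (n + 2)" by metis
    define K where "K = (\<Inter>n. B n (k n))"
    have Kc: "closedin X K" unfolding K_def by (intro closedin_Inter) (use Bc in auto)
    have KS: "K \<subseteq> S" using closedin_subset[OF Kc] tS by simp
    have "mtotally_bounded K"
      unfolding mtotally_bounded_def
    proof (intro allI impI)
      fix r :: real assume r: "r > 0"
      obtain n where n: "1 / Suc n < r / 2" using r by (metis half_gt_zero nat_approx_posE)
      \<comment> \<open>Total boundedness asks for centres in \<open>K\<close>, so every ball that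
        meets \<open>K\<close> is recentred at a point of \<open>K\<close>. This doubles the radius,
        whence the bound \<open>r / 2\<close> above.\<close>
      define p where "p = (\<lambda>i. SOME x. x \<in> K \<and> x \<in> mcball (c i) (1 / Suc n))"
      let ?I = "{i. i < k n \<and> K \<inter> mcball (c i) (1 / Suc n) \<noteq> {}}"
      have p: "p i \<in> K \<and> p i \<in> mcball (c i) (1 / Suc n)" if "i \<in> ?I" for i
        unfolding p_def by (rule someI_ex) (use that in auto)
      have "K \<subseteq> (\<Union>x\<in>p ` ?I. mball x r)"
      proof
        fix x assume x: "x \<in> K"
        then have "x \<in> B n (k n)" unfolding K_def by auto
        then obtain i where i: "i < k n" "x \<in> mcball (c i) (1 / Suc n)" unfolding B_def by auto
        then have "i \<in> ?I" using x by auto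
        note pi = p[OF this]
        have "d (p i) x \<le> d (p i) (c i) + d (c i) x" using i pi KS x by (intro triangle) auto
        also have "\<dots> \<le> 1 / Suc n + 1 / Suc n" using i pi by (intro add_mono) (auto simp: commute)
        also have "\<dots> < r" using n by simp
        finally have "x \<in> mball (p i) r" using pi KS x by auto
        then show "x \<in> (\<Union>x\<in>p ` ?I. mball x r)" using \<open>i \<in> ?I\<close> by blast
      qed
      moreover have "p ` ?I \<subseteq> K" using p by auto
      ultimately show "\<exists>F. finite F \<and> F \<subseteq> K \<and> K \<subseteq> (\<Union>x\<in>F. mball x r)"
        by (intro exI[of _ "p ` ?I"]) auto
    qed
    then have "compactin mtopology (mtopology closure_of K)"
      using mtotally_bounded_eq_compact_closure_of[OF mc] by blast
    moreover have "mtopology closure_of K = K" using Kc by (simp add: Xe closure_of_closedin)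
    ultimately have Kcomp: "compactin X K" by (simp add: Xe)
    have Ss: "S \<in> sets M" using sets.top[of M] sp tS by simp
    have le: "measure M (S - B n (k n)) \<le> (e/4) * (1/2)^n" for n
      using k[of n] by (auto intro!: less_imp_le simp: power_divide mult.commute)
    have geo: "summable (\<lambda>n. (e/4) * (1/2::real)^n)" by (intro summable_mult summable_geometric) auto
    have sm: "summable (\<lambda>n. measure M (S - B n (k n)))"
      by (rule summable_comparison_test'[OF geo, where N=0]) (use le in auto)
    have "measure M (S - K) = measure M (\<Union>n. S - B n (k n))" unfolding K_def by (rule arg_cong) blast
    also have "\<dots> \<le> (\<Sum>n. measure M (S - B n (k n)))"
      by (rule finite_measure_subadditive_countably) (use Ss Bs sm in auto)
    also have "\<dots> \<le> (\<Sum>n. (e/4) * (1/2)^n)"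
      by (rule suminf_le[OF le sm geo])
    also have "\<dots> = e / 2" by (subst suminf_mult) (auto simp: suminf_geometric)
    also have "\<dots> < e" using e by simp
    finally show ?thesis using Kcomp Kc tS by blast
  qed
qed

lemma dini_compact:
  fixes f :: "nat \<Rightarrow> 'b \<Rightarrow> real"
  assumes K: "compactin X K" and c: "\<And>n. continuous_map X euclideanreal (f n)"
    and dec: "\<And>n s. s \<in> topspace X \<Longrightarrow> f (Suc n) s \<le> f n s"
    and lim: "\<And>s. s \<in> topspace X \<Longrightarrow> (\<lambda>n. f n s) \<longlonglongrightarrow> 0" and e: "e > 0"
  shows "\<exists>N. \<forall>n\<ge>N. \<forall>s\<in>K. f n s < e"
proof -
  define U where "U = (\<lambda>n. {s \<in> topspace X. f n s \<in> {..<e}})"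
  have Uo: "openin X (U n)" for n
    unfolding U_def using c by (intro openin_continuous_map_preimage[of X euclideanreal]) auto
  have mono: "f n s \<le> f m s" if "s \<in> topspace X" "m \<le> n" for m n s
    using lift_Suc_antimono_le[of "\<lambda>n. f n s", OF dec[OF that(1)] that(2)] .
  have KX: "K \<subseteq> topspace X" using K compactin_subset_topspace by blast
  have "K \<subseteq> \<Union>(range U)"
  proof
    fix s assume "s \<in> K"
    then have s: "s \<in> topspace X" using KX by auto
    then have "\<forall>\<^sub>F n in sequentially. f n s < e" using lim e by (intro order_tendstoD(2)) auto
    then obtain n where "f n s < e" using eventually_happens' sequentially_bot by blast
    then show "s \<in> \<Union>(range U)" using s by (auto simp: U_def)
  qed
  then obtain F where F: "finite F" "F \<subseteq> range U" "K \<subseteq> \<Union>F"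
    using compactinD[OF K, of "range U"] Uo by blast
  then obtain I where I: "finite I" "F = U ` I" by (meson finite_subset_image)
  obtain N where N: "\<And>i. i \<in> I \<Longrightarrow> i \<le> N" using I(1)[unfolded finite_nat_set_iff_bounded_le] by blast
  show ?thesis
  proof (intro exI[of _ N] allI impI ballI)
    fix n s assume n: "n \<ge> N" and s: "s \<in> K"
    then have "s \<in> \<Union>(U ` I)" using F(3) I(2) by (metis subsetD)
    then obtain i where i: "i \<in> I" "s \<in> U i" by (rule UN_E)
    have "s \<in> topspace X" using s KX by blast
    moreover have "i \<le> n" using N[OF i(1)] n by simp
    ultimately have "f n s \<le> f i s" by (rule mono)
    then show "f n s < e" using i by (simp add: U_def)
  qed
qed

section \<open>The Hahn--Banach theorem\<close>

definition sublinear_on :: "('b \<Rightarrow> real) set \<Rightarrow> (('b \<Rightarrow> real) \<Rightarrow> real) \<Rightarrow> bool" where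
  "sublinear_on V p \<longleftrightarrow> (\<forall>f\<in>V. \<forall>g\<in>V. p (\<lambda>s. f s + g s) \<le> p f + p g) \<and>
     (\<forall>f\<in>V. \<forall>a\<ge>0. p (\<lambda>s. a * f s) = a * p f)"

lemma sublinear_onD:
  assumes "sublinear_on V p"
  shows "f \<in> V \<Longrightarrow> g \<in> V \<Longrightarrow> p (\<lambda>s. f s + g s) \<le> p f + p g"
    "f \<in> V \<Longrightarrow> 0 \<le> a \<Longrightarrow> p (\<lambda>s. a * f s) = a * p f"
  using assms unfolding sublinear_on_def by auto

text \<open>Hahn--Banach through Zorn's lemma: a minimal sublinear functional \<open>m\<close> is linear, since
  \<open>y \<mapsto> inf\<^sub>t (m (y + t x) - t m x)\<close> is again sublinear and below \<open>m\<close>.\<close>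

lemma sublinear_dominates_linear:
  fixes V :: "('b \<Rightarrow> real) set"
  assumes V: "\<And>f g. f \<in> V \<Longrightarrow> g \<in> V \<Longrightarrow> (\<lambda>s. f s + g s) \<in> V" "\<And>f a. f \<in> V \<Longrightarrow> (\<lambda>s. a * f s) \<in> V"
    and q: "sublinear_on V q"
  shows "\<exists>L. (\<forall>f\<in>V. L f \<le> q f) \<and> (\<forall>f\<in>V. \<forall>g\<in>V. L (\<lambda>s. f s + g s) = L f + L g) \<and>
    (\<forall>f\<in>V. \<forall>a. L (\<lambda>s. a * f s) = a * L f)"
proof -
  \<comment> \<open>Functionals are put to 0 outside \<open>V\<close>, so that the pointwise order
    is antisymmetric and minimality can be stated as an equality.\<close>
  define A where "A = {p. sublinear_on V p \<and> (\<forall>f\<in>V. p f \<le> q f) \<and> (\<forall>f. f \<notin> V \<longrightarrow> p f = 0)}"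
  \<comment> \<open>The order is reversed: a maximal element in the sense of Zorn's lemma is a
    minimal sublinear functional.\<close>
  define P :: "(('b \<Rightarrow> real) \<Rightarrow> real) \<Rightarrow> (('b \<Rightarrow> real) \<Rightarrow> real) \<Rightarrow> bool" where "P = (\<lambda>a b. \<forall>f. b f \<le> a f)"
  have zero: "p (\<lambda>s. 0) = 0" if "sublinear_on V p" "f \<in> V" for p f
    using sublinear_onD(2)[OF that, of 0] by simp
  have lower: "- p (\<lambda>s. - 1 * f s) \<le> p f" if "sublinear_on V p" "f \<in> V" for p f
    using sublinear_onD(1)[OF that(1) that(2) V(2)[OF that(2), of "-1"]] zero[OF that] by simp
  have po: "partial_order_on A (relation_of P A)"
    by (rule partial_order_on_relation_ofI) (auto simp: P_def intro: order_trans, metis order_antisym ext)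
  have "\<exists>m\<in>A. \<forall>a\<in>A. P m a \<longrightarrow> a = m"
  proof (rule predicate_Zorn[OF po])
    fix C assume C: "C \<in> Chains (relation_of P A)"
    then have CA: "C \<subseteq> A" by (auto simp: Chains_def relation_of_def)
    show "\<exists>u\<in>A. \<forall>a\<in>C. P a u"
    proof (cases "C = {}")
      case True
      have "(\<lambda>f. if f \<in> V then q f else 0) \<in> A"
        using q V by (auto simp: A_def sublinear_on_def)
      then show ?thesis using True by auto
    next
      case False
      define u where "u = (\<lambda>f. if f \<in> V then (INF p\<in>C. p f) else 0)"
      \<comment> \<open>Sublinearity gives \<open>- p (- f) \<le> p f\<close>, and
        \<open>p \<le> q\<close> turns \<open>- q (- f)\<close> into a lower bound common to the
        whole chain.\<close>
      have bdd: "bdd_below ((\<lambda>p. p f) ` C)" if f: "f \<in> V" for f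
      proof (rule bdd_belowI2)
        fix p assume p: "p \<in> C"
        then have "p \<in> A" using CA by auto
        then have "p (\<lambda>s. - 1 * f s) \<le> q (\<lambda>s. - 1 * f s)" "- p (\<lambda>s. - 1 * f s) \<le> p f"
          using V(2)[OF f] lower f unfolding A_def by blast+
        then show "- q (\<lambda>s. - 1 * f s) \<le> p f" by linarith
      qed
      have u_le: "u f \<le> p f" if "p \<in> C" "f \<in> V" for p f
        unfolding u_def using that bdd by (auto intro: cINF_lower)
      have u_ge: "c \<le> u f" if "f \<in> V" "\<And>p. p \<in> C \<Longrightarrow> c \<le> p f" for c f
        unfolding u_def using that False by (auto intro: cINF_greatest)
      have Cs: "sublinear_on V p" if "p \<in> C" for p using CA that by (auto simp: A_def)
      have add: "u (\<lambda>s. f s + g s) \<le> u f + u g" if fg: "f \<in> V" "g \<in> V" for f g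
      proof -
        \<comment> \<open>Along a chain one functional lies below both \<open>p1\<close> and
          \<open>p2\<close>; an infimum over an arbitrary family of sublinear functionals need not
          be subadditive.\<close>
        have *: "u (\<lambda>s. f s + g s) \<le> p1 f + p2 g" if p: "p1 \<in> C" "p2 \<in> C" for p1 p2
        proof -
          have "P p1 p2 \<or> P p2 p1" using C p by (auto simp: Chains_def relation_of_def)
          then obtain p where "p \<in> C" "p f \<le> p1 f" "p g \<le> p2 g" using p unfolding P_def by blast
          moreover have "u (\<lambda>s. f s + g s) \<le> p (\<lambda>s. f s + g s)" using u_le[OF \<open>p \<in> C\<close>] V(1) fg by blast
          ultimately show ?thesis using sublinear_onD(1)[OF Cs[OF \<open>p \<in> C\<close>] fg] by linarith
        qed
        have "u (\<lambda>s. f s + g s) - p1 f \<le> u g" if "p1 \<in> C" for p1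
        proof (rule u_ge[OF fg(2)])
          fix p assume "p \<in> C"
          from *[OF that this] show "u (\<lambda>s. f s + g s) - p1 f \<le> p g" by linarith
        qed
        then have "u (\<lambda>s. f s + g s) - u g \<le> p1 f" if "p1 \<in> C" for p1 using that by (smt (verit))
        then have "u (\<lambda>s. f s + g s) - u g \<le> u f" by (intro u_ge fg)
        then show ?thesis by simp
      qed
      have half: "u (\<lambda>s. a * f s) \<le> a * u f" if "f \<in> V" "a > 0" for f a
      proof -
        have "u (\<lambda>s. a * f s) / a \<le> u f"
        proof (rule u_ge[OF that(1)])
          fix p assume p: "p \<in> C"
          then show "u (\<lambda>s. a * f s) / a \<le> p f"
            using u_le[OF p V(2)[OF that(1), of a]] sublinear_onD(2)[OF Cs[OF p] that(1), of a] that(2)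
            by (simp add: field_simps)
        qed
        then show ?thesis using that(2) by (simp add: field_simps)
      qed
      have hom: "u (\<lambda>s. a * f s) = a * u f" if f: "f \<in> V" and a: "a \<ge> 0" for f a
      proof (cases "a = 0")
        case True
        have "(\<lambda>s. 0) \<in> V" using V(2)[OF f, of 0] by simp
        moreover obtain p where p: "p \<in> C" using \<open>C \<noteq> {}\<close> by auto
        ultimately have "u (\<lambda>s. 0) \<le> 0" using u_le[of p "\<lambda>s. 0"] zero[OF Cs[OF p] f] by simp
        moreover have "0 \<le> u (\<lambda>s. 0)"
          by (rule u_ge[OF \<open>(\<lambda>s. 0) \<in> V\<close>]) (simp only: zero[OF Cs f] order_refl)
        ultimately show ?thesis using True by simp
      next
        case False
        then have "a > 0" using a by simp
        have "u (\<lambda>s. (1/a) * (a * f s)) \<le> (1/a) * u (\<lambda>s. a * f s)"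
          using \<open>a > 0\<close> by (intro half V f) auto
        then have "a * u f \<le> u (\<lambda>s. a * f s)" using \<open>a > 0\<close> by (simp add: field_simps)
        then show ?thesis using half[OF f \<open>a > 0\<close>] by simp
      qed
      have "u \<in> A"
      proof -
        obtain p where p: "p \<in> C" using False by auto
        then have "\<forall>f\<in>V. p f \<le> q f" using CA by (auto simp: A_def)
        then have "\<forall>f\<in>V. u f \<le> q f" using u_le[OF p] by (meson order_trans)
        then show ?thesis using add hom unfolding A_def sublinear_on_def u_def by auto
      qed
      moreover have "P a u" if "a \<in> C" for a
        unfolding P_def using u_le[OF that] CA that by (auto simp: u_def A_def)
      ultimately show ?thesis by blast
    qed
  qed
  then obtain m where mA: "m \<in> A" and min: "\<And>a. a \<in> A \<Longrightarrow> P m a \<Longrightarrow> a = m" by blast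
  have ms: "sublinear_on V m" and mq: "\<And>f. f \<in> V \<Longrightarrow> m f \<le> q f" and m0: "\<And>f. f \<notin> V \<Longrightarrow> m f = 0"
    using mA by (auto simp: A_def)
  have add: "m (\<lambda>s. y s + x s) = m y + m x" if xy: "x \<in> V" "y \<in> V" for x y
  proof -
    define r where "r = (\<lambda>y. if y \<in> V then (INF t\<in>{0..}. m (\<lambda>s. y s + t * x s) - t * m x) else 0)"
    have lb: "- m (\<lambda>s. - 1 * y s) \<le> m (\<lambda>s. y s + t * x s) - t * m x" if y: "y \<in> V" and t: "t \<ge> 0" for y t
    proof -
      have "m (\<lambda>s. (y s + t * x s) + - 1 * y s) \<le> m (\<lambda>s. y s + t * x s) + m (\<lambda>s. - 1 * y s)"
        by (intro sublinear_onD(1)[OF ms] V xy y)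
      then have "t * m x \<le> m (\<lambda>s. y s + t * x s) + m (\<lambda>s. - 1 * y s)"
        using sublinear_onD(2)[OF ms xy(1) t] by simp
      then show ?thesis by simp
    qed
    have bdd: "bdd_below ((\<lambda>t. m (\<lambda>s. y s + t * x s) - t * m x) ` {0..})" if "y \<in> V" for y
      by (rule bdd_belowI2) (use lb that in auto)
    have r_le: "r y \<le> m (\<lambda>s. y s + t * x s) - t * m x" if "y \<in> V" "t \<ge> 0" for y t
      unfolding r_def using that bdd by (auto intro: cINF_lower)
    have r_ge: "c \<le> r y" if "y \<in> V" "\<And>t. t \<ge> 0 \<Longrightarrow> c \<le> m (\<lambda>s. y s + t * x s) - t * m x" for c y
      unfolding r_def using that by (auto intro: cINF_greatest)
    have r_add: "r (\<lambda>s. f s + g s) \<le> r f + r g" if fg: "f \<in> V" "g \<in> V" for f g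
    proof -
      have *: "r (\<lambda>s. f s + g s) \<le> (m (\<lambda>s. f s + t1 * x s) - t1 * m x) + (m (\<lambda>s. g s + t2 * x s) - t2 * m x)"
        if t: "t1 \<ge> 0" "t2 \<ge> 0" for t1 t2
      proof -
        have "r (\<lambda>s. f s + g s) \<le> m (\<lambda>s. (f s + g s) + (t1 + t2) * x s) - (t1 + t2) * m x"
          by (rule r_le) (use t V fg in auto)
        moreover have "m (\<lambda>s. (f s + t1 * x s) + (g s + t2 * x s)) \<le> m (\<lambda>s. f s + t1 * x s) + m (\<lambda>s. g s + t2 * x s)"
          by (intro sublinear_onD(1)[OF ms] V fg xy)
        moreover have "(\<lambda>s. (f s + t1 * x s) + (g s + t2 * x s)) = (\<lambda>s. (f s + g s) + (t1 + t2) * x s)"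
          by (auto simp: algebra_simps)
        ultimately show ?thesis by (simp add: algebra_simps)
      qed
      have "r (\<lambda>s. f s + g s) - r g \<le> m (\<lambda>s. f s + t1 * x s) - t1 * m x" if t1: "t1 \<ge> 0" for t1
      proof -
        have "r (\<lambda>s. f s + g s) - (m (\<lambda>s. f s + t1 * x s) - t1 * m x) \<le> r g"
        proof (rule r_ge[OF fg(2)])
          fix t :: real assume "t \<ge> 0"
          from *[OF t1 this] show "r (\<lambda>s. f s + g s) - (m (\<lambda>s. f s + t1 * x s) - t1 * m x) \<le> m (\<lambda>s. g s + t * x s) - t * m x"
            by linarith
        qed
        then show ?thesis by linarith
      qed
      then have "r (\<lambda>s. f s + g s) - r g \<le> r f" by (intro r_ge fg)
      then show ?thesis by simp
    qed
    have half: "r (\<lambda>s. a * f s) \<le> a * r f" if "f \<in> V" "a > 0" for f a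
    proof -
      have "r (\<lambda>s. a * f s) / a \<le> r f"
      proof (rule r_ge[OF that(1)])
        fix t :: real assume t: "t \<ge> 0"
        have "r (\<lambda>s. a * f s) \<le> m (\<lambda>s. a * f s + (a * t) * x s) - (a * t) * m x"
          by (rule r_le) (use t that V in auto)
        also have "m (\<lambda>s. a * f s + (a * t) * x s) = m (\<lambda>s. a * (f s + t * x s))"
          by (simp add: algebra_simps)
        also have "\<dots> = a * m (\<lambda>s. f s + t * x s)"
          by (rule sublinear_onD(2)[OF ms]) (use that V xy in auto)
        finally show "r (\<lambda>s. a * f s) / a \<le> m (\<lambda>s. f s + t * x s) - t * m x"
          using that(2) by (simp add: field_simps)
      qed
      then show ?thesis using that(2) by (simp add: field_simps)
    qed
    have r_hom: "r (\<lambda>s. a * f s) = a * r f" if f: "f \<in> V" and a: "a \<ge> 0" for f a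
    proof (cases "a = 0")
      case True
      have z: "(\<lambda>s. 0) \<in> V" using V(2)[OF f, of 0] by simp
      have "m (\<lambda>s. 0 + t * x s) - t * m x = 0" if "t \<ge> 0" for t
        using sublinear_onD(2)[OF ms xy(1) that] by simp
      then have "r (\<lambda>s. 0) = 0" using r_le[OF z, of 0] r_ge[OF z, of 0] zero[OF ms f] by simp
      then show ?thesis using True by simp
    next
      case False
      then have "a > 0" using a by simp
      have "r (\<lambda>s. (1/a) * (a * f s)) \<le> (1/a) * r (\<lambda>s. a * f s)"
        using \<open>a > 0\<close> by (intro half V f) auto
      then have "a * r f \<le> r (\<lambda>s. a * f s)" using \<open>a > 0\<close> by (simp add: field_simps)
      then show ?thesis using half[OF f \<open>a > 0\<close>] by simp
    qed
    have rm: "r f \<le> m f" if "f \<in> V" for f using r_le[OF that, of 0] by simp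
    have "sublinear_on V r" using r_add r_hom by (simp add: sublinear_on_def)
    moreover have "\<forall>f\<in>V. r f \<le> q f" using rm mq order_trans by blast
    ultimately have "r \<in> A" unfolding A_def by (simp add: r_def)
    moreover have "P m r" unfolding P_def using rm m0 by (metis order_refl r_def)
    ultimately have "r = m" by (rule min)
    \<comment> \<open>The choice \<open>t = 1\<close> in the infimum yields the reverse of
      subadditivity.\<close>
    then have "m y \<le> m (\<lambda>s. y s + 1 * x s) - 1 * m x" using r_le[OF xy(2), of 1] by simp
    then show ?thesis using sublinear_onD(1)[OF ms xy(2,1)] by simp
  qed
  have "m (\<lambda>s. a * f s) = a * m f" if f: "f \<in> V" for f a
  proof (cases "a \<ge> 0")
    case True then show ?thesis using sublinear_onD(2)[OF ms f] by simp
  next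
    case False
    have "m (\<lambda>s. a * f s + (-a) * f s) = m (\<lambda>s. a * f s) + m (\<lambda>s. (-a) * f s)"
      by (intro add V f)
    then show ?thesis using sublinear_onD(2)[OF ms f, of "-a"] False zero[OF ms f] by simp
  qed
  then show ?thesis using mq add by (intro exI[of _ m]) blast
qed

section \<open>Almost everywhere convergence of approximate minimizers\<close>

lemma AE_summable_of_integral:
  fixes d :: "nat \<Rightarrow> 'b \<Rightarrow> real"
  assumes i: "\<And>k. integrable M (d k)" and nn: "\<And>k s. s \<in> space M \<Longrightarrow> 0 \<le> d k s"
    and sm: "summable (\<lambda>k. \<integral>s. d k s \<partial>M)"
  shows "AE s in M. summable (\<lambda>k. d k s)"
proof -
  have "(\<integral>\<^sup>+s. (\<Sum>k. ennreal (d k s)) \<partial>M) = (\<Sum>k. \<integral>\<^sup>+s. ennreal (d k s) \<partial>M)"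
    using i by (intro nn_integral_suminf) auto
  also have "\<dots> = (\<Sum>k. ennreal (\<integral>s. d k s \<partial>M))"
    using i nn by (intro suminf_cong nn_integral_eq_integral) (auto intro: AE_I2)
  also have "\<dots> = ennreal (\<Sum>k. \<integral>s. d k s \<partial>M)"
    using sm nn by (intro suminf_ennreal2 integral_nonneg_AE AE_I2)
  finally have "(\<integral>\<^sup>+s. (\<Sum>k. ennreal (d k s)) \<partial>M) \<noteq> \<infinity>" by simp
  then have "AE s in M. (\<Sum>k. ennreal (d k s)) \<noteq> \<infinity>"
    using i by (intro nn_integral_PInf_AE) auto
  then show ?thesis
  proof (rule AE_mp, intro AE_I2 impI)
    fix s assume "s \<in> space M" "(\<Sum>k. ennreal (d k s)) \<noteq> \<infinity>"
    then show "summable (\<lambda>k. d k s)" using summable_suminf_not_top[of "\<lambda>k. d k s"] nn by simp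
  qed
qed

text \<open>Monotone convergence without a limit given in advance: the increments are nonnegative
  with summable integrals, so the sequence converges almost everywhere.\<close>

lemma bounded_monotone_integrals:
  fixes f :: "nat \<Rightarrow> 'b \<Rightarrow> real"
  assumes i: "\<And>k. integrable M (f k)" and mono: "\<And>k s. s \<in> space M \<Longrightarrow> f k s \<le> f (Suc k) s"
    and C: "\<And>k. (\<integral>s. f k s \<partial>M) \<le> C"
  obtains g where "integrable M g" "AE s in M. (\<lambda>k. f k s) \<longlonglongrightarrow> g s" "(\<integral>s. g s \<partial>M) \<le> C"
proof -
  define I where "I = (\<lambda>k. \<integral>s. f k s \<partial>M)"
  have "incseq I" unfolding I_def by (intro incseq_SucI integral_mono i mono)
  then obtain l where l: "I \<longlonglongrightarrow> l" using C unfolding I_def by (metis incseq_convergent)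
  have lC: "l \<le> C" using l C unfolding I_def by (intro LIMSEQ_le_const2) auto
  have "summable (\<lambda>k. \<integral>s. f (Suc k) s - f k s \<partial>M)"
  proof -
    have "(\<lambda>k. I (Suc k) - I k) sums (l - I 0)" by (rule telescope_sums[OF l])
    then show ?thesis using i unfolding I_def sums_iff by (simp add: Bochner_Integration.integral_diff)
  qed
  then have "AE s in M. summable (\<lambda>k. f (Suc k) s - f k s)"
    by (intro AE_summable_of_integral) (use i mono in auto)
  then have lim: "AE s in M. (\<lambda>k. f k s) \<longlonglongrightarrow> lim (\<lambda>k. f k s)"
  proof eventually_elim
    case (elim s)
    then have "convergent (\<lambda>n. \<Sum>k<n. f (Suc k) s - f k s)" using summable_iff_convergent by blast
    then have "convergent (\<lambda>n. f n s - f 0 s)"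
      by (simp only: sum_lessThan_telescope[of "\<lambda>k. f k s"])
    from convergent_add[OF this convergent_const[of "f 0 s"]] have "convergent (\<lambda>n. f n s)" by simp
    then show ?case by (simp add: convergent_LIMSEQ_iff)
  qed
  have mono': "AE s in M. mono (\<lambda>k. f k s)" using mono by (intro AE_I2) (auto intro: incseq_SucI)
  have m: "(\<lambda>s. lim (\<lambda>k. f k s)) \<in> borel_measurable M" using i by measurable
  show thesis
    using that[OF integrable_monotone_convergence[OF i mono' lim l[unfolded I_def] m] lim]
      integral_monotone_convergence[OF i mono' lim l[unfolded I_def] m] lC by simp
qed

lemma abs_le_abs_sinh: "\<bar>t\<bar> \<le> \<bar>sinh t\<bar>" for t :: real
proof -
  have pos: "t \<le> sinh t" if "t \<ge> 0" for t :: real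
  proof -
    have "sinh 0 - 0 \<le> sinh t - t"
    proof (rule DERIV_nonneg_imp_nondecreasing[OF that])
      fix x :: real
      show "\<exists>y. ((\<lambda>x. sinh x - x) has_real_derivative y) (at x) \<and> 0 \<le> y"
        by (intro exI[of _ "cosh x - 1"] conjI) (auto intro!: derivative_eq_intros cosh_real_ge_1)
    qed
    then show ?thesis by simp
  qed
  show ?thesis
  proof (cases "t \<ge> 0")
    case False
    then have "- t \<le> sinh (- t)" by (intro pos) simp
    then show ?thesis using False by simp
  qed (use pos in force)
qed

text \<open>With \<open>x = sinh a\<close> and \<open>y = sinh b\<close>, the midpoint convexity gap of \<open>sqrt (1 + x\<^sup>2)\<close> times the
  sum of the mean and the midpoint value equals \<open>sinh\<^sup>2 ((a - b) / 2)\<close>.\<close>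

lemma arsinh_dist_le_gap:
  fixes x y :: real
  assumes d: "\<delta> > 0"
  defines "g \<equiv> (sqrt (1 + x\<^sup>2) + sqrt (1 + y\<^sup>2)) / 2 - sqrt (1 + ((x + y) / 2)\<^sup>2)"
  shows "\<bar>arsinh x - arsinh y\<bar> \<le> g / \<delta> + \<delta> * (sqrt (1 + x\<^sup>2) + sqrt (1 + y\<^sup>2))"
proof -
  define a b where "a = arsinh x" and "b = arsinh y"
  have xy: "x = sinh a" "y = sinh b" by (simp_all add: a_def b_def)
  have ch: "sqrt (1 + (sinh t)\<^sup>2) = cosh t" for t :: real
    by (metis abs_of_pos cosh_real_pos cosh_square_eq add.commute real_sqrt_abs)
  define m where "m = sqrt (1 + ((x + y) / 2)\<^sup>2)"
  define P where "P = cosh a + cosh b"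
  have m: "m\<^sup>2 = 1 + ((x + y) / 2)\<^sup>2" "m > 0" unfolding m_def by (auto intro: add_pos_nonneg)
  have P: "P > 0" unfolding P_def by (simp add: add_pos_pos)
  have g: "g = P / 2 - m" unfolding g_def m_def P_def xy ch ..
  have "g * (P / 2 + m) = (P / 2)\<^sup>2 - m\<^sup>2" unfolding g by (simp add: power2_eq_square algebra_simps)
  also have "\<dots> = (cosh (a - b) - 1) / 2"
  proof -
    have "(cosh a)\<^sup>2 = (sinh a)\<^sup>2 + 1" "(cosh b)\<^sup>2 = (sinh b)\<^sup>2 + 1" by (simp_all add: cosh_square_eq)
    moreover have "cosh (a - b) = cosh a * cosh b - sinh a * sinh b" by (rule cosh_diff)
    ultimately show ?thesis unfolding m P_def xy by (simp add: power2_eq_square field_simps)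
  qed
  also have "cosh (a - b) = 2 * (sinh ((a - b) / 2))\<^sup>2 + 1"
  proof -
    have "cosh (2 * t) = 2 * (sinh t)\<^sup>2 + 1" for t :: real
      using cosh_double[of t] cosh_square_eq[of t] by simp
    moreover have "a - b = 2 * ((a - b) / 2)" by simp
    ultimately show ?thesis by metis
  qed
  finally have eq: "g * (P / 2 + m) = (sinh ((a - b) / 2))\<^sup>2" by simp
  have g0: "g \<ge> 0"
    using eq P m(2) by (metis add_pos_pos half_gt_zero mult_neg_pos not_less zero_le_power2)
  have "((a - b) / 2)\<^sup>2 \<le> (sinh ((a - b) / 2))\<^sup>2" by (rule abs_le_square_iff[THEN iffD1]) (rule abs_le_abs_sinh)
  also have "\<dots> \<le> g * P" unfolding eq[symmetric] using g0 g by (intro mult_left_mono) auto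
  finally have sq: "(a - b)\<^sup>2 \<le> 4 * (g * P)" by (simp add: power2_eq_square field_simps)
  \<comment> \<open>The arithmetic-geometric mean inequality trades the product \<open>g * P\<close>
    for a sum whose terms can be integrated separately; \<open>\<delta>\<close> remains free to
    balance them.\<close>
  also have "\<dots> \<le> (g / \<delta> + \<delta> * P)\<^sup>2"
  proof -
    have "(g / \<delta> + \<delta> * P)\<^sup>2 - 4 * (g * P) = (g / \<delta> - \<delta> * P)\<^sup>2" using d by (simp add: power2_eq_square field_simps)
    then show ?thesis by (smt (verit) zero_le_power2)
  qed
  finally have "\<bar>a - b\<bar> \<le> \<bar>g / \<delta> + \<delta> * P\<bar>" by (simp add: abs_le_square_iff)
  also have "\<dots> = g / \<delta> + \<delta> * P" using g0 d P by (intro abs_of_nonneg) auto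
  finally show ?thesis unfolding P_def a_def b_def ch[symmetric] by simp
qed

text \<open>A substitute for Komlos' theorem: approximate minimizers of the strictly convex functional
  \<open>\<integral> sqrt (1 + w\<^sup>2)\<close> over nested convex sets.\<close>

lemma nested_convex_AE_convergent:
  fixes W :: "nat \<Rightarrow> 'i set" and ev :: "'i \<Rightarrow> 'b \<Rightarrow> real"
  assumes M: "finite_measure M" and ne: "\<And>n. W n \<noteq> {}" and dec: "\<And>n. W (Suc n) \<subseteq> W n"
    and int: "\<And>n x. x \<in> W n \<Longrightarrow> integrable M (ev x)"
    and bound: "\<And>n x. x \<in> W n \<Longrightarrow> (\<integral>s. \<bar>ev x s\<bar> \<partial>M) \<le> R"
    and mid: "\<And>n x y. x \<in> W n \<Longrightarrow> y \<in> W n \<Longrightarrow> \<exists>z\<in>W n. \<forall>s\<in>space M. ev z s = (ev x s + ev y s) / 2"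
  obtains X where "\<And>n. X n \<in> W n" "AE s in M. convergent (\<lambda>n. ev (X n) s)"
proof -
  interpret finite_measure M by fact
  define \<phi> :: "real \<Rightarrow> real" where "\<phi> = (\<lambda>t. sqrt (1 + t\<^sup>2))"
  have \<phi>1: "0 \<le> \<phi> t" "\<phi> t \<le> 1 + \<bar>t\<bar>" for t
  proof -
    have "1 + t\<^sup>2 \<le> (1 + \<bar>t\<bar>)\<^sup>2" by (simp add: power2_eq_square algebra_simps)
    then show "\<phi> t \<le> 1 + \<bar>t\<bar>" unfolding \<phi>_def by (rule real_le_lsqrt[rotated -1]) auto
  qed (simp add: \<phi>_def)
  have antimono: "W m \<subseteq> W n" if "n \<le> m" for n m
    using lift_Suc_antimono_le[of W, OF dec that] .
  have [measurable]: "\<phi> \<in> borel_measurable borel" unfolding \<phi>_def by measurable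
  have \<phi>i: "integrable M (\<lambda>s. \<phi> (ev x s))" if "x \<in> W n" for x n
    by (rule Bochner_Integration.integrable_bound[of M "\<lambda>s. 1 + \<bar>ev x s\<bar>"])
       (use int[OF that] \<phi>1 in auto)
  define F where "F = (\<lambda>x. \<integral>s. \<phi> (ev x s) \<partial>M)"
  define B where "B = measure M (space M) + R"
  have F0: "0 \<le> F x" for x unfolding F_def by (simp add: \<phi>1)
  have FB: "F x \<le> B" if "x \<in> W n" for x n
  proof -
    have "F x \<le> (\<integral>s. 1 + \<bar>ev x s\<bar> \<partial>M)"
      unfolding F_def by (rule integral_mono) (use \<phi>i[OF that] int[OF that] \<phi>1 in auto)
    also have "\<dots> = measure M (space M) + (\<integral>s. \<bar>ev x s\<bar> \<partial>M)"
      using int[OF that] by (subst Bochner_Integration.integral_add) auto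
    finally show ?thesis using bound[OF that] unfolding B_def by simp
  qed
  define J where "J = (\<lambda>n. INF x\<in>W n. F x)"
  have bdd: "bdd_below (F ` W n)" for n by (rule bdd_belowI2[of _ 0]) (rule F0)
  have Jle: "J n \<le> F x" if "x \<in> W n" for n x
    unfolding J_def by (rule cINF_lower[OF bdd that])
  have "incseq J"
    unfolding J_def by (intro incseq_SucI cINF_superset_mono ne bdd dec) auto
  moreover have "J n \<le> B" for n using ne[of n] Jle FB by (meson ex_in_conv order_trans)
  ultimately obtain l where l: "J \<longlonglongrightarrow> l" "\<And>n. J n \<le> l"
    by (metis incseq_convergent)
  have "\<exists>x\<in>W n. F x \<le> J n + 1 / Suc n" for n
  proof -
    have "(INF x\<in>W n. F x) < J n + 1 / Suc n" unfolding J_def by simp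
    then obtain x where "x \<in> W n" "F x < J n + 1 / Suc n"
      using cINF_less_iff[OF ne bdd] by blast
    then show ?thesis by (auto intro: less_imp_le)
  qed
  then obtain Y where Y: "\<And>n. Y n \<in> W n" "\<And>n. F (Y n) \<le> J n + 1 / Suc n" by metis
  \<comment> \<open>A bound for the convexity gap of \<open>Y n\<close> and \<open>Y m\<close> with
    \<open>n \<le> m\<close>: their midpoint lies in \<open>W n\<close>, so its value is at least
    \<open>J n\<close>, while neither end exceeds \<open>l + 1 / Suc n\<close>.\<close>
  define e where "e = (\<lambda>n. (l - J n) + 1 / Suc n)"
  have gap: "(\<integral>s. (\<phi> (ev (Y n) s) + \<phi> (ev (Y m) s)) / 2 - \<phi> ((ev (Y n) s + ev (Y m) s) / 2) \<partial>M) \<le> e n" 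
     "integrable M (\<lambda>s. (\<phi> (ev (Y n) s) + \<phi> (ev (Y m) s)) / 2 - \<phi> ((ev (Y n) s + ev (Y m) s) / 2))" if "n \<le> m" for n m
  proof -
    have Ym: "Y m \<in> W n" using Y(1) antimono[OF that] by blast
    obtain z where z: "z \<in> W n" "\<forall>s\<in>space M. ev z s = (ev (Y n) s + ev (Y m) s) / 2"
      using mid[OF Y(1) Ym] by blast
    have eqz: "\<phi> (ev z s) = \<phi> ((ev (Y n) s + ev (Y m) s) / 2)" if "s \<in> space M" for s
      by (rule arg_cong[of _ _ \<phi>]) (use z(2) that in blast)
    have iz: "integrable M (\<lambda>s. \<phi> ((ev (Y n) s + ev (Y m) s) / 2))"
    proof -
      from eqz have "integrable M (\<lambda>s. \<phi> (ev z s)) = integrable M (\<lambda>s. \<phi> ((ev (Y n) s + ev (Y m) s) / 2))"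
        by (rule Bochner_Integration.integrable_cong[OF refl])
      then show ?thesis using \<phi>i[OF z(1)] by blast
    qed
    have Fz: "F z = (\<integral>s. \<phi> ((ev (Y n) s + ev (Y m) s) / 2) \<partial>M)"
      unfolding F_def by (rule Bochner_Integration.integral_cong[OF refl eqz])
    show "integrable M (\<lambda>s. (\<phi> (ev (Y n) s) + \<phi> (ev (Y m) s)) / 2 - \<phi> ((ev (Y n) s + ev (Y m) s) / 2))"
      using iz \<phi>i[OF Y(1)] by (intro Bochner_Integration.integrable_diff integrable_divide_zero Bochner_Integration.integrable_add) auto
    have "(\<integral>s. (\<phi> (ev (Y n) s) + \<phi> (ev (Y m) s)) / 2 - \<phi> ((ev (Y n) s + ev (Y m) s) / 2) \<partial>M)
       = (F (Y n) + F (Y m)) / 2 - F z"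
      unfolding Fz unfolding F_def using iz \<phi>i[OF Y(1)]
      by (subst Bochner_Integration.integral_diff) auto
    also have "\<dots> \<le> e n"
    proof -
      have "1 / real (Suc m) \<le> 1 / real (Suc n)" using that by (simp add: frac_le)
      moreover have "J n \<le> F z" by (rule Jle[OF z(1)])
      moreover have "J n \<le> l" "J m \<le> l" using l by auto
      ultimately show ?thesis using Y(2)[of n] Y(2)[of m] unfolding e_def by argo
    qed
    finally show "(\<integral>s. (\<phi> (ev (Y n) s) + \<phi> (ev (Y m) s)) / 2 - \<phi> ((ev (Y n) s + ev (Y m) s) / 2) \<partial>M) \<le> e n" .
  qed
  have e0: "e \<longlonglongrightarrow> 0"
  proof -
    have "(\<lambda>n. (l - J n) + inverse (real (Suc n))) \<longlonglongrightarrow> (l - l) + 0"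
      by (intro tendsto_intros l LIMSEQ_inverse_real_of_nat)
    then show ?thesis by (simp add: e_def inverse_eq_divide)
  qed
  have "\<exists>N. \<forall>n\<ge>N. e n < (1/4)^k" for k
    using order_tendstoD(2)[OF e0, of "(1/4)^k"] by (simp add: eventually_sequentially)
  then obtain N where N: "\<And>k n. n \<ge> N k \<Longrightarrow> e n < (1/4)^k" by metis
  \<comment> \<open>The indices make the gaps smaller than \<open>4^(-k)\<close>. With
    \<open>\<delta> = 2^(-k)\<close> both terms of \<open>arsinh_dist_le_gap\<close> have integrals
    of order \<open>2^(-k)\<close>, so the increments are summable.\<close>
  define r where "r = rec_nat (N 0) (\<lambda>k p. max (Suc p) (N (Suc k)))"
  have r: "r (Suc k) = max (Suc (r k)) (N (Suc k))" for k unfolding r_def by simp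
  have rN: "r k \<ge> N k" for k by (cases k) (simp_all add: r, simp add: r_def)
  have rs: "strict_mono r" by (rule strict_monoI_Suc) (simp add: r)
  \<comment> \<open>Convergence is proved in the coordinate \<open>arsinh\<close>, where the gap
    controls distances in \<open>L\<^sup>1\<close>, and is carried back by continuity of
    \<open>sinh\<close>.\<close>
  define D where "D = (\<lambda>k s. \<bar>arsinh (ev (Y (r k)) s) - arsinh (ev (Y (r (Suc k))) s)\<bar>)"
  have [measurable]: "(arsinh :: real \<Rightarrow> real) \<in> borel_measurable borel"
    unfolding arsinh_real_def[abs_def] by measurable
  have Ym[measurable]: "ev (Y n) \<in> borel_measurable M" for n using int[OF Y(1)] by auto
  have D: "integrable M (D k)" "(\<integral>s. D k s \<partial>M) \<le> (1/2)^k * (1 + 2 * B)" for k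
  proof -
    let ?n = "r k" and ?m = "r (Suc k)" and ?d = "(1/2)^k :: real"
    let ?G = "\<lambda>s. (\<phi> (ev (Y ?n) s) + \<phi> (ev (Y ?m) s)) / 2 - \<phi> ((ev (Y ?n) s + ev (Y ?m) s) / 2)"
    let ?H = "\<lambda>s. ?G s / ?d + ?d * (\<phi> (ev (Y ?n) s) + \<phi> (ev (Y ?m) s))"
    have nm: "?n \<le> ?m" by (simp add: r)
    have le: "D k s \<le> ?H s" for s
      unfolding D_def \<phi>_def by (rule arsinh_dist_le_gap) simp
    have iH: "integrable M ?H" using gap(2)[OF nm] \<phi>i[OF Y(1)] by simp
    show i: "integrable M (D k)"
    proof (rule Bochner_Integration.integrable_bound[OF iH])
      show "D k \<in> borel_measurable M" unfolding D_def by measurable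
      have "0 \<le> D k s" for s by (simp add: D_def)
      then show "AE s in M. norm (D k s) \<le> norm (?H s)" using le by (intro AE_I2) (smt (verit) real_norm_def)
    qed
    have "(\<integral>s. D k s \<partial>M) \<le> (\<integral>s. ?H s \<partial>M)" by (rule integral_mono[OF i iH le])
    also have "\<dots> = (\<integral>s. ?G s \<partial>M) / ?d + ?d * (F (Y ?n) + F (Y ?m))"
      unfolding F_def using gap(2)[OF nm] \<phi>i[OF Y(1)]
      by (subst Bochner_Integration.integral_add) auto
    also have "\<dots> \<le> (1/4)^k / ?d + ?d * (B + B)"
      using gap(1)[OF nm] N[OF rN[of k]] FB[OF Y(1)]
      by (intro add_mono divide_right_mono mult_left_mono) (auto intro: less_imp_le order_trans)
    also have "(1/4)^k / ?d = ?d"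
    proof -
      have "(1/4 :: real)^k = ?d * ?d" by (simp add: power_mult_distrib[symmetric])
      then show ?thesis by simp
    qed
    finally show "(\<integral>s. D k s \<partial>M) \<le> (1/2)^k * (1 + 2 * B)" by (simp add: algebra_simps)
  qed
  have "summable (\<lambda>k. \<integral>s. D k s \<partial>M)"
  proof (rule summable_comparison_test'[where N=0])
    show "summable (\<lambda>k. (1/2)^k * (1 + 2 * B) :: real)" by (intro summable_mult2 summable_geometric) auto
    fix k show "norm (\<integral>s. D k s \<partial>M) \<le> (1/2)^k * (1 + 2 * B)"
      using D(2)[of k] by (simp add: D_def)
  qed
  from AE_summable_of_integral[OF D(1) _ this] have "AE s in M. summable (\<lambda>k. D k s)"
    by (simp add: D_def)
  then have "AE s in M. convergent (\<lambda>k. ev (Y (r k)) s)"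
  proof eventually_elim
    case (elim s)
    define A where "A = (\<lambda>k. arsinh (ev (Y (r k)) s))"
    have "summable (\<lambda>k. \<bar>A (Suc k) - A k\<bar>)" using elim unfolding D_def A_def by (simp add: abs_minus_commute)
    then have "summable (\<lambda>k. A (Suc k) - A k)" by (rule summable_rabs_cancel)
    then have "convergent (\<lambda>n. \<Sum>k<n. A (Suc k) - A k)" using summable_iff_convergent by blast
    then have "convergent (\<lambda>n. A n - A 0)" by (simp only: sum_lessThan_telescope)
    from convergent_add[OF this convergent_const[of "A 0"]] have "convergent A" by simp
    then obtain a where "A \<longlonglongrightarrow> a" by (auto simp: convergent_def)
    then have "(\<lambda>k. sinh (A k)) \<longlonglongrightarrow> sinh a" by (intro tendsto_intros)
    then show ?case unfolding A_def by (auto simp: convergent_def)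
  qed
  moreover have "Y (r n) \<in> W n" for n
    using Y(1)[of "r n"] antimono[OF seq_suble[OF rs]] by blast
  ultimately show thesis using that[of "\<lambda>n. Y (r n)"] by blast
qed

text \<open>Fubini's theorem as resampling of one coordinate. The integral \<open>F x\<close> over
  the new value does not depend on \<open>x i\<close>, so integrating it over all coordinates is the
  same as integrating it over the others, and this gives the measure of the exceptional set.\<close>

lemma AE_PiM_update:
  fixes M :: "'i \<Rightarrow> 'b measure"
  assumes M: "\<And>i. prob_space (M i)" and I: "finite I" "i \<in> I" and ae: "AE x in PiM I M. P x"
  shows "AE x in PiM I M. AE y in M i. P (x(i := y))"
proof -
  interpret product_prob_space M I by (rule product_prob_spaceI) (rule M)
  obtain N where N: "N \<in> null_sets (PiM I M)" "{x\<in>space (PiM I M). \<not> P x} \<subseteq> N"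
    using ae unfolding eventually_ae_filter by auto
  define J where "J = I - {i}"
  have J: "finite J" "i \<notin> J" "insert i J = I" using I by (auto simp: J_def)
  define f :: "_ \<Rightarrow> ennreal" where "f = indicator N"
  have f: "f \<in> borel_measurable (PiM I M)" unfolding f_def using N(1) by (intro borel_measurable_indicator) auto
  define F where "F = (\<lambda>x. \<integral>\<^sup>+y. f (x(i := y)) \<partial>M i)"
  have upd: "(\<lambda>(x, y). x(i := y)) \<in> PiM I M \<Otimes>\<^sub>M M i \<rightarrow>\<^sub>M PiM I M"
  proof -
    have "(\<lambda>z. (fst z)(i := snd z)) \<in> PiM I M \<Otimes>\<^sub>M M i \<rightarrow>\<^sub>M PiM I M"
      using I by (intro measurable_fun_upd[where J=I]) auto
    then show ?thesis by (simp add: case_prod_beta')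
  qed
  have Fm: "F \<in> borel_measurable (PiM I M)"
  proof -
    have "case_prod (\<lambda>x y. f (x(i := y))) \<in> borel_measurable (PiM I M \<Otimes>\<^sub>M M i)"
      using measurable_compose[OF upd f] by (simp add: case_prod_beta')
    then show ?thesis unfolding F_def by (rule sigma_finite_measure.borel_measurable_nn_integral[OF prob_space_imp_sigma_finite[OF M]])
  qed
  have "(\<integral>\<^sup>+x. f x \<partial>PiM I M) = 0" unfolding f_def using N by (simp add: null_sets_def)
  then have "(\<integral>\<^sup>+x. F x \<partial>PiM J M) = 0"
    using product_nn_integral_insert[OF J(1,2), of f] f J(3) by (simp add: F_def)
  moreover have "(\<integral>\<^sup>+x. F x \<partial>PiM I M) = (\<integral>\<^sup>+x. F x \<partial>PiM J M)"
    using product_nn_integral_insert[OF J(1,2), of F] Fm J(3) by (simp add: F_def prob_space.emeasure_space_1[OF M])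
  ultimately have "(\<integral>\<^sup>+x. F x \<partial>PiM I M) = 0" by simp
  then have F0: "AE x in PiM I M. F x = 0" using Fm by (simp add: nn_integral_0_iff_AE)
  show ?thesis
  proof (rule AE_mp[OF F0], rule AE_I2, rule impI)
    fix x assume x: "x \<in> space (PiM I M)" and "F x = 0"
    have ux: "(\<lambda>y. x(i := y)) \<in> M i \<rightarrow>\<^sub>M PiM I M"
      using measurable_compose[OF measurable_Pair1'[OF x] upd] by simp
    have f0: "AE y in M i. f (x(i := y)) = 0"
      using \<open>F x = 0\<close> measurable_compose[OF ux f] unfolding F_def by (simp add: nn_integral_0_iff_AE)
    show "AE y in M i. P (x(i := y))"
    proof (rule AE_mp[OF f0], rule AE_I2, rule impI)
      fix y assume y: "y \<in> space (M i)" "f (x(i := y)) = 0"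
      then have "x(i := y) \<in> space (PiM I M)" using measurable_space[OF ux] by simp
      then show "P (x(i := y))" using y(2) N(2) unfolding f_def by (auto simp: indicator_def split: if_splits)
    qed
  qed
qed

section \<open>The functional \<open>H\<close>\<close>

lemma ext_integral_eq:
  fixes f :: "'b \<Rightarrow> ereal" and g :: "'b \<Rightarrow> real"
  assumes "AE s in M. f s = ereal (g s)" and g: "integrable M g"
  shows "ext_integral M f = ereal (\<integral>s. g s \<partial>M)"
proof -
  have 1: "(\<integral>\<^sup>+ s. e2ennreal (f s) \<partial>M) = (\<integral>\<^sup>+ s. ennreal (g s) \<partial>M)"
    by (rule nn_integral_cong_AE) (use assms(1) in \<open>auto simp: ennreal.rep_eq\<close>)
  have 2: "(\<integral>\<^sup>+ s. e2ennreal (- f s) \<partial>M) = (\<integral>\<^sup>+ s. ennreal (- g s) \<partial>M)"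
    by (rule nn_integral_cong_AE) (use assms(1) in \<open>auto simp: ennreal.rep_eq\<close>)
  have fin: "(\<integral>\<^sup>+ s. ennreal (g s) \<partial>M) < \<infinity>" "(\<integral>\<^sup>+ s. ennreal (- g s) \<partial>M) < \<infinity>"
    using g unfolding real_integrable_def by (auto simp: less_top)
  have "(\<integral>s. g s \<partial>M) = enn2real (\<integral>\<^sup>+ s. ennreal (g s) \<partial>M) - enn2real (\<integral>\<^sup>+ s. ennreal (- g s) \<partial>M)"
    by (rule real_lebesgue_integral_def[OF g])
  moreover have "enn2ereal x = ereal (enn2real x)" if "x < \<infinity>" for x
    using that by (cases x) (auto simp: enn2ereal_ennreal)
  ultimately show ?thesis unfolding ext_integral_def 1 2 using fin by (simp add: less_top)
qed

text \<open>The integrable minorant bounds the negative part, so a value below infinity leaves the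
  positive part as the only concern, and that is finite by the convention on integrals.\<close>

lemma ext_integral_finite:
  fixes f :: "'b \<Rightarrow> ereal" and g :: "'b \<Rightarrow> real"
  assumes f: "f \<in> borel_measurable M" and lower: "AE s in M. ereal (g s) \<le> f s" and g: "integrable M g"
    and fin: "ext_integral M f < \<infinity>"
  shows "AE s in M. f s = ereal (real_of_ereal (f s))" "integrable M (\<lambda>s. real_of_ereal (f s))"
    "ext_integral M f = ereal (\<integral>s. real_of_ereal (f s) \<partial>M)"
proof -
  have pos: "(\<integral>\<^sup>+ s. e2ennreal (f s) \<partial>M) \<noteq> \<infinity>"
    using fin unfolding ext_integral_def by (auto split: if_splits)
  have fm: "(\<lambda>s. e2ennreal (f s)) \<in> borel_measurable M" using f by measurable
  have "AE s in M. e2ennreal (f s) \<noteq> \<infinity>" by (rule nn_integral_PInf_AE[OF fm pos])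
  with lower show eq: "AE s in M. f s = ereal (real_of_ereal (f s))"
  proof eventually_elim
    case (elim s)
    then show ?case by (cases "f s") (auto simp: e2ennreal_infty)
  qed
  have pg: "(\<integral>\<^sup>+ s. ennreal (- g s) \<partial>M) \<noteq> \<infinity>" using g unfolding real_integrable_def by auto
  show i: "integrable M (\<lambda>s. real_of_ereal (f s))"
    unfolding real_integrable_def
  proof (intro conjI)
    show "(\<lambda>s. real_of_ereal (f s)) \<in> borel_measurable M" using f by measurable
    have "(\<integral>\<^sup>+ s. ennreal (real_of_ereal (f s)) \<partial>M) = (\<integral>\<^sup>+ s. e2ennreal (f s) \<partial>M)"
      by (rule nn_integral_cong_AE) (use eq in \<open>eventually_elim, metis ennreal.rep_eq e2ennreal_ereal\<close>)
    then show "(\<integral>\<^sup>+ s. ennreal (real_of_ereal (f s)) \<partial>M) \<noteq> \<infinity>" using pos by simp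
    have "(\<integral>\<^sup>+ s. ennreal (- real_of_ereal (f s)) \<partial>M) \<le> (\<integral>\<^sup>+ s. ennreal (- g s) \<partial>M)"
    proof (rule nn_integral_mono_AE)
      show "AE s in M. ennreal (- real_of_ereal (f s)) \<le> ennreal (- g s)"
        using eq lower
      proof eventually_elim
        case (elim s)
        then have "g s \<le> real_of_ereal (f s)" by (metis ereal_less_eq(3))
        then show ?case by (intro ennreal_leI) simp
      qed
    qed
    then show "(\<integral>\<^sup>+ s. ennreal (- real_of_ereal (f s)) \<partial>M) \<noteq> \<infinity>" using pg by (metis infinity_ennreal_def top.extremum_uniqueI)
  qed
  show "ext_integral M f = ereal (\<integral>s. real_of_ereal (f s) \<partial>M)"
    by (rule ext_integral_eq[OF eq i])
qed

lemma ext_integrableD: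
  assumes "ext_integrable M f"
  shows "AE s in M. f s = ereal (real_of_ereal (f s))" "integrable M (\<lambda>s. real_of_ereal (f s))"
proof -
  have f: "f \<in> borel_measurable M" and fin: "(\<integral>\<^sup>+ s. e2ennreal \<bar>f s\<bar> \<partial>M) \<noteq> \<infinity>"
    using assms unfolding ext_integrable_def by auto
  have "AE s in M. e2ennreal \<bar>f s\<bar> \<noteq> \<infinity>" by (rule nn_integral_PInf_AE[OF _ fin]) (use f in measurable)
  then show eq: "AE s in M. f s = ereal (real_of_ereal (f s))"
  proof eventually_elim
    case (elim s)
    then show ?case by (cases "f s") (auto simp: e2ennreal_infty)
  qed
  have "(\<integral>\<^sup>+ s. ennreal (norm (real_of_ereal (f s))) \<partial>M) = (\<integral>\<^sup>+ s. e2ennreal \<bar>f s\<bar> \<partial>M)"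
  proof (rule nn_integral_cong_AE)
    show "AE s in M. ennreal (norm (real_of_ereal (f s))) = e2ennreal \<bar>f s\<bar>"
      using eq
    proof eventually_elim
      case (elim s)
      then show ?case by (metis e2ennreal_ereal abs_ereal.simps(1) real_norm_def)
    qed
  qed
  then show "integrable M (\<lambda>s. real_of_ereal (f s))"
    using fin f by (intro integrableI_bounded) (auto simp: less_top)
qed

text \<open>The alternative on \<open>\<mu>\<close> is kept out of the locale and passed explicitly
  to the lemmas that use it, on limits of minimizing sequences and on integrals of path
  sums.\<close>

locale ot_setup =
  fixes T :: nat
    and S :: "nat \<Rightarrow> 'a topology"
    and \<psi> :: "nat \<Rightarrow> 'a \<Rightarrow> real"
    and \<mu> :: "(nat \<Rightarrow> 'a) measure"
    and h :: "real \<Rightarrow> (nat \<Rightarrow> 'a) \<Rightarrow> ereal"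
  assumes polish: "\<And>t. t \<le> T \<Longrightarrow> polish_topology (S t)"
    and psi_cont: "\<And>t. t \<le> T \<Longrightarrow> continuous_map (S t) euclideanreal (\<psi> t)"
    and psi_ge1: "\<And>t y. t \<le> T \<Longrightarrow> y \<in> topspace (S t) \<Longrightarrow> 1 \<le> \<psi> t y"
    and mu_prob: "prob_space \<mu>"
    and mu_sets: "sets \<mu> = sets (borel_of (prod_top T S))"
    and mu_marg: "\<And>t. t \<le> T \<Longrightarrow> integrable (marg S \<mu> t) (\<psi> t)"
    and h_normal: "convex_normal_integrand (borel_of (prod_top T S)) h"
    and h_mono: "\<And>s. s \<in> topspace (prod_top T S) \<Longrightarrow> mono (\<lambda>u. h u s)"
    and D_isc: "inner_semicontinuous (prod_top T S) (cl_dom h)"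
    and cl_dom_H:
      "wC_top (prod_top T S) (weight T \<psi>) closure_of
         {u \<in> wC (prod_top T S) (weight T \<psi>). H_fun (prod_top T S) (weight T \<psi>) \<mu> h u < \<infinity>}
       = wC_sel (prod_top T S) (weight T \<psi>) (cl_dom h)"
    and H_proper: "\<exists>u \<in> wC (prod_top T S) (weight T \<psi>). H_fun (prod_top T S) (weight T \<psi>) \<mu> h u < \<infinity>"
    and h_conj: "\<forall>\<^sub>F v in nhds 1. ext_integrable \<mu> (integrand_conj h v)"
begin

section \<open>The weighted space \<open>C\<close> and measurability of the integrand\<close>

abbreviation X where "X \<equiv> prod_top T S"
abbreviation \<Omega> where "\<Omega> \<equiv> topspace X"
abbreviation wt where "wt \<equiv> weight T \<psi>"
abbreviation D where "D \<equiv> cl_dom h"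
abbreviation H where "H \<equiv> H_fun X wt \<mu> h"
abbreviation C where "C \<equiv> wC X wt"
abbreviation CD where "CD \<equiv> wC_sel X wt D"
abbreviation m where "m \<equiv> marg S \<mu>"

sublocale mu: prob_space \<mu> by (rule mu_prob)

lemma space_mu: "space \<mu> = \<Omega>"
  using sets_eq_imp_space_eq[OF mu_sets] by simp

lemma Omega_ne: "\<Omega> \<noteq> {}"
  using mu.not_empty space_mu by simp

lemma metrizable_S: "t \<le> T \<Longrightarrow> metrizable_space (S t)"
  using polish unfolding polish_topology_def by (auto intro: completely_metrizable_imp_metrizable_space)

lemma metrizable_X: "metrizable_space X"
  unfolding metrizable_space_product_topology using metrizable_S by (auto intro: countable_finite)

lemma proj_cont: "t \<le> T \<Longrightarrow> continuous_map X (S t) (\<lambda>s. s t)"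
  by (rule continuous_map_product_projection) simp

lemma Omega_proj: "s \<in> \<Omega> \<Longrightarrow> t \<le> T \<Longrightarrow> s t \<in> topspace (S t)"
  by (auto simp: topspace_product_topology PiE_def Pi_def)

lemma proj_meas: "t \<le> T \<Longrightarrow> sets M = sets (borel_of X) \<Longrightarrow> (\<lambda>s. s t) \<in> M \<rightarrow>\<^sub>M borel_of (S t)"
  using continuous_map_measurable_borel_of[OF proj_cont] measurable_cong_sets by blast

lemma sets_m [simp]: "sets (m t) = sets (borel_of (S t))" by (simp add: marg_def)

lemma space_m [simp]: "space (m t) = topspace (S t)" by (simp add: marg_def)

lemma prob_m: "t \<le> T \<Longrightarrow> prob_space (m t)"
  unfolding marg_def by (rule mu.prob_space_distr) (rule proj_meas[OF _ mu_sets])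

lemma m_cong_meas: "x \<in> borel_measurable (m t) \<longleftrightarrow> x \<in> borel_measurable (borel_of (S t))"
  using measurable_cong_sets[OF sets_m refl] by blast

lemma integrable_m_iff:
  fixes x :: "'a \<Rightarrow> real"
  assumes "t \<le> T" "x \<in> borel_measurable (borel_of (S t))"
  shows "integrable (m t) x \<longleftrightarrow> integrable \<mu> (\<lambda>s. x (s t))"
  unfolding marg_def by (rule integrable_distr_eq[OF proj_meas[OF assms(1) mu_sets] assms(2)])

lemma integrable_m:
  fixes x :: "'a \<Rightarrow> real"
  assumes "t \<le> T" "integrable (m t) x"
  shows "integrable \<mu> (\<lambda>s. x (s t))"
  using integrable_m_iff[OF assms(1)] assms(2) m_cong_meas borel_measurable_integrable by blast

lemma integral_m:
  fixes x :: "'a \<Rightarrow> real"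
  assumes "t \<le> T" "x \<in> borel_measurable (borel_of (S t))"
  shows "(\<integral>y. x y \<partial>m t) = (\<integral>s. x (s t) \<partial>\<mu>)"
  unfolding marg_def by (rule integral_distr[OF proj_meas[OF assms(1) mu_sets] assms(2)])

lemma wt_ge1: "s \<in> \<Omega> \<Longrightarrow> 1 \<le> wt s"
proof -
  assume s: "s \<in> \<Omega>"
  have "1 \<le> \<psi> 0 (s 0)" using psi_ge1[of 0] Omega_proj[OF s, of 0] by simp
  also have "\<dots> \<le> (\<Sum>t\<le>T. \<psi> t (s t))"
    using psi_ge1 Omega_proj[OF s] by (intro member_le_sum) (auto intro: order_trans[OF zero_le_one])
  finally show ?thesis by (simp add: weight_def)
qed

lemma wt_cont: "continuous_map X euclideanreal wt"
  unfolding weight_def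
  by (intro continuous_map_sum) (use continuous_map_compose[OF proj_cont psi_cont] in \<open>auto simp: o_def\<close>)

lemma wt_integrable: "integrable \<mu> wt"
  unfolding weight_def by (intro Bochner_Integration.integrable_sum integrable_m mu_marg) auto

lemma cont_meas: "continuous_map X euclideanreal u \<Longrightarrow> sets M = sets (borel_of X) \<Longrightarrow> u \<in> borel_measurable M"
  using continuous_map_borel_measurable measurable_cong_sets by blast

lemma C_I:
  assumes "continuous_map X euclideanreal u" "\<And>s. s \<in> \<Omega> \<Longrightarrow> \<bar>u s\<bar> \<le> c * wt s"
  shows "restrict u \<Omega> \<in> C"
  unfolding wC_def
proof (intro CollectI conjI)
  show "continuous_map X euclideanreal (restrict u \<Omega>)"
    by (rule continuous_map_eq[OF assms(1)]) simp
  show "bounded ((\<lambda>s. restrict u \<Omega> s / wt s) ` \<Omega>)"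
    unfolding bounded_iff
  proof (intro exI[of _ c] ballI)
    fix y assume "y \<in> (\<lambda>s. restrict u \<Omega> s / wt s) ` \<Omega>"
    then obtain s where s: "s \<in> \<Omega>" "y = u s / wt s" by auto
    have "0 < wt s" using wt_ge1[OF s(1)] by simp
    then show "norm y \<le> c" using assms(2)[OF s(1)] s(2) by (simp add: pos_divide_le_eq)
  qed
qed auto

lemma C_D:
  assumes "u \<in> C"
  shows "continuous_map X euclideanreal u" "\<exists>c\<ge>0. \<forall>s\<in>\<Omega>. \<bar>u s\<bar> \<le> c * wt s" "u \<in> extensional \<Omega>"
proof -
  show "continuous_map X euclideanreal u" "u \<in> extensional \<Omega>" using assms by (auto simp: wC_def)
  obtain c where c: "\<And>s. s \<in> \<Omega> \<Longrightarrow> \<bar>u s / wt s\<bar> \<le> c" using assms by (auto simp: wC_def bounded_iff)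
  have "\<bar>u s\<bar> \<le> \<bar>c\<bar> * wt s" if "s \<in> \<Omega>" for s
    using c[OF that] wt_ge1[OF that] by (simp add: abs_divide pos_divide_le_eq mult_right_mono order_trans)
  then show "\<exists>c\<ge>0. \<forall>s\<in>\<Omega>. \<bar>u s\<bar> \<le> c * wt s" by (intro exI[of _ "\<bar>c\<bar>"]) auto
qed

lemma wt_bounded_integrable:
  fixes u :: "_ \<Rightarrow> real"
  assumes "sets M = sets (borel_of X)" "integrable M wt" "u \<in> borel_measurable M" "\<And>s. s \<in> \<Omega> \<Longrightarrow> \<bar>u s\<bar> \<le> c * wt s"
  shows "integrable M u"
proof (rule Bochner_Integration.integrable_bound[of M "\<lambda>s. c * wt s"])
  show "AE s in M. norm (u s) \<le> norm (c * wt s)"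
  proof (rule AE_I2)
    fix s assume "s \<in> space M"
    then have "s \<in> \<Omega>" using sets_eq_imp_space_eq[OF assms(1)] by simp
    then show "norm (u s) \<le> norm (c * wt s)" using assms(4)[of s] by simp
  qed
qed (use assms in auto)

lemma C_integrable: "u \<in> C \<Longrightarrow> sets M = sets (borel_of X) \<Longrightarrow> integrable M wt \<Longrightarrow> integrable M u"
  using C_D(1,2) wt_bounded_integrable cont_meas by metis

lemma h_closed: "s \<in> \<Omega> \<Longrightarrow> closed {u. h u s \<le> ereal \<alpha>}"
proof -
  assume s: "s \<in> \<Omega>"
  then have "closed (epi h s)" using h_normal by (auto simp: convex_normal_integrand_def)
  then have "closed ((\<lambda>u. (u, \<alpha>)) -` epi h s)" by (rule closed_vimage) (intro continuous_intros)
  moreover have "(\<lambda>u. (u, \<alpha>)) -` epi h s = {u. h u s \<le> ereal \<alpha>}" by (auto simp: epi_def)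
  ultimately show ?thesis by simp
qed

lemma h_le: "s \<in> \<Omega> \<Longrightarrow> u \<le> v \<Longrightarrow> h u s \<le> h v s"
  using h_mono by (auto simp: mono_def)

text \<open>Closed epigraphs have closed sublevel sets, which for a nondecreasing function means
  continuity from the left. So \<open>h (w s) s\<close> can be recovered from rationals below
  \<open>w s\<close>.\<close>

lemma h_left_cont:
  assumes s: "s \<in> \<Omega>" and le: "\<And>q. q < u \<Longrightarrow> h q s \<le> z"
  shows "h u s \<le> z"
proof (rule dense_ge)
  fix y assume "z < y"
  then obtain \<alpha> where \<alpha>: "z < ereal \<alpha>" "ereal \<alpha> < y" using ereal_dense2 by blast
  have "u \<in> closure {q. h q s \<le> ereal \<alpha>}"
    unfolding closure_sequential
  proof (intro exI[of _ "\<lambda>n. u - 1 / Suc n"] conjI allI)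
    show "u - 1 / real (Suc n) \<in> {q. h q s \<le> ereal \<alpha>}" for n
      using le[of "u - 1 / real (Suc n)"] \<alpha>(1) by (auto intro: order_trans less_imp_le)
    have "(\<lambda>n. u - inverse (real (Suc n))) \<longlonglongrightarrow> u - 0"
      by (intro tendsto_intros LIMSEQ_inverse_real_of_nat)
    then show "(\<lambda>n. u - 1 / real (Suc n)) \<longlonglongrightarrow> u" by (simp add: inverse_eq_divide)
  qed
  then have "h u s \<le> ereal \<alpha>" using h_closed[OF s, of \<alpha>] by simp
  then show "h u s \<le> y" using \<alpha>(2) by simp
qed

text \<open>Normality speaks of epigraphs that hit open sets. What it makes measurable directly is
  therefore not \<open>h q\<close> but an infimum over an open half-line, whose strict sublevel sets
  are tested by open rectangles.\<close>

lemma h_right_inf_meas: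
  assumes M: "sets M = sets (borel_of X)"
  shows "(\<lambda>s. INF u\<in>{q<..}. h u s) \<in> borel_measurable M"
proof (rule borel_measurableI_less)
  have sp: "space M = \<Omega>" using sets_eq_imp_space_eq[OF M] by simp
  have less_real: "{s \<in> space M. (INF u\<in>{q<..}. h u s) < ereal \<alpha>} \<in> sets M" for \<alpha>
  proof -
    have "{s \<in> space M. (INF u\<in>{q<..}. h u s) < ereal \<alpha>} = {s \<in> space (borel_of X). epi h s \<inter> ({q<..} \<times> {..<\<alpha>}) \<noteq> {}}"
    proof (intro Collect_cong conj_cong)
      fix s
      show "((INF u\<in>{q<..}. h u s) < ereal \<alpha>) = (epi h s \<inter> ({q<..} \<times> {..<\<alpha>}) \<noteq> {})"
      proof
        assume "(INF u\<in>{q<..}. h u s) < ereal \<alpha>"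
        then obtain u where u: "u > q" "h u s < ereal \<alpha>" unfolding INF_less_iff by auto
        then obtain \<beta> where "h u s < ereal \<beta>" "ereal \<beta> < ereal \<alpha>" using ereal_dense2 by blast
        then have "(u, \<beta>) \<in> epi h s \<inter> ({q<..} \<times> {..<\<alpha>})" using u by (auto simp: epi_def)
        then show "epi h s \<inter> ({q<..} \<times> {..<\<alpha>}) \<noteq> {}" by blast
      next
        assume "epi h s \<inter> ({q<..} \<times> {..<\<alpha>}) \<noteq> {}"
        then obtain u \<beta> where "h u s \<le> ereal \<beta>" "u > q" "\<beta> < \<alpha>" by (auto simp: epi_def)
        then show "(INF u\<in>{q<..}. h u s) < ereal \<alpha>" unfolding INF_less_iff
          by (intro bexI[of _ u]) (auto intro: le_less_trans)
      qed
    qed (use sp in auto)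
    moreover have "{s \<in> space (borel_of X). epi h s \<inter> ({q<..} \<times> {..<\<alpha>}) \<noteq> {}} \<in> sets (borel_of X)"
    proof (rule h_normal[unfolded convex_normal_integrand_def, THEN conjunct1, rule_format])
      show "open ({q<..} \<times> {..<\<alpha>})" by (intro open_Times) auto
    qed
    ultimately show ?thesis using M by simp
  qed
  fix y
  show "{s \<in> space M. (INF u\<in>{q<..}. h u s) < y} \<in> sets M"
  proof (cases y)
    case PInf
    define f where "f = (\<lambda>s. INF u\<in>{q<..}. h u s)"
    have "f s < \<infinity> \<longleftrightarrow> (\<exists>n. f s < ereal (real n))" for s
      unfolding less_PInf_Ex_of_nat[symmetric] by simp
    then have "{s \<in> space M. f s < y} = (\<Union>n. {s \<in> space M. f s < ereal (real n)})"
      unfolding PInf by blast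
    also have "\<dots> \<in> sets M" unfolding f_def by (intro sets.countable_UN image_subsetI) (rule less_real)
    finally show ?thesis unfolding f_def .
  next
    case (real r)
    then show ?thesis using less_real[of r] by simp
  qed simp
qed

text \<open>For a rational \<open>r < w s\<close>, the infimum over \<open>u > r\<close> is at most
  \<open>h (w s) s\<close> and at least \<open>h q s\<close> for every \<open>q < r\<close>; left
  continuity then identifies the supremum over \<open>r\<close>. The default
  \<open>-\<infinity>\<close> discards the rationals that are not below \<open>w s\<close>.\<close>

lemma h_comp_meas:
  assumes M: "sets M = sets (borel_of X)" and w: "w \<in> borel_measurable M"
  shows "(\<lambda>s. h (w s) s) \<in> borel_measurable M"
proof -
  let ?g = "\<lambda>s. SUP r::rat. if of_rat r < w s then (INF u\<in>{of_rat r<..}. h u s) else -\<infinity>"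
  have sp: "space M = \<Omega>" using sets_eq_imp_space_eq[OF M] by simp
  have "?g \<in> borel_measurable M"
    using w h_right_inf_meas[OF M] by (intro borel_measurable_SUP measurable_If) auto
  moreover have "?g s = h (w s) s" if s: "s \<in> space M" for s
  proof (rule antisym)
    show "?g s \<le> h (w s) s" by (rule SUP_least) (auto intro: INF_lower)
    show "h (w s) s \<le> ?g s"
    proof (rule h_left_cont)
      fix q assume "q < w s"
      then obtain r :: rat where r: "q < of_rat r" "of_rat r < w s" using of_rat_dense by blast
      have "h q s \<le> (INF u\<in>{of_rat r<..}. h u s)"
        using r s sp by (intro INF_greatest h_le) auto
      also have "\<dots> \<le> ?g s" using r by (intro SUP_upper2[of r]) auto
      finally show "h q s \<le> ?g s" .
    qed (use s sp in simp)
  qed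
  ultimately show ?thesis by (simp cong: measurable_cong)
qed

end

lemma ext_integral_less_PInf: "ext_integral M f < \<infinity> \<longleftrightarrow> (\<integral>\<^sup>+ s. e2ennreal (f s) \<partial>M) \<noteq> \<infinity>"
proof -
  have "enn2ereal a - b < \<infinity>" if "a \<noteq> \<infinity>" "b \<ge> 0" for a b
    using that by (cases a; cases b) (auto simp: enn2ereal_ennreal)
  then show ?thesis unfolding ext_integral_def by auto
qed

context ot_setup
begin

section \<open>The right end of the domain, and the functional \<open>H\<close> on its
  domain\<close>

definition d :: "(nat \<Rightarrow> 'a) \<Rightarrow> ereal" where "d s = (SUP u\<in>D s. ereal u)"

text \<open>Real representatives of \<open>h\<close>, and with \<open>kap\<close> of its conjugate.
  Infinite values become 0, so they carry information only together with a statement of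
  finiteness.\<close>

definition hr :: "real \<Rightarrow> (nat \<Rightarrow> 'a) \<Rightarrow> real" where "hr u s = real_of_ereal (h u s)"

definition kap :: "real \<Rightarrow> (nat \<Rightarrow> 'a) \<Rightarrow> real" where "kap v s = real_of_ereal (integrand_conj h v s)"

lemma H_notin: "u \<notin> CD \<Longrightarrow> H u = \<infinity>"
  by (simp add: H_fun_def indic_def)

lemma H_in: "u \<in> CD \<Longrightarrow> H u = ext_integral \<mu> (\<lambda>s. h (u s) s)"
  by (simp add: H_fun_def indic_def)

lemma H_less_D: "H u < \<infinity> \<Longrightarrow> u \<in> CD"
  using H_notin[of u] by (cases "u \<in> CD") auto

lemma CD_C: "u \<in> CD \<Longrightarrow> u \<in> C" by (simp add: wC_sel_def)

lemma CD_D: "u \<in> CD \<Longrightarrow> s \<in> \<Omega> \<Longrightarrow> u s \<in> D s" by (simp add: wC_sel_def)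

lemma D_ne: "s \<in> \<Omega> \<Longrightarrow> D s \<noteq> {}"
proof -
  assume s: "s \<in> \<Omega>"
  obtain u where "H u < \<infinity>" using H_proper by blast
  then show "D s \<noteq> {}" using CD_D[OF H_less_D s] by blast
qed

lemma D_finite:
  assumes s: "s \<in> \<Omega>" and u: "u \<in> D s" "v < u"
  shows "h v s < \<infinity>"
proof -
  have "\<exists>a\<in>{u. h u s < \<infinity>}. dist a u < u - v"
    using u unfolding cl_dom_def closure_approachable by simp
  then obtain a where a: "h a s < \<infinity>" "\<bar>a - u\<bar> < u - v" by (auto simp: dist_real_def)
  then have "v \<le> a" by linarith
  then show ?thesis using h_le[OF s] a(1) le_less_trans by blast
qed

lemma D_closed: "closed (D s)" by (simp add: cl_dom_def)

lemma dom_D: "h u s < \<infinity> \<Longrightarrow> u \<in> D s"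
  unfolding cl_dom_def by (rule closure_subset[THEN subsetD]) simp

lemma D_down: "s \<in> \<Omega> \<Longrightarrow> u \<in> D s \<Longrightarrow> v \<le> u \<Longrightarrow> v \<in> D s"
  using D_finite[of s u v] dom_D[of v s] by (cases "v = u") auto

lemma d_less_iff: "ereal a < d s \<longleftrightarrow> (\<exists>u\<in>D s. a < u)"
  unfolding d_def less_SUP_iff by auto

text \<open>Everything strictly below the supremum belongs to \<open>D s\<close> because
  \<open>D s\<close> is downward closed, and closedness adds the end point.\<close>

lemma D_iff:
  assumes s: "s \<in> \<Omega>"
  shows "u \<in> D s \<longleftrightarrow> ereal u \<le> d s"
proof
  assume "ereal u \<le> d s"
  have "u \<in> closure (D s)"
    unfolding closure_sequential
  proof (intro exI[of _ "\<lambda>n. u - 1 / Suc n"] conjI allI)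
    fix n
    have "ereal (u - 1 / Suc n) < ereal u" by simp
    then have "ereal (u - 1 / Suc n) < d s" using \<open>ereal u \<le> d s\<close> less_le_trans by blast
    then obtain u' where "u' \<in> D s" "u - 1 / Suc n < u'" unfolding d_less_iff by blast
    then show "u - 1 / Suc n \<in> D s" using D_down[OF s, of u' "u - 1 / Suc n"] by simp
  next
    have "(\<lambda>n. u - inverse (real (Suc n))) \<longlonglongrightarrow> u - 0"
      by (intro tendsto_intros LIMSEQ_inverse_real_of_nat)
    then show "(\<lambda>n. u - 1 / real (Suc n)) \<longlonglongrightarrow> u" by (simp add: inverse_eq_divide)
  qed
  then show "u \<in> D s" using D_closed by simp
next
  assume "u \<in> D s"
  then show "ereal u \<le> d s" unfolding d_def by (rule SUP_upper)
qed

text \<open>Tested on the open half-line above \<open>a\<close>, inner semicontinuity of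
  \<open>D\<close> is lower semicontinuity of \<open>d\<close>.\<close>

lemma d_open: "openin X {s \<in> \<Omega>. ereal a < d s}"
proof -
  have "openin X {s \<in> \<Omega>. D s \<inter> {a<..} \<noteq> {}}"
    by (rule D_isc[unfolded inner_semicontinuous_def, rule_format, OF open_greaterThan])
  moreover have "{s \<in> \<Omega>. D s \<inter> {a<..} \<noteq> {}} = {s \<in> \<Omega>. ereal a < d s}"
    by (auto simp: d_less_iff)
  ultimately show ?thesis by simp
qed

lemma d_gt_MInf: "s \<in> \<Omega> \<Longrightarrow> d s > -\<infinity>"
proof -
  assume s: "s \<in> \<Omega>"
  then obtain u where "u \<in> D s" using D_ne by blast
  then have "ereal u \<le> d s" using D_iff[OF s] by simp
  then show "d s > -\<infinity>" by (cases "d s") auto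
qed

lemma d_meas: "sets M = sets (borel_of X) \<Longrightarrow> d \<in> borel_measurable M"
proof (rule borel_measurableI_greater)
  fix y assume M: "sets M = sets (borel_of X)"
  have sp: "space M = \<Omega>" using sets_eq_imp_space_eq[OF M] by simp
  show "{x \<in> space M. y < d x} \<in> sets M"
  proof (cases y)
    case (real r)
    then show ?thesis using openin_borel_of[OF d_open[of r]] M sp by simp
  next
    case MInf
    then have eq: "{x \<in> space M. y < d x} = space M" using d_gt_MInf sp by auto
    show ?thesis unfolding eq by (rule sets.top)
  qed simp
qed

lemma conj_eps: "\<exists>\<epsilon>>0. ext_integrable \<mu> (integrand_conj h (1 - \<epsilon>)) \<and> ext_integrable \<mu> (integrand_conj h (1 + \<epsilon>))"
proof -
  obtain e where e: "e > 0" "\<And>v. dist v 1 < e \<Longrightarrow> ext_integrable \<mu> (integrand_conj h v)"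
    using h_conj unfolding eventually_nhds_metric by blast
  have "ext_integrable \<mu> (integrand_conj h (1 - e/2))" "ext_integrable \<mu> (integrand_conj h (1 + e/2))"
    using e(1) by (auto intro!: e(2) simp: dist_real_def)
  then show ?thesis using e(1) half_gt_zero by blast
qed

lemma conj_1: "ext_integrable \<mu> (integrand_conj h 1)"
  using h_conj by (rule eventually_nhds_x_imp_x)

lemma h_ge_kap:
  assumes "ext_integrable \<mu> (integrand_conj h v)"
  shows "AE s in \<mu>. \<forall>u. ereal (u * v - kap v s) \<le> h u s"
  using ext_integrableD(1)[OF assms]
proof eventually_elim
  case (elim s)
  show ?case
  proof
    fix u
    have "ereal (u * v) - h u s \<le> integrand_conj h v s"
      unfolding integrand_conj_def by (rule SUP_upper) simp
    also have "\<dots> = ereal (kap v s)" using elim by (simp add: kap_def)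
    finally show "ereal (u * v - kap v s) \<le> h u s" by (cases "h u s") auto
  qed
qed

lemma kap_integrable: "ext_integrable \<mu> (integrand_conj h v) \<Longrightarrow> integrable \<mu> (kap v)"
  using ext_integrableD(2) unfolding kap_def by blast

text \<open>Fenchel's inequality at slope 1, the coefficient of the sums in (B). It provides an
  integrable minorant of \<open>h(u)\<close> for integrable \<open>u\<close> and excludes the value
  \<open>-\<infinity>\<close>.\<close>

lemma h_ge_1: "AE s in \<mu>. \<forall>u. ereal (u - kap 1 s) \<le> h u s"
  using h_ge_kap[OF conj_1] by simp

lemma h_proper: "AE s in \<mu>. \<forall>u. h u s \<noteq> -\<infinity>"
  using h_ge_1
proof eventually_elim
  case (elim s)
  show ?case
  proof
    fix u
    have "ereal (u - kap 1 s) \<le> h u s" using elim by blast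
    then show "h u s \<noteq> -\<infinity>" by auto
  qed
qed

lemma hr_eq: "h u s \<noteq> -\<infinity> \<Longrightarrow> h u s < \<infinity> \<Longrightarrow> h u s = ereal (hr u s)"
  unfolding hr_def by (cases "h u s") auto

lemma hr_meas: "sets M = sets (borel_of X) \<Longrightarrow> w \<in> borel_measurable M \<Longrightarrow> (\<lambda>s. hr (w s) s) \<in> borel_measurable M"
  unfolding hr_def using h_comp_meas by measurable

lemma H_fin:
  assumes u: "u \<in> C" "H u < \<infinity>"
  shows "AE s in \<mu>. h (u s) s = ereal (hr (u s) s)" "integrable \<mu> (\<lambda>s. hr (u s) s)"
    "H u = ereal (\<integral>s. hr (u s) s \<partial>\<mu>)"
proof -
  have CD: "u \<in> CD" by (rule H_less_D) fact
  have m: "(\<lambda>s. h (u s) s) \<in> borel_measurable \<mu>"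
    by (rule h_comp_meas[OF mu_sets]) (rule cont_meas[OF C_D(1)[OF u(1)] mu_sets])
  have lower: "AE s in \<mu>. ereal (u s - kap 1 s) \<le> h (u s) s" using h_ge_1 by eventually_elim blast
  have i: "integrable \<mu> (\<lambda>s. u s - kap 1 s)"
    by (intro Bochner_Integration.integrable_diff C_integrable[OF u(1) mu_sets wt_integrable] kap_integrable conj_1)
  have fin: "ext_integral \<mu> (\<lambda>s. h (u s) s) < \<infinity>" using u(2) H_in[OF CD] by simp
  show "AE s in \<mu>. h (u s) s = ereal (hr (u s) s)" "integrable \<mu> (\<lambda>s. hr (u s) s)"
    "H u = ereal (\<integral>s. hr (u s) s \<partial>\<mu>)"
    using ext_integral_finite[OF m lower i fin] H_in[OF CD] by (simp_all add: hr_def)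
qed

text \<open>Both ingredients of \<open>H\<close> respect the order: \<open>D s\<close> is downward
  closed and \<open>h\<close> is nondecreasing. So the domain of \<open>H\<close> is a lower set in
  \<open>C\<close>.\<close>

lemma H_mono:
  assumes u: "u \<in> C" and v: "v \<in> C" "H v < \<infinity>" and le: "\<And>s. s \<in> \<Omega> \<Longrightarrow> u s \<le> v s"
  shows "H u < \<infinity>"
proof -
  have vCD: "v \<in> CD" by (rule H_less_D) fact
  have "u s \<in> D s" if "s \<in> \<Omega>" for s
    using D_down[OF that CD_D[OF vCD that] le[OF that]] .
  then have uCD: "u \<in> CD" unfolding wC_sel_def using u by blast
  have "(\<integral>\<^sup>+ s. e2ennreal (h (u s) s) \<partial>\<mu>) \<le> (\<integral>\<^sup>+ s. e2ennreal (h (v s) s) \<partial>\<mu>)"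
    by (rule nn_integral_mono) (use le h_le space_mu in \<open>auto intro: e2ennreal_mono\<close>)
  moreover have "(\<integral>\<^sup>+ s. e2ennreal (h (v s) s) \<partial>\<mu>) \<noteq> \<infinity>"
    using v(2) unfolding H_in[OF vCD] ext_integral_less_PInf .
  ultimately show ?thesis unfolding H_in[OF uCD] ext_integral_less_PInf
    by (metis infinity_ennreal_def top.extremum_uniqueI)
qed

lemma Metric_C: "Metric_space C (wdist X wt)"
  by (rule Metric_space_wC[OF Omega_ne wt_ge1])

lemma wdist_less:
  assumes uv: "u \<in> C" "v \<in> C" "wdist X wt u v < e" and s: "s \<in> \<Omega>"
  shows "\<bar>u s - v s\<bar> \<le> e * wt s"
proof -
  obtain a b where ab: "\<forall>s\<in>\<Omega>. \<bar>u s\<bar> \<le> a * wt s" "\<forall>s\<in>\<Omega>. \<bar>v s\<bar> \<le> b * wt s"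
    using C_D(2)[OF uv(1)] C_D(2)[OF uv(2)] by blast
  have "bdd_above ((\<lambda>s. \<bar>(u s - v s) / wt s\<bar>) ` \<Omega>)"
  proof (rule bdd_aboveI2)
    fix s assume s: "s \<in> \<Omega>"
    then have "\<bar>u s - v s\<bar> \<le> (a + b) * wt s" using ab by (smt (verit) distrib_right)
    then show "\<bar>(u s - v s) / wt s\<bar> \<le> a + b" using wt_ge1[OF s] by (simp add: abs_divide pos_divide_le_eq)
  qed
  then have "\<bar>(u s - v s) / wt s\<bar> \<le> wdist X wt u v"
    using uv(1,2) s unfolding wdist_def by (auto intro: cSUP_upper)
  then have "\<bar>(u s - v s) / wt s\<bar> \<le> e" using uv(3) by simp
  then show ?thesis using wt_ge1[OF s] by (simp add: abs_divide pos_divide_le_eq)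
qed

text \<open>This is how the closure condition on the domain of \<open>H\<close> is used. Some
  \<open>v\<close> in that domain lies within \<open>e\<close> of \<open>u\<close> in the weighted
  norm, so \<open>u - e * wt \<le> v\<close>, and the domain is a lower set.\<close>

lemma H_slack:
  assumes u: "u \<in> CD" and e: "e > 0"
  shows "restrict (\<lambda>s. u s - e * wt s) \<Omega> \<in> C" "H (restrict (\<lambda>s. u s - e * wt s) \<Omega>) < \<infinity>"
proof -
  interpret Metric_space C "wdist X wt" by (rule Metric_C)
  have uC: "u \<in> C" using u CD_C by blast
  have "u \<in> mtopology closure_of {u \<in> C. H u < \<infinity>}" unfolding cl_dom_H by (rule u)
  then obtain v where v: "v \<in> C" "H v < \<infinity>" "wdist X wt u v < e"
    unfolding metric_closure_of using e by auto
  obtain c where c: "\<forall>s\<in>\<Omega>. \<bar>u s\<bar> \<le> c * wt s" using C_D(2)[OF uC] by blast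
  show C: "restrict (\<lambda>s. u s - e * wt s) \<Omega> \<in> C"
  proof (rule C_I)
    show "continuous_map X euclideanreal (\<lambda>s. u s - e * wt s)"
      by (intro continuous_map_diff continuous_map_real_mult_left C_D(1) uC wt_cont)
    fix s assume s: "s \<in> \<Omega>"
    then have "\<bar>u s\<bar> \<le> c * wt s" "0 \<le> e * wt s" using c e wt_ge1[OF s] by auto
    then show "\<bar>u s - e * wt s\<bar> \<le> (c + e) * wt s" by (simp add: algebra_simps)
  qed
  show "H (restrict (\<lambda>s. u s - e * wt s) \<Omega>) < \<infinity>"
  proof (rule H_mono[OF C v(1,2)])
    fix s assume s: "s \<in> \<Omega>"
    from wdist_less[OF uC v(1,3) s] s show "restrict (\<lambda>s. u s - e * wt s) \<Omega> s \<le> v s" by simp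
  qed
qed

lemma h_convex:
  assumes s: "s \<in> \<Omega>" and fin: "h u s = ereal a" "h v s = ereal b" and t: "0 \<le> t" "t \<le> 1"
  shows "h ((1 - t) * u + t * v) s \<le> ereal ((1 - t) * a + t * b)"
proof -
  have "convex (epi h s)" using h_normal s by (auto simp: convex_normal_integrand_def)
  moreover have "(u, a) \<in> epi h s" "(v, b) \<in> epi h s" using fin by (auto simp: epi_def)
  ultimately have "(1 - t) *\<^sub>R (u, a) + t *\<^sub>R (v, b) \<in> epi h s"
    using t by (intro convexD) auto
  then show ?thesis by (simp add: epi_def)
qed

lemma hr_mono: "s \<in> \<Omega> \<Longrightarrow> (\<forall>u. h u s \<noteq> -\<infinity>) \<Longrightarrow> h v s < \<infinity> \<Longrightarrow> u \<le> v \<Longrightarrow> hr u s \<le> hr v s"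
proof -
  assume s: "s \<in> \<Omega>" and pr: "\<forall>u. h u s \<noteq> -\<infinity>" and v: "h v s < \<infinity>" and uv: "u \<le> v"
  have le: "h u s \<le> h v s" by (rule h_le[OF s uv])
  then have "h u s < \<infinity>" using v by (rule le_less_trans)
  then have "ereal (hr u s) \<le> ereal (hr v s)" using le hr_eq[of u s] hr_eq[of v s] pr v by simp
  then show ?thesis by simp
qed

text \<open>Below \<open>b\<close> a finite convex function is continuous. At \<open>b\<close>
  itself the approach is from the left only: monotonicity bounds the limit from above, and closed
  sublevel sets bound it from below.\<close>

lemma hr_tendsto:
  assumes s: "s \<in> \<Omega>" and pr: "\<forall>u. h u s \<noteq> -\<infinity>" and b: "h b s < \<infinity>"
    and le: "\<And>n. v n \<le> b" and lim: "v \<longlonglongrightarrow> l"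
  shows "(\<lambda>n. hr (v n) s) \<longlonglongrightarrow> hr l s"
proof -
  have lb: "l \<le> b" using lim le by (intro LIMSEQ_le_const2) auto
  have eq: "h u s = ereal (hr u s)" if "u \<le> b" for u
    using hr_eq pr b h_le[OF s that] le_less_trans by blast
  show ?thesis
  proof (cases "l < b")
    case True
    have "convex_on {..<b} (\<lambda>u. hr u s)"
    proof (rule convex_onI)
      fix t x y assume t: "0 < t" "t < (1::real)" and xy: "x \<in> {..<b}" "y \<in> {..<b}"
      have "(1 - t) * x + t * y \<le> max x y"
        using t by (intro convex_bound_le) auto
      then have xyb: "(1 - t) * x + t * y \<le> b" using xy by auto
      have "h ((1 - t) * x + t * y) s \<le> ereal ((1 - t) * hr x s + t * hr y s)"
        by (rule h_convex[OF s eq eq]) (use t xy in auto)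
      then show "hr ((1 - t) *\<^sub>R x + t *\<^sub>R y) s \<le> (1 - t) * hr x s + t * hr y s"
        using eq[OF xyb] by simp
    qed simp
    then have "continuous_on {..<b} (\<lambda>u. hr u s)" by (intro convex_on_continuous) auto
    then have "isCont (\<lambda>u. hr u s) l" using True by (simp add: continuous_on_eq_continuous_at)
    then show ?thesis by (rule isCont_tendsto_compose[OF _ lim])
  next
    case False
    then have l: "l = b" using lb by simp
    show ?thesis
    proof (rule order_tendstoI)
      fix a assume a: "a < hr l s"
      have "open (- {u. h u s \<le> ereal a})" using h_closed[OF s] by (rule open_Compl)
      moreover have "l \<in> - {u. h u s \<le> ereal a}" using a eq[OF lb] by simp
      ultimately have "\<forall>\<^sub>F n in sequentially. v n \<in> - {u. h u s \<le> ereal a}"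
        using lim by (rule topological_tendstoD[rotated 1]) 
      then show "\<forall>\<^sub>F n in sequentially. a < hr (v n) s"
        by eventually_elim (use eq[OF le] in simp)
    next
      fix a assume a: "hr l s < a"
      have "hr (v n) s \<le> hr l s" for n unfolding l by (rule hr_mono[OF s pr b le])
      then show "\<forall>\<^sub>F n in sequentially. hr (v n) s < a" by (intro always_eventually allI) (rule le_less_trans[OF _ a])
    qed
  qed
qed

lemma H_convex:
  assumes u: "u \<in> C" "H u < \<infinity>" and v: "v \<in> C" "H v < \<infinity>" and t: "0 \<le> t" "t \<le> 1"
  shows "restrict (\<lambda>s. (1 - t) * u s + t * v s) \<Omega> \<in> C" (is "?z \<in> C")
    "H (restrict (\<lambda>s. (1 - t) * u s + t * v s) \<Omega>) < \<infinity>"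
    "real_of_ereal (H (restrict (\<lambda>s. (1 - t) * u s + t * v s) \<Omega>)) \<le> (1 - t) * real_of_ereal (H u) + t * real_of_ereal (H v)"
proof -
  obtain a b where ab: "\<forall>s\<in>\<Omega>. \<bar>u s\<bar> \<le> a * wt s" "\<forall>s\<in>\<Omega>. \<bar>v s\<bar> \<le> b * wt s"
    using C_D(2)[OF u(1)] C_D(2)[OF v(1)] by blast
  show C: "?z \<in> C"
  proof (rule C_I[where c="(1 - t) * a + t * b"])
    show "continuous_map X euclideanreal (\<lambda>s. (1 - t) * u s + t * v s)"
      by (intro continuous_map_add continuous_map_real_mult_left C_D(1) u v)
    fix s assume s: "s \<in> \<Omega>"
    have "\<bar>(1 - t) * u s + t * v s\<bar> \<le> (1 - t) * \<bar>u s\<bar> + t * \<bar>v s\<bar>"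
      using t by (intro order_trans[OF abs_triangle_ineq]) (simp add: abs_mult)
    also have "\<dots> \<le> (1 - t) * (a * wt s) + t * (b * wt s)"
      using ab s t by (intro add_mono mult_left_mono) auto
    finally show "\<bar>(1 - t) * u s + t * v s\<bar> \<le> ((1 - t) * a + t * b) * wt s" by (simp add: algebra_simps)
  qed
  have uCD: "u \<in> CD" "v \<in> CD" using u v H_less_D by auto
  have zCD: "?z \<in> CD"
    unfolding wC_sel_def
  proof (intro CollectI conjI ballI C)
    fix s assume s: "s \<in> \<Omega>"
    have "(1 - t) * u s + t * v s \<le> max (u s) (v s)"
      using t by (intro convex_bound_le) auto
    moreover have "max (u s) (v s) \<in> D s" using CD_D[OF _ s] uCD by (simp add: max_def)
    ultimately show "?z s \<in> D s" using D_down[OF s] s by simp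
  qed
  have zm: "(\<lambda>s. h (?z s) s) \<in> borel_measurable \<mu>"
    by (rule h_comp_meas[OF mu_sets]) (rule cont_meas[OF C_D(1)[OF C] mu_sets])
  have le: "AE s in \<mu>. h (?z s) s \<le> ereal ((1 - t) * hr (u s) s + t * hr (v s) s)"
    using H_fin(1)[OF u] H_fin(1)[OF v] AE_space
  proof eventually_elim
    case (elim s)
    then have "s \<in> \<Omega>" by (simp add: space_mu)
    then show ?case using h_convex[OF _ elim(1,2) t] by simp
  qed
  have i: "integrable \<mu> (\<lambda>s. (1 - t) * hr (u s) s + t * hr (v s) s)"
    using H_fin(2)[OF u] H_fin(2)[OF v] by simp
  have "(\<integral>\<^sup>+ s. e2ennreal (h (?z s) s) \<partial>\<mu>) \<le> (\<integral>\<^sup>+ s. ennreal ((1 - t) * hr (u s) s + t * hr (v s) s) \<partial>\<mu>)"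
  proof (rule nn_integral_mono_AE)
    show "AE s in \<mu>. e2ennreal (h (?z s) s) \<le> ennreal ((1 - t) * hr (u s) s + t * hr (v s) s)"
      using le
    proof eventually_elim
      case (elim s)
      from e2ennreal_mono[OF elim] show ?case by simp
    qed
  qed
  also have "\<dots> < \<infinity>" using i unfolding real_integrable_def by (auto simp: less_top)
  finally show fin: "H ?z < \<infinity>" unfolding H_in[OF zCD] ext_integral_less_PInf by simp
  have "(\<integral>s. hr (?z s) s \<partial>\<mu>) \<le> (\<integral>s. (1 - t) * hr (u s) s + t * hr (v s) s \<partial>\<mu>)"
  proof (rule integral_mono_AE[OF H_fin(2)[OF C fin] i])
    show "AE s in \<mu>. hr (?z s) s \<le> (1 - t) * hr (u s) s + t * hr (v s) s"
      using le H_fin(1)[OF C fin]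
    proof eventually_elim
      case (elim s)
      then have "ereal (hr (?z s) s) \<le> ereal ((1 - t) * hr (u s) s + t * hr (v s) s)" by simp
      then show ?case by simp
    qed
  qed
  also have "\<dots> = (1 - t) * (\<integral>s. hr (u s) s \<partial>\<mu>) + t * (\<integral>s. hr (v s) s \<partial>\<mu>)"
    using H_fin(2)[OF u] H_fin(2)[OF v] by simp
  finally show "real_of_ereal (H ?z) \<le> (1 - t) * real_of_ereal (H u) + t * real_of_ereal (H v)"
    unfolding H_fin(3)[OF u] H_fin(3)[OF v] H_fin(3)[OF C fin] real_of_ereal.simps .
qed

section \<open>Existence of a dual solution\<close>

definition V where "V = {z :: (nat \<Rightarrow> 'a) \<Rightarrow> real. \<exists>c\<ge>0. \<forall>s\<in>\<Omega>. \<bar>z s\<bar> \<le> c * wt s}"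

definition adm :: "(nat \<Rightarrow> 'a \<Rightarrow> real) \<Rightarrow> bool" where "adm x \<longleftrightarrow> (\<forall>t\<le>T. integrable (m t) (x t))"

definition Sx :: "(nat \<Rightarrow> 'a \<Rightarrow> real) \<Rightarrow> real" where "Sx x = (\<Sum>t\<le>T. \<integral>y. x t y \<partial>m t)"

text \<open>A perturbation of (B) with \<open>x\<^sub>t\<close> integrable and \<open>- \<Sum>\<^sub>t x\<^sub>t\<close> relaxed to a continuous majorant \<open>u\<close>. Its value
  is defined for all \<open>z\<close> bounded by the weight, continuous or not, so that a subgradient at \<open>0\<close>
  is positive and can be evaluated on functions depending on one coordinate only.\<close>

definition vals :: "((nat \<Rightarrow> 'a) \<Rightarrow> real) \<Rightarrow> real set" where
  "vals z = {r. \<exists>x u. adm x \<and> u \<in> C \<and> H u < \<infinity> \<and> (\<forall>s\<in>\<Omega>. z s \<le> u s + path_sum T x s) \<and>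
     Sx x + real_of_ereal (H u) \<le> r}"

definition p0 :: real where "p0 = Inf (vals (\<lambda>_. 0))"

lemma V_lin: "f \<in> V \<Longrightarrow> g \<in> V \<Longrightarrow> (\<lambda>s. f s + g s) \<in> V" "f \<in> V \<Longrightarrow> (\<lambda>s. a * f s) \<in> V"
proof -
  assume "f \<in> V"
  then obtain c where c: "c \<ge> 0" "\<forall>s\<in>\<Omega>. \<bar>f s\<bar> \<le> c * wt s" unfolding V_def by auto
  then have "\<forall>s\<in>\<Omega>. \<bar>a * f s\<bar> \<le> (\<bar>a\<bar> * c) * wt s" by (auto simp: abs_mult mult.assoc intro: mult_left_mono)
  then show "(\<lambda>s. a * f s) \<in> V" unfolding V_def using c by (intro CollectI exI[of _ "\<bar>a\<bar> * c"]) auto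
  assume "g \<in> V"
  then obtain b where b: "b \<ge> 0" "\<forall>s\<in>\<Omega>. \<bar>g s\<bar> \<le> b * wt s" unfolding V_def by auto
  have "\<forall>s\<in>\<Omega>. \<bar>f s + g s\<bar> \<le> (c + b) * wt s"
  proof
    fix s assume "s \<in> \<Omega>"
    then have "\<bar>f s\<bar> \<le> c * wt s" "\<bar>g s\<bar> \<le> b * wt s" using c b by auto
    then show "\<bar>f s + g s\<bar> \<le> (c + b) * wt s" unfolding distrib_right by linarith
  qed
  then show "(\<lambda>s. f s + g s) \<in> V" unfolding V_def using b c by (intro CollectI exI[of _ "c + b"]) auto
qed

lemma V_bounded: "(\<And>s. s \<in> \<Omega> \<Longrightarrow> \<bar>z s\<bar> \<le> c) \<Longrightarrow> z \<in> V"
proof -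
  assume b: "\<And>s. s \<in> \<Omega> \<Longrightarrow> \<bar>z s\<bar> \<le> c"
  have "\<bar>z s\<bar> \<le> \<bar>c\<bar> * wt s" if "s \<in> \<Omega>" for s
  proof -
    have "\<bar>z s\<bar> \<le> \<bar>c\<bar> * 1" using b[OF that] by simp
    also have "\<dots> \<le> \<bar>c\<bar> * wt s" using wt_ge1[OF that] by (intro mult_left_mono) auto
    finally show ?thesis .
  qed
  then show ?thesis unfolding V_def by (intro CollectI exI[of _ "\<bar>c\<bar>"]) auto
qed

lemma C_V: "u \<in> C \<Longrightarrow> u \<in> V" using C_D(2) by (simp add: V_def)

lemma adm_lin: "adm x \<Longrightarrow> adm y \<Longrightarrow> adm (\<lambda>t r. a * x t r + b * y t r)"
  unfolding adm_def by auto

lemma Sx_lin: "adm x \<Longrightarrow> adm y \<Longrightarrow> Sx (\<lambda>t r. a * x t r + b * y t r) = a * Sx x + b * Sx y"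
  unfolding adm_def Sx_def by (simp add: sum.distrib sum_distrib_left)

lemma path_sum_lin: "path_sum T (\<lambda>t r. a * x t r + b * y t r) s = a * path_sum T x s + b * path_sum T y s"
  by (simp add: sum.distrib sum_distrib_left)

lemma path_sum_integrable: "adm x \<Longrightarrow> integrable \<mu> (path_sum T x)"
  unfolding adm_def by (intro Bochner_Integration.integrable_sum integrable_m) auto

lemma path_sum_integral: "adm x \<Longrightarrow> (\<integral>s. path_sum T x s \<partial>\<mu>) = Sx x"
proof -
  assume a: "adm x"
  have "(\<integral>s. path_sum T x s \<partial>\<mu>) = (\<Sum>t\<le>T. \<integral>s. x t (s t) \<partial>\<mu>)"
    using a unfolding adm_def by (intro Bochner_Integration.integral_sum integrable_m) auto
  also have "\<dots> = Sx x"
    unfolding Sx_def using a unfolding adm_def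
    by (intro sum.cong refl integral_m[symmetric]) (auto simp: m_cong_meas[symmetric])
  finally show ?thesis .
qed

text \<open>Integrating \<open>u - kap 1 \<le> h(u)\<close> and
  \<open>0 \<le> u + \<Sum>\<^sub>t x\<^sub>t\<close> leaves only the integral of
  \<open>kap 1\<close>, as the integral of \<open>u\<close> cancels.\<close>

lemma vals_lower:
  assumes "r \<in> vals (\<lambda>_. 0)"
  shows "- (\<integral>s. kap 1 s \<partial>\<mu>) \<le> r"
proof -
  obtain x u where x: "adm x" and u: "u \<in> C" "H u < \<infinity>"
    and le: "\<And>s. s \<in> \<Omega> \<Longrightarrow> 0 \<le> u s + path_sum T x s" and r: "Sx x + real_of_ereal (H u) \<le> r"
    using assms unfolding vals_def by blast
  have i: "integrable \<mu> u" by (rule C_integrable[OF u(1) mu_sets wt_integrable])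
  have k: "integrable \<mu> (kap 1)" by (rule kap_integrable[OF conj_1])
  have "(\<integral>s. u s - kap 1 s \<partial>\<mu>) \<le> (\<integral>s. hr (u s) s \<partial>\<mu>)"
  proof (rule integral_mono_AE)
    show "AE s in \<mu>. u s - kap 1 s \<le> hr (u s) s"
      using h_ge_1 H_fin(1)[OF u]
    proof eventually_elim
      case (elim s)
      then have "ereal (u s - kap 1 s) \<le> ereal (hr (u s) s)" by metis
      then show ?case by simp
    qed
  qed (use i k H_fin(2)[OF u] in auto)
  then have "(\<integral>s. u s \<partial>\<mu>) - (\<integral>s. kap 1 s \<partial>\<mu>) \<le> real_of_ereal (H u)"
    using i k by (simp add: H_fin(3)[OF u])
  moreover have "0 \<le> (\<integral>s. u s + path_sum T x s \<partial>\<mu>)"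
    by (intro integral_nonneg_AE AE_I2) (use le space_mu in auto)
  moreover have "(\<integral>s. u s + path_sum T x s \<partial>\<mu>) = (\<integral>s. u s \<partial>\<mu>) + Sx x"
    using i path_sum_integrable[OF x] path_sum_integral[OF x] by simp
  ultimately show ?thesis using r by linarith
qed

lemma vals_bdd: "bdd_below (vals (\<lambda>_. 0))"
  by (rule bdd_belowI) (rule vals_lower)

text \<open>The choice \<open>x t = (c + b) * \<psi> t\<close> absorbs every weight-bounded
  \<open>z\<close>. The value function is thus below infinity on all of \<open>V\<close>, which is
  the qualification behind the existence of a subgradient.\<close>

lemma vals_ne:
  assumes "z \<in> V"
  shows "\<exists>r. r \<in> vals z"
proof -
  obtain c where c: "\<forall>s\<in>\<Omega>. \<bar>z s\<bar> \<le> c * wt s" using assms unfolding V_def by auto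
  obtain u where u: "u \<in> C" "H u < \<infinity>" using H_proper by blast
  obtain b where b: "\<forall>s\<in>\<Omega>. \<bar>u s\<bar> \<le> b * wt s" using C_D(2)[OF u(1)] by blast
  define x where "x = (\<lambda>t y. (c + b) * \<psi> t y)"
  have "adm x" unfolding adm_def x_def using mu_marg by auto
  moreover have "z s \<le> u s + path_sum T x s" if "s \<in> \<Omega>" for s
  proof -
    have "path_sum T x s = c * wt s + b * wt s" by (simp add: x_def weight_def sum_distrib_left distrib_right sum.distrib)
    moreover have "\<bar>z s\<bar> \<le> c * wt s" "\<bar>u s\<bar> \<le> b * wt s" using c b that by auto
    ultimately show ?thesis by linarith
  qed
  ultimately have "Sx x + real_of_ereal (H u) \<in> vals z" unfolding vals_def using u by blast
  then show ?thesis by blast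
qed

lemma vals_convex:
  assumes r: "r1 \<in> vals z1" "r2 \<in> vals z2" and t: "0 \<le> t" "t \<le> 1"
  shows "(1 - t) * r1 + t * r2 \<in> vals (\<lambda>s. (1 - t) * z1 s + t * z2 s)"
proof -
  obtain x u where x: "adm x" and u: "u \<in> C" "H u < \<infinity>"
    and le: "\<And>s. s \<in> \<Omega> \<Longrightarrow> z1 s \<le> u s + path_sum T x s" and r1: "Sx x + real_of_ereal (H u) \<le> r1"
    using r(1) unfolding vals_def by blast
  obtain y v where y: "adm y" and v: "v \<in> C" "H v < \<infinity>"
    and le': "\<And>s. s \<in> \<Omega> \<Longrightarrow> z2 s \<le> v s + path_sum T y s" and r2: "Sx y + real_of_ereal (H v) \<le> r2"
    using r(2) unfolding vals_def by blast
  let ?x = "\<lambda>i r. (1 - t) * x i r + t * y i r" and ?u = "restrict (\<lambda>s. (1 - t) * u s + t * v s) \<Omega>"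
  have "\<forall>s\<in>\<Omega>. (1 - t) * z1 s + t * z2 s \<le> ?u s + path_sum T ?x s"
  proof
    fix s assume s: "s \<in> \<Omega>"
    have "(1 - t) * z1 s + t * z2 s \<le> (1 - t) * (u s + path_sum T x s) + t * (v s + path_sum T y s)"
      using t le[OF s] le'[OF s] by (intro add_mono mult_left_mono) auto
    also have "\<dots> = ((1 - t) * u s + t * v s) + ((1 - t) * path_sum T x s + t * path_sum T y s)" by (simp add: algebra_simps)
    also have "\<dots> = ?u s + path_sum T ?x s" using s unfolding path_sum_lin by simp
    finally show "(1 - t) * z1 s + t * z2 s \<le> ?u s + path_sum T ?x s" .
  qed
  moreover have "Sx ?x + real_of_ereal (H ?u) \<le> (1 - t) * r1 + t * r2"
  proof -
    have "Sx ?x + real_of_ereal (H ?u) \<le> ((1 - t) * Sx x + t * Sx y) + ((1 - t) * real_of_ereal (H u) + t * real_of_ereal (H v))"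
      unfolding Sx_lin[OF x y] using H_convex(3)[OF u v t] by (rule add_left_mono)
    also have "\<dots> = (1 - t) * (Sx x + real_of_ereal (H u)) + t * (Sx y + real_of_ereal (H v))" by (simp add: algebra_simps)
    also have "\<dots> \<le> (1 - t) * r1 + t * r2" using r1 r2 t by (intro add_mono mult_left_mono) auto
    finally show ?thesis .
  qed
  ultimately show ?thesis unfolding vals_def
    using adm_lin[OF x y] H_convex(1,2)[OF u v t] by (intro CollectI exI[of _ ?x] exI[of _ ?u]) blast
qed

text \<open>Difference quotients of the value function at 0; \<open>Inf (Q z)\<close> is its
  directional derivative along \<open>z\<close>.\<close>

definition Q :: "((nat \<Rightarrow> 'a) \<Rightarrow> real) \<Rightarrow> real set" where
  "Q z = {(r - p0) / t | r t. t > 0 \<and> r \<in> vals (\<lambda>s. t * z s)}"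

lemma Q_I: "t > 0 \<Longrightarrow> r \<in> vals (\<lambda>s. t * z s) \<Longrightarrow> (r - p0) / t \<in> Q z"
  unfolding Q_def by blast

lemma Q_E:
  assumes "a \<in> Q z"
  obtains r t where "a = (r - p0) / t" "t > 0" "r \<in> vals (\<lambda>s. t * z s)"
  using assms unfolding Q_def by blast

lemma Q_add:
  assumes "a \<in> Q z1" "b \<in> Q z2"
  shows "a + b \<in> Q (\<lambda>s. z1 s + z2 s)"
proof -
  obtain r1 t1 where 1: "a = (r1 - p0) / t1" "t1 > 0" "r1 \<in> vals (\<lambda>s. t1 * z1 s)" using assms(1) by (rule Q_E)
  obtain r2 t2 where 2: "b = (r2 - p0) / t2" "t2 > 0" "r2 \<in> vals (\<lambda>s. t2 * z2 s)" using assms(2) by (rule Q_E)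
  \<comment> \<open>The weights satisfy \<open>(1 - l) * t1 = l * t2 = t\<close>: after averaging,
    both directions carry the same step \<open>t\<close>, half the harmonic mean of
    \<open>t1\<close> and \<open>t2\<close>.\<close>
  define l where "l = t1 / (t1 + t2)"
  define t where "t = t1 * t2 / (t1 + t2)"
  have l: "0 \<le> l" "l \<le> 1" "1 - l = t2 / (t1 + t2)" using 1 2 by (auto simp: l_def field_simps)
  have t: "t > 0" unfolding t_def using 1(2) 2(2) by simp
  have "(1 - l) * r1 + l * r2 \<in> vals (\<lambda>s. (1 - l) * (t1 * z1 s) + l * (t2 * z2 s))"
    by (rule vals_convex[OF 1(3) 2(3) l(1,2)])
  moreover have "(1 - l) * (t1 * z1 s) + l * (t2 * z2 s) = t * (z1 s + z2 s)" for s
  proof -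
    have "(1 - l) * t1 = t" "l * t2 = t" unfolding l(3) unfolding l_def t_def by simp_all
    then have "(1 - l) * (t1 * z1 s) + l * (t2 * z2 s) = t * z1 s + t * z2 s" by (metis mult.assoc)
    then show ?thesis by (simp add: distrib_left)
  qed
  ultimately have "((1 - l) * r1 + l * r2 - p0) / t \<in> Q (\<lambda>s. z1 s + z2 s)" using t by (intro Q_I) simp_all
  moreover have "((1 - l) * r1 + l * r2 - p0) / t = a + b"
  proof -
    have "(1 - l) * r1 + l * r2 - p0 = (1 - l) * (r1 - p0) + l * (r2 - p0)" by (simp add: algebra_simps)
    also have "\<dots> = (t2 * (r1 - p0) + t1 * (r2 - p0)) / (t1 + t2)"
      unfolding l(3) unfolding l_def by (simp add: add_divide_distrib)
    also have "\<dots> / t = (t2 * (r1 - p0) + t1 * (r2 - p0)) / (t1 * t2)"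
      unfolding t_def using 1(2) 2(2) by simp
    also have "\<dots> = a + b" unfolding 1(1) 2(1) using 1(2) 2(2) by (simp add: add_divide_distrib field_simps)
    finally show ?thesis .
  qed
  ultimately show ?thesis by simp
qed

lemma Q_scale:
  assumes "b \<in> Q z" "a > 0"
  shows "a * b \<in> Q (\<lambda>s. a * z s)"
proof -
  obtain r t where 1: "b = (r - p0) / t" "t > 0" "r \<in> vals (\<lambda>s. t * z s)" using assms(1) by (rule Q_E)
  have "(r - p0) / (t / a) \<in> Q (\<lambda>s. a * z s)" by (rule Q_I) (use 1 assms(2) in auto)
  then show ?thesis using 1(1) assms(2) by (simp add: mult.commute)
qed

lemma Q_zero: "a \<in> Q (\<lambda>_. 0) \<Longrightarrow> 0 \<le> a"
proof (erule Q_E)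
  fix r t :: real assume "a = (r - p0) / t" "t > 0" and r: "r \<in> vals (\<lambda>s. t * 0)"
  have "p0 \<le> r" unfolding p0_def using r by (intro cInf_lower vals_bdd) simp
  then show "0 \<le> a" using \<open>a = _\<close> \<open>t > 0\<close> by simp
qed

lemma Q_ne: "z \<in> V \<Longrightarrow> Q z \<noteq> {}"
  using vals_ne[of "\<lambda>s. 1 * z s"] Q_I[of 1 _ z] by force

text \<open>A single quotient \<open>b\<close> along \<open>- z\<close> bounds all quotients
  \<open>a\<close> along \<open>z\<close>: the sum \<open>a + b\<close> is a quotient along 0, hence
  nonnegative because \<open>p0\<close> is an infimum.\<close>

lemma Q_bdd: "z \<in> V \<Longrightarrow> bdd_below (Q z)"
proof -
  assume z: "z \<in> V"
  obtain b where b: "b \<in> Q (\<lambda>s. - 1 * z s)" using Q_ne[OF V_lin(2)[OF z, of "-1"]] by blast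
  show ?thesis
  proof (rule bdd_belowI[of _ "- b"])
    fix a assume "a \<in> Q z"
    from Q_zero[of "a + b"] Q_add[OF this b] show "- b \<le> a" by simp
  qed
qed

lemma sublinear_Inf_Q: "sublinear_on V (\<lambda>z. Inf (Q z))"
  unfolding sublinear_on_def
proof (intro conjI ballI allI impI)
  fix f g assume f: "f \<in> V" and g: "g \<in> V"
  have *: "Inf (Q (\<lambda>s. f s + g s)) \<le> a + b" if "a \<in> Q f" "b \<in> Q g" for a b
    by (rule cInf_lower[OF Q_add[OF that] Q_bdd[OF V_lin(1)[OF f g]]])
  have "Inf (Q (\<lambda>s. f s + g s)) - Inf (Q g) \<le> Inf (Q f)"
  proof (rule cInf_greatest[OF Q_ne[OF f]])
    fix a assume a: "a \<in> Q f"
    have "Inf (Q (\<lambda>s. f s + g s)) - a \<le> Inf (Q g)"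
    proof (rule cInf_greatest[OF Q_ne[OF g]])
      fix b assume "b \<in> Q g"
      from *[OF a this] show "Inf (Q (\<lambda>s. f s + g s)) - a \<le> b" by simp
    qed
    then show "Inf (Q (\<lambda>s. f s + g s)) - Inf (Q g) \<le> a" by simp
  qed
  then show "Inf (Q (\<lambda>s. f s + g s)) \<le> Inf (Q f) + Inf (Q g)" by simp
next
  have half: "Inf (Q (\<lambda>s. a * f s)) \<le> a * Inf (Q f)" if "f \<in> V" "a > 0" for f a
  proof -
    have "Inf (Q (\<lambda>s. a * f s)) / a \<le> Inf (Q f)"
    proof (rule cInf_greatest[OF Q_ne[OF that(1)]])
      fix b assume "b \<in> Q f"
      then have "Inf (Q (\<lambda>s. a * f s)) \<le> a * b"
        by (intro cInf_lower Q_scale Q_bdd V_lin that)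
      then show "Inf (Q (\<lambda>s. a * f s)) / a \<le> b" using that(2) by (simp add: field_simps)
    qed
    then show ?thesis using that(2) by (simp add: field_simps)
  qed
  have full: "Inf (Q (\<lambda>s. a * f s)) = a * Inf (Q f)" if f: "f \<in> V" and a: "a > 0" for f a
  proof -
    have "Inf (Q (\<lambda>s. (1/a) * (a * f s))) \<le> (1/a) * Inf (Q (\<lambda>s. a * f s))"
      by (intro half V_lin f) (use a in simp)
    then have "a * Inf (Q f) \<le> Inf (Q (\<lambda>s. a * f s))" using a by (simp add: field_simps)
    then show ?thesis using half[OF f a] by simp
  qed
  fix f a assume f: "f \<in> V" and a: "0 \<le> (a::real)"
  show "Inf (Q (\<lambda>s. a * f s)) = a * Inf (Q f)"
  proof (cases "a = 0")
    case True
    have "(\<lambda>s. 0) \<in> V" using V_lin(2)[OF f, of 0] by simp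
    from full[OF this, of 2] show ?thesis using True by simp
  next
    case False
    then show ?thesis using full[OF f, of a] a by simp
  qed
qed

text \<open>\<open>L\<close> is linear and below the directional derivative. For
  \<open>z \<le> 0\<close> every value at 0 is also a value at \<open>z\<close>, so
  \<open>L z \<le> 0\<close>. A path sum as perturbation shifts the values by \<open>Sx x\<close>,
  and using both signs gives equality. The last bound compares the value at \<open>u\<close> with
  the candidate \<open>x = 0\<close>.\<close>

lemma dual_functional:
  "\<exists>L. (\<forall>f\<in>V. \<forall>g\<in>V. L (\<lambda>s. f s + g s) = L f + L g) \<and>
    (\<forall>f\<in>V. \<forall>a. L (\<lambda>s. a * f s) = a * L f) \<and>
    (\<forall>f\<in>V. (\<forall>s\<in>\<Omega>. f s \<le> 0) \<longrightarrow> L f \<le> 0) \<and>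
    (\<forall>x. adm x \<longrightarrow> path_sum T x \<in> V \<longrightarrow> L (path_sum T x) = Sx x) \<and>
    (\<forall>u\<in>C. H u < \<infinity> \<longrightarrow> L u - real_of_ereal (H u) \<le> - p0)"
proof -
  obtain L where L: "(\<forall>f\<in>V. L f \<le> Inf (Q f)) \<and> (\<forall>f\<in>V. \<forall>g\<in>V. L (\<lambda>s. f s + g s) = L f + L g) \<and>
    (\<forall>f\<in>V. \<forall>a. L (\<lambda>s. a * f s) = a * L f)"
  proof -
    have "\<exists>L. (\<forall>f\<in>V. L f \<le> Inf (Q f)) \<and> (\<forall>f\<in>V. \<forall>g\<in>V. L (\<lambda>s. f s + g s) = L f + L g) \<and>
      (\<forall>f\<in>V. \<forall>a. L (\<lambda>s. a * f s) = a * L f)"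
      by (rule sublinear_dominates_linear[OF _ _ sublinear_Inf_Q]) (rule V_lin; assumption)+
    then show thesis using that by (elim exE)
  qed
  have L_le: "\<And>f. f \<in> V \<Longrightarrow> L f \<le> Inf (Q f)"
    and L_add: "\<And>f g. f \<in> V \<Longrightarrow> g \<in> V \<Longrightarrow> L (\<lambda>s. f s + g s) = L f + L g"
    and L_scale: "\<And>f a. f \<in> V \<Longrightarrow> L (\<lambda>s. a * f s) = a * L f"
    using L by simp_all
  have L_vals: "L z \<le> r - p0" if "z \<in> V" "r \<in> vals z" for z r
  proof -
    have "(r - p0) / 1 \<in> Q z" by (rule Q_I) (use that in auto)
    then have "Inf (Q z) \<le> r - p0" using Q_bdd[OF that(1)] by (simp add: cInf_lower)
    then show ?thesis using L_le[OF that(1)] by simp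
  qed
  have V0: "(\<lambda>_. 0) \<in> V" by (rule V_bounded[of _ 0]) simp
  have p0_ge: "c \<le> p0" if "\<And>r. r \<in> vals (\<lambda>_. 0) \<Longrightarrow> c \<le> r" for c
    unfolding p0_def by (rule cInf_greatest) (use vals_ne[OF V0] that in auto)
  have pos: "L z \<le> 0" if z: "z \<in> V" and le: "\<And>s. s \<in> \<Omega> \<Longrightarrow> z s \<le> 0" for z
  proof -
    have sub: "vals (\<lambda>_. 0) \<subseteq> vals z"
    proof
      fix r assume "r \<in> vals (\<lambda>_. 0)"
      then obtain x u where x: "adm x" and u: "u \<in> C" "H u < \<infinity>"
        and le0: "\<And>s. s \<in> \<Omega> \<Longrightarrow> 0 \<le> u s + path_sum T x s" and r: "Sx x + real_of_ereal (H u) \<le> r"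
        unfolding vals_def by blast
      have "\<forall>s\<in>\<Omega>. z s \<le> u s + path_sum T x s" using le0 le order_trans by blast
      then show "r \<in> vals z" unfolding vals_def using x u r by blast
    qed
    have "L z + p0 \<le> p0"
    proof (rule p0_ge)
      fix r assume "r \<in> vals (\<lambda>_. 0)"
      then show "L z + p0 \<le> r" using L_vals[OF z] sub by fastforce
    qed
    then show ?thesis by simp
  qed
  have marg_le: "L (path_sum T x) \<le> Sx x" if x: "adm x" "path_sum T x \<in> V" for x
  proof -
    have "L (path_sum T x) - Sx x + p0 \<le> p0"
    proof (rule p0_ge)
      fix r assume "r \<in> vals (\<lambda>_. 0)"
      then obtain y u where y: "adm y" and u: "u \<in> C" "H u < \<infinity>"
        and le0: "\<And>s. s \<in> \<Omega> \<Longrightarrow> 0 \<le> u s + path_sum T y s" and r: "Sx y + real_of_ereal (H u) \<le> r"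
        unfolding vals_def by blast
      let ?y = "\<lambda>t r. 1 * x t r + 1 * y t r"
      have "\<forall>s\<in>\<Omega>. path_sum T x s \<le> u s + path_sum T ?y s"
        unfolding path_sum_lin using le0 by fastforce
      moreover have "Sx ?y + real_of_ereal (H u) \<le> r + Sx x" unfolding Sx_lin[OF x(1) y] using r by simp
      ultimately have "r + Sx x \<in> vals (path_sum T x)"
        unfolding vals_def using adm_lin[OF x(1) y, of 1 1] u by (intro CollectI exI[of _ ?y] exI[of _ u]) blast
      from L_vals[OF x(2) this] show "L (path_sum T x) - Sx x + p0 \<le> r" by simp
    qed
    then show ?thesis by simp
  qed
  have marg: "L (path_sum T x) = Sx x" if x: "adm x" "path_sum T x \<in> V" for x
  proof -
    let ?x = "\<lambda>t r. - 1 * x t r + 0 * x t r"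
    have e: "path_sum T ?x = (\<lambda>s. - 1 * path_sum T x s)" using path_sum_lin[of "-1" x _ 0 x] by auto
    have "L (path_sum T ?x) \<le> Sx ?x"
      by (rule marg_le[OF adm_lin[OF x(1) x(1)]]) (unfold e, rule V_lin(2)[OF x(2)])
    then have "- L (path_sum T x) \<le> - Sx x"
      unfolding e Sx_lin[OF x(1) x(1)] using L_scale[OF x(2), of "-1"] by simp
    then show ?thesis using marg_le[OF x] by simp
  qed
  have bd: "L u - real_of_ereal (H u) \<le> - p0" if u: "u \<in> C" "H u < \<infinity>" for u
  proof -
    have "adm (\<lambda>_ _. 0)" by (simp add: adm_def)
    moreover have "Sx (\<lambda>_ _. 0) = 0" by (simp add: Sx_def)
    ultimately have "real_of_ereal (H u) \<in> vals u"
      unfolding vals_def using u by (intro CollectI exI[of _ "\<lambda>_ _. 0"] exI[of _ u]) auto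
    from L_vals[OF C_V[OF u(1)] this] show ?thesis by simp
  qed
  show ?thesis
  proof (rule exI[of _ L], intro conjI ballI allI impI)
    show "L (\<lambda>s. f s + g s) = L f + L g" if "f \<in> V" "g \<in> V" for f g by (rule L_add[OF that])
    show "L (\<lambda>s. a * f s) = a * L f" if "f \<in> V" for f a by (rule L_scale[OF that])
    show "L f \<le> 0" if "f \<in> V" "\<forall>s\<in>\<Omega>. f s \<le> 0" for f by (rule pos[OF that(1) bspec[OF that(2)]])
    show "L (path_sum T x) = Sx x" if "adm x" "path_sum T x \<in> V" for x by (rule marg[OF that])
    show "L u - real_of_ereal (H u) \<le> - p0" if "u \<in> C" "H u < \<infinity>" for u by (rule bd[OF that])
  qed
qed

section \<open>From the dual functional to a measure\<close>

definition single :: "nat \<Rightarrow> ('a \<Rightarrow> real) \<Rightarrow> nat \<Rightarrow> 'a \<Rightarrow> real" where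
  "single t f = (\<lambda>i y. if i = t then f y else 0)"

lemma single_simps:
  assumes t: "t \<le> T"
  shows "path_sum T (single t f) s = f (s t)" "Sx (single t f) = (\<integral>y. f y \<partial>m t)"
    "adm (single t f) \<longleftrightarrow> integrable (m t) f"
proof -
  have "path_sum T (single t f) s = (\<Sum>i\<le>T. if i = t then f (s t) else 0)"
    unfolding single_def by (rule sum.cong) auto
  then show "path_sum T (single t f) s = f (s t)" using t by simp
  have "Sx (single t f) = (\<Sum>i\<le>T. if i = t then (\<integral>y. f y \<partial>m t) else 0)"
    unfolding Sx_def single_def by (rule sum.cong) auto
  then show "Sx (single t f) = (\<integral>y. f y \<partial>m t)" using t by simp
  show "adm (single t f) \<longleftrightarrow> integrable (m t) f"
  proof -
    have "integrable (m i) (\<lambda>y. if i = t then f y else 0)" if "integrable (m t) f" for i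
      using that by (cases "i = t") auto
    then show ?thesis unfolding adm_def single_def using t by auto
  qed
qed

text \<open>For Daniell's condition, Dini's theorem controls the functions on a product of compact
  sets. Outside that product they are at most \<open>c\<close> times a sum of indicators of one
  coordinate each, and \<open>L\<close> sends those to the \<open>m t\<close>-masses outside the
  compact sets.\<close>

lemma dual_measure:
  obtains M where "sets M = sets (borel_of X)" "finite_measure M"
    "\<And>t. t \<le> T \<Longrightarrow> distr M (borel_of (S t)) (\<lambda>s. s t) = m t"
    "\<And>u. u \<in> C \<Longrightarrow> H u < \<infinity> \<Longrightarrow> (\<integral>s. u s \<partial>M) - real_of_ereal (H u) \<le> - p0"
proof -
  obtain L where L: "(\<forall>f\<in>V. \<forall>g\<in>V. L (\<lambda>s. f s + g s) = L f + L g) \<and>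
    (\<forall>f\<in>V. \<forall>a. L (\<lambda>s. a * f s) = a * L f) \<and>
    (\<forall>f\<in>V. (\<forall>s\<in>\<Omega>. f s \<le> 0) \<longrightarrow> L f \<le> 0) \<and>
    (\<forall>x. adm x \<longrightarrow> path_sum T x \<in> V \<longrightarrow> L (path_sum T x) = Sx x) \<and>
    (\<forall>u\<in>C. H u < \<infinity> \<longrightarrow> L u - real_of_ereal (H u) \<le> - p0)"
    using dual_functional by (elim exE)
  have LV_add: "\<And>f g. f \<in> V \<Longrightarrow> g \<in> V \<Longrightarrow> L (\<lambda>s. f s + g s) = L f + L g"
    and LV_scale: "\<And>f a. f \<in> V \<Longrightarrow> L (\<lambda>s. a * f s) = a * L f"
    and L_neg: "\<And>f. f \<in> V \<Longrightarrow> (\<And>s. s \<in> \<Omega> \<Longrightarrow> f s \<le> 0) \<Longrightarrow> L f \<le> 0"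
    and L_marg: "\<And>x. adm x \<Longrightarrow> path_sum T x \<in> V \<Longrightarrow> L (path_sum T x) = Sx x"
    and L_bd: "\<And>u. u \<in> C \<Longrightarrow> H u < \<infinity> \<Longrightarrow> L u - real_of_ereal (H u) \<le> - p0"
    using L by blast+
  have LV_mono: "L f \<le> L g" if "f \<in> V" "g \<in> V" "\<And>s. s \<in> \<Omega> \<Longrightarrow> f s \<le> g s" for f g
  proof -
    have "L (\<lambda>s. f s + - 1 * g s) \<le> 0"
      by (intro L_neg V_lin that) (use that(3) in auto)
    then show ?thesis using LV_add[OF that(1) V_lin(2)[OF that(2), of "-1"]] LV_scale[OF that(2), of "-1"] by simp
  qed
  have L_single: "L (\<lambda>s. f (s t)) = (\<integral>y. f y \<partial>m t)" if "t \<le> T" "integrable (m t) f" "(\<lambda>s. f (s t)) \<in> V" for f t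
  proof -
    have "path_sum T (single t f) = (\<lambda>s. f (s t))" using single_simps(1)[OF that(1)] by auto
    then show ?thesis using L_marg[of "single t f"] single_simps(2,3)[OF that(1), of f] that by simp
  qed
  have L1: "L (\<lambda>_. 1) = 1"
  proof -
    interpret prob_space "m 0" by (rule prob_m) simp
    show ?thesis using L_single[of 0 "\<lambda>_. 1"] V_bounded[of "\<lambda>_. 1" 1] prob_space by simp
  qed
  have cV: "f \<in> V" if "f \<in> cfun X" for f
    using that V_bounded unfolding cfun_def by blast
  have LV_sum: "L (\<lambda>s. \<Sum>i\<in>I. f i s) = (\<Sum>i\<in>I. L (f i))" "(\<lambda>s. \<Sum>i\<in>I. f i s) \<in> V"
    if "finite I" "\<And>i. i \<in> I \<Longrightarrow> f i \<in> V" for f :: "nat \<Rightarrow> _" and I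
  proof -
    have "L (\<lambda>s. \<Sum>i\<in>I. f i s) = (\<Sum>i\<in>I. L (f i)) \<and> (\<lambda>s. \<Sum>i\<in>I. f i s) \<in> V"
      using that
    proof (induction I)
      case empty
      have "(\<lambda>_. 0) \<in> V" by (rule V_bounded[of _ 0]) simp
      then show ?case using LV_scale[of "\<lambda>_. 0" 0] by simp
    next
      case (insert i I)
      then have "f i \<in> V" "(\<lambda>s. \<Sum>i\<in>I. f i s) \<in> V" by auto
      from LV_add[OF this] V_lin(1)[OF this] insert show ?case by simp
    qed
    then show "L (\<lambda>s. \<Sum>i\<in>I. f i s) = (\<Sum>i\<in>I. L (f i))" "(\<lambda>s. \<Sum>i\<in>I. f i s) \<in> V" by auto
  qed
  have dan: "daniell X L"
  proof
    show "metrizable_space X" by (rule metrizable_X)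
    show "L (\<lambda>s. f s + g s) = L f + L g" if "f \<in> cfun X" "g \<in> cfun X" for f g using LV_add cV that by blast
    show "L (\<lambda>s. c * f s) = c * L f" if "f \<in> cfun X" for f c using LV_scale cV that by blast
    show "0 \<le> L f" if "f \<in> cfun X" "\<And>s. s \<in> \<Omega> \<Longrightarrow> 0 \<le> f s" for f
    proof -
      have "L (\<lambda>s. - 1 * f s) \<le> 0" by (intro L_neg V_lin cV that) (use that(2) in auto)
      then show ?thesis using LV_scale[OF cV[OF that(1)], of "-1"] by simp
    qed
    fix F :: "nat \<Rightarrow> (nat \<Rightarrow> 'a) \<Rightarrow> real"
    assume Fc: "\<And>n. F n \<in> cfun X" and Fd: "\<And>n s. s \<in> \<Omega> \<Longrightarrow> F (Suc n) s \<le> F n s"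
      and Fl: "\<And>s. s \<in> \<Omega> \<Longrightarrow> (\<lambda>n. F n s) \<longlonglongrightarrow> 0"
    have Fle: "F n s \<le> F k s" if "s \<in> \<Omega>" "k \<le> n" for k n s
      using lift_Suc_antimono_le[of "\<lambda>n. F n s", OF Fd[OF that(1)] that(2)] .
    have F0: "0 \<le> F n s" if "s \<in> \<Omega>" for n s
      by (rule LIMSEQ_le_const2[OF Fl[OF that]]) (use Fle[OF that] in blast)
    obtain c0 where c0: "\<forall>s\<in>\<Omega>. \<bar>F 0 s\<bar> \<le> c0" using Fc[of 0] unfolding cfun_def by blast
    define c where "c = \<bar>c0\<bar> + 1"
    have c: "c > 0" "\<And>n s. s \<in> \<Omega> \<Longrightarrow> F n s \<le> c"
    proof -
      show "c > 0" by (simp add: c_def)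
      fix n s assume s: "s \<in> \<Omega>"
      have "F n s \<le> F 0 s" by (rule Fle[OF s]) simp
      then show "F n s \<le> c" using c0 s unfolding c_def by fastforce
    qed
    show "(\<lambda>n. L (F n)) \<longlonglongrightarrow> 0"
    proof (rule LIMSEQ_I)
      fix e :: real assume e: "e > 0"
      \<comment> \<open>Chosen so that the \<open>T + 1\<close> coordinates together contribute
        \<open>e / 4\<close>.\<close>
      define \<delta> where "\<delta> = e / (4 * c * (real T + 1))"
      have \<delta>: "\<delta> > 0" unfolding \<delta>_def using e c by simp
      have "\<exists>K. compactin (S t) K \<and> closedin (S t) K \<and> measure (m t) (topspace (S t) - K) < \<delta>" if "t \<le> T" for t
        by (rule polish_tight[OF polish[OF that] _ sets_m \<delta>]) (rule prob_space.finite_measure[OF prob_m[OF that]])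
      then obtain K where K: "\<And>t. t \<le> T \<Longrightarrow> compactin (S t) (K t)" "\<And>t. t \<le> T \<Longrightarrow> closedin (S t) (K t)"
        "\<And>t. t \<le> T \<Longrightarrow> measure (m t) (topspace (S t) - K t) < \<delta>" by metis
      have "compactin X (PiE {..T} K)" unfolding compactin_PiE using K(1) by auto
      moreover have "continuous_map X euclideanreal (F n)" for n using Fc[of n] by (simp add: cfun_def)
      moreover have "0 < e/4" using e by simp
      ultimately have "\<exists>N. \<forall>n\<ge>N. \<forall>s\<in>PiE {..T} K. F n s < e/4"
        using Fd Fl by (intro dini_compact)
      then obtain N where N: "\<And>n s. n \<ge> N \<Longrightarrow> s \<in> PiE {..T} K \<Longrightarrow> F n s < e/4" by blast
      \<comment> \<open>These indicators are in general discontinuous; \<open>L\<close> may be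
        applied to them because \<open>V\<close> contains all weight-bounded functions.\<close>
      define g where "g = (\<lambda>t. indicator (topspace (S t) - K t) :: 'a \<Rightarrow> real)"
      have gV: "(\<lambda>s. g t (s t)) \<in> V" for t by (rule V_bounded[of _ 1]) (simp add: g_def)
      have gi: "integrable (m t) (g t)" "(\<integral>y. g t y \<partial>m t) < \<delta>" if t: "t \<le> T" for t
      proof -
        interpret prob_space "m t" by (rule prob_m[OF t])
        have s: "topspace (S t) - K t \<in> sets (m t)"
          using closedin_borel_of[OF K(2)[OF t]] by (metis sets_m sets.compl_sets space_m)
        show "integrable (m t) (g t)" unfolding g_def using s by (intro integrable_real_indicator) (auto simp: less_top[symmetric])
        show "(\<integral>y. g t y \<partial>m t) < \<delta>" unfolding g_def using s K(3)[OF t] by (simp add: Int_absorb2)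
      qed
      have "norm (L (F n) - 0) < e" if n: "n \<ge> N" for n
      proof -
        have "L (F n) \<le> L (\<lambda>s. (e/4) * 1 + c * (\<Sum>t\<le>T. g t (s t)))"
        proof (rule LV_mono)
          show "F n \<in> V" by (rule cV[OF Fc])
          show "(\<lambda>s. (e/4) * 1 + c * (\<Sum>t\<le>T. g t (s t))) \<in> V"
            by (intro V_lin LV_sum(2) gV V_bounded[of "\<lambda>_. 1" 1]) auto
          fix s assume s: "s \<in> \<Omega>"
          show "F n s \<le> (e/4) * 1 + c * (\<Sum>t\<le>T. g t (s t))"
          proof (cases "s \<in> PiE {..T} K")
            case True
            have "0 \<le> c * (\<Sum>t\<le>T. g t (s t))" using c(1) by (intro mult_nonneg_nonneg sum_nonneg) (auto simp: g_def)
            then show ?thesis using N[OF n True] by linarith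
          next
            case False
            then obtain t where t: "t \<le> T" "s t \<notin> K t" using s by (auto simp: PiE_iff)
            have "g t (s t) = 1" using t Omega_proj[OF s t(1)] by (simp add: g_def)
            then have "1 \<le> (\<Sum>t\<le>T. g t (s t))"
              using member_le_sum[of t "{..T}" "\<lambda>t. g t (s t)"] t by (simp add: g_def)
            then have "c * 1 \<le> c * (\<Sum>t\<le>T. g t (s t))" using c(1) by (intro mult_left_mono) auto
            then show ?thesis using c(2)[OF s, of n] e by linarith
          qed
        qed
        also have "\<dots> = (e/4) * L (\<lambda>_. 1) + c * L (\<lambda>s. \<Sum>t\<le>T. g t (s t))"
        proof -
          have V1: "(\<lambda>_. 1) \<in> V" by (rule V_bounded[of _ 1]) simp
          have Vs: "(\<lambda>s. \<Sum>t\<le>T. g t (s t)) \<in> V" by (rule LV_sum(2)) (use gV in auto)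
          show ?thesis
            using LV_add[OF V_lin(2)[OF V1, of "e/4"] V_lin(2)[OF Vs, of c]] LV_scale[OF V1, of "e/4"] LV_scale[OF Vs, of c] by simp
        qed
        also have "L (\<lambda>s. \<Sum>t\<le>T. g t (s t)) = (\<Sum>t\<le>T. L (\<lambda>s. g t (s t)))"
          by (rule LV_sum(1)) (use gV in auto)
        also have "\<dots> = (\<Sum>t\<le>T. \<integral>y. g t y \<partial>m t)"
          by (rule sum.cong) (use L_single gi gV in auto)
        also have "(e/4) * L (\<lambda>_. 1) + c * (\<Sum>t\<le>T. \<integral>y. g t y \<partial>m t) \<le> e/4 + c * (\<Sum>t\<le>T. \<delta>)"
        proof -
          have "(\<Sum>t\<le>T. \<integral>y. g t y \<partial>m t) \<le> (\<Sum>t\<le>T. \<delta>)"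
          proof (rule sum_mono)
            fix t assume "t \<in> {..T}"
            then show "(\<integral>y. g t y \<partial>m t) \<le> \<delta>" using gi(2)[of t] by simp
          qed
          then have "c * (\<Sum>t\<le>T. \<integral>y. g t y \<partial>m t) \<le> c * (\<Sum>t\<le>T. \<delta>)"
            using c(1) by (intro mult_left_mono) auto
          then show ?thesis using L1 by simp
        qed
        also have "c * (\<Sum>t\<le>T. \<delta>) = e/4"
        proof -
          define n1 where "n1 = real T + 1"
          have "n1 > 0" "(\<Sum>t\<le>T. \<delta>) = n1 * \<delta>" unfolding n1_def by simp_all
          then show ?thesis using c(1) unfolding \<delta>_def n1_def[symmetric] by simp
        qed
        finally have "L (F n) \<le> e/2" by simp
        moreover have "0 \<le> L (F n)"
        proof -
          have "L (\<lambda>s. - 1 * F n s) \<le> 0" by (intro L_neg V_lin cV Fc) (use F0 in auto)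
          then show ?thesis using LV_scale[OF cV[OF Fc], of "-1"] by simp
        qed
        ultimately show ?thesis using e by simp
      qed
      then show "\<exists>N. \<forall>n\<ge>N. norm (L (F n) - 0) < e" by blast
    qed
  qed
  interpret daniell X L by (rule dan)
  have fin: "finite_measure repr" by (rule finite_repr)
  have marg: "distr repr (borel_of (S t)) (\<lambda>s. s t) = m t" if t: "t \<le> T" for t
  proof -
    have pm: "(\<lambda>s. s t) \<in> repr \<rightarrow>\<^sub>M borel_of (S t)" by (rule proj_meas[OF t]) simp
    let ?d = "distr repr (borel_of (S t)) (\<lambda>s. s t)"
    have fd: "finite_measure ?d" by (rule finite_measure.finite_measure_distr[OF fin pm])
    have fm: "finite_measure (m t)" by (rule prob_space.finite_measure[OF prob_m[OF t]])
    have eq: "(\<integral>y. f y \<partial>?d) = (\<integral>y. f y \<partial>m t)" if f: "f \<in> cfun (S t)" for f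
    proof -
      obtain c where fc: "continuous_map (S t) euclideanreal f" "\<forall>y\<in>topspace (S t). \<bar>f y\<bar> \<le> c" using f by (auto simp: cfun_def)
      have fX: "(\<lambda>s. f (s t)) \<in> cfun X"
        by (rule cfunI[where c=c]) (use continuous_map_compose[OF proj_cont[OF t] fc(1)] fc(2) Omega_proj t in \<open>auto simp: o_def\<close>)
      have "(\<integral>y. f y \<partial>?d) = (\<integral>s. f (s t) \<partial>repr)"
        by (rule integral_distr[OF pm]) (rule continuous_map_borel_measurable[OF fc(1)])
      also have "\<dots> = L (\<lambda>s. f (s t))" by (rule L_eq_integral[OF fX, symmetric])
      also have "\<dots> = (\<integral>y. f y \<partial>m t)"
        by (rule L_single[OF t cfun_integrable[OF fm sets_m f] cV[OF fX]])
      finally show ?thesis .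
    qed
    interpret d: finite_measure ?d by (rule fd)
    interpret mt: finite_measure "m t" by (rule fm)
    show ?thesis
    proof (rule measure_eqI)
      fix A assume A: "A \<in> sets ?d"
      have "measure ?d A \<le> measure (m t) A"
        by (rule measure_le_cfun[OF metrizable_S[OF t] fd _ fm sets_m _ A]) (simp_all add: eq)
      moreover have "measure (m t) A \<le> measure ?d A"
        by (rule measure_le_cfun[OF metrizable_S[OF t] fm sets_m fd]) (use A in \<open>simp_all add: eq\<close>)
      ultimately show "emeasure ?d A = emeasure (m t) A"
        by (simp add: d.emeasure_eq_measure mt.emeasure_eq_measure)
    qed simp
  qed
  have wV: "wt \<in> V"
  proof -
    have "\<bar>wt s\<bar> \<le> 1 * wt s" if "s \<in> \<Omega>" for s using wt_ge1[OF that] by simp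
    then show ?thesis unfolding V_def by (intro CollectI exI[of _ 1]) simp
  qed
  have wi: "integrable repr wt" and wI: "(\<integral>s. wt s \<partial>repr) = L wt"
  proof -
    have pm: "(\<lambda>s. s t) \<in> repr \<rightarrow>\<^sub>M borel_of (S t)" if "t \<le> T" for t by (rule proj_meas[OF that]) simp
    have psm: "\<psi> t \<in> borel_measurable (borel_of (S t))" if "t \<le> T" for t
      by (rule continuous_map_borel_measurable[OF psi_cont[OF that]])
    have i: "integrable repr (\<lambda>s. \<psi> t (s t))" if t: "t \<le> T" for t
      using integrable_distr_eq[OF pm[OF t] psm[OF t]] marg[OF t] mu_marg[OF t] by simp
    have I: "(\<integral>s. \<psi> t (s t) \<partial>repr) = (\<integral>y. \<psi> t y \<partial>m t)" if t: "t \<le> T" for t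
      using integral_distr[OF pm[OF t] psm[OF t]] marg[OF t] by simp
    show "integrable repr wt" unfolding weight_def by (intro Bochner_Integration.integrable_sum i) auto
    have "(\<integral>s. wt s \<partial>repr) = (\<Sum>t\<le>T. \<integral>y. \<psi> t y \<partial>m t)"
      unfolding weight_def using i I by (subst Bochner_Integration.integral_sum) auto
    also have "\<dots> = L wt"
    proof -
      have e: "path_sum T \<psi> = wt" by (rule ext) (simp add: weight_def)
      have "adm \<psi>" using mu_marg by (simp add: adm_def)
      from L_marg[OF this] wV show ?thesis unfolding e by (simp add: Sx_def)
    qed
    finally show "(\<integral>s. wt s \<partial>repr) = L wt" .
  qed
  \<comment> \<open>On the bounded truncations \<open>min u n\<close> the functional and the
    integral agree; monotonicity of \<open>L\<close> on \<open>V\<close> bounds them all by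
    \<open>L u\<close>, and dominated convergence passes to \<open>u\<close>.\<close>
  have ge_nonneg: "(\<integral>s. u s \<partial>repr) \<le> L u"
    if u: "continuous_map X euclideanreal u" "u \<in> V" "\<And>s. s \<in> \<Omega> \<Longrightarrow> 0 \<le> u s" for u
  proof -
    obtain c where c: "\<forall>s\<in>\<Omega>. \<bar>u s\<bar> \<le> c * wt s" using u(2) unfolding V_def by blast
    have um: "u \<in> borel_measurable repr" by (rule cont_meas[OF u(1)]) simp
    have nc: "(\<lambda>s. min (u s) (real n)) \<in> cfun X" for n
    proof (rule cfunI[where c="real n"])
      show "continuous_map X euclideanreal (\<lambda>s. min (u s) (real n))"
        by (rule continuous_map_real_min[OF u(1)]) simp
      show "\<bar>min (u s) (real n)\<bar> \<le> real n" if "s \<in> \<Omega>" for s using u(3)[OF that] by simp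
    qed
    have "(\<lambda>n. \<integral>s. min (u s) (real n) \<partial>repr) \<longlonglongrightarrow> (\<integral>s. u s \<partial>repr)"
    proof (rule integral_dominated_convergence[where w="\<lambda>s. c * wt s"])
      show "AE s in repr. (\<lambda>n. min (u s) (real n)) \<longlonglongrightarrow> u s"
      proof (rule AE_I2)
        fix s
        obtain n0 where "u s \<le> real n0" using real_arch_simple by blast
        then have "min (u s) (real n) = u s" if "n \<ge> n0" for n using that by simp
        then show "(\<lambda>n. min (u s) (real n)) \<longlonglongrightarrow> u s"
          by (intro tendsto_eventually eventually_sequentiallyI[of n0])
      qed
      show "AE s in repr. norm (min (u s) (real n)) \<le> c * wt s" for n
      proof (rule AE_I2)
        fix s assume "s \<in> space repr"
        then have s: "s \<in> \<Omega>" by (simp add: space_repr)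
        have "\<bar>min (u s) (real n)\<bar> \<le> \<bar>u s\<bar>" using u(3)[OF s] by simp
        then show "norm (min (u s) (real n)) \<le> c * wt s" using c s by fastforce
      qed
    qed (use um wi in auto)
    moreover have "(\<integral>s. min (u s) (real n) \<partial>repr) \<le> L u" for n
    proof -
      have "(\<integral>s. min (u s) (real n) \<partial>repr) = L (\<lambda>s. min (u s) (real n))" by (rule L_eq_integral[OF nc, symmetric])
      also have "\<dots> \<le> L u" by (rule LV_mono[OF cV[OF nc] u(2)]) simp
      finally show ?thesis .
    qed
    ultimately show ?thesis by (intro LIMSEQ_le_const2) auto
  qed
  \<comment> \<open>Adding a multiple of \<open>wt\<close> makes \<open>u\<close> nonnegative, and
    on \<open>wt\<close> both sides agree since they are computed from the marginals. This
    inequality is the direction needed against the bound on \<open>L u - H u\<close>.\<close>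
  have ge: "(\<integral>s. u s \<partial>repr) \<le> L u"
    if u: "continuous_map X euclideanreal u" "u \<in> V" for u
  proof -
    obtain c where c: "\<forall>s\<in>\<Omega>. \<bar>u s\<bar> \<le> c * wt s" using u(2) unfolding V_def by blast
    have ui: "integrable repr u" by (rule wt_bounded_integrable[OF _ wi cont_meas[OF u(1)]]) (use c in auto)
    have "(\<integral>s. u s + c * wt s \<partial>repr) \<le> L (\<lambda>s. u s + c * wt s)"
    proof (rule ge_nonneg)
      show "continuous_map X euclideanreal (\<lambda>s. u s + c * wt s)"
        by (intro continuous_map_add continuous_map_real_mult_left u wt_cont)
      show "(\<lambda>s. u s + c * wt s) \<in> V" by (intro V_lin u wV)
      fix s assume "s \<in> \<Omega>"
      then have "\<bar>u s\<bar> \<le> c * wt s" using c by blast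
      then show "0 \<le> u s + c * wt s" by linarith
    qed
    also have "L (\<lambda>s. u s + c * wt s) = L u + c * L wt"
      using LV_add[OF u(2) V_lin(2)[OF wV, of c]] LV_scale[OF wV, of c] by simp
    finally show ?thesis using ui wi wI by simp
  qed
  show thesis
  proof (rule that[of repr])
    show "sets repr = sets (borel_of X)" by simp
    show "finite_measure repr" by (rule fin)
    show "distr repr (borel_of (S t)) (\<lambda>s. s t) = m t" if "t \<le> T" for t by (rule marg[OF that])
    fix u assume u: "u \<in> C" "H u < \<infinity>"
    have "(\<integral>s. u s \<partial>repr) \<le> L u" by (rule ge[OF C_D(1)[OF u(1)] C_V[OF u(1)]])
    then show "(\<integral>s. u s \<partial>repr) - real_of_ereal (H u) \<le> - p0" using L_bd[OF u] by linarith
  qed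
qed

section \<open>Existence of a primal solution\<close>

text \<open>Fenchel's inequality at the slopes \<open>1 + e\<close> and \<open>1 - e\<close>
  controls positive and negative \<open>u\<close> respectively. This is where a whole neighborhood
  of 1 is used.\<close>

lemma coercive:
  obtains e k where "e > 0" "integrable \<mu> k" "AE s in \<mu>. \<forall>u. ereal (e * \<bar>u\<bar> - k s) \<le> ereal (- u) + h u s"
proof -
  obtain e where e: "e > 0" and i: "ext_integrable \<mu> (integrand_conj h (1 - e))" "ext_integrable \<mu> (integrand_conj h (1 + e))"
    using conj_eps by blast
  let ?k = "\<lambda>s. \<bar>kap (1 - e) s\<bar> + \<bar>kap (1 + e) s\<bar>"
  have "AE s in \<mu>. \<forall>u. ereal (e * \<bar>u\<bar> - ?k s) \<le> ereal (- u) + h u s"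
    using h_ge_kap[OF i(1)] h_ge_kap[OF i(2)]
  proof eventually_elim
    case (elim s)
    show ?case
    proof
      fix u
      have "ereal (u * (1 - e) - kap (1 - e) s) \<le> h u s" "ereal (u * (1 + e) - kap (1 + e) s) \<le> h u s" using elim by blast+
      then show "ereal (e * \<bar>u\<bar> - ?k s) \<le> ereal (- u) + h u s"
        by (cases "h u s") (auto simp: algebra_simps abs_if split: if_splits)
    qed
  qed
  moreover have "integrable \<mu> ?k" using kap_integrable[OF i(1)] kap_integrable[OF i(2)] by simp
  ultimately show thesis using that[of e ?k] e by blast
qed

text \<open>The integrand is caught between \<open>w - kap 1\<close>, from Fenchel's inequality at
  slope 1, and the integrable \<open>b\<close>.\<close>

lemma hr_integrable_between:
  assumes w: "integrable \<mu> w" and le: "AE s in \<mu>. h (w s) s \<le> ereal (b s)" and b: "integrable \<mu> b"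
  shows "AE s in \<mu>. h (w s) s = ereal (hr (w s) s)" "integrable \<mu> (\<lambda>s. hr (w s) s)"
    "(\<integral>s. hr (w s) s \<partial>\<mu>) \<le> (\<integral>s. b s \<partial>\<mu>)"
proof -
  have wm: "w \<in> borel_measurable \<mu>" using w by simp
  show eq: "AE s in \<mu>. h (w s) s = ereal (hr (w s) s)"
    using le h_proper
  proof eventually_elim
    case (elim s)
    from elim(1) have "h (w s) s < \<infinity>" by (rule le_less_trans) simp
    then show ?case using elim(2) by (intro hr_eq) blast+
  qed
  have le': "AE s in \<mu>. hr (w s) s \<le> b s"
    using eq le
  proof eventually_elim
    case (elim s)
    then have "ereal (hr (w s) s) \<le> ereal (b s)" by simp
    then show ?case by simp
  qed
  have ge: "AE s in \<mu>. w s - kap 1 s \<le> hr (w s) s"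
    using eq h_ge_1
  proof eventually_elim
    case (elim s)
    have "ereal (w s - kap 1 s) \<le> h (w s) s" using elim(2) by blast
    then show ?case unfolding elim(1) by simp
  qed
  have ki: "integrable \<mu> (kap 1)" by (rule kap_integrable[OF conj_1])
  show i: "integrable \<mu> (\<lambda>s. hr (w s) s)"
  proof (rule Bochner_Integration.integrable_bound[of \<mu> "\<lambda>s. \<bar>b s\<bar> + \<bar>w s - kap 1 s\<bar>"])
    show "(\<lambda>s. hr (w s) s) \<in> borel_measurable \<mu>" by (rule hr_meas[OF mu_sets wm])
    show "AE s in \<mu>. norm (hr (w s) s) \<le> norm (\<bar>b s\<bar> + \<bar>w s - kap 1 s\<bar>)"
      using le' ge by eventually_elim auto
  qed (use w b ki in auto)
  show "(\<integral>s. hr (w s) s \<partial>\<mu>) \<le> (\<integral>s. b s \<partial>\<mu>)" by (rule integral_mono_AE[OF i b le'])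
qed

text \<open>Sublevel sets of (B) over integrable summands. The constraint is imposed at every point,
  so that a limit inherits it wherever the sums converge.\<close>

definition W :: "nat \<Rightarrow> (nat \<Rightarrow> 'a \<Rightarrow> real) set" where
  "W n = {x. adm x \<and> (\<forall>s\<in>\<Omega>. - path_sum T x s \<in> D s) \<and>
     (AE s in \<mu>. h (- path_sum T x s) s = ereal (hr (- path_sum T x s) s)) \<and>
     integrable \<mu> (\<lambda>s. hr (- path_sum T x s) s) \<and>
     (\<integral>s. path_sum T x s + hr (- path_sum T x s) s \<partial>\<mu>) \<le> p0 + 1 / Suc n}"

text \<open>Near-optimal \<open>x\<close> and \<open>u\<close> from \<open>vals\<close> satisfy
  \<open>- \<Sum>\<^sub>t x\<^sub>t \<le> u\<close>. As \<open>h\<close> is nondecreasing, putting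
  the sum in place of its continuous majorant \<open>u\<close> does not raise the objective.\<close>

lemma W_ne: "W n \<noteq> {}"
proof -
  have "(\<lambda>_. 0) \<in> V" by (rule V_bounded[of _ 0]) simp
  then have ne: "vals (\<lambda>_. 0) \<noteq> {}" using vals_ne by blast
  have "Inf (vals (\<lambda>_. 0)) < p0 + 1 / Suc n" by (simp add: p0_def)
  then obtain r where r: "r \<in> vals (\<lambda>_. 0)" "r < p0 + 1 / Suc n"
    using cInf_less_iff[OF ne vals_bdd] by blast
  obtain x u where x: "adm x" and u: "u \<in> C" "H u < \<infinity>"
    and le: "\<And>s. s \<in> \<Omega> \<Longrightarrow> 0 \<le> u s + path_sum T x s" and r': "Sx x + real_of_ereal (H u) \<le> r"
    using r(1) unfolding vals_def by blast
  have uCD: "u \<in> CD" by (rule H_less_D[OF u(2)])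
  have le': "- path_sum T x s \<le> u s" if "s \<in> \<Omega>" for s using le[OF that] by simp
  have i: "integrable \<mu> (\<lambda>s. - path_sum T x s)" using path_sum_integrable[OF x] by simp
  have hle: "AE s in \<mu>. h (- path_sum T x s) s \<le> ereal (hr (u s) s)"
    using H_fin(1)[OF u] AE_space
  proof eventually_elim
    case (elim s)
    then have "s \<in> \<Omega>" by (simp add: space_mu)
    then show ?case using h_le[OF _ le'] elim(1) by metis
  qed
  note b = hr_integrable_between[OF i hle H_fin(2)[OF u]]
  have "(\<integral>s. path_sum T x s + hr (- path_sum T x s) s \<partial>\<mu>) = Sx x + (\<integral>s. hr (- path_sum T x s) s \<partial>\<mu>)"
    using path_sum_integrable[OF x] path_sum_integral[OF x] b(2) by simp
  also have "\<dots> \<le> Sx x + real_of_ereal (H u)" using b(3) by (simp add: H_fin(3)[OF u])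
  also have "\<dots> \<le> p0 + 1 / Suc n" using r r' by simp
  finally have obj: "(\<integral>s. path_sum T x s + hr (- path_sum T x s) s \<partial>\<mu>) \<le> p0 + 1 / Suc n" .
  have "- path_sum T x s \<in> D s" if "s \<in> \<Omega>" for s
    by (rule D_down[OF that CD_D[OF uCD that] le'[OF that]])
  then have "x \<in> W n" unfolding W_def using x b(1,2) obj by simp
  then show ?thesis by blast
qed

lemma W_dec: "W (Suc n) \<subseteq> W n"
proof -
  have "1 / real (Suc (Suc n)) \<le> 1 / real (Suc n)" by (simp add: frac_le)
  then show ?thesis unfolding W_def by (auto simp del: of_nat_Suc)
qed

lemma W_bound: "\<exists>R. \<forall>n x. x \<in> W n \<longrightarrow> (\<integral>s. \<bar>path_sum T x s\<bar> \<partial>\<mu>) \<le> R"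
proof -
  obtain e k where e: "e > 0" and k: "integrable \<mu> k" and
    ae: "AE s in \<mu>. \<forall>u. ereal (e * \<bar>u\<bar> - k s) \<le> ereal (- u) + h u s"
    by (rule coercive)
  have "(\<integral>s. \<bar>path_sum T x s\<bar> \<partial>\<mu>) \<le> (p0 + 1 + (\<integral>s. k s \<partial>\<mu>)) / e" if x: "x \<in> W n" for n x
  proof -
    have a: "adm x" and eq: "AE s in \<mu>. h (- path_sum T x s) s = ereal (hr (- path_sum T x s) s)"
      and i: "integrable \<mu> (\<lambda>s. hr (- path_sum T x s) s)"
      and obj: "(\<integral>s. path_sum T x s + hr (- path_sum T x s) s \<partial>\<mu>) \<le> p0 + 1 / Suc n"
      using x by (auto simp: W_def)
    have ip: "integrable \<mu> (path_sum T x)" by (rule path_sum_integrable[OF a])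
    have "(\<integral>s. e * \<bar>path_sum T x s\<bar> - k s \<partial>\<mu>) \<le> (\<integral>s. path_sum T x s + hr (- path_sum T x s) s \<partial>\<mu>)"
    proof (rule integral_mono_AE)
      show "AE s in \<mu>. e * \<bar>path_sum T x s\<bar> - k s \<le> path_sum T x s + hr (- path_sum T x s) s"
        using ae eq
      proof eventually_elim
        case (elim s)
        have "ereal (e * \<bar>- path_sum T x s\<bar> - k s) \<le> ereal (- (- path_sum T x s)) + h (- path_sum T x s) s"
          using elim(1) by blast
        then show ?case unfolding elim(2) by simp
      qed
    qed (use ip i k in auto)
    then have "e * (\<integral>s. \<bar>path_sum T x s\<bar> \<partial>\<mu>) - (\<integral>s. k s \<partial>\<mu>) \<le> p0 + 1 / Suc n"
      using ip k obj by simp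
    moreover have "1 / real (Suc n) \<le> 1" by simp
    ultimately have "e * (\<integral>s. \<bar>path_sum T x s\<bar> \<partial>\<mu>) \<le> p0 + 1 + (\<integral>s. k s \<partial>\<mu>)" by linarith
    then show ?thesis using e by (simp add: pos_le_divide_eq mult.commute)
  qed
  then show ?thesis by blast
qed

lemma W_mid:
  assumes x: "x \<in> W n" and y: "y \<in> W n"
  shows "\<exists>z\<in>W n. \<forall>s\<in>space \<mu>. path_sum T z s = (path_sum T x s + path_sum T y s) / 2"
proof -
  have ax: "adm x" and ay: "adm y" using x y by (auto simp: W_def)
  have Dx: "\<And>s. s \<in> \<Omega> \<Longrightarrow> - path_sum T x s \<in> D s" and Dy: "\<And>s. s \<in> \<Omega> \<Longrightarrow> - path_sum T y s \<in> D s"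
    using x y by (auto simp: W_def)
  have eqx: "AE s in \<mu>. h (- path_sum T x s) s = ereal (hr (- path_sum T x s) s)"
    and eqy: "AE s in \<mu>. h (- path_sum T y s) s = ereal (hr (- path_sum T y s) s)"
    and ix: "integrable \<mu> (\<lambda>s. hr (- path_sum T x s) s)" and iy: "integrable \<mu> (\<lambda>s. hr (- path_sum T y s) s)"
    and ox: "(\<integral>s. path_sum T x s + hr (- path_sum T x s) s \<partial>\<mu>) \<le> p0 + 1 / Suc n"
    and oy: "(\<integral>s. path_sum T y s + hr (- path_sum T y s) s \<partial>\<mu>) \<le> p0 + 1 / Suc n"
    using x y by (auto simp: W_def)
  define z where "z = (\<lambda>t r. 1/2 * x t r + 1/2 * y t r)"
  have az: "adm z" unfolding z_def by (rule adm_lin[OF ax ay])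
  have pz: "path_sum T z s = 1/2 * path_sum T x s + 1/2 * path_sum T y s" for s
    unfolding z_def by (rule path_sum_lin)
  have Dz: "- path_sum T z s \<in> D s" if s: "s \<in> \<Omega>" for s
  proof -
    have "max (- path_sum T x s) (- path_sum T y s) \<in> D s" using Dx[OF s] Dy[OF s] by (simp add: max_def)
    then show ?thesis by (rule D_down[OF s]) (simp add: pz)
  qed
  have iz: "integrable \<mu> (\<lambda>s. - path_sum T z s)" using path_sum_integrable[OF az] by simp
  have hle: "AE s in \<mu>. h (- path_sum T z s) s \<le> ereal (1/2 * hr (- path_sum T x s) s + 1/2 * hr (- path_sum T y s) s)"
    using eqx eqy AE_space
  proof eventually_elim
    case (elim s)
    then have "s \<in> \<Omega>" by (simp add: space_mu)
    from h_convex[OF this elim(1,2), of "1/2"] show ?case by (simp add: pz)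
  qed
  have ib: "integrable \<mu> (\<lambda>s. 1/2 * hr (- path_sum T x s) s + 1/2 * hr (- path_sum T y s) s)" using ix iy by simp
  note b = hr_integrable_between[OF iz hle ib]
  have "(\<integral>s. path_sum T z s + hr (- path_sum T z s) s \<partial>\<mu>) = (\<integral>s. path_sum T z s \<partial>\<mu>) + (\<integral>s. hr (- path_sum T z s) s \<partial>\<mu>)"
    using path_sum_integrable[OF az] b(2) by simp
  also have "(\<integral>s. path_sum T z s \<partial>\<mu>) = 1/2 * (\<integral>s. path_sum T x s \<partial>\<mu>) + 1/2 * (\<integral>s. path_sum T y s \<partial>\<mu>)"
    unfolding pz using path_sum_integrable[OF ax] path_sum_integrable[OF ay] by simp
  also have "(\<integral>s. hr (- path_sum T z s) s \<partial>\<mu>) \<le> 1/2 * (\<integral>s. hr (- path_sum T x s) s \<partial>\<mu>) + 1/2 * (\<integral>s. hr (- path_sum T y s) s \<partial>\<mu>)"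
    using b(3) ix iy by simp
  finally have "(\<integral>s. path_sum T z s + hr (- path_sum T z s) s \<partial>\<mu>) \<le> p0 + 1 / Suc n"
    using ox oy path_sum_integrable[OF ax] path_sum_integrable[OF ay] ix iy by simp
  then have "z \<in> W n" unfolding W_def using az Dz b(1,2) by simp
  then show ?thesis using pz by (intro bexI[of _ z]) (auto simp: add_divide_distrib)
qed

lemma AE_m_D:
  assumes t: "t \<le> T" and A: "AE y in m t. P y"
  shows "AE s in \<mu>. P (s t)"
  using AE_distrD[OF proj_meas[OF t mu_sets]] A unfolding marg_def by blast

text \<open>A base point \<open>r\<close> is chosen at which the sums converge, and still converge
  after almost every change of any single coordinate. The difference of two such sums is
  \<open>x n t y - x n t (r t)\<close>, so the summands normalized at \<open>r\<close> converge one
  by one.\<close>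

lemma W_converges:
  assumes ac: "absolutely_continuous \<mu> (PiM {..T} m)"
  shows "\<exists>x xl A. (\<forall>n. x n \<in> W n) \<and> (\<forall>t\<le>T. A t \<in> sets (borel_of (S t)) \<and> measure (m t) (A t) = 1 \<and>
      xl t \<in> borel_measurable (borel_of (S t))) \<and>
    (\<forall>s\<in>PiE {..T} A. (\<lambda>n. path_sum T (x n) s) \<longlonglongrightarrow> path_sum T xl s)"
proof -
  obtain R where R: "\<And>n x. x \<in> W n \<Longrightarrow> (\<integral>s. \<bar>path_sum T x s\<bar> \<partial>\<mu>) \<le> R" using W_bound by blast
  have Wi: "integrable \<mu> (path_sum T x)" if "x \<in> W n" for n x
    using that path_sum_integrable by (simp add: W_def)
  obtain x where x: "\<And>n. x n \<in> W n" and conv: "AE s in \<mu>. convergent (\<lambda>n. path_sum T (x n) s)"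
    by (rule nested_convex_AE_convergent[of \<mu> W "path_sum T" R])
       (use mu.finite_measure_axioms W_ne W_dec Wi R W_mid in \<open>blast+\<close>)
  define P where "P = (\<lambda>s. convergent (\<lambda>n. path_sum T (x n) s))"
  \<comment> \<open>The product space expects probability measures at all indices; beyond
    \<open>T\<close> the family is padded with \<open>m 0\<close>.\<close>
  define m' where "m' = (\<lambda>t. if t \<le> T then m t else m 0)"
  have prob_m': "prob_space (m' t)" for t unfolding m'_def using prob_m by auto
  have Pi': "PiM {..T} m' = PiM {..T} m" by (rule PiM_cong) (auto simp: m'_def)
  have "AE s in PiM {..T} m'. P s"
  proof -
    obtain N where N: "N \<in> null_sets \<mu>" "{s\<in>space \<mu>. \<not> P s} \<subseteq> N"
      using conv unfolding P_def eventually_ae_filter by auto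
    have "N \<in> null_sets (PiM {..T} m')" using N(1) ac Pi' unfolding absolutely_continuous_def by auto
    moreover have "space (PiM {..T} m') = space \<mu>"
      unfolding Pi' space_mu by (auto simp: space_PiM)
    ultimately show ?thesis using N(2) unfolding eventually_ae_filter by auto
  qed
  note aeP = this
  have "AE s in PiM {..T} m'. AE y in m' t. P (s(t := y))" if "t \<le> T" for t
    by (rule AE_PiM_update[OF prob_m' _ _ aeP]) (use that in auto)
  then have aeU: "AE s in PiM {..T} m'. \<forall>t\<in>{..T}. AE y in m' t. P (s(t := y))"
    by (intro AE_finite_allI) auto
  interpret Pr: prob_space "PiM {..T} m'" by (rule prob_space_PiM) (rule prob_m')
  have "\<exists>s. P s \<and> (\<forall>t\<in>{..T}. AE y in m' t. P (s(t := y)))"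
  proof (rule ccontr)
    assume neg: "\<not> ?thesis"
    have "AE s in PiM {..T} m'. False"
      using aeP aeU
    proof eventually_elim
      case (elim s)
      then show ?case using neg by blast
    qed
    then show False by (simp add: Pr.AE_False)
  qed
  then obtain r where r0: "P r" "\<forall>t\<in>{..T}. AE y in m' t. P (r(t := y))" by blast
  have r: "AE y in m t. P (r(t := y))" if "t \<le> T" for t
  proof -
    have "m' t = m t" using that by (simp add: m'_def)
    moreover have "AE y in m' t. P (r(t := y))" by (rule bspec[OF r0(2)]) (use that in simp)
    ultimately show ?thesis by (rule subst[where P="\<lambda>M. AE y in M. P (r(t := y))"])
  qed
  define g where "g = (\<lambda>n t y. x n t y - x n t (r t))"
  have upd: "path_sum T (x n) (r(t := y)) = path_sum T (x n) r + g n t y" if "t \<le> T" for n t y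
  proof -
    have "path_sum T (x n) (r(t := y)) = x n t y + (\<Sum>i\<in>{..T} - {t}. x n i (r i))"
      using that by (subst sum.remove[of _ t]) (auto intro!: sum.cong)
    moreover have "path_sum T (x n) r = x n t (r t) + (\<Sum>i\<in>{..T} - {t}. x n i (r i))"
      using that by (subst sum.remove[of _ t]) auto
    ultimately show ?thesis by (simp add: g_def)
  qed
  have all: "path_sum T (x n) s = path_sum T (x n) r + (\<Sum>t\<le>T. g n t (s t))" for n s
    by (simp add: g_def sum_subtractf)
  have gm[measurable]: "g n t \<in> borel_measurable (borel_of (S t))" if "t \<le> T" for n t
  proof -
    have "integrable (m t) (x n t)" using x[of n] that by (auto simp: W_def adm_def)
    then have "x n t \<in> borel_measurable (borel_of (S t))" using m_cong_meas borel_measurable_integrable by blast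
    then show ?thesis unfolding g_def by (intro borel_measurable_diff) auto
  qed
  \<comment> \<open>The Cauchy condition describes a Borel set of full measure on which convergence
    holds everywhere. The sums then converge on the whole product of the sets \<open>A t\<close>,
    the kind of set on which the constraint of (B) is stated.\<close>
  define A where "A = (\<lambda>t. {y \<in> space (borel_of (S t)). Cauchy (\<lambda>n. g n t y)})"
  have As: "A t \<in> sets (borel_of (S t))" if "t \<le> T" for t
    unfolding A_def using gm[OF that] by (rule sets_Collect_Cauchy)
  have A1: "measure (m t) (A t) = 1" if t: "t \<le> T" for t
  proof -
    interpret prob_space "m t" by (rule prob_m[OF t])
    have "AE y in m t. y \<in> A t"
      using r[OF t] AE_space
    proof eventually_elim
      case (elim y)
      have "convergent (\<lambda>n. path_sum T (x n) (r(t := y)) - path_sum T (x n) r)"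
        using convergent_diff[OF elim(1)[unfolded P_def] r0(1)[unfolded P_def]] .
      then have "convergent (\<lambda>n. g n t y)" unfolding upd[OF t] by simp
      then show ?case using elim(2) unfolding A_def by (simp add: Cauchy_convergent_iff)
    qed
    then show ?thesis using As[OF t] prob_eq_1[of "A t"] by simp
  qed
  define c where "c = lim (\<lambda>n. path_sum T (x n) r)"
  have c: "(\<lambda>n. path_sum T (x n) r) \<longlonglongrightarrow> c" using r0(1) unfolding P_def c_def convergent_LIMSEQ_iff .
  \<comment> \<open>The normalization has split off the sums at \<open>r\<close>; their limit
    \<open>c\<close> is put back into coordinate 0.\<close>
  define xl where "xl = (\<lambda>t y. lim (\<lambda>n. g n t y) + (if t = 0 then c else 0))"
  have "xl t \<in> borel_measurable (borel_of (S t))" if "t \<le> T" for t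
    unfolding xl_def using gm[OF that] by (intro borel_measurable_add borel_measurable_lim_metric) auto
  moreover have "(\<lambda>n. path_sum T (x n) s) \<longlonglongrightarrow> path_sum T xl s" if s: "s \<in> PiE {..T} A" for s
  proof -
    have "(\<lambda>n. g n t (s t)) \<longlonglongrightarrow> lim (\<lambda>n. g n t (s t))" if "t \<le> T" for t
      using s that by (auto simp: A_def PiE_iff Cauchy_convergent_iff convergent_LIMSEQ_iff)
    then have "(\<lambda>n. path_sum T (x n) r + (\<Sum>t\<le>T. g n t (s t))) \<longlonglongrightarrow> c + (\<Sum>t\<le>T. lim (\<lambda>n. g n t (s t)))"
      by (intro tendsto_add c tendsto_sum) auto
    moreover have "c + (\<Sum>t\<le>T. lim (\<lambda>n. g n t (s t))) = path_sum T xl s"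
      by (simp add: xl_def sum.distrib)
    ultimately show ?thesis unfolding all[symmetric] by simp
  qed
  ultimately show ?thesis using x As A1 by (intro exI[of _ x] exI[of _ xl] exI[of _ A]) blast
qed

text \<open>Adding \<open>kap 1\<close> makes the integrands nonnegative, as Fatou's lemma requires.
  Closed sublevel sets of \<open>h\<close> give lower semicontinuity along the convergent sums, and
  closedness of \<open>D s\<close> preserves the constraint on the product set.\<close>

lemma primal_exists:
  assumes ac: "absolutely_continuous \<mu> (PiM {..T} m)"
  shows "\<exists>x\<in>constrB T S \<mu> h. objB T \<mu> h x \<le> ereal p0"
proof -
  obtain x xl A where *: "(\<forall>n. x n \<in> W n) \<and> (\<forall>t\<le>T. A t \<in> sets (borel_of (S t)) \<and> measure (m t) (A t) = 1 \<and>
      xl t \<in> borel_measurable (borel_of (S t))) \<and>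
    (\<forall>s\<in>PiE {..T} A. (\<lambda>n. path_sum T (x n) s) \<longlonglongrightarrow> path_sum T xl s)"
    using W_converges[OF ac] by (elim exE)
  have x: "\<And>n. x n \<in> W n" and A: "\<And>t. t \<le> T \<Longrightarrow> A t \<in> sets (borel_of (S t))"
    "\<And>t. t \<le> T \<Longrightarrow> measure (m t) (A t) = 1" and xm: "\<And>t. t \<le> T \<Longrightarrow> xl t \<in> borel_measurable (borel_of (S t))"
    and lim: "\<And>s. s \<in> PiE {..T} A \<Longrightarrow> (\<lambda>n. path_sum T (x n) s) \<longlonglongrightarrow> path_sum T xl s"
    using * by blast+
  have AO: "PiE {..T} A \<subseteq> \<Omega>"
    unfolding topspace_product_topology using A(1)[THEN sets.sets_into_space] by (intro PiE_mono) auto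
  have "- path_sum T xl s \<in> D s" if s: "s \<in> PiE {..T} A" for s
  proof (rule closed_sequentially[OF D_closed])
    show "- path_sum T (x n) s \<in> D s" for n using x[of n] s AO by (auto simp: W_def)
    show "(\<lambda>n. - path_sum T (x n) s) \<longlonglongrightarrow> - path_sum T xl s" by (intro tendsto_intros lim s)
  qed
  then have xB: "xl \<in> constrB T S \<mu> h" unfolding constrB_def using xm A by (intro CollectI conjI exI[of _ A]) auto
  have aeA: "AE s in \<mu>. s \<in> PiE {..T} A"
  proof -
    have "AE s in \<mu>. s t \<in> A t" if t: "t \<le> T" for t
    proof -
      interpret prob_space "m t" by (rule prob_m[OF t])
      have "AE y in m t. y \<in> A t" using A[OF t] prob_eq_1[of "A t"] by simp
      then show ?thesis by (rule AE_m_D[OF t])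
    qed
    then have "AE s in \<mu>. \<forall>t\<in>{..T}. s t \<in> A t" by (intro AE_finite_allI) auto
    then show ?thesis using AE_space
      by eventually_elim (auto simp: space_mu PiE_iff)
  qed
  define f where "f = (\<lambda>n s. path_sum T (x n) s + hr (- path_sum T (x n) s) s)"
  define F where "F = (\<lambda>s. ereal (path_sum T xl s) + h (- path_sum T xl s) s)"
  have eq: "AE s in \<mu>. \<forall>n. h (- path_sum T (x n) s) s = ereal (hr (- path_sum T (x n) s) s)"
    unfolding AE_all_countable using x by (auto simp: W_def)
  have fi: "integrable \<mu> (f n)" "(\<integral>s. f n s \<partial>\<mu>) \<le> p0 + 1 / Suc n" for n
    unfolding f_def using x[of n] path_sum_integrable by (auto simp: W_def)
  have k: "integrable \<mu> (kap 1)" by (rule kap_integrable[OF conj_1])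
  have f0: "AE s in \<mu>. \<forall>n. 0 \<le> f n s + kap 1 s"
    using eq h_ge_1
  proof eventually_elim
    case (elim s)
    show ?case
    proof
      fix n
      have "ereal (- path_sum T (x n) s - kap 1 s) \<le> ereal (hr (- path_sum T (x n) s) s)" using elim by metis
      then show "0 \<le> f n s + kap 1 s" unfolding f_def by simp
    qed
  qed
  have pm: "path_sum T xl \<in> borel_measurable \<mu>"
    by (intro borel_measurable_sum measurable_compose[OF proj_meas[OF _ mu_sets] xm]) auto
  have Fm: "F \<in> borel_measurable \<mu>"
    unfolding F_def using pm h_comp_meas[OF mu_sets, of "\<lambda>s. - path_sum T xl s"] by measurable
  have lsc: "AE s in \<mu>. e2ennreal (F s + ereal (kap 1 s)) \<le> liminf (\<lambda>n. ennreal (f n s + kap 1 s))"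
    using eq aeA h_proper
  proof eventually_elim
    case (elim s)
    have s: "s \<in> \<Omega>" using elim(2) AO by blast
    let ?w = "\<lambda>n. - path_sum T (x n) s" and ?l = "- path_sum T xl s"
    have wl: "?w \<longlonglongrightarrow> ?l" by (intro tendsto_intros lim elim(2))
    show ?case
      unfolding le_Liminf_iff
    proof (intro allI impI)
      fix y assume y: "y < e2ennreal (F s + ereal (kap 1 s))"
      then obtain r where r: "y = ennreal r" "0 \<le> r" by (cases y) auto
      have "ereal r < F s + ereal (kap 1 s)"
      proof (rule ccontr)
        assume "\<not> ?thesis"
        then have "F s + ereal (kap 1 s) \<le> ereal r" by simp
        from e2ennreal_mono[OF this] show False using y r by simp
      qed
      then have "ereal (r + ?l - kap 1 s) < h ?l s"
        unfolding F_def by (cases "h ?l s") auto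
      \<comment> \<open>The number \<open>\<alpha>\<close> separates the two terms of the objective:
        eventually \<open>h\<close> exceeds \<open>\<alpha>\<close>, and the sum is close enough to
        its limit for the total to exceed \<open>r\<close>.\<close>
      then obtain \<alpha> where \<alpha>: "ereal (r + ?l - kap 1 s) < ereal \<alpha>" "ereal \<alpha> < h ?l s" using ereal_dense2 by blast
      have "open (- {u. h u s \<le> ereal \<alpha>})" using h_closed[OF s] by (rule open_Compl)
      moreover have "?l \<in> - {u. h u s \<le> ereal \<alpha>}" using \<alpha>(2) by simp
      ultimately have 1: "\<forall>\<^sub>F n in sequentially. ?w n \<in> - {u. h u s \<le> ereal \<alpha>}"
        by (rule topological_tendstoD[OF wl])
      have "?l < \<alpha> - r + kap 1 s" using \<alpha>(1) by simp
      then have 2: "\<forall>\<^sub>F n in sequentially. ?w n < \<alpha> - r + kap 1 s" by (rule order_tendstoD(2)[OF wl])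
      show "\<forall>\<^sub>F n in sequentially. y < ennreal (f n s + kap 1 s)"
        using 1 2
      proof eventually_elim
        case (elim n)
        have "h (?w n) s = ereal (hr (?w n) s)" using \<open>\<forall>n. h (- path_sum T (x n) s) s = _\<close> by blast
        then have "\<alpha> < hr (?w n) s" using elim(1) by simp
        then have "r < f n s + kap 1 s" using elim(2) unfolding f_def by simp
        then show ?case using r by (simp add: ennreal_less_iff)
      qed
    qed
  qed
  have "(\<integral>\<^sup>+s. e2ennreal (F s + ereal (kap 1 s)) \<partial>\<mu>) \<le> (\<integral>\<^sup>+s. liminf (\<lambda>n. ennreal (f n s + kap 1 s)) \<partial>\<mu>)"
    by (rule nn_integral_mono_AE[OF lsc])
  also have "\<dots> \<le> liminf (\<lambda>n. \<integral>\<^sup>+s. ennreal (f n s + kap 1 s) \<partial>\<mu>)"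
    by (rule nn_integral_liminf) (use fi k in auto)
  also have "\<dots> \<le> liminf (\<lambda>n. ennreal (p0 + (\<integral>s. kap 1 s \<partial>\<mu>) + inverse (real (Suc n))))"
  proof (rule Liminf_mono, rule always_eventually, rule allI)
    fix n
    have "(\<integral>\<^sup>+s. ennreal (f n s + kap 1 s) \<partial>\<mu>) = ennreal (\<integral>s. f n s + kap 1 s \<partial>\<mu>)"
      by (rule nn_integral_eq_integral) (use fi k f0 in \<open>auto elim!: eventually_mono\<close>)
    also have "\<dots> \<le> ennreal (p0 + (\<integral>s. kap 1 s \<partial>\<mu>) + inverse (real (Suc n)))"
      using fi k by (intro ennreal_leI) (simp add: inverse_eq_divide algebra_simps)
    finally show "(\<integral>\<^sup>+s. ennreal (f n s + kap 1 s) \<partial>\<mu>) \<le> \<dots>" .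
  qed
  also have "\<dots> = ennreal (p0 + (\<integral>s. kap 1 s \<partial>\<mu>) + 0)"
    by (intro lim_imp_Liminf tendsto_ennrealI tendsto_add tendsto_const LIMSEQ_inverse_real_of_nat) simp
  finally have bound: "(\<integral>\<^sup>+s. e2ennreal (F s + ereal (kap 1 s)) \<partial>\<mu>) \<le> ennreal (p0 + (\<integral>s. kap 1 s \<partial>\<mu>))" by simp
  define G where "G = (\<lambda>s. real_of_ereal (F s))"
  have Gm: "G \<in> borel_measurable \<mu>" unfolding G_def using Fm by measurable
  have "AE s in \<mu>. e2ennreal (F s + ereal (kap 1 s)) \<noteq> \<infinity>"
  proof (rule nn_integral_PInf_AE)
    show "(\<lambda>s. e2ennreal (F s + ereal (kap 1 s))) \<in> borel_measurable \<mu>" using Fm k by measurable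
    show "(\<integral>\<^sup>+s. e2ennreal (F s + ereal (kap 1 s)) \<partial>\<mu>) \<noteq> \<infinity>" using bound by (auto simp: top_unique)
  qed
  then have FG: "AE s in \<mu>. F s = ereal (G s) \<and> 0 \<le> G s + kap 1 s"
    using h_ge_1
  proof eventually_elim
    case (elim s)
    have "ereal (- path_sum T xl s - kap 1 s) \<le> h (- path_sum T xl s) s" using elim(2) by blast
    then show ?case using elim(1) unfolding G_def F_def
      by (cases "h (- path_sum T xl s) s") (auto simp: e2ennreal_infty)
  qed
  have nn: "(\<integral>\<^sup>+s. ennreal (G s + kap 1 s) \<partial>\<mu>) = (\<integral>\<^sup>+s. e2ennreal (F s + ereal (kap 1 s)) \<partial>\<mu>)"
    by (rule nn_integral_cong_AE) (use FG in \<open>auto elim!: eventually_mono\<close>)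
  have GK: "integrable \<mu> (\<lambda>s. G s + kap 1 s)"
  proof (rule integrableI_nonneg)
    show "AE s in \<mu>. 0 \<le> G s + kap 1 s" using FG by eventually_elim blast
    show "(\<integral>\<^sup>+s. ennreal (G s + kap 1 s) \<partial>\<mu>) < \<infinity>" unfolding nn using bound by (auto intro: le_less_trans)
  qed (use Gm k in auto)
  have Gi: "integrable \<mu> G" using Bochner_Integration.integrable_diff[OF GK k] by simp
  have pk: "0 \<le> p0 + (\<integral>s. kap 1 s \<partial>\<mu>)"
  proof -
    have "- (\<integral>s. kap 1 s \<partial>\<mu>) \<le> p0"
      unfolding p0_def by (rule cInf_greatest) (use vals_lower vals_ne[OF V_bounded[of "\<lambda>_. 0" 0]] in auto)
    then show ?thesis by simp
  qed
  have "ennreal (\<integral>s. G s + kap 1 s \<partial>\<mu>) \<le> ennreal (p0 + (\<integral>s. kap 1 s \<partial>\<mu>))"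
  proof -
    have "(\<integral>\<^sup>+s. ennreal (G s + kap 1 s) \<partial>\<mu>) = ennreal (\<integral>s. G s + kap 1 s \<partial>\<mu>)"
      by (rule nn_integral_eq_integral[OF GK]) (use FG in \<open>auto elim!: eventually_mono\<close>)
    then show ?thesis using bound nn by simp
  qed
  then have "(\<integral>s. G s + kap 1 s \<partial>\<mu>) \<le> p0 + (\<integral>s. kap 1 s \<partial>\<mu>)" using pk by (simp add: ennreal_le_iff)
  then have "(\<integral>s. G s \<partial>\<mu>) \<le> p0" using Gi k by simp
  moreover have "objB T \<mu> h xl = ereal (\<integral>s. G s \<partial>\<mu>)"
    unfolding objB_def F_def[symmetric]
    by (rule ext_integral_eq[OF _ Gi]) (use FG in \<open>auto simp: F_def elim!: eventually_mono\<close>)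
  ultimately show ?thesis using xB by (intro bexI[of _ xl]) auto
qed

section \<open>Couplings and the conjugate of \<open>H\<close>\<close>

definition coupling :: "(nat \<Rightarrow> 'a) measure \<Rightarrow> bool" where
  "coupling M \<longleftrightarrow> sets M = sets (borel_of X) \<and> finite_measure M \<and>
     (\<forall>t\<le>T. distr M (borel_of (S t)) (\<lambda>s. s t) = m t)"

text \<open>The Lebesgue decomposition with its witnesses: the \<open>\<mu>\<close>-null set
  \<open>N\<close> carries the singular part of \<open>M\<close>, and \<open>y\<close> is a density
  of the rest, nonnegative at every point.\<close>

definition decomp :: "(nat \<Rightarrow> 'a) measure \<Rightarrow> ((nat \<Rightarrow> 'a) \<Rightarrow> real) \<Rightarrow> (nat \<Rightarrow> 'a) set \<Rightarrow> bool" where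
  "decomp M y N \<longleftrightarrow> N \<in> null_sets \<mu> \<and> y \<in> borel_measurable \<mu> \<and> (\<forall>s. 0 \<le> y s) \<and>
     density M (indicator (\<Omega> - N)) = density \<mu> (\<lambda>s. ennreal (y s))"

lemma coupling_sets: "coupling M \<Longrightarrow> sets M = sets (borel_of X)" by (simp add: coupling_def)
lemma coupling_sets_mu: "coupling M \<Longrightarrow> sets M = sets \<mu>" by (simp add: coupling_def mu_sets)
lemma coupling_finite: "coupling M \<Longrightarrow> finite_measure M" by (simp add: coupling_def)
lemma coupling_distr: "coupling M \<Longrightarrow> t \<le> T \<Longrightarrow> distr M (borel_of (S t)) (\<lambda>s. s t) = m t" by (simp add: coupling_def)
lemma coupling_space: "coupling M \<Longrightarrow> space M = \<Omega>" using sets_eq_imp_space_eq[OF coupling_sets] by simp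

lemma coupling_mu: "coupling \<mu>"
  unfolding coupling_def using mu_sets mu.finite_measure_axioms by (simp add: marg_def)

lemma coupling_integrable:
  fixes x :: "'a \<Rightarrow> real"
  assumes M: "coupling M" and t: "t \<le> T" and x: "integrable (m t) x"
  shows "integrable M (\<lambda>s. x (s t))" "(\<integral>s. x (s t) \<partial>M) = (\<integral>y. x y \<partial>m t)"
proof -
  have xm: "x \<in> borel_measurable (borel_of (S t))" using x m_cong_meas borel_measurable_integrable by blast
  note pm = proj_meas[OF t coupling_sets[OF M]]
  show "integrable M (\<lambda>s. x (s t))"
    using integrable_distr_eq[OF pm xm] x unfolding coupling_distr[OF M t] by simp
  show "(\<integral>s. x (s t) \<partial>M) = (\<integral>y. x y \<partial>m t)"
    using integral_distr[OF pm xm] unfolding coupling_distr[OF M t] by simp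
qed

lemma coupling_AE:
  assumes M: "coupling M" and t: "t \<le> T" and A: "AE y in m t. P y"
  shows "AE s in M. P (s t)"
  using AE_distrD[OF proj_meas[OF t coupling_sets[OF M]], of P] A unfolding coupling_distr[OF M t] by blast

lemma coupling_PiE:
  assumes M: "coupling M" and A: "\<And>t. t \<le> T \<Longrightarrow> A t \<in> sets (borel_of (S t))" "\<And>t. t \<le> T \<Longrightarrow> measure (m t) (A t) = 1"
  shows "AE s in M. s \<in> PiE {..T} A"
proof -
  have "AE s in M. s t \<in> A t" if t: "t \<le> T" for t
  proof -
    interpret prob_space "m t" by (rule prob_m[OF t])
    have "AE y in m t. y \<in> A t" using A[OF t] prob_eq_1[of "A t"] by simp
    then show ?thesis by (rule coupling_AE[OF M t])
  qed
  then have "AE s in M. \<forall>t\<in>{..T}. s t \<in> A t" by (intro AE_finite_allI) auto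
  then show ?thesis using AE_space
    by eventually_elim (auto simp: coupling_space[OF M] PiE_iff)
qed

lemma coupling_wt: "coupling M \<Longrightarrow> integrable M wt"
  unfolding weight_def by (intro Bochner_Integration.integrable_sum coupling_integrable(1) mu_marg) auto

text \<open>Von Neumann's device: \<open>\<mu>\<close> has a density \<open>f\<close> with respect
  to \<open>\<mu> + M\<close>. Off the set \<open>N\<close> where \<open>f\<close> vanishes, a
  \<open>\<mu>\<close>-null set is null for the sum and hence for \<open>M\<close>.\<close>

lemma decomp_exists:
  assumes M: "coupling M"
  shows "\<exists>y N. decomp M y N"
proof -
  interpret M: finite_measure M by (rule coupling_finite[OF M])
  have sM: "sets \<mu> = sets M" using coupling_sets_mu[OF M] by simp
  define \<tau> where "\<tau> = msum \<mu> M"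
  have st: "sets \<tau> = sets \<mu>" unfolding \<tau>_def by simp
  interpret t: finite_measure \<tau> unfolding \<tau>_def by (rule finite_measure_msum[OF sM mu.finite_measure_axioms M.finite_measure_axioms])
  have et: "emeasure \<tau> A = emeasure \<mu> A + emeasure M A" if "A \<in> sets \<mu>" for A
    unfolding \<tau>_def by (rule emeasure_msum[OF sM that])
  have "absolutely_continuous \<tau> \<mu>"
    unfolding absolutely_continuous_def using et st by (auto simp: null_sets_def)
  from t.Radon_Nikodym[OF this st[symmetric]] obtain f where f: "f \<in> borel_measurable \<tau>" "density \<tau> f = \<mu>" by blast
  define N where "N = {s \<in> space \<tau>. f s = 0}"
  have Nt: "N \<in> sets \<tau>" unfolding N_def using f by measurable
  have N: "N \<in> null_sets \<mu>"
  proof -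
    have "emeasure \<mu> N = (\<integral>\<^sup>+s. f s * indicator N s \<partial>\<tau>)" using f Nt by (metis emeasure_density)
    also have "\<dots> = (\<integral>\<^sup>+s. 0 \<partial>\<tau>)" by (rule nn_integral_cong) (auto simp: N_def indicator_def)
    finally show ?thesis using Nt st by (simp add: null_sets_def)
  qed
  define Ma where "Ma = density M (indicator (\<Omega> - N) :: _ \<Rightarrow> ennreal)"
  have ONs: "\<Omega> - N \<in> sets M" using sets.compl_sets[of N M] N sM coupling_space[OF M] by auto
  have eMa: "emeasure Ma A = emeasure M (A - N)" if A: "A \<in> sets M" for A
  proof -
    have "emeasure Ma A = emeasure M ((\<Omega> - N) \<inter> A)" unfolding Ma_def using A ONs by (simp add: emeasure_restricted)
    also have "(\<Omega> - N) \<inter> A = A - N" using sets.sets_into_space[OF A] coupling_space[OF M] by auto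
    finally show ?thesis .
  qed
  have finMa: "finite_measure Ma"
  proof
    have "emeasure Ma (space Ma) = emeasure M (space M - N)" using eMa[OF sets.top] by (simp add: Ma_def)
    then show "emeasure Ma (space Ma) \<noteq> \<infinity>" using M.emeasure_finite by simp
  qed
  have sMa: "sets Ma = sets \<mu>" unfolding Ma_def using sM by simp
  have acMa: "absolutely_continuous \<mu> Ma"
    unfolding absolutely_continuous_def
  proof
    fix A assume A: "A \<in> null_sets \<mu>"
    then have As: "A \<in> sets \<mu>" "A \<in> sets \<tau>" "A \<in> sets M" using st sM by auto
    have "(\<integral>\<^sup>+s. f s * indicator A s \<partial>\<tau>) = 0" using A f As by (metis emeasure_density null_setsD1)
    then have "AE s in \<tau>. f s * indicator A s = 0" using f As by (subst (asm) nn_integral_0_iff_AE) auto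
    then have "AE s in \<tau>. s \<notin> A - N"
      using AE_space by eventually_elim (auto simp: N_def indicator_def split: if_splits)
    then have "emeasure \<tau> (A - N) = 0"
      using As Nt by (subst (asm) AE_iff_measurable[of "A - N"]) (auto dest: sets.sets_into_space)
    then have "emeasure M (A - N) = 0" using et[of "A - N"] As N by auto
    then show "A \<in> null_sets Ma" using eMa[OF As(3)] As sMa by (simp add: null_sets_def)
  qed
  interpret Ma: finite_measure Ma by (rule finMa)
  obtain y where y: "y \<in> borel_measurable \<mu>" "AE s in \<mu>. RN_deriv \<mu> Ma s = ennreal (y s)" "\<And>s. 0 \<le> y s"
    using mu.real_RN_deriv[OF finMa acMa sMa] by metis
  have "density \<mu> (\<lambda>s. ennreal (y s)) = density \<mu> (RN_deriv \<mu> Ma)"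
    by (rule density_cong) (use y in \<open>auto elim!: eventually_mono\<close>)
  also have "\<dots> = Ma" by (rule mu.density_RN_deriv[OF acMa sMa])
  finally have "density M (indicator (\<Omega> - N)) = density \<mu> (\<lambda>s. ennreal (y s))" unfolding Ma_def by (rule sym)
  then show ?thesis unfolding decomp_def using N y(1,3) by blast
qed

lemma decomp_integrable:
  fixes f :: "_ \<Rightarrow> real"
  assumes M: "coupling M" and dec: "decomp M y N" and f: "f \<in> borel_measurable \<mu>"
  shows "integrable M f \<longleftrightarrow> integrable \<mu> (\<lambda>s. y s * f s) \<and> integrable M (\<lambda>s. indicator N s * f s)"
    "integrable M f \<Longrightarrow> (\<integral>s. f s \<partial>M) = (\<integral>s. y s * f s \<partial>\<mu>) + (\<integral>s. indicator N s * f s \<partial>M)"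
proof -
  have sM: "sets M = sets \<mu>" by (rule coupling_sets_mu[OF M])
  have N: "N \<in> null_sets \<mu>" and y: "y \<in> borel_measurable \<mu>" "\<And>s. 0 \<le> y s"
    and eq: "density M (indicator (\<Omega> - N)) = density \<mu> (\<lambda>s. ennreal (y s))" using dec by (auto simp: decomp_def)
  have fM: "f \<in> borel_measurable M" using f sM measurable_cong_sets by blast
  have Ns: "N \<in> sets M" using N sM by auto
  have ON: "\<Omega> - N \<in> sets M" using sets.compl_sets[OF Ns] coupling_space[OF M] by simp
  have eq': "density M (\<lambda>s. ennreal (indicator (\<Omega> - N) s)) = density \<mu> (\<lambda>s. ennreal (y s))"
    using eq by (simp add: ennreal_indicator)
  have i1: "integrable M (\<lambda>s. indicator (\<Omega> - N) s * f s) \<longleftrightarrow> integrable \<mu> (\<lambda>s. y s * f s)"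
  proof -
    have "integrable (density M (\<lambda>s. ennreal (indicator (\<Omega> - N) s))) f \<longleftrightarrow> integrable M (\<lambda>s. indicator (\<Omega> - N) s *\<^sub>R f s)"
      by (rule integrable_density) (use fM ON in auto)
    moreover have "integrable (density \<mu> (\<lambda>s. ennreal (y s))) f \<longleftrightarrow> integrable \<mu> (\<lambda>s. y s *\<^sub>R f s)"
      by (rule integrable_density) (use f y in auto)
    ultimately show ?thesis unfolding eq' by simp
  qed
  have I1: "(\<integral>s. indicator (\<Omega> - N) s * f s \<partial>M) = (\<integral>s. y s * f s \<partial>\<mu>)"
  proof -
    have "integral\<^sup>L (density M (\<lambda>s. ennreal (indicator (\<Omega> - N) s))) f = (\<integral>s. indicator (\<Omega> - N) s *\<^sub>R f s \<partial>M)"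
      by (rule integral_density) (use fM ON in auto)
    moreover have "integral\<^sup>L (density \<mu> (\<lambda>s. ennreal (y s))) f = (\<integral>s. y s *\<^sub>R f s \<partial>\<mu>)"
      by (rule integral_density) (use f y in auto)
    ultimately show ?thesis unfolding eq' by simp
  qed
  have split: "f s = indicator (\<Omega> - N) s * f s + indicator N s * f s" if "s \<in> space M" for s
    using that coupling_space[OF M] by (auto simp: indicator_def)
  have i2: "integrable M f \<longleftrightarrow> integrable M (\<lambda>s. indicator (\<Omega> - N) s * f s) \<and> integrable M (\<lambda>s. indicator N s * f s)"
  proof
    assume "integrable M f"
    then show "integrable M (\<lambda>s. indicator (\<Omega> - N) s * f s) \<and> integrable M (\<lambda>s. indicator N s * f s)"
      using integrable_mult_indicator[OF ON, of f] integrable_mult_indicator[OF Ns, of f] by simp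
  next
    assume "integrable M (\<lambda>s. indicator (\<Omega> - N) s * f s) \<and> integrable M (\<lambda>s. indicator N s * f s)"
    then have "integrable M (\<lambda>s. indicator (\<Omega> - N) s * f s + indicator N s * f s)" by simp
    moreover have "integrable M f = integrable M (\<lambda>s. indicator (\<Omega> - N) s * f s + indicator N s * f s)"
      by (rule Bochner_Integration.integrable_cong[OF refl]) (rule split)
    ultimately show "integrable M f" by simp
  qed
  show "integrable M f \<longleftrightarrow> integrable \<mu> (\<lambda>s. y s * f s) \<and> integrable M (\<lambda>s. indicator N s * f s)"
    unfolding i2 i1 ..
  assume "integrable M f"
  then have ii: "integrable M (\<lambda>s. indicator (\<Omega> - N) s * f s)" "integrable M (\<lambda>s. indicator N s * f s)" using i2 by auto
  have "(\<integral>s. f s \<partial>M) = (\<integral>s. indicator (\<Omega> - N) s * f s + indicator N s * f s \<partial>M)"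
    by (rule Bochner_Integration.integral_cong[OF refl]) (rule split)
  also have "\<dots> = (\<integral>s. y s * f s \<partial>\<mu>) + (\<integral>s. indicator N s * f s \<partial>M)"
    using Bochner_Integration.integral_add[OF ii] I1 by simp
  finally show "(\<integral>s. f s \<partial>M) = (\<integral>s. y s * f s \<partial>\<mu>) + (\<integral>s. indicator N s * f s \<partial>M)" .
qed

text \<open>For rational \<open>q\<close>, a continuous function rises from the level
  \<open>- K * wt\<close>, which lies in \<open>D\<close> because it is below \<open>u0\<close>,
  towards \<open>q\<close> inside the open set where \<open>d > q\<close>. As \<open>d\<close> is
  lower semicontinuous, countably many such functions pass every level below
  \<open>d\<close>.\<close>

lemma lower_continuous_exhaustion:
  assumes K: "K \<ge> 0" and u0: "u0 \<in> CD" "\<And>s. s \<in> \<Omega> \<Longrightarrow> \<bar>u0 s\<bar> \<le> K * wt s"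
  shows "\<exists>e :: nat \<Rightarrow> _. (\<forall>i. e i \<in> CD) \<and> (\<forall>i. \<forall>s\<in>\<Omega>. - K * wt s \<le> e i s) \<and>
    (\<forall>s\<in>\<Omega>. \<forall>a. ereal a < d s \<longrightarrow> (\<exists>i. a < e i s))"
proof -
  have "\<exists>\<theta> :: nat \<Rightarrow> _ \<Rightarrow> real. (\<forall>n. continuous_map X euclideanreal (\<theta> n)) \<and>
     (\<forall>n. \<forall>s\<in>\<Omega>. 0 \<le> \<theta> n s \<and> \<theta> n s \<le> 1 \<and> (\<not> ereal (of_rat q) < d s \<longrightarrow> \<theta> n s = 0)) \<and>
     (\<forall>s\<in>\<Omega>. ereal (of_rat q) < d s \<longrightarrow> (\<exists>n. \<theta> n s = 1))" for q :: rat
    by (rule open_indicator_approx[OF metrizable_X d_open[of "of_rat q"]]) blast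
  then obtain \<theta> :: "rat \<Rightarrow> nat \<Rightarrow> _ \<Rightarrow> real" where
    \<theta>c: "\<And>q n. continuous_map X euclideanreal (\<theta> q n)" and
    \<theta>01: "\<And>q n s. s \<in> \<Omega> \<Longrightarrow> 0 \<le> \<theta> q n s \<and> \<theta> q n s \<le> 1 \<and> (\<not> ereal (of_rat q) < d s \<longrightarrow> \<theta> q n s = 0)" and
    \<theta>1: "\<And>q s. s \<in> \<Omega> \<Longrightarrow> ereal (of_rat q) < d s \<Longrightarrow> \<exists>n. \<theta> q n s = 1"
    by metis
  \<comment> \<open>Where \<open>\<theta>\<close> is 1 this is the maximum of
    \<open>- K * wt\<close> and \<open>q\<close>, where \<open>\<theta>\<close> is 0 it is
    \<open>- K * wt\<close>. The positive part keeps \<open>- K * wt\<close> a lower bound for every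
    \<open>q\<close>.\<close>
  define g where "g = (\<lambda>q n s. - K * wt s + max 0 (of_rat q + K * wt s) * \<theta> q n s)"
  have gC: "restrict (g q n) \<Omega> \<in> C" for q n
  proof (rule C_I[where c="2 * K + \<bar>of_rat q\<bar>"])
    show "continuous_map X euclideanreal (g q n)"
      unfolding g_def
      by (intro continuous_map_add continuous_map_real_mult_left continuous_map_real_mult continuous_map_real_max wt_cont \<theta>c) auto
    fix s assume s: "s \<in> \<Omega>"
    have w1: "1 \<le> wt s" by (rule wt_ge1[OF s])
    have "max 0 (of_rat q + K * wt s) * \<theta> q n s \<le> max 0 (of_rat q + K * wt s) * 1"
      using \<theta>01[OF s] by (intro mult_left_mono) auto
    moreover have "0 \<le> max 0 (of_rat q + K * wt s) * \<theta> q n s"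
      using \<theta>01[OF s] by (intro mult_nonneg_nonneg) auto
    moreover have "\<bar>of_rat q\<bar> * 1 \<le> \<bar>of_rat q\<bar> * wt s" using w1 by (intro mult_left_mono) auto
    moreover have "0 \<le> K * wt s" using K w1 by simp
    moreover have "max 0 (of_rat q + K * wt s) \<le> \<bar>of_rat q\<bar> + K * wt s" using \<open>0 \<le> K * wt s\<close> by linarith
    moreover have "(2 * K + \<bar>of_rat q\<bar>) * wt s = 2 * (K * wt s) + \<bar>of_rat q\<bar> * wt s"
      by (simp only: distrib_right mult.assoc)
    moreover have "g q n s = - (K * wt s) + max 0 (of_rat q + K * wt s) * \<theta> q n s" by (simp add: g_def)
    moreover have "\<bar>gg\<bar> \<le> B"
      if "x \<le> P * 1" "0 \<le> x" "r * 1 \<le> rW" "0 \<le> KW" "P \<le> r + KW" "B = 2 * KW + rW" "gg = - KW + x"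
      for gg B x P r rW KW :: real
      using that by linarith
    ultimately show "\<bar>g q n s\<bar> \<le> (2 * K + \<bar>of_rat q\<bar>) * wt s" by blast
  qed
  have lowD: "- K * wt s \<in> D s" if s: "s \<in> \<Omega>" for s
    by (rule D_down[OF s CD_D[OF u0(1) s]]) (use u0(2)[OF s] in linarith)
  have gD: "g q n s \<in> D s" if s: "s \<in> \<Omega>" for q n s
  proof (cases "ereal (of_rat q) < d s")
    case True
    then have qD: "of_rat q \<in> D s" using D_iff[OF s] by simp
    have "max 0 (of_rat q + K * wt s) * \<theta> q n s \<le> max 0 (of_rat q + K * wt s) * 1"
      using \<theta>01[OF s] by (intro mult_left_mono) auto
    then have "g q n s \<le> max (- K * wt s) (of_rat q)" unfolding g_def by (simp add: max_def split: if_splits)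
    moreover have "max (- K * wt s) (of_rat q) \<in> D s" using lowD[OF s] qD by (simp add: max_def)
    ultimately show ?thesis using D_down[OF s] by blast
  next
    case False
    then show ?thesis using \<theta>01[OF s] lowD[OF s] unfolding g_def by simp
  qed
  \<comment> \<open>One natural number codes the rational level together with the stage of its
    approximation.\<close>
  define e where "e = (\<lambda>i. restrict (g (from_nat (fst (prod_decode i))) (snd (prod_decode i))) \<Omega>)"
  have "e i \<in> CD" for i unfolding e_def wC_sel_def using gC gD by simp
  moreover have "- K * wt s \<le> e i s" if "s \<in> \<Omega>" for i s
    using \<theta>01[OF that] that unfolding e_def g_def by (simp add: mult_nonneg_nonneg)
  moreover have "\<exists>i. a < e i s" if s: "s \<in> \<Omega>" and a: "ereal a < d s" for s a
  proof -
    obtain b where b: "ereal a < ereal b" "ereal b < d s" using a ereal_dense2 by blast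
    obtain q where q: "a < of_rat q" "of_rat q < b" using of_rat_dense b(1) by auto
    have "ereal (of_rat q) < d s" using q(2) b(2) by (meson ereal_less(2) less_ereal.simps(1) less_trans)
    then obtain n where n: "\<theta> q n s = 1" using \<theta>1[OF s] by blast
    have "g q n s \<ge> of_rat q" unfolding g_def n by (simp add: max_def)
    then have "a < e (prod_encode (to_nat q, n)) s" using q(1) s unfolding e_def by simp
    then show ?thesis by blast
  qed
  ultimately show ?thesis by blast
qed

text \<open>The bound \<open>c\<close>, known for continuous functions, is extended to a measurable
  \<open>w\<close> between \<open>a\<close> and \<open>b\<close>. Since \<open>N\<close> is
  \<open>\<mu>\<close>-null, replacing \<open>w\<close> by \<open>b\<close> on \<open>N\<close>
  leaves the integral of \<open>h\<close> unchanged, while under \<open>M\<close> it isolates the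
  singular part with the largest admissible value.\<close>

lemma conj_core:
  assumes M: "coupling M" and dec: "decomp M y N"
    and c: "\<And>u. u \<in> C \<Longrightarrow> H u < \<infinity> \<Longrightarrow> (\<integral>s. u s \<partial>M) - real_of_ereal (H u) \<le> c"
    and a: "a \<in> C" and b: "b \<in> C" "H b < \<infinity>" and w: "w \<in> borel_measurable \<mu>"
    and between: "\<And>s. s \<in> \<Omega> \<Longrightarrow> a s \<le> w s \<and> w s \<le> b s"
  shows "integrable \<mu> (\<lambda>s. w s * y s - hr (w s) s)"
    "(\<integral>s. w s * y s - hr (w s) s \<partial>\<mu>) + (\<integral>s. indicator N s * b s \<partial>M) \<le> c"
proof -
  have sM: "sets M = sets \<mu>" by (rule coupling_sets_mu[OF M])
  have spM: "space M = \<Omega>" by (rule coupling_space[OF M])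
  have N: "N \<in> null_sets \<mu>" and ym: "y \<in> borel_measurable \<mu>" using dec by (auto simp: decomp_def)
  have ab: "a s \<le> b s" if "s \<in> \<Omega>" for s using between[OF that] by linarith
  have Ha: "H a < \<infinity>" by (rule H_mono[OF a b ab])
  have am: "a \<in> borel_measurable \<mu>" and bm: "b \<in> borel_measurable \<mu>"
    using cont_meas[OF C_D(1)] mu_sets a b by auto
  obtain ca cb where cab: "ca \<ge> 0" "\<forall>s\<in>\<Omega>. \<bar>a s\<bar> \<le> ca * wt s" "cb \<ge> 0" "\<forall>s\<in>\<Omega>. \<bar>b s\<bar> \<le> cb * wt s"
    using C_D(2)[OF a] C_D(2)[OF b(1)] by blast
  define k where "k = ca + cb"
  have kb: "\<bar>v\<bar> \<le> k * wt s" if "s \<in> \<Omega>" "a s \<le> v" "v \<le> b s" for s v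
  proof -
    have "\<bar>a s\<bar> \<le> ca * wt s" "\<bar>b s\<bar> \<le> cb * wt s" "0 \<le> ca * wt s" "0 \<le> cb * wt s"
      using cab that(1) wt_ge1[OF that(1)] by auto
    then show ?thesis using that(2,3) unfolding k_def distrib_right by linarith
  qed
  define w' where "w' = (\<lambda>s. if s \<in> N then b s else w s)"
  have w'm: "w' \<in> borel_measurable \<mu>" unfolding w'_def using N bm w by (intro measurable_If_set) auto
  have w'b: "a s \<le> w' s \<and> w' s \<le> b s" if "s \<in> \<Omega>" for s using between[OF that] ab[OF that] by (simp add: w'_def)
  define \<tau> where "\<tau> = msum \<mu> M"
  have st: "sets \<tau> = sets (borel_of X)" unfolding \<tau>_def by (simp add: mu_sets)
  have ft: "finite_measure \<tau>" unfolding \<tau>_def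
    by (rule finite_measure_msum[OF sM[symmetric] mu.finite_measure_axioms coupling_finite[OF M]])
  have wtm: "wt \<in> borel_measurable \<mu>" by (rule cont_meas[OF wt_cont mu_sets])
  \<comment> \<open>Division by the weight makes the function bounded, hence accessible to bounded
    continuous functions. As \<open>\<tau>\<close> is the sum of \<open>\<mu>\<close> and
    \<open>M\<close>, they converge almost everywhere for both.\<close>
  have "integrable \<tau> (\<lambda>s. w' s / wt s)"
  proof (rule finite_measure.integrable_const_bound[OF ft, of _ k])
    show "AE s in \<tau>. norm (w' s / wt s) \<le> k"
    proof (rule AE_I2)
      fix s assume "s \<in> space \<tau>"
      then have s: "s \<in> \<Omega>" by (simp add: \<tau>_def space_mu)
      show "norm (w' s / wt s) \<le> k" using kb[OF s, of "w' s"] w'b[OF s] wt_ge1[OF s] by (simp add: abs_divide pos_divide_le_eq)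
    qed
    have "(\<lambda>s. w' s / wt s) \<in> borel_measurable \<mu>" using w'm wtm by measurable
    then show "(\<lambda>s. w' s / wt s) \<in> borel_measurable \<tau>" using measurable_cong_sets[of \<tau> \<mu>] st mu_sets by blast
  qed
  from cfun_dense_AE[OF metrizable_X ft st this] obtain g where g: "\<And>n. g n \<in> cfun X"
    "AE s in \<tau>. (\<lambda>n. g n s) \<longlonglongrightarrow> w' s / wt s" by blast
  \<comment> \<open>Clamping between \<open>a\<close> and \<open>b\<close> keeps the approximants in
    the domain of \<open>H\<close>, provides integrable bounds, and does not disturb the limit,
    which already lies between \<open>a\<close> and \<open>b\<close>.\<close>
  define u where "u = (\<lambda>n. restrict (\<lambda>s. max (a s) (min (b s) (g n s * wt s))) \<Omega>)"
  have uC: "u n \<in> C" for n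
    unfolding u_def
  proof (rule C_I[where c=k])
    show "continuous_map X euclideanreal (\<lambda>s. max (a s) (min (b s) (g n s * wt s)))"
    proof -
      have "continuous_map X euclideanreal (g n)" using g(1)[of n] by (simp add: cfun_def)
      then show ?thesis
        by (intro continuous_map_real_max continuous_map_real_min continuous_map_real_mult wt_cont C_D(1)[OF a] C_D(1)[OF b(1)])
    qed
    fix s assume s: "s \<in> \<Omega>"
    show "\<bar>max (a s) (min (b s) (g n s * wt s))\<bar> \<le> k * wt s" using ab[OF s] by (intro kb[OF s]) auto
  qed
  have ub: "a s \<le> u n s \<and> u n s \<le> b s" if "s \<in> \<Omega>" for s n using that ab[OF that] by (simp add: u_def)
  have Hu: "H (u n) < \<infinity>" for n by (rule H_mono[OF uC b]) (use ub in blast)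
  have lim: "AE s in L. (\<lambda>n. u n s) \<longlonglongrightarrow> w' s" if L: "L = \<mu> \<or> L = M" for L
  proof -
    have "AE s in L. (\<lambda>n. g n s) \<longlonglongrightarrow> w' s / wt s"
      using AE_msumD[OF sM[symmetric] g(2)[unfolded \<tau>_def]] L by blast
    then show ?thesis using AE_space
    proof eventually_elim
      case (elim s)
      then have s: "s \<in> \<Omega>" using L space_mu spM by auto
      have "(\<lambda>n. max (a s) (min (b s) (g n s * wt s))) \<longlonglongrightarrow> max (a s) (min (b s) (w' s / wt s * wt s))"
        by (intro tendsto_max tendsto_min tendsto_const tendsto_mult elim(1))
      moreover have "max (a s) (min (b s) (w' s / wt s * wt s)) = w' s"
        using w'b[OF s] wt_ge1[OF s] by auto
      ultimately show ?case using s by (simp add: u_def)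
    qed
  qed
  have wtM: "integrable M wt" by (rule coupling_wt[OF M])
  have um: "u n \<in> borel_measurable M" for n by (rule cont_meas[OF C_D(1)[OF uC] coupling_sets[OF M]])
  have w'M: "w' \<in> borel_measurable M" using w'm sM measurable_cong_sets by blast
  have L1: "(\<lambda>n. \<integral>s. u n s \<partial>M) \<longlonglongrightarrow> (\<integral>s. w' s \<partial>M)"
  proof (rule integral_dominated_convergence[where w="\<lambda>s. k * wt s"])
    show "AE s in M. norm (u n s) \<le> k * wt s" for n
      by (rule AE_I2) (use kb ub spM in auto)
  qed (use lim[OF disjI2[OF refl]] um w'M wtM in auto)
  have hai: "integrable \<mu> (\<lambda>s. hr (a s) s)" and hbi: "integrable \<mu> (\<lambda>s. hr (b s) s)"
    using H_fin(2)[OF a Ha] H_fin(2)[OF b] by auto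
  have hab: "AE s in \<mu>. \<forall>v. a s \<le> v \<longrightarrow> v \<le> b s \<longrightarrow> \<bar>hr v s\<bar> \<le> \<bar>hr (a s) s\<bar> + \<bar>hr (b s) s\<bar>"
    using h_proper H_fin(1)[OF b] AE_space
  proof eventually_elim
    case (elim s)
    then have s: "s \<in> \<Omega>" by (simp add: space_mu)
    have fb: "h (b s) s < \<infinity>" using elim(2) by simp
    show ?case
    proof (intro allI impI)
      fix v assume v: "a s \<le> v" "v \<le> b s"
      have "h v s \<le> h (b s) s" by (rule h_le[OF s v(2)])
      then have "h v s < \<infinity>" using fb by (rule le_less_trans)
      then have "hr (a s) s \<le> hr v s" using hr_mono[OF s elim(1) _ v(1)] by blast
      moreover have "hr v s \<le> hr (b s) s" by (rule hr_mono[OF s elim(1) fb v(2)])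
      ultimately show "\<bar>hr v s\<bar> \<le> \<bar>hr (a s) s\<bar> + \<bar>hr (b s) s\<bar>" by linarith
    qed
  qed
  have hwm: "(\<lambda>s. hr (w s) s) \<in> borel_measurable \<mu>" by (rule hr_meas[OF mu_sets w])
  have hwi: "integrable \<mu> (\<lambda>s. hr (w s) s)"
  proof (rule Bochner_Integration.integrable_bound[of \<mu> "\<lambda>s. \<bar>hr (a s) s\<bar> + \<bar>hr (b s) s\<bar>"])
    show "AE s in \<mu>. norm (hr (w s) s) \<le> norm (\<bar>hr (a s) s\<bar> + \<bar>hr (b s) s\<bar>)"
      using hab AE_space by eventually_elim (use between space_mu in auto)
  qed (use hai hbi hwm in auto)
  have L2: "(\<lambda>n. \<integral>s. hr (u n s) s \<partial>\<mu>) \<longlonglongrightarrow> (\<integral>s. hr (w s) s \<partial>\<mu>)"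
  proof (rule integral_dominated_convergence[where w="\<lambda>s. \<bar>hr (a s) s\<bar> + \<bar>hr (b s) s\<bar>"])
    have "AE s in \<mu>. s \<notin> N" by (rule AE_not_in[OF N])
    with lim[OF disjI1[OF refl]] h_proper H_fin(1)[OF b] AE_space
    show "AE s in \<mu>. (\<lambda>n. hr (u n s) s) \<longlonglongrightarrow> hr (w s) s"
    proof eventually_elim
      case (elim s)
      then have s: "s \<in> \<Omega>" by (simp add: space_mu)
      have fb: "h (b s) s < \<infinity>" using elim(3) by simp
      have ul: "(\<lambda>n. u n s) \<longlonglongrightarrow> w s" using elim(1,5) by (simp add: w'_def)
      show ?case by (rule hr_tendsto[OF s elim(2) fb _ ul]) (use ub[OF s] in blast)
    qed
    show "AE s in \<mu>. norm (hr (u n s) s) \<le> \<bar>hr (a s) s\<bar> + \<bar>hr (b s) s\<bar>" for n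
      using hab AE_space by eventually_elim (use ub space_mu in auto)
    show "(\<lambda>s. hr (u n s) s) \<in> borel_measurable \<mu>" for n
      by (rule hr_meas[OF mu_sets cont_meas[OF C_D(1)[OF uC] mu_sets]])
  qed (use hwm hai hbi in auto)
  have "(\<lambda>n. (\<integral>s. u n s \<partial>M) - (\<integral>s. hr (u n s) s \<partial>\<mu>)) \<longlonglongrightarrow> (\<integral>s. w' s \<partial>M) - (\<integral>s. hr (w s) s \<partial>\<mu>)"
    by (rule tendsto_diff[OF L1 L2])
  then have le: "(\<integral>s. w' s \<partial>M) - (\<integral>s. hr (w s) s \<partial>\<mu>) \<le> c"
  proof (rule LIMSEQ_le_const2, intro exI allI impI)
    fix n
    show "(\<integral>s. u n s \<partial>M) - (\<integral>s. hr (u n s) s \<partial>\<mu>) \<le> c" using c[OF uC Hu, of n] by (simp add: H_fin(3)[OF uC Hu])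
  qed
  have w'i: "integrable M w'"
    by (rule wt_bounded_integrable[OF coupling_sets[OF M] wtM w'M, of k]) (use kb w'b in auto)
  have yw': "integrable \<mu> (\<lambda>s. y s * w' s)" using decomp_integrable(1)[OF M dec w'm] w'i by blast
  have aeq: "AE s in \<mu>. y s * w' s = w s * y s"
    using AE_not_in[OF N] by eventually_elim (simp add: w'_def)
  have ywi: "integrable \<mu> (\<lambda>s. w s * y s)"
    using integrable_cong_AE[of "\<lambda>s. y s * w' s" \<mu> "\<lambda>s. w s * y s"] aeq yw' w ym by auto
  have ywI: "(\<integral>s. y s * w' s \<partial>\<mu>) = (\<integral>s. w s * y s \<partial>\<mu>)"
    by (rule integral_cong_AE) (use aeq w w'm ym in auto)
  have "(\<integral>s. w' s \<partial>M) = (\<integral>s. w s * y s \<partial>\<mu>) + (\<integral>s. indicator N s * w' s \<partial>M)"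
    using decomp_integrable(2)[OF M dec w'm w'i] ywI by simp
  also have "(\<integral>s. indicator N s * w' s \<partial>M) = (\<integral>s. indicator N s * b s \<partial>M)"
    by (rule Bochner_Integration.integral_cong) (auto simp: w'_def indicator_def)
  finally have "(\<integral>s. w' s \<partial>M) = (\<integral>s. w s * y s \<partial>\<mu>) + (\<integral>s. indicator N s * b s \<partial>M)" .
  then show "(\<integral>s. w s * y s - hr (w s) s \<partial>\<mu>) + (\<integral>s. indicator N s * b s \<partial>M) \<le> c"
    using le ywi hwi by simp
  show "integrable \<mu> (\<lambda>s. w s * y s - hr (w s) s)" using ywi hwi by simp
qed

text \<open>A rational slightly below \<open>u\<close> costs little in the linear term and nothing
  in \<open>h\<close>, which is nondecreasing.\<close>

lemma conj_rat:
  assumes s: "s \<in> \<Omega>"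
  shows "integrand_conj h v s = (SUP q::rat. ereal (of_rat q * v) - h (of_rat q) s)" (is "_ = ?Z")
proof (rule antisym)
  show "?Z \<le> integrand_conj h v s"
  proof (rule SUP_least)
    fix q :: rat
    show "ereal (of_rat q * v) - h (of_rat q) s \<le> integrand_conj h v s"
      unfolding integrand_conj_def by (rule SUP_upper[of "of_rat q" UNIV "\<lambda>u. ereal (u * v) - h u s"]) simp
  qed
  show "integrand_conj h v s \<le> ?Z"
    unfolding integrand_conj_def
  proof (rule SUP_least)
    fix u
    show "ereal (u * v) - h u s \<le> ?Z"
    proof (cases "h u s")
      case (real r)
      have "ereal (u * v - r) \<le> ?Z + ereal \<epsilon>" if \<epsilon>: "\<epsilon> > 0" for \<epsilon>
      proof -
        define \<delta> where "\<delta> = \<epsilon> / (\<bar>v\<bar> + 1)"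
        have \<delta>: "\<delta> > 0" unfolding \<delta>_def using \<epsilon> by simp
        obtain q where q: "u - \<delta> < of_rat q" "of_rat q < u" using of_rat_dense[of "u - \<delta>" u] \<delta> by auto
        have "(u - of_rat q) * v \<le> (u - of_rat q) * (\<bar>v\<bar> + 1)" using q by (intro mult_left_mono) auto
        also have "\<dots> \<le> \<delta> * (\<bar>v\<bar> + 1)" using q by (intro mult_right_mono) auto
        also have "\<dots> = \<epsilon>" unfolding \<delta>_def by simp
        finally have "u * v - r \<le> of_rat q * v - r + \<epsilon>" by (simp add: left_diff_distrib)
        then have "ereal (u * v - r) \<le> (ereal (of_rat q * v) - ereal r) + ereal \<epsilon>" by simp
        also have "\<dots> \<le> (ereal (of_rat q * v) - h (of_rat q) s) + ereal \<epsilon>"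
          using h_le[OF s, of "of_rat q" u] q(2) real by (intro add_right_mono ereal_minus_mono) auto
        also have "\<dots> \<le> ?Z + ereal \<epsilon>"
          by (intro add_right_mono SUP_upper[of q UNIV "\<lambda>q. ereal (of_rat q * v) - h (of_rat q) s"]) simp
        finally show ?thesis .
      qed
      note eps = this
      have "ereal (u * v - r) \<le> ?Z" by (rule ereal_le_epsilon2, rule eps)
      then show ?thesis unfolding real by (simp only: ereal_minus)
    next
      case MInf
      obtain q :: rat where q: "of_rat q < u" using of_rat_dense[of "u - 1" u] by auto
      have "h (of_rat q) s \<le> -\<infinity>" using h_le[OF s, of "of_rat q" u] q MInf by simp
      then have "ereal (of_rat q * v) - h (of_rat q) s = \<infinity>" by simp
      moreover have "ereal (of_rat q * v) - h (of_rat q) s \<le> ?Z"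
        by (rule SUP_upper[of q UNIV "\<lambda>q. ereal (of_rat q * v) - h (of_rat q) s"]) simp
      ultimately have "?Z = \<infinity>" by simp
      then show ?thesis by simp
    qed simp
  qed
qed

lemma conj_meas:
  assumes y: "y \<in> borel_measurable \<mu>"
  shows "(\<lambda>s. integrand_conj h (y s) s) \<in> borel_measurable \<mu>"
proof -
  have hq: "(\<lambda>s. h (of_rat q) s) \<in> borel_measurable \<mu>" for q :: rat by (rule h_comp_meas[OF mu_sets]) simp
  have "(\<lambda>s. SUP q::rat. ereal (of_rat q * y s) - h (of_rat q) s) \<in> borel_measurable \<mu>"
    using y hq by (intro borel_measurable_SUP borel_measurable_ereal_diff) auto
  moreover have "integrand_conj h (y s) s = (SUP q::rat. ereal (of_rat q * y s) - h (of_rat q) s)" if "s \<in> space \<mu>" for s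
    by (rule conj_rat) (use that space_mu in simp)
  ultimately show ?thesis by (simp cong: measurable_cong)
qed

text \<open>\<open>conj_core\<close> is applied with upper barriers \<open>B k\<close> that increase
  to \<open>d\<close>, and with \<open>wk k\<close>, the best of finitely many candidates for
  maximizing \<open>w * y - h(w)\<close>. The two integrals in its bound increase with
  \<open>k\<close> while their sum stays below \<open>c\<close>, so both converge; monotone
  convergence identifies the limits as the integrals of \<open>h\<^sup>*(y)\<close> and of
  \<open>d\<close> over \<open>N\<close>.\<close>

lemma conj_lower:
  assumes M: "coupling M" and dec: "decomp M y N"
    and c: "\<And>u. u \<in> C \<Longrightarrow> H u < \<infinity> \<Longrightarrow> (\<integral>s. u s \<partial>M) - real_of_ereal (H u) \<le> c"
  shows "AE s in \<mu>. integrand_conj h (y s) s = ereal (kap (y s) s)"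
    "integrable \<mu> (\<lambda>s. kap (y s) s)"
    "AE s in M. s \<in> N \<longrightarrow> d s = ereal (real_of_ereal (d s))"
    "integrable M (\<lambda>s. indicator N s * real_of_ereal (d s))"
    "(\<integral>s. kap (y s) s \<partial>\<mu>) + (\<integral>s. indicator N s * real_of_ereal (d s) \<partial>M) \<le> c"
proof -
  have sM: "sets M = sets \<mu>" by (rule coupling_sets_mu[OF M])
  have spM: "space M = \<Omega>" by (rule coupling_space[OF M])
  have N: "N \<in> null_sets \<mu>" and ym: "y \<in> borel_measurable \<mu>" using dec by (auto simp: decomp_def)
  have NM: "N \<in> sets M" using N sM by auto
  have wtM: "integrable M wt" by (rule coupling_wt[OF M])
  obtain u0 where u0: "u0 \<in> C" "H u0 < \<infinity>" using H_proper by blast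
  obtain K where K: "K \<ge> 0" "\<forall>s\<in>\<Omega>. \<bar>u0 s\<bar> \<le> K * wt s" using C_D(2)[OF u0(1)] by blast
  obtain e :: "nat \<Rightarrow> _" where eCD: "\<And>i. e i \<in> CD" and eK: "\<And>i s. s \<in> \<Omega> \<Longrightarrow> - K * wt s \<le> e i s"
    and ed: "\<And>s a. s \<in> \<Omega> \<Longrightarrow> ereal a < d s \<Longrightarrow> \<exists>i. a < e i s"
    using lower_continuous_exhaustion[OF K(1) H_less_D[OF u0(2)]] K(2) by blast
  \<comment> \<open>Running maxima of the exhausting family; they stay in \<open>C(D)\<close> and
    increase to \<open>d\<close>.\<close>
  define mx where "mx = rec_nat (e 0) (\<lambda>k p. restrict (\<lambda>s. max (p s) (e (Suc k) s)) \<Omega>)"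
  have mx0: "mx 0 = e 0" and mxS: "mx (Suc k) = restrict (\<lambda>s. max (mx k s) (e (Suc k) s)) \<Omega>" for k
    by (simp_all add: mx_def)
  have mxCD: "mx k \<in> CD" for k
  proof (induction k)
    case (Suc k)
    obtain a b where ab: "\<forall>s\<in>\<Omega>. \<bar>mx k s\<bar> \<le> a * wt s" "a \<ge> 0" "\<forall>s\<in>\<Omega>. \<bar>e (Suc k) s\<bar> \<le> b * wt s" "b \<ge> 0"
      using C_D(2)[OF CD_C[OF Suc]] C_D(2)[OF CD_C[OF eCD[of "Suc k"]]] by blast
    have "mx (Suc k) \<in> C"
      unfolding mxS
    proof (rule C_I[where c="a + b"])
      show "continuous_map X euclideanreal (\<lambda>s. max (mx k s) (e (Suc k) s))"
        by (intro continuous_map_real_max C_D(1)[OF CD_C[OF Suc]] C_D(1)[OF CD_C[OF eCD]])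
      fix s assume s: "s \<in> \<Omega>"
      then have "\<bar>mx k s\<bar> \<le> a * wt s" "\<bar>e (Suc k) s\<bar> \<le> b * wt s" "0 \<le> a * wt s" "0 \<le> b * wt s"
        using ab wt_ge1[OF s] by auto
      then show "\<bar>max (mx k s) (e (Suc k) s)\<bar> \<le> (a + b) * wt s" unfolding distrib_right by linarith
    qed
    moreover have "mx (Suc k) s \<in> D s" if s: "s \<in> \<Omega>" for s
      using CD_D[OF Suc s] CD_D[OF eCD[of "Suc k"] s] s unfolding mxS by (simp add: max_def)
    ultimately show ?case unfolding wC_sel_def by blast
  qed (simp add: mx0 eCD)
  have mx_mono: "mx k s \<le> mx (Suc k) s" "e (Suc k) s \<le> mx (Suc k) s" if "s \<in> \<Omega>" for k s
    using that unfolding mxS by simp_all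
  have mx_le: "mx i s \<le> mx k s" if "s \<in> \<Omega>" "i \<le> k" for i k s
    using lift_Suc_mono_le[of "\<lambda>k. mx k s", OF mx_mono(1)[OF that(1)] that(2)] .
  have e_mx: "e k s \<le> mx k s" if "s \<in> \<Omega>" for k s
    by (cases k) (use mx_mono(2)[OF that] in \<open>auto simp: mx0\<close>)
  have mxK: "- K * wt s \<le> mx k s" if "s \<in> \<Omega>" for k s
    using eK[OF that, of k] e_mx[OF that, of k] by linarith
  \<comment> \<open>The slack \<open>wt / (k + 1)\<close> moves \<open>mx k\<close> from
    \<open>C(D)\<close> into the domain of \<open>H\<close>. It also makes \<open>B k\<close>
    strictly smaller than \<open>mx k\<close>, so that \<open>h (B k s) s\<close> is below infinity
    at every point.\<close>
  define B where "B = (\<lambda>k. restrict (\<lambda>s. mx k s - (1 / Suc k) * wt s) \<Omega>)"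
  have BC: "B k \<in> C" and BH: "H (B k) < \<infinity>" for k
    using H_slack[OF mxCD, of "1 / real (Suc k)" k] unfolding B_def by simp_all
  have inv_mono: "1 / real (Suc k) \<le> 1 / real (Suc i)" if "i \<le> k" for i k using that by (simp add: frac_le)
  have B_mono: "B i s \<le> B k s" if s: "s \<in> \<Omega>" and "i \<le> k" for i k s
  proof -
    have "(1 / real (Suc k)) * wt s \<le> (1 / real (Suc i)) * wt s"
      using inv_mono[OF that(2)] wt_ge1[OF s] by (intro mult_right_mono) auto
    then show ?thesis using mx_le[OF that] s unfolding B_def by simp
  qed
  have Bmx: "B k s \<le> mx k s" if s: "s \<in> \<Omega>" for k s using s wt_ge1[OF s] unfolding B_def by simp
  have Bd: "ereal (B k s) \<le> d s" if s: "s \<in> \<Omega>" for k s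
    using D_iff[OF s] D_down[OF s CD_D[OF mxCD s] Bmx[OF s]] by blast
  \<comment> \<open>The lower barriers tend to \<open>-\<infinity>\<close>, so every rational
    eventually lies above them. As \<open>mx k \<ge> - K * wt\<close> and the slack is at most
    \<open>wt\<close>, the constant \<open>K + 1 + k\<close> puts \<open>A k\<close> below
    \<open>B k\<close>.\<close>
  define A where "A = (\<lambda>k. restrict (\<lambda>s. - (K + 1 + real k) * wt s) \<Omega>)"
  have AC: "A k \<in> C" for k
    unfolding A_def
  proof (rule C_I[where c="K + 1 + real k"])
    show "continuous_map X euclideanreal (\<lambda>s. - (K + 1 + real k) * wt s)"
      by (intro continuous_map_real_mult_left wt_cont)
    show "\<bar>- (K + 1 + real k) * wt s\<bar> \<le> (K + 1 + real k) * wt s" if "s \<in> \<Omega>" for s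
      using wt_ge1[OF that] K(1) by (simp add: abs_mult)
  qed
  have A_mono: "A k s \<le> A i s" if s: "s \<in> \<Omega>" and "i \<le> k" for i k s
    using that wt_ge1[OF s] unfolding A_def by (simp add: mult_right_mono)
  have AB: "A k s \<le> B k s" if s: "s \<in> \<Omega>" for k s
  proof -
    have "(1 / real (Suc k)) * wt s \<le> 1 * wt s" using wt_ge1[OF s] by (intro mult_right_mono) auto
    moreover have "- (K + 1 + real k) * wt s = - K * wt s - 1 * wt s - real k * wt s" by (simp add: algebra_simps)
    moreover have "0 \<le> real k * wt s" using wt_ge1[OF s] by simp
    ultimately show ?thesis using mxK[OF s, of k] s unfolding A_def B_def by simp
  qed
  have measC: "u \<in> borel_measurable \<mu>" if "u \<in> C" for u by (rule cont_meas[OF C_D(1)[OF that] mu_sets])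
  \<comment> \<open>The index \<open>j\<close> codes a rational and a barrier number
    \<open>i \<le> j\<close>; the candidate is that rational clamped into \<open>[A i, B i]\<close>.
    So the candidates with \<open>j \<le> k\<close> all fit between \<open>A k\<close> and
    \<open>B k\<close>.\<close>
  define cand where "cand = (\<lambda>j s. max (A (snd (prod_decode j)) s)
      (min (of_rat (from_nat (fst (prod_decode j)))) (B (snd (prod_decode j)) s)))"
  have candm: "cand j \<in> borel_measurable \<mu>" for j
    unfolding cand_def using measC[OF AC] measC[OF BC] by (intro borel_measurable_max borel_measurable_min) auto
  have cand_between: "A k s \<le> cand j s \<and> cand j s \<le> B k s" if s: "s \<in> \<Omega>" and jk: "j \<le> k" for j k s
  proof -
    let ?i = "snd (prod_decode j)"
    have "?i \<le> prod_encode (fst (prod_decode j), ?i)" by (rule le_prod_encode_2)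
    then have "?i \<le> k" using jk by simp
    then have "A k s \<le> A ?i s" "B ?i s \<le> B k s" "A ?i s \<le> B ?i s" using A_mono[OF s] B_mono[OF s] AB[OF s] by auto
    then show ?thesis unfolding cand_def by auto
  qed
  define val where "val = (\<lambda>v s. v * y s - hr v s)"
  have valm: "(\<lambda>s. val (w s) s) \<in> borel_measurable \<mu>" if "w \<in> borel_measurable \<mu>" for w
    unfolding val_def using that ym hr_meas[OF mu_sets that] by measurable
  \<comment> \<open>A pointwise choice of the best among the candidates \<open>0, ..., k\<close>;
    finitely many comparisons keep it measurable.\<close>
  define wk where "wk = rec_nat (cand 0) (\<lambda>k p s. if val (p s) s < val (cand (Suc k) s) s then cand (Suc k) s else p s)"
  have wk0: "wk 0 = cand 0" and wkS: "wk (Suc k) = (\<lambda>s. if val (wk k s) s < val (cand (Suc k) s) s then cand (Suc k) s else wk k s)" for k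
    unfolding wk_def by simp_all
  have wkm: "wk k \<in> borel_measurable \<mu>" for k
  proof (induction k)
    case (Suc k)
    have "{s \<in> space \<mu>. val (wk k s) s < val (cand (Suc k) s) s} \<in> sets \<mu>"
      using valm[OF Suc] valm[OF candm] by measurable
    then show ?case unfolding wkS using Suc candm by (intro measurable_If) auto
  qed (simp add: wk0 candm)
  have wk_between: "A k s \<le> wk k s \<and> wk k s \<le> B k s" if s: "s \<in> \<Omega>" for k s
  proof (induction k)
    case (Suc k)
    have "A (Suc k) s \<le> A k s" "B k s \<le> B (Suc k) s" using A_mono[OF s] B_mono[OF s] by auto
    then show ?case using Suc cand_between[OF s, of "Suc k" "Suc k"] unfolding wkS by auto
  qed (use cand_between[OF s, of 0 0] in \<open>simp add: wk0\<close>)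
  define f where "f = (\<lambda>k s. val (wk k s) s)"
  have f_Suc: "f k s \<le> f (Suc k) s" "val (cand (Suc k) s) s \<le> f (Suc k) s" for k s
    unfolding f_def wkS by auto
  have f_mono: "f i s \<le> f k s" if "i \<le> k" for i k s
    using lift_Suc_mono_le[of "\<lambda>k. f k s", OF f_Suc(1) that] .
  have cand_f: "val (cand k s) s \<le> f k s" for k s
    by (cases k) (use f_Suc(2) in \<open>auto simp: f_def wk0\<close>)
  define bN where "bN = (\<lambda>k s. indicator N s * B k s)"
  have core: "integrable \<mu> (f k)" "(\<integral>s. f k s \<partial>\<mu>) + (\<integral>s. bN k s \<partial>M) \<le> c" for k
    unfolding f_def val_def bN_def
    by (rule conj_core[OF M dec c AC BC BH wkm wk_between]; assumption)+
  have bNi: "integrable M (bN k)" for k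
    using integrable_mult_indicator[OF NM C_integrable[OF BC coupling_sets[OF M] wtM], of k] by (simp add: bN_def)
  have bN_mono: "bN k s \<le> bN (Suc k) s" if "s \<in> space M" for k s
    unfolding bN_def using B_mono[of s k "Suc k"] that spM by (intro mult_left_mono) auto
  define F where "F = (\<lambda>k. \<integral>s. f k s \<partial>\<mu>)"
  define G where "G = (\<lambda>k. \<integral>s. bN k s \<partial>M)"
  have FG: "F k + G k \<le> c" for k using core(2) unfolding F_def G_def .
  have Finc: "incseq F" unfolding F_def by (intro incseq_SucI integral_mono core f_Suc)
  have Ginc: "incseq G" unfolding G_def by (intro incseq_SucI integral_mono bNi bN_mono)
  \<comment> \<open>Only the sum is bounded by \<open>c\<close>; each term inherits a bound because
    the other never falls below its initial value.\<close>
  have "F k \<le> c - G 0" for k using FG[of k] incseqD[OF Ginc, of 0 k] by simp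
  then obtain l1 where l1: "F \<longlonglongrightarrow> l1" "\<And>k. F k \<le> l1" using incseq_convergent[OF Finc] by metis
  have "G k \<le> c - F 0" for k using FG[of k] incseqD[OF Finc, of 0 k] by simp
  then obtain l2 where l2: "G \<longlonglongrightarrow> l2" "\<And>k. G k \<le> l2" using incseq_convergent[OF Ginc] by metis
  have l12: "l1 + l2 \<le> c" by (rule LIMSEQ_le_const2[OF tendsto_add[OF l1(1) l2(1)]]) (use FG in auto)
  obtain g1 where g1: "integrable \<mu> g1" "AE s in \<mu>. (\<lambda>k. f k s) \<longlonglongrightarrow> g1 s" "(\<integral>s. g1 s \<partial>\<mu>) \<le> l1"
    by (rule bounded_monotone_integrals[of \<mu> f l1])
       (use core(1) f_Suc(1) l1(2)[unfolded F_def] in \<open>blast+\<close>)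
  obtain g2 where g2: "integrable M g2" "AE s in M. (\<lambda>k. bN k s) \<longlonglongrightarrow> g2 s" "(\<integral>s. g2 s \<partial>M) \<le> l2"
    by (rule bounded_monotone_integrals[of M bN l2])
       (use bNi bN_mono l2(2)[unfolded G_def] in \<open>blast+\<close>)
  have exhaust: "\<exists>i0. \<forall>i\<ge>i0. a \<le> B i s" if s: "s \<in> \<Omega>" and a: "ereal a < d s" for s a
  proof -
    obtain b where b: "ereal a < ereal b" "ereal b < d s" using a ereal_dense2 by blast
    obtain i1 where i1: "b < e i1 s" using ed[OF s b(2)] by blast
    have ba: "b - a > 0" using b(1) by simp
    have "(\<lambda>k. inverse (real (Suc k)) * wt s) \<longlonglongrightarrow> 0 * wt s" by (intro tendsto_intros LIMSEQ_inverse_real_of_nat)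
    then have "\<forall>\<^sub>F k in sequentially. inverse (real (Suc k)) * wt s < b - a" using ba by (intro order_tendstoD(2)) auto
    then obtain i2 where i2: "\<And>k. k \<ge> i2 \<Longrightarrow> inverse (real (Suc k)) * wt s < b - a" unfolding eventually_sequentially by blast
    have "a \<le> B i s" if i: "i \<ge> max i1 i2" for i
    proof -
      have "b \<le> mx i s" using i1 e_mx[OF s, of i1] mx_le[OF s, of i1 i] i by linarith
      moreover have "(1 / real (Suc i)) * wt s < b - a" using i2[of i] i by (simp add: inverse_eq_divide)
      ultimately show ?thesis using s unfolding B_def by simp
    qed
    then show ?thesis by blast
  qed
  have conj: "AE s in \<mu>. integrand_conj h (y s) s = ereal (g1 s)"
    using g1(2) h_proper AE_space
  proof eventually_elim
    case (elim s)
    then have s: "s \<in> \<Omega>" by (simp add: space_mu)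
    have f_le: "f k s \<le> g1 s" for k
      by (rule incseq_le[OF _ elim(1)]) (auto intro: incseq_SucI f_Suc)
    have fin: "h (B k s) s < \<infinity>" for k
    proof -
      have "B k s < mx k s" using s wt_ge1[OF s] unfolding B_def by simp
      then show ?thesis by (rule D_finite[OF s CD_D[OF mxCD s]])
    qed
    have q_le: "val (of_rat q) s \<le> g1 s" if q: "ereal (of_rat q) < d s" for q :: rat
    proof -
      obtain i0 where i0: "\<And>i. i \<ge> i0 \<Longrightarrow> of_rat q \<le> B i s" using exhaust[OF s q] by blast
      obtain i1 :: nat where i1: "\<bar>of_rat q\<bar> \<le> real i1" using real_arch_simple by blast
      define i where "i = max i0 i1"
      have "A i s \<le> of_rat q"
      proof -
        have "real i * 1 \<le> (K + 1 + real i) * wt s" using K(1) wt_ge1[OF s] by (intro mult_mono) auto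
        moreover have "real i1 \<le> real i" by (simp add: i_def)
        moreover have "A i s = - ((K + 1 + real i) * wt s)"
          using s unfolding A_def by (simp only: restrict_apply if_True mult_minus_left)
        ultimately show ?thesis using i1 by linarith
      qed
      moreover have "of_rat q \<le> B i s" by (rule i0) (simp add: i_def)
      ultimately have "cand (prod_encode (to_nat q, i)) s = of_rat q" unfolding cand_def by simp
      then show ?thesis using cand_f[of "prod_encode (to_nat q, i)" s] f_le[of "prod_encode (to_nat q, i)"] by simp
    qed
    show ?case
    proof (rule antisym)
      show "integrand_conj h (y s) s \<le> ereal (g1 s)"
        unfolding integrand_conj_def
      proof (rule SUP_least)
        fix v
        show "ereal (v * y s) - h v s \<le> ereal (g1 s)"
        proof (cases "h v s < \<infinity>")
          case True
          have hv: "h v s = ereal (hr v s)" using hr_eq elim(2) True by blast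
          have vd: "ereal v \<le> d s" using D_iff[OF s] dom_D[OF True] by blast
          \<comment> \<open>A rational strictly below \<open>v\<close> is strictly below
            \<open>d s\<close> and hence occurs unclamped among the candidates.
            \<open>\<delta>\<close> makes the loss in the linear term at most
            \<open>\<epsilon>\<close>; the summand 1 covers the case \<open>y s = 0\<close>.\<close>
          have "v * y s - hr v s \<le> g1 s"
          proof (rule field_le_epsilon)
            fix \<epsilon> :: real assume \<epsilon>: "\<epsilon> > 0"
            define \<delta> where "\<delta> = \<epsilon> / (\<bar>y s\<bar> + 1)"
            have \<delta>: "\<delta> > 0" unfolding \<delta>_def using \<epsilon> by simp
            obtain q where q: "v - \<delta> < of_rat q" "of_rat q < v" using of_rat_dense[of "v - \<delta>" v] \<delta> by auto
            have "ereal (of_rat q) < d s" using q(2) vd less_le_trans[of "ereal (of_rat q)" "ereal v" "d s"] by simp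
            then have "of_rat q * y s - hr (of_rat q) s \<le> g1 s" using q_le unfolding val_def by blast
            moreover have "hr (of_rat q) s \<le> hr v s" by (rule hr_mono[OF s elim(2) True]) (use q in simp)
            moreover have "(v - of_rat q) * y s \<le> \<epsilon>"
            proof -
              have "(v - of_rat q) * y s \<le> (v - of_rat q) * (\<bar>y s\<bar> + 1)" using q by (intro mult_left_mono) auto
              also have "\<dots> \<le> \<delta> * (\<bar>y s\<bar> + 1)" using q by (intro mult_right_mono) auto
              also have "\<dots> = \<epsilon>" unfolding \<delta>_def by simp
              finally show ?thesis .
            qed
            ultimately show "v * y s - hr v s \<le> g1 s + \<epsilon>" by (simp add: left_diff_distrib)
          qed
          then show ?thesis unfolding hv by simp
        qed simp
      qed
      have "f k s \<le> g1 s" for k by (rule f_le)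
      have fc: "ereal (f k s) \<le> integrand_conj h (y s) s" for k
      proof -
        have "h (wk k s) s \<le> h (B k s) s" using wk_between[OF s] by (intro h_le[OF s]) blast
        then have "h (wk k s) s < \<infinity>" using fin[of k] by (rule le_less_trans)
        then have hw: "h (wk k s) s = ereal (hr (wk k s) s)" using hr_eq elim(2) by blast
        have "ereal (wk k s * y s) - h (wk k s) s \<le> integrand_conj h (y s) s"
          unfolding integrand_conj_def by (rule SUP_upper[of _ UNIV "\<lambda>u. ereal (u * y s) - h u s"]) simp
        then show ?thesis unfolding hw f_def val_def by simp
      qed
      have "(\<lambda>k. ereal (f k s)) \<longlonglongrightarrow> ereal (g1 s)" using elim(1) by simp
      then show "ereal (g1 s) \<le> integrand_conj h (y s) s"
        by (rule LIMSEQ_le_const2) (use fc in blast)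
    qed
  qed
  then show eq: "AE s in \<mu>. integrand_conj h (y s) s = ereal (kap (y s) s)"
    by eventually_elim (simp add: kap_def)
  have kg: "AE s in \<mu>. g1 s = kap (y s) s" using conj by eventually_elim (simp add: kap_def)
  have km: "(\<lambda>s. kap (y s) s) \<in> borel_measurable \<mu>"
    unfolding kap_def using conj_meas[OF ym] by measurable
  show "integrable \<mu> (\<lambda>s. kap (y s) s)"
    using integrable_cong_AE[OF borel_measurable_integrable[OF g1(1)] km kg] g1(1) by simp
  have kI: "(\<integral>s. kap (y s) s \<partial>\<mu>) = (\<integral>s. g1 s \<partial>\<mu>)"
    using integral_cong_AE[OF borel_measurable_integrable[OF g1(1)] km kg] by simp
  have dN: "AE s in M. (s \<in> N \<longrightarrow> d s = ereal (g2 s)) \<and> (s \<notin> N \<longrightarrow> g2 s = 0)"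
    using g2(2) AE_space
  proof eventually_elim
    case (elim s)
    then have s: "s \<in> \<Omega>" by (simp add: spM)
    show ?case
    proof (intro conjI impI)
      assume sN: "s \<in> N"
      have lim: "(\<lambda>k. B k s) \<longlonglongrightarrow> g2 s" using elim(1) sN by (simp add: bN_def)
      show "d s = ereal (g2 s)"
      proof (rule antisym)
        show "d s \<le> ereal (g2 s)"
        proof (rule ccontr)
          assume "\<not> ?thesis"
          then have "ereal (g2 s) < d s" by simp
          then obtain a where a: "ereal (g2 s) < ereal a" "ereal a < d s" using ereal_dense2 by blast
          obtain i0 where "\<And>i. i \<ge> i0 \<Longrightarrow> a \<le> B i s" using exhaust[OF s a(2)] by blast
          then have "a \<le> g2 s" using lim by (intro LIMSEQ_le_const[OF lim]) blast
          then show False using a(1) by simp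
        qed
        have "(\<lambda>k. ereal (B k s)) \<longlonglongrightarrow> ereal (g2 s)" using lim by simp
        then show "ereal (g2 s) \<le> d s" by (rule LIMSEQ_le_const2) (use Bd[OF s] in blast)
      qed
    next
      assume "s \<notin> N"
      then have "(\<lambda>k. 0) \<longlonglongrightarrow> g2 s" using elim(1) by (simp add: bN_def)
      then show "g2 s = 0" by (simp add: LIMSEQ_const_iff)
    qed
  qed
  then show "AE s in M. s \<in> N \<longrightarrow> d s = ereal (real_of_ereal (d s))"
    by eventually_elim auto
  have dg: "AE s in M. g2 s = indicator N s * real_of_ereal (d s)"
    using dN by eventually_elim (auto simp: indicator_def)
  have dm: "(\<lambda>s. indicator N s * real_of_ereal (d s)) \<in> borel_measurable M"
    using NM d_meas[OF coupling_sets[OF M]] by measurable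
  show "integrable M (\<lambda>s. indicator N s * real_of_ereal (d s))"
    using integrable_cong_AE[OF borel_measurable_integrable[OF g2(1)] dm dg] g2(1) by simp
  have dI: "(\<integral>s. indicator N s * real_of_ereal (d s) \<partial>M) = (\<integral>s. g2 s \<partial>M)"
    using integral_cong_AE[OF borel_measurable_integrable[OF g2(1)] dm dg] by simp
  show "(\<integral>s. kap (y s) s \<partial>\<mu>) + (\<integral>s. indicator N s * real_of_ereal (d s) \<partial>M) \<le> c"
    unfolding kI dI using g1(3) g2(3) l12 by linarith
qed

end

section \<open>Finite signed measures\<close>

lemma sets_pos_var [simp]: "sets (pos_var M \<nu>) = sets M"
  unfolding pos_var_def by (simp add: sets.space_closed)

lemma space_pos_var [simp]: "space (pos_var M \<nu>) = space M"
  unfolding pos_var_def by (simp add: sets.space_closed)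

lemma sets_neg_var [simp]: "sets (neg_var M \<nu>) = sets M" by (simp add: neg_var_def)

lemma space_neg_var [simp]: "space (neg_var M \<nu>) = space M" by (simp add: neg_var_def)

lemma total_var_msum: "total_var M \<nu> = msum (pos_var M \<nu>) (neg_var M \<nu>)"
  by (simp add: total_var_def msum_def)

lemma signed_measure_uminus: "signed_measure M \<nu> \<Longrightarrow> signed_measure M (\<lambda>A. - \<nu> A)"
  unfolding signed_measure_def by (auto intro: sums_minus)

lemma signed_measure_sums:
  "signed_measure M \<nu> \<Longrightarrow> range A \<subseteq> sets M \<Longrightarrow> disjoint_family A \<Longrightarrow> (\<lambda>i::nat. \<nu> (A i)) sums \<nu> (\<Union>i. A i)"
  unfolding signed_measure_def by blast

lemma signed_measure_empty: "signed_measure M \<nu> \<Longrightarrow> \<nu> {} = 0"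
  unfolding signed_measure_def by blast

lemma signed_measure_Un:
  assumes "signed_measure M \<nu>" "A \<in> sets M" "B \<in> sets M" "A \<inter> B = {}"
  shows "\<nu> (A \<union> B) = \<nu> A + \<nu> B"
proof -
  have "(\<lambda>i. \<nu> (binaryset A B i)) sums \<nu> (\<Union>i. binaryset A B i)"
    by (rule signed_measure_sums[OF assms(1)])
       (use assms(2-4) in \<open>auto simp: range_binaryset_eq disjoint_family_on_def binaryset_def\<close>)
  moreover have "(\<lambda>i. \<nu> (binaryset A B i)) sums (\<nu> A + \<nu> B)"
    by (rule binaryset_sums) (rule signed_measure_empty[OF assms(1)])
  ultimately show ?thesis using sums_unique2 by (metis UN_binaryset_eq)
qed

text \<open>The formula becomes usable once the supremum is known to be countably additive. A subset
  of the union is cut along the sets \<open>A i\<close>; conversely, subsets of disjoint sets are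
  united. Since \<open>ennreal\<close> sends negative values to 0, pieces of negative
  \<open>\<nu>\<close> simply do not contribute.\<close>

lemma emeasure_pos_var:
  assumes \<nu>: "signed_measure M \<nu>" and A: "A \<in> sets M"
  shows "emeasure (pos_var M \<nu>) A = (SUP B\<in>{B \<in> sets M. B \<subseteq> A}. ennreal (\<nu> B))"
proof -
  define p where "p = (\<lambda>A. SUP B\<in>{B \<in> sets M. B \<subseteq> A}. ennreal (\<nu> B))"
  have p_eq: "p A = (SUP B\<in>{B \<in> sets M. B \<subseteq> A}. ennreal (\<nu> B))" for A by (simp add: p_def)
  have upper: "ennreal (\<nu> B) \<le> p A" if "B \<in> sets M" "B \<subseteq> A" for A B
    unfolding p_def by (rule SUP_upper) (use that in simp)
  have "positive (sets M) p"
    unfolding positive_def p_def using signed_measure_empty[OF \<nu>] by simp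
  moreover have "countably_additive (sets M) p"
  proof (rule countably_additiveI)
    fix A :: "nat \<Rightarrow> _" assume A: "range A \<subseteq> sets M" "disjoint_family A" "(\<Union>i. A i) \<in> sets M"
    have As: "A i \<in> sets M" for i using A(1) by blast
    show "(\<Sum>i. p (A i)) = p (\<Union>i. A i)"
    proof (rule antisym)
      show "p (\<Union>i. A i) \<le> (\<Sum>i. p (A i))"
        unfolding p_eq[of "\<Union>i. A i"]
      proof (rule SUP_least)
        fix B assume "B \<in> {B \<in> sets M. B \<subseteq> (\<Union>i. A i)}"
        then have B: "B \<in> sets M" "B \<subseteq> (\<Union>i. A i)" by auto
        have "(\<lambda>i. \<nu> (B \<inter> A i)) sums \<nu> (\<Union>i. B \<inter> A i)"
        proof (rule signed_measure_sums[OF \<nu>])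
          show "range (\<lambda>i. B \<inter> A i) \<subseteq> sets M" using B As by auto
          have dj: "A i \<inter> A j = {}" if "i \<noteq> j" for i j
            using A(2) that unfolding disjoint_family_on_def by blast
          show "disjoint_family (\<lambda>i. B \<inter> A i)"
            unfolding disjoint_family_on_def
          proof (intro ballI impI)
            fix i j :: nat assume "i \<noteq> j"
            then show "(B \<inter> A i) \<inter> (B \<inter> A j) = {}" using dj[of i j] by blast
          qed
        qed
        also have "(\<Union>i. B \<inter> A i) = B" using B(2) by auto
        finally have "(\<lambda>n. ennreal (\<Sum>i<n. \<nu> (B \<inter> A i))) \<longlonglongrightarrow> ennreal (\<nu> B)"
          unfolding sums_def by (intro tendsto_ennrealI)
        then show "ennreal (\<nu> B) \<le> (\<Sum>i. p (A i))"
        proof (rule LIMSEQ_le_const2, intro exI allI impI)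
          fix n
          have "ennreal (\<Sum>i<n. \<nu> (B \<inter> A i)) \<le> ennreal (\<Sum>i<n. max 0 (\<nu> (B \<inter> A i)))"
            by (intro ennreal_leI sum_mono) auto
          also have "\<dots> = (\<Sum>i<n. ennreal (max 0 (\<nu> (B \<inter> A i))))" by (rule sum_ennreal[symmetric]) auto
          also have "\<dots> = (\<Sum>i<n. ennreal (\<nu> (B \<inter> A i)))"
            by (rule sum.cong) (auto simp: max_def ennreal_neg)
          also have "\<dots> \<le> (\<Sum>i<n. p (A i))"
            by (intro sum_mono upper) (use B As in auto)
          also have "\<dots> \<le> (\<Sum>i. p (A i))" by (rule sum_le_suminf) auto
          finally show "ennreal (\<Sum>i<n. \<nu> (B \<inter> A i)) \<le> (\<Sum>i. p (A i))" .
        qed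
      qed
      have fin: "(\<Sum>i<n. p (A i)) \<le> p (\<Union>i<n. A i)" for n
      proof (induction n)
        case (Suc n)
        have two: "p E + p F \<le> p (E \<union> F)" if EF: "E \<in> sets M" "F \<in> sets M" "E \<inter> F = {}" for E F
        proof -
          have *: "ennreal (\<nu> B) + ennreal (\<nu> B') \<le> p (E \<union> F)" if B: "B \<in> sets M" "B \<subseteq> E" "B' \<in> sets M" "B' \<subseteq> F" for B B'
          proof -
            have e: "\<nu> (B \<union> B') = \<nu> B + \<nu> B'" by (rule signed_measure_Un[OF \<nu>]) (use B EF in auto)
            have "ennreal (\<nu> (B \<union> B')) \<le> p (E \<union> F)" "ennreal (\<nu> B) \<le> p (E \<union> F)" "ennreal (\<nu> B') \<le> p (E \<union> F)"
              by (intro upper; use B in blast)+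
            then show ?thesis unfolding e
              by (cases "\<nu> B \<ge> 0"; cases "\<nu> B' \<ge> 0") (auto simp: ennreal_neg)
          qed
          have ne: "{B \<in> sets M. B \<subseteq> E} \<noteq> {}" "{B \<in> sets M. B \<subseteq> F} \<noteq> {}" by blast+
          have 1: "ennreal (\<nu> B) + p F \<le> p (E \<union> F)" if "B \<in> sets M" "B \<subseteq> E" for B
          proof -
            have "ennreal (\<nu> B) + p F = (SUP B'\<in>{B \<in> sets M. B \<subseteq> F}. ennreal (\<nu> B) + ennreal (\<nu> B'))"
              unfolding p_eq[of F] by (rule ennreal_SUP_add_right[OF ne(2)])
            also have "\<dots> \<le> p (E \<union> F)" by (rule SUP_least) (use * that in auto)
            finally show ?thesis .
          qed
          have "p E + p F = (SUP B\<in>{B \<in> sets M. B \<subseteq> E}. ennreal (\<nu> B) + p F)"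
            unfolding p_eq[of E] by (rule ennreal_SUP_add_left[OF ne(1), symmetric])
          also have "\<dots> \<le> p (E \<union> F)" by (rule SUP_least) (use 1 in auto)
          finally show ?thesis .
        qed
        have "(\<Sum>i<Suc n. p (A i)) \<le> p (\<Union>i<n. A i) + p (A n)" using Suc by (simp add: add_right_mono)
        also have "\<dots> \<le> p ((\<Union>i<n. A i) \<union> A n)"
        proof (rule two)
          show "(\<Union>i<n. A i) \<inter> A n = {}"
          proof -
            have "A i \<inter> A n = {}" if "i < n" for i
              using that by (intro disjoint_family_onD[OF A(2)]) auto
            then show ?thesis by blast
          qed
          show "(\<Union>i<n. A i) \<in> sets M" by (intro sets.countable_UN') (auto simp: As)
          show "A n \<in> sets M" by (rule As)
        qed
        also have "(\<Union>i<n. A i) \<union> A n = (\<Union>i<Suc n. A i)" by (auto simp: less_Suc_eq)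
        finally show ?case .
      qed simp
      have "p (\<Union>i<n. A i) \<le> p (\<Union>i. A i)" for n
        unfolding p_def by (rule SUP_subset_mono) auto
      note mono = this
      show "(\<Sum>i. p (A i)) \<le> p (\<Union>i. A i)"
        by (rule suminf_le_const) (simp, rule order_trans[OF fin mono])
    qed
  qed
  ultimately show ?thesis
    unfolding pos_var_def p_def[symmetric] p_eq[symmetric] using A by (intro emeasure_measure_of_sigma sets.sigma_algebra_axioms)
qed

lemma emeasure_neg_var:
  "signed_measure M \<nu> \<Longrightarrow> A \<in> sets M \<Longrightarrow> emeasure (neg_var M \<nu>) A = (SUP B\<in>{B \<in> sets M. B \<subseteq> A}. ennreal (- \<nu> B))"
  unfolding neg_var_def by (rule emeasure_pos_var[OF signed_measure_uminus])

text \<open>For \<open>B \<subseteq> A\<close>, the value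
  \<open>\<nu> B = \<nu> A - \<nu> (A - B)\<close> is at most \<open>\<nu> A\<close> plus the
  negative variation of \<open>A\<close>. The supremum over \<open>B\<close> gives one inequality,
  and the same argument for \<open>- \<nu>\<close> gives the other.\<close>

lemma jordan_decomposition:
  assumes \<nu>: "signed_measure M \<nu>" and fp: "finite_measure (pos_var M \<nu>)" and fn: "finite_measure (neg_var M \<nu>)"
    and A: "A \<in> sets M"
  shows "\<nu> A = measure (pos_var M \<nu>) A - measure (neg_var M \<nu>) A"
proof -
  interpret p: finite_measure "pos_var M \<nu>" by fact
  interpret n: finite_measure "neg_var M \<nu>" by fact
  have half: "measure (pos_var M \<mu>) A \<le> \<mu> A + measure (neg_var M \<mu>) A"
    if mu: "signed_measure M \<mu>" and f: "finite_measure (pos_var M \<mu>)" "finite_measure (neg_var M \<mu>)" for \<mu>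
  proof -
    interpret p: finite_measure "pos_var M \<mu>" by fact
    interpret n: finite_measure "neg_var M \<mu>" by fact
    have B: "\<mu> B \<le> \<mu> A + measure (neg_var M \<mu>) A" if B: "B \<in> sets M" "B \<subseteq> A" for B
    proof -
      have "\<mu> (B \<union> (A - B)) = \<mu> B + \<mu> (A - B)" by (rule signed_measure_Un[OF mu]) (use A B in auto)
      moreover have "B \<union> (A - B) = A" using B by auto
      moreover have "ennreal (- \<mu> (A - B)) \<le> emeasure (neg_var M \<mu>) A"
        unfolding emeasure_neg_var[OF mu A] by (rule SUP_upper) (use A B in auto)
      then have "- \<mu> (A - B) \<le> measure (neg_var M \<mu>) A"
        unfolding n.emeasure_eq_measure
        using measure_nonneg[of "neg_var M \<mu>" A] by (auto simp: ennreal_le_iff2)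
      ultimately show ?thesis by simp
    qed
    have nn: "0 \<le> \<mu> A + measure (neg_var M \<mu>) A" using B[of "{}"] signed_measure_empty[OF mu] by simp
    have "emeasure (pos_var M \<mu>) A \<le> ennreal (\<mu> A + measure (neg_var M \<mu>) A)"
      unfolding emeasure_pos_var[OF mu A] by (rule SUP_least) (use B in \<open>auto intro: ennreal_leI\<close>)
    then show ?thesis unfolding p.emeasure_eq_measure using nn by (simp add: ennreal_le_iff)
  qed
  have nn: "neg_var M (\<lambda>A. - \<nu> A) = pos_var M \<nu>" by (simp add: neg_var_def)
  have pn: "pos_var M (\<lambda>A. - \<nu> A) = neg_var M \<nu>" by (simp add: neg_var_def)
  show ?thesis using half[OF \<nu> fp fn] half[OF signed_measure_uminus[OF \<nu>]] fp fn unfolding nn pn by simp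
qed

section \<open>Nonnegative measures as signed measures, and uniqueness of densities\<close>

lemma signed_measure_measure:
  assumes "finite_measure M" "sets M = sets M0"
  shows "signed_measure M0 (measure M)"
proof -
  interpret finite_measure M by fact
  show ?thesis
    unfolding signed_measure_def
  proof (intro conjI allI impI)
    fix A :: "nat \<Rightarrow> _" assume "range A \<subseteq> sets M0" "disjoint_family A"
    then show "(\<lambda>i. measure M (A i)) sums measure M (\<Union>i. A i)"
      using assms(2) by (intro finite_measure_UNION) auto
  next
    fix A assume "A \<notin> sets M0"
    then show "measure M A = 0" using assms(2) by (simp add: measure_notin_sets)
  qed simp
qed

lemma pos_var_measure:
  assumes M: "finite_measure M" "sets M = sets M0"
  shows "pos_var M0 (measure M) = M"
proof (rule measure_eqI)
  interpret finite_measure M by fact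
  fix A assume "A \<in> sets (pos_var M0 (measure M))"
  then have A: "A \<in> sets M0" by simp
  have "emeasure (pos_var M0 (measure M)) A = (SUP B\<in>{B \<in> sets M0. B \<subseteq> A}. ennreal (measure M B))"
    by (rule emeasure_pos_var[OF signed_measure_measure[OF M] A])
  also have "\<dots> = emeasure M A"
  proof (rule antisym)
    show "(SUP B\<in>{B \<in> sets M0. B \<subseteq> A}. ennreal (measure M B)) \<le> emeasure M A"
      using A M(2) by (intro SUP_least) (auto simp: emeasure_eq_measure[symmetric] intro: emeasure_mono)
    show "emeasure M A \<le> (SUP B\<in>{B \<in> sets M0. B \<subseteq> A}. ennreal (measure M B))"
      using A by (intro SUP_upper2[of A]) (auto simp: emeasure_eq_measure)
  qed
  finally show "emeasure (pos_var M0 (measure M)) A = emeasure M A" .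
qed (simp add: M)

lemma neg_var_measure:
  assumes M: "finite_measure M" "sets M = sets M0" and A: "A \<in> sets M0"
  shows "emeasure (neg_var M0 (measure M)) A = 0"
  unfolding emeasure_neg_var[OF signed_measure_measure[OF M] A]
  by (intro SUP_eq_const) (auto simp: ennreal_neg)

lemma total_var_measure:
  assumes M: "finite_measure M" "sets M = sets M0"
  shows "total_var M0 (measure M) = M"
proof (rule measure_eqI)
  fix A assume "A \<in> sets (total_var M0 (measure M))"
  then have A: "A \<in> sets M0" by (simp add: total_var_msum)
  show "emeasure (total_var M0 (measure M)) A = emeasure M A"
    unfolding total_var_msum
    using emeasure_msum[of "pos_var M0 (measure M)" "neg_var M0 (measure M)" A] A neg_var_measure[OF M A]
    by (simp add: pos_var_measure[OF M] M(2))
qed (simp add: total_var_msum M)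

lemma signed_integral_measure:
  assumes M: "finite_measure M" "sets M = sets M0"
  shows "signed_integral M0 (measure M) u = (\<integral>s. u s \<partial>M)"
proof -
  have "AE s in neg_var M0 (measure M). u s = 0"
    by (rule AE_I'[of "space M0"]) (auto simp: null_sets_def neg_var_measure[OF M])
  then have "(\<integral>s. u s \<partial>neg_var M0 (measure M)) = 0" by (rule integral_eq_zero_AE)
  then show ?thesis unfolding signed_integral_def pos_var_measure[OF M] by simp
qed

text \<open>\<open>signed_density\<close> is a choice, so it is determined only almost everywhere:
  two densities of the same set function are compared on the set where one exceeds the
  other.\<close>

lemma signed_density_measure:
  assumes P: "finite_measure P" and f: "integrable P f" "\<And>A. A \<in> sets P \<Longrightarrow> \<nu> A = (\<integral>s\<in>A. f s \<partial>P)"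
  shows "AE s in P. signed_density P \<nu> s = f s"
proof -
  define g where "g = signed_density P \<nu>"
  have "integrable P g \<and> (\<forall>A\<in>sets P. \<nu> A = (\<integral>s\<in>A. g s \<partial>P))"
    unfolding g_def signed_density_def
    by (rule someI[of "\<lambda>f. integrable P f \<and> (\<forall>A\<in>sets P. \<nu> A = (\<integral>s\<in>A. f s \<partial>P))" f]) (use f in blast)
  then have g: "integrable P g" "\<And>A. A \<in> sets P \<Longrightarrow> \<nu> A = (\<integral>s\<in>A. g s \<partial>P)" by auto
  have le: "AE s in P. a s \<le> b s" if a: "integrable P a" and b: "integrable P b"
    and eq: "\<And>A. A \<in> sets P \<Longrightarrow> (\<integral>s\<in>A. a s \<partial>P) = (\<integral>s\<in>A. b s \<partial>P)" for a b :: "_ \<Rightarrow> real"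
  proof -
    define A where "A = {s \<in> space P. b s < a s}"
    have A: "A \<in> sets P" unfolding A_def using a b by measurable
    have iA: "integrable P (\<lambda>s. indicator A s * a s)" "integrable P (\<lambda>s. indicator A s * b s)"
      using integrable_mult_indicator[OF A a] integrable_mult_indicator[OF A b] by simp_all
    have "(\<integral>s. indicator A s * (a s - b s) \<partial>P) = 0"
      using eq[OF A] iA unfolding set_lebesgue_integral_def by (simp add: right_diff_distrib)
    moreover have "integrable P (\<lambda>s. indicator A s * (a s - b s))" using iA by (simp add: right_diff_distrib)
    moreover have "AE s in P. 0 \<le> indicator A s * (a s - b s)" by (rule AE_I2) (auto simp: A_def indicator_def)
    ultimately have "AE s in P. indicator A s * (a s - b s) = 0" by (subst (asm) integral_nonneg_eq_0_iff_AE)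
    then show ?thesis using AE_space by eventually_elim (auto simp: A_def indicator_def split: if_splits)
  qed
  have "AE s in P. g s \<le> f s" by (rule le[OF g(1) f(1)]) (simp only: g(2)[symmetric] f(2)[symmetric])
  moreover have "AE s in P. f s \<le> g s" by (rule le[OF f(1) g(1)]) (simp only: g(2)[symmetric] f(2)[symmetric])
  ultimately have "AE s in P. g s = f s" by eventually_elim simp
  then show ?thesis unfolding g_def .
qed

section \<open>Problem (A) in terms of couplings\<close>

context ot_setup
begin

lemma constrA_I:
  assumes M: "coupling M"
  shows "measure M \<in> constrA T S \<psi> \<mu>"
proof -
  have f: "finite_measure M" "sets M = sets (borel_of X)" using M by (auto simp: coupling_def)
  have "measure M {s \<in> \<Omega>. s t \<in> B} = measure (m t) B" if t: "t \<le> T" and B: "B \<in> sets (borel_of (S t))" for t B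
  proof -
    have "measure (m t) B = measure (distr M (borel_of (S t)) (\<lambda>s. s t)) B" by (simp only: coupling_distr[OF M t])
    also have "\<dots> = measure M ((\<lambda>s. s t) -` B \<inter> space M)" by (rule measure_distr[OF proj_meas[OF t f(2)] B])
    also have "(\<lambda>s. s t) -` B \<inter> space M = {s \<in> \<Omega>. s t \<in> B}" using coupling_space[OF M] by auto
    finally show ?thesis by simp
  qed
  then show ?thesis unfolding constrA_def wM_def
    using signed_measure_measure[OF f] coupling_wt[OF M] by (simp add: total_var_measure[OF f])
qed

lemma objA_coupling:
  assumes M: "coupling M"
  shows "objA X wt \<mu> h (measure M) = (SUP u\<in>C. ereal (\<integral>s. u s \<partial>M) - H u)"
proof -
  have f: "finite_measure M" "sets M = sets (borel_of X)" using M by (auto simp: coupling_def)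
  show ?thesis unfolding objA_def functional_conj_def by (simp add: signed_integral_measure[OF f])
qed

lemma objA_le_iff:
  assumes M: "coupling M"
  shows "objA X wt \<mu> h (measure M) \<le> ereal c \<longleftrightarrow>
    (\<forall>u\<in>C. H u < \<infinity> \<longrightarrow> (\<integral>s. u s \<partial>M) - real_of_ereal (H u) \<le> c)"
proof -
  have "ereal (\<integral>s. u s \<partial>M) - H u \<le> ereal c \<longleftrightarrow> (H u < \<infinity> \<longrightarrow> (\<integral>s. u s \<partial>M) - real_of_ereal (H u) \<le> c)" if u: "u \<in> C" for u
  proof (cases "H u < \<infinity>")
    case True
    then show ?thesis using H_fin(3)[OF u True] by simp
  next
    case False
    then have "H u = \<infinity>" by simp
    then show ?thesis by simp
  qed
  then show ?thesis unfolding objA_coupling[OF M] SUP_le_iff by blast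
qed

lemma objA_gt_MInf:
  assumes M: "coupling M"
  shows "objA X wt \<mu> h (measure M) > -\<infinity>"
proof -
  obtain u where u: "u \<in> C" "H u < \<infinity>" using H_proper by blast
  have "ereal (\<integral>s. u s \<partial>M) - H u \<le> objA X wt \<mu> h (measure M)"
    unfolding objA_coupling[OF M] by (rule SUP_upper[OF u(1)])
  moreover have "ereal (\<integral>s. u s \<partial>M) - H u > -\<infinity>" unfolding H_fin(3)[OF u] by simp
  ultimately show ?thesis by (rule less_le_trans[rotated])
qed

text \<open>If a continuous \<open>f\<close> with values in \<open>[0, 1]\<close> had a negative
  integral under \<open>\<nu>\<close>, then along \<open>u0 - k * f\<close> the linear term would
  grow without bound while \<open>H\<close> does not increase, and the objective would be infinite.
  Hence \<open>\<nu>\<close> is nonnegative.\<close>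

lemma feasible_A_coupling:
  assumes \<nu>: "\<nu> \<in> constrA T S \<psi> \<mu>" and fin: "objA X wt \<mu> h \<nu> < \<infinity>"
  shows "\<exists>M. coupling M \<and> \<nu> = measure M"
proof -
  let ?B = "borel_of X"
  have sm: "signed_measure ?B \<nu>" and it: "integrable (total_var ?B \<nu>) wt"
    and marg: "\<And>t B. t \<le> T \<Longrightarrow> B \<in> sets (borel_of (S t)) \<Longrightarrow> \<nu> {s \<in> \<Omega>. s t \<in> B} = measure (m t) B"
    using \<nu> by (auto simp: constrA_def wM_def)
  let ?p = "pos_var ?B \<nu>" and ?n = "neg_var ?B \<nu>"
  \<comment> \<open>Because \<open>wt \<ge> 1\<close>, integrability of the weight bounds the total
    variation.\<close>
  have ft: "finite_measure (total_var ?B \<nu>)"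
  proof
    have "emeasure (total_var ?B \<nu>) (space (total_var ?B \<nu>)) = (\<integral>\<^sup>+s. 1 \<partial>total_var ?B \<nu>)" by simp
    also have "\<dots> \<le> (\<integral>\<^sup>+s. ennreal (wt s) \<partial>total_var ?B \<nu>)"
    proof (rule nn_integral_mono)
      fix s assume "s \<in> space (total_var ?B \<nu>)"
      then have "1 \<le> wt s" by (intro wt_ge1) (simp add: total_var_msum)
      then show "1 \<le> ennreal (wt s)" using ennreal_leI by fastforce
    qed
    also have "\<dots> < \<infinity>" using it unfolding real_integrable_def by (auto simp: less_top)
    finally show "emeasure (total_var ?B \<nu>) (space (total_var ?B \<nu>)) \<noteq> \<infinity>" by simp
  qed
  have spn: "sets ?p = sets ?n" by simp
  have le: "?p \<le> total_var ?B \<nu>" "?n \<le> total_var ?B \<nu>"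
    unfolding total_var_msum by (rule le_msum[OF spn]; simp)+
  have wt_nn: "AE s in total_var ?B \<nu>. 0 \<le> wt s"
    by (rule AE_I2) (metis (no_types, lifting) order_trans space_borel_of space_msum space_pos_var total_var_msum wt_ge1 zero_le_one)
  have fin_pn: "finite_measure L \<and> integrable L wt" if L: "L = ?p \<or> L = ?n" for L
  proof
    have leL: "L \<le> total_var ?B \<nu>" using le L by blast
    have sL: "sets L = sets (total_var ?B \<nu>)" using L by (auto simp: total_var_msum)
    have spL: "space L = space (total_var ?B \<nu>)" by (rule sets_eq_imp_space_eq[OF sL])
    have spO: "space L = \<Omega>" using L by auto
    show "finite_measure L"
    proof
      have "emeasure L (space L) \<le> emeasure (total_var ?B \<nu>) (space L)" using leL sL by (subst (asm) le_measure) auto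
      then show "emeasure L (space L) \<noteq> \<infinity>" unfolding spL
        using finite_measure.emeasure_finite[OF ft] by (metis infinity_ennreal_def top.extremum_uniqueI)
    qed
    have i: "integrable (total_var ?B \<nu>) (\<lambda>s. \<bar>wt s\<bar>)" using it by simp
    have "integrable L (\<lambda>s. \<bar>wt s\<bar>)" by (rule integral_mono_measure_nonneg(1)[OF leL sL i]) simp
    then show "integrable L wt"
      by (rule Bochner_Integration.integrable_bound) (use cont_meas[OF wt_cont, of L] L in auto)
  qed
  have fp: "finite_measure ?p" and fn: "finite_measure ?n" and ip: "integrable ?p wt" and neg_int: "integrable ?n wt"
    using fin_pn by auto
  obtain u0 where u0: "u0 \<in> C" "H u0 < \<infinity>" using H_proper by blast
  obtain K where K: "K \<ge> 0" "\<forall>s\<in>\<Omega>. \<bar>u0 s\<bar> \<le> K * wt s" using C_D(2)[OF u0(1)] by blast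
  obtain c where c: "objA X wt \<mu> h \<nu> \<le> ereal c" using fin by (cases "objA X wt \<mu> h \<nu>") auto
  have SI: "signed_integral ?B \<nu> u - real_of_ereal (H u) \<le> c" if u: "u \<in> C" "H u < \<infinity>" for u
  proof -
    have "ereal (signed_integral ?B \<nu> u) - H u \<le> objA X wt \<mu> h \<nu>"
      unfolding objA_def functional_conj_def by (rule SUP_upper[OF u(1)])
    then have "ereal (signed_integral ?B \<nu> u) - H u \<le> ereal c" using c by (rule order_trans)
    then show ?thesis unfolding H_fin(3)[OF u] by simp
  qed
  have pos: "(\<integral>s. f s \<partial>?n) \<le> (\<integral>s. f s \<partial>?p)" if f: "f \<in> cfun X" "\<forall>s\<in>\<Omega>. 0 \<le> f s \<and> f s \<le> 1" for f
  proof (rule ccontr)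
    assume "\<not> ?thesis"
    then have neg: "(\<integral>s. f s \<partial>?n) - (\<integral>s. f s \<partial>?p) > 0" by simp
    define SI0 where "SI0 = signed_integral ?B \<nu> u0"
    have fi: "integrable ?p f" "integrable ?n f" by (auto intro!: cfun_integrable[OF _ _ f(1)] fp fn)
    have u0i: "integrable ?p u0" "integrable ?n u0"
      by (auto intro!: C_integrable[OF u0(1)] ip neg_int)
    have main: "SI0 + real k * ((\<integral>s. f s \<partial>?n) - (\<integral>s. f s \<partial>?p)) - real_of_ereal (H u0) \<le> c" for k :: nat
    proof -
      define u where "u = restrict (\<lambda>s. u0 s - real k * f s) \<Omega>"
      have uC: "u \<in> C" unfolding u_def
      proof (rule C_I[where c="K + real k"])
        show "continuous_map X euclideanreal (\<lambda>s. u0 s - real k * f s)"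
          using f(1) by (intro continuous_map_diff continuous_map_real_mult_left C_D(1)[OF u0(1)]) (simp add: cfun_def)
        fix s assume s: "s \<in> \<Omega>"
        have "\<bar>u0 s\<bar> \<le> K * wt s" using K s by blast
        moreover have "0 \<le> real k * f s" "real k * f s \<le> real k * wt s"
          using f(2) s wt_ge1[OF s] by (auto intro!: mult_left_mono)
        ultimately show "\<bar>u0 s - real k * f s\<bar> \<le> (K + real k) * wt s" unfolding distrib_right by linarith
      qed
      have ule: "u s \<le> u0 s" if "s \<in> \<Omega>" for s using that f(2) unfolding u_def by simp
      have Hu: "H u < \<infinity>" by (rule H_mono[OF uC u0 ule])
      have "(\<integral>s. hr (u s) s \<partial>\<mu>) \<le> (\<integral>s. hr (u0 s) s \<partial>\<mu>)"
      proof (rule integral_mono_AE[OF H_fin(2)[OF uC Hu] H_fin(2)[OF u0]])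
        show "AE s in \<mu>. hr (u s) s \<le> hr (u0 s) s"
          using h_proper H_fin(1)[OF u0] AE_space
        proof eventually_elim
          case (elim s)
          then have s: "s \<in> \<Omega>" by (simp add: space_mu)
          have "h (u0 s) s < \<infinity>" using elim(2) by simp
          then show ?case by (rule hr_mono[OF s elim(1) _ ule[OF s]])
        qed
      qed
      then have Hle: "real_of_ereal (H u) \<le> real_of_ereal (H u0)" by (simp add: H_fin(3)[OF uC Hu] H_fin(3)[OF u0])
      have Iu: "(\<integral>s. u s \<partial>L) = (\<integral>s. u0 s \<partial>L) - real k * (\<integral>s. f s \<partial>L)"
        if L: "space L = \<Omega>" "integrable L u0" "integrable L f" for L
      proof -
        have "(\<integral>s. u s \<partial>L) = (\<integral>s. u0 s - real k * f s \<partial>L)"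
          by (rule Bochner_Integration.integral_cong) (simp_all add: u_def L(1))
        then show ?thesis using L by simp
      qed
      have "signed_integral ?B \<nu> u = SI0 + real k * ((\<integral>s. f s \<partial>?n) - (\<integral>s. f s \<partial>?p))"
        unfolding signed_integral_def SI0_def
        by (subst (1 2) Iu) (simp_all add: u0i fi algebra_simps)
      then show ?thesis using SI[OF uC Hu] Hle by linarith
    qed
    obtain k :: nat where "c - SI0 + real_of_ereal (H u0) < real k * ((\<integral>s. f s \<partial>?n) - (\<integral>s. f s \<partial>?p))"
      using reals_Archimedean3[OF neg] by blast
    then show False using main[of k] by linarith
  qed
  have \<nu>0: "0 \<le> \<nu> A" for A
  proof (cases "A \<in> sets ?B")
    case True
    have "measure ?n A \<le> measure ?p A"
      by (rule measure_le_cfun[OF metrizable_X fn _ fp _ pos]) (use True in auto)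
    then show ?thesis using jordan_decomposition[OF sm fp fn True] by simp
  next
    case False
    then show ?thesis using sm by (simp add: signed_measure_def)
  qed
  have add: "\<nu> E \<le> \<nu> A" if "E \<in> sets ?B" "A \<in> sets ?B" "E \<subseteq> A" for E A
  proof -
    have "\<nu> (E \<union> (A - E)) = \<nu> E + \<nu> (A - E)" by (rule signed_measure_Un[OF sm]) (use that in auto)
    moreover have "E \<union> (A - E) = A" using that by auto
    ultimately show ?thesis using \<nu>0[of "A - E"] by simp
  qed
  have pe: "emeasure ?p A = ennreal (\<nu> A)" if A: "A \<in> sets ?B" for A
    unfolding emeasure_pos_var[OF sm A]
    by (intro antisym SUP_least SUP_upper) (use A add in \<open>auto intro: ennreal_leI\<close>)
  have \<nu>p: "\<nu> = measure ?p"
  proof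
    fix A show "\<nu> A = measure ?p A"
    proof (cases "A \<in> sets ?B")
      case True then show ?thesis using pe[OF True] \<nu>0 by (simp add: measure_def)
    next
      case False then show ?thesis using sm by (simp add: signed_measure_def measure_notin_sets)
    qed
  qed
  have "coupling ?p"
    unfolding coupling_def
  proof (intro conjI allI impI fp)
    show "sets ?p = sets ?B" by simp
    fix t assume t: "t \<le> T"
    have pm: "(\<lambda>s. s t) \<in> ?p \<rightarrow>\<^sub>M borel_of (S t)" by (rule proj_meas[OF t]) simp
    interpret d: finite_measure "distr ?p (borel_of (S t)) (\<lambda>s. s t)"
      by (rule finite_measure.finite_measure_distr[OF fp pm])
    interpret mt: prob_space "m t" by (rule prob_m[OF t])
    show "distr ?p (borel_of (S t)) (\<lambda>s. s t) = m t"
    proof (rule measure_eqI)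
      fix B assume "B \<in> sets (distr ?p (borel_of (S t)) (\<lambda>s. s t))"
      then have B: "B \<in> sets (borel_of (S t))" by simp
      have "measure (distr ?p (borel_of (S t)) (\<lambda>s. s t)) B = measure ?p ((\<lambda>s. s t) -` B \<inter> space ?p)"
        by (rule measure_distr[OF pm B])
      also have "(\<lambda>s. s t) -` B \<inter> space ?p = {s \<in> \<Omega>. s t \<in> B}" by auto
      also have "measure ?p {s \<in> \<Omega>. s t \<in> B} = measure (m t) B" using marg[OF t B] \<nu>p by simp
      finally show "emeasure (distr ?p (borel_of (S t)) (\<lambda>s. s t)) B = emeasure (m t) B"
        by (simp add: d.emeasure_eq_measure mt.emeasure_eq_measure)
    qed simp
  qed
  then show ?thesis using \<nu>p by blast
qed

section \<open>The duality gap\<close>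

text \<open>\<open>ac_part\<close> is a definite description, so uniqueness has to be shown. Any two
  absolutely continuous parts agree with \<open>M\<close> off the union \<open>P\<close> of the two
  exceptional null sets, and both vanish on measurable subsets of \<open>P\<close>.\<close>

lemma decomp_parts:
  assumes M: "coupling M" and dec: "decomp M y N"
  shows "ac_part \<mu> (measure M) = measure (density M (indicator (\<Omega> - N)))" (is "_ = measure ?Ma")
    "sing_part \<mu> (measure M) = measure (density M (indicator N))" (is "_ = measure ?Ms")
    "finite_measure (density M (indicator N))"
    "AE s in \<mu>. signed_density \<mu> (ac_part \<mu> (measure M)) s = y s"
proof -
  interpret M: finite_measure M by (rule coupling_finite[OF M])
  have sM: "sets M = sets \<mu>" by (rule coupling_sets_mu[OF M])
  have N: "N \<in> null_sets \<mu>" and y: "y \<in> borel_measurable \<mu>" "\<And>s. 0 \<le> y s"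
    and eq: "?Ma = density \<mu> (\<lambda>s. ennreal (y s))" using dec by (auto simp: decomp_def)
  have Ns: "N \<in> sets M" using N sM by auto
  have ON: "\<Omega> - N \<in> sets M" using sets.compl_sets[OF Ns] coupling_space[OF M] by simp
  have eMa: "emeasure ?Ma A = emeasure M (A - N)" if A: "A \<in> sets M" for A
  proof -
    have "(\<Omega> - N) \<inter> A = A - N" using sets.sets_into_space[OF A] coupling_space[OF M] by auto
    then show ?thesis using emeasure_restricted[OF ON A] by simp
  qed
  have eMs: "emeasure ?Ms A = emeasure M (N \<inter> A)" if A: "A \<in> sets M" for A
    by (rule emeasure_restricted[OF Ns A])
  have finMa: "finite_measure ?Ma"
    by (rule finite_measureI) (use eMa[OF sets.top] M.emeasure_finite in simp)
  show finMs: "finite_measure ?Ms"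
    by (rule finite_measureI) (use eMs[OF sets.top] M.emeasure_finite in simp)
  have mMa: "measure ?Ma A = measure M (A - N)" if "A \<in> sets \<mu>" for A
    using eMa[of A] that sM by (simp add: measure_def)
  have mMs: "measure ?Ms A = measure M (N \<inter> A)" if "A \<in> sets \<mu>" for A
    using eMs[of A] that sM by (simp add: measure_def)
  have sma: "signed_measure \<mu> (measure ?Ma)" by (rule signed_measure_measure[OF finMa]) (simp add: sM)
  have ac: "signed_ac \<mu> (measure ?Ma)"
    unfolding signed_ac_def
  proof
    fix A assume A: "A \<in> null_sets \<mu>"
    have "absolutely_continuous \<mu> ?Ma" unfolding eq using y by (intro absolutely_continuousI_density) auto
    then have "A \<in> null_sets ?Ma" using A unfolding absolutely_continuous_def by blast
    then show "measure ?Ma A = 0" by (simp add: measure_def null_setsD1)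
  qed
  have sing: "signed_singular \<mu> (\<lambda>A. measure M A - measure ?Ma A)"
    unfolding signed_singular_def
  proof (intro bexI[OF _ N] ballI impI)
    fix A assume A: "A \<in> sets \<mu>" "A \<inter> N = {}"
    then have "A - N = A" by auto
    then show "measure M A - measure ?Ma A = 0" using mMa[OF A(1)] by simp
  qed
  show acp: "ac_part \<mu> (measure M) = measure ?Ma"
    unfolding ac_part_def
  proof (rule the_equality)
    show "signed_measure \<mu> (measure ?Ma) \<and> signed_ac \<mu> (measure ?Ma) \<and>
        signed_singular \<mu> (\<lambda>A. measure M A - measure ?Ma A)" using sma ac sing by blast
    fix \<nu> assume "signed_measure \<mu> \<nu> \<and> signed_ac \<mu> \<nu> \<and> signed_singular \<mu> (\<lambda>A. measure M A - \<nu> A)"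
    then have \<nu>: "signed_measure \<mu> \<nu>" "signed_ac \<mu> \<nu>" "signed_singular \<mu> (\<lambda>A. measure M A - \<nu> A)" by auto
    obtain N' where N': "N' \<in> null_sets \<mu>" "\<And>A. A \<in> sets \<mu> \<Longrightarrow> A \<inter> N' = {} \<Longrightarrow> measure M A - \<nu> A = 0"
      using \<nu>(3) unfolding signed_singular_def by blast
    define P where "P = N \<union> N'"
    have P: "P \<in> null_sets \<mu>" unfolding P_def using N N' by auto
    have key: "\<kappa> A = measure M (A - P)"
      if k: "signed_measure \<mu> \<kappa>" "signed_ac \<mu> \<kappa>" and s: "\<And>A. A \<in> sets \<mu> \<Longrightarrow> A \<inter> P = {} \<Longrightarrow> measure M A - \<kappa> A = 0"
        and A: "A \<in> sets \<mu>" for \<kappa> A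
    proof -
      have Ps: "P \<in> sets \<mu>" using P by auto
      have "\<kappa> ((A - P) \<union> (A \<inter> P)) = \<kappa> (A - P) + \<kappa> (A \<inter> P)"
        by (rule signed_measure_Un[OF k(1)]) (use A Ps in auto)
      moreover have "(A - P) \<union> (A \<inter> P) = A" by auto
      moreover have "A \<inter> P \<in> null_sets \<mu>" using null_set_Int1[OF P A] by simp
      then have "\<kappa> (A \<inter> P) = 0" using k(2) unfolding signed_ac_def by blast
      moreover have "measure M (A - P) - \<kappa> (A - P) = 0" by (rule s) (use A Ps in auto)
      ultimately show ?thesis by simp
    qed
    show "\<nu> = measure ?Ma"
    proof
      fix A
      show "\<nu> A = measure ?Ma A"
      proof (cases "A \<in> sets \<mu>")
        case True
        have "\<nu> A = measure M (A - P)"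
          by (rule key[OF \<nu>(1,2) _ True]) (rule N'(2), auto simp: P_def)
        moreover have "measure ?Ma A = measure M (A - P)"
        proof (rule key[OF sma ac _ True])
          fix B assume B: "B \<in> sets \<mu>" "B \<inter> P = {}"
          then have "B - N = B" by (auto simp: P_def)
          then show "measure M B - measure ?Ma B = 0" using mMa[OF B(1)] by simp
        qed
        ultimately show ?thesis by simp
      next
        case False
        then show ?thesis using \<nu>(1) sma unfolding signed_measure_def by simp
      qed
    qed
  qed
  show "sing_part \<mu> (measure M) = measure ?Ms"
  proof
    fix A
    show "sing_part \<mu> (measure M) A = measure ?Ms A"
    proof (cases "A \<in> sets \<mu>")
      case True
      have "measure M ((A - N) \<union> (N \<inter> A)) = measure M (A - N) + measure M (N \<inter> A)"
        by (rule M.finite_measure_Union) (use True Ns sM in auto)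
      moreover have "(A - N) \<union> (N \<inter> A) = A" by auto
      ultimately show ?thesis unfolding sing_part_def acp mMa[OF True] mMs[OF True] by simp
    next
      case False
      then show ?thesis unfolding sing_part_def acp by (simp add: measure_notin_sets sM)
    qed
  qed
  have fy: "(\<integral>\<^sup>+s. ennreal (y s) \<partial>\<mu>) < \<infinity>"
  proof -
    have "(\<integral>\<^sup>+s. ennreal (y s) \<partial>\<mu>) = (\<integral>\<^sup>+s. ennreal (y s) * indicator (space \<mu>) s \<partial>\<mu>)"
      by (rule nn_integral_cong) simp
    also have "\<dots> = emeasure ?Ma (space \<mu>)" unfolding eq using y by (intro emeasure_density[symmetric]) auto
    also have "\<dots> < \<infinity>" using finite_measure.emeasure_finite[OF finMa] by (simp add: less_top[symmetric])
    finally show ?thesis .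
  qed
  have yi: "integrable \<mu> y" by (rule integrableI_nonneg) (use y fy in auto)
  show "AE s in \<mu>. signed_density \<mu> (ac_part \<mu> (measure M)) s = y s"
    unfolding acp
  proof (rule signed_density_measure[OF mu.finite_measure_axioms yi])
    fix A assume A: "A \<in> sets \<mu>"
    have iA: "integrable \<mu> (\<lambda>s. indicator A s * y s)" using integrable_mult_indicator[OF A yi] by simp
    have "emeasure ?Ma A = (\<integral>\<^sup>+s. ennreal (y s) * indicator A s \<partial>\<mu>)" unfolding eq using y A by (intro emeasure_density) auto
    also have "\<dots> = (\<integral>\<^sup>+s. ennreal (indicator A s * y s) \<partial>\<mu>)"
      by (rule nn_integral_cong) (auto simp: indicator_def)
    also have "\<dots> = ennreal (\<integral>s. indicator A s * y s \<partial>\<mu>)"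
      by (rule nn_integral_eq_integral[OF iA]) (use y in auto)
    finally have "measure ?Ma A = (\<integral>s. indicator A s * y s \<partial>\<mu>)"
      using y by (simp add: measure_def integral_nonneg)
    then show "measure ?Ma A = (\<integral>s\<in>A. y s \<partial>\<mu>)" unfolding set_lebesgue_integral_def by simp
  qed
qed

text \<open>The normal cone of a half-line contains a positive number only at its right end. The
  number 1 is the one that matters, being the density of the nonnegative singular part with respect
  to its own variation.\<close>

lemma ncone_iff:
  assumes s: "s \<in> \<Omega>"
  shows "1 \<in> ncone (D s) w \<longleftrightarrow> ereal w = d s"
proof
  assume "1 \<in> ncone (D s) w"
  then have w: "w \<in> D s" "\<And>u. u \<in> D s \<Longrightarrow> u \<le> w" unfolding ncone_def by (auto split: if_splits)
  show "ereal w = d s"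
    unfolding d_def by (rule antisym[OF SUP_upper[OF w(1)] SUP_least]) (use w(2) in simp)
next
  assume e: "ereal w = d s"
  then have "w \<in> D s" using D_iff[OF s] by simp
  moreover have "u \<le> w" if "u \<in> D s" for u using that unfolding D_iff[OF s] e[symmetric] by simp
  ultimately show "1 \<in> ncone (D s) w" unfolding ncone_def by simp
qed

lemma singular_condition:
  assumes M: "coupling M" and dec: "decomp M y N"
  shows "(AE s in total_var \<mu> (sing_part \<mu> (measure M)).
      signed_density (total_var \<mu> (sing_part \<mu> (measure M))) (sing_part \<mu> (measure M)) s \<in> ncone (D s) (w s)) \<longleftrightarrow>
    (AE s in M. s \<in> N \<longrightarrow> ereal (w s) = d s)"
proof -
  let ?Ms = "density M (indicator N)"
  have sM: "sets M = sets \<mu>" by (rule coupling_sets_mu[OF M])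
  have Ns: "N \<in> sets M" using dec sM by (auto simp: decomp_def)
  have fin: "finite_measure ?Ms" by (rule decomp_parts(3)[OF M dec])
  have tv: "total_var \<mu> (measure ?Ms) = ?Ms" by (rule total_var_measure[OF fin]) (simp add: sM)
  interpret Ms: finite_measure ?Ms by (rule fin)
  have one: "AE s in ?Ms. signed_density ?Ms (measure ?Ms) s = 1"
    by (rule signed_density_measure[OF fin])
       (auto simp: set_lebesgue_integral_def Int_absorb2 dest: sets.sets_into_space)
  have "(AE s in ?Ms. signed_density ?Ms (measure ?Ms) s \<in> ncone (D s) (w s)) \<longleftrightarrow> (AE s in ?Ms. 1 \<in> ncone (D s) (w s))"
  proof
    assume "AE s in ?Ms. signed_density ?Ms (measure ?Ms) s \<in> ncone (D s) (w s)"
    with one show "AE s in ?Ms. 1 \<in> ncone (D s) (w s)" by eventually_elim simp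
  next
    assume "AE s in ?Ms. 1 \<in> ncone (D s) (w s)"
    with one show "AE s in ?Ms. signed_density ?Ms (measure ?Ms) s \<in> ncone (D s) (w s)" by eventually_elim simp
  qed
  also have "\<dots> \<longleftrightarrow> (AE s in M. s \<in> N \<longrightarrow> 1 \<in> ncone (D s) (w s))"
    using Ns by (subst AE_density) (auto simp: indicator_def)
  also have "\<dots> \<longleftrightarrow> (AE s in M. s \<in> N \<longrightarrow> ereal (w s) = d s)"
    by (rule AE_cong) (simp add: ncone_iff coupling_space[OF M])
  finally show ?thesis unfolding decomp_parts(2)[OF M dec] tv .
qed

text \<open>Coercivity bounds the absolute value of the sum by the objective and an integrable
  function, so the sum is integrable even when its summands are not. The bound by \<open>d\<close>
  holds under every coupling, because a product of sets of full marginal measure has full measure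
  under each of them.\<close>

lemma feasible_B:
  assumes x: "feasible (constrB T S \<mu> h) (objB T \<mu> h) x"
  shows "\<And>t. t \<le> T \<Longrightarrow> x t \<in> borel_measurable (borel_of (S t))"
    "\<And>M. coupling M \<Longrightarrow> AE s in M. ereal (- path_sum T x s) \<le> d s"
    "integrable \<mu> (path_sum T x)"
    "AE s in \<mu>. h (- path_sum T x s) s = ereal (hr (- path_sum T x s) s)"
    "integrable \<mu> (\<lambda>s. hr (- path_sum T x s) s)"
    "objB T \<mu> h x = ereal (\<integral>s. path_sum T x s + hr (- path_sum T x s) s \<partial>\<mu>)"
proof -
  have xB: "x \<in> constrB T S \<mu> h" and fin: "objB T \<mu> h x < \<infinity>" using x by (auto simp: feasible_def)
  show xm: "\<And>t. t \<le> T \<Longrightarrow> x t \<in> borel_measurable (borel_of (S t))" using xB by (simp add: constrB_def)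
  obtain A where A: "\<And>t. t \<le> T \<Longrightarrow> A t \<in> sets (borel_of (S t))" "\<And>t. t \<le> T \<Longrightarrow> measure (m t) (A t) = 1"
    and AD: "\<And>s. s \<in> PiE {..T} A \<Longrightarrow> - path_sum T x s \<in> D s"
    using xB unfolding constrB_def by blast
  show "AE s in M. ereal (- path_sum T x s) \<le> d s" if M: "coupling M" for M
  proof -
    have aeP: "AE s in M. s \<in> PiE {..T} A" by (rule coupling_PiE[OF M]) (rule A, assumption)+
    from aeP AE_space show ?thesis
    proof eventually_elim
      case (elim s)
      from elim(2) have s: "s \<in> \<Omega>" using coupling_space[OF M] by simp
      show ?case using AD[OF elim(1)] by (simp only: D_iff[OF s])
    qed
  qed
  have pm: "path_sum T x \<in> borel_measurable \<mu>"
    by (intro borel_measurable_sum measurable_compose[OF proj_meas[OF _ mu_sets] xm]) auto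
  define F where "F = (\<lambda>s. ereal (path_sum T x s) + h (- path_sum T x s) s)"
  have Fm: "F \<in> borel_measurable \<mu>"
    unfolding F_def using pm h_comp_meas[OF mu_sets, of "\<lambda>s. - path_sum T x s"] by measurable
  obtain e k where e: "e > 0" and k: "integrable \<mu> k" and
    ae: "AE s in \<mu>. \<forall>u. ereal (e * \<bar>u\<bar> - k s) \<le> ereal (- u) + h u s"
    by (rule coercive)
  have lower: "AE s in \<mu>. ereal (e * \<bar>path_sum T x s\<bar> - k s) \<le> F s"
    using ae
  proof eventually_elim
    case (elim s)
    from elim[rule_format, of "- path_sum T x s"] show ?case by (simp add: F_def)
  qed
  have lower': "AE s in \<mu>. ereal (- k s) \<le> F s"
    using lower
  proof eventually_elim
    case (elim s)
    have "ereal (- k s) \<le> ereal (e * \<bar>path_sum T x s\<bar> - k s)" using e by simp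
    then show ?case using elim by (rule order_trans)
  qed
  have mk: "integrable \<mu> (\<lambda>s. - k s)" using k by simp
  have finF: "ext_integral \<mu> F < \<infinity>" using fin unfolding objB_def F_def .
  note Ff = ext_integral_finite[OF Fm lower' mk finF]
  show ip: "integrable \<mu> (path_sum T x)"
  proof (rule Bochner_Integration.integrable_bound[of \<mu> "\<lambda>s. (real_of_ereal (F s) + k s) / e"])
    show "AE s in \<mu>. norm (path_sum T x s) \<le> norm ((real_of_ereal (F s) + k s) / e)"
      using lower Ff(1)
    proof eventually_elim
      case (elim s)
      have "ereal (e * \<bar>path_sum T x s\<bar> - k s) \<le> ereal (real_of_ereal (F s))" using elim by metis
      then have "e * \<bar>path_sum T x s\<bar> \<le> real_of_ereal (F s) + k s" by simp
      then have "\<bar>path_sum T x s\<bar> \<le> (real_of_ereal (F s) + k s) / e" using e by (simp add: pos_le_divide_eq mult.commute)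
      then show ?case unfolding real_norm_def by (rule order_trans[OF _ abs_ge_self])
    qed
  qed (use Ff(2) k pm in auto)
  show eq: "AE s in \<mu>. h (- path_sum T x s) s = ereal (hr (- path_sum T x s) s)"
    using Ff(1)
  proof eventually_elim
    case (elim s)
    then show ?case unfolding F_def hr_def by (cases "h (- path_sum T x s) s") auto
  qed
  have Feq: "AE s in \<mu>. real_of_ereal (F s) = path_sum T x s + hr (- path_sum T x s) s"
    using eq
  proof eventually_elim
    case (elim s)
    then show ?case unfolding F_def by simp
  qed
  have hm: "(\<lambda>s. hr (- path_sum T x s) s) \<in> borel_measurable \<mu>" by (rule hr_meas[OF mu_sets]) (use pm in measurable)
  show hi: "integrable \<mu> (\<lambda>s. hr (- path_sum T x s) s)"
  proof -
    have "integrable \<mu> (\<lambda>s. real_of_ereal (F s) - path_sum T x s)" using Ff(2) ip by simp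
    moreover have "AE s in \<mu>. real_of_ereal (F s) - path_sum T x s = hr (- path_sum T x s) s"
      using Feq by eventually_elim simp
    ultimately show ?thesis by (rule integrable_cong_AE_imp[OF _ hm])
  qed
  show "objB T \<mu> h x = ereal (\<integral>s. path_sum T x s + hr (- path_sum T x s) s \<partial>\<mu>)"
    unfolding objB_def F_def[symmetric]
  proof (rule ext_integral_eq)
    show "AE s in \<mu>. F s = ereal (path_sum T x s + hr (- path_sum T x s) s)"
      using eq by eventually_elim (simp add: F_def)
  qed (use ip hi in simp)
qed

text \<open>By Fubini's theorem the sum has an integrable section in coordinate \<open>t\<close> for
  some choice \<open>r\<close> of the other coordinates. That section differs from
  \<open>x t\<close> by a constant, which is integrable under a probability measure.\<close>

lemma product_summands_integrable:
  assumes prod: "\<mu> = PiM {..T} m" and xm: "\<And>t. t \<le> T \<Longrightarrow> x t \<in> borel_measurable (borel_of (S t))"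
    and ip: "integrable \<mu> (path_sum T x)" and t: "t \<le> T"
  shows "integrable (m t) (x t)"
proof -
  define m' where "m' = (\<lambda>t. if t \<le> T then m t else m 0)"
  have prob_m': "prob_space (m' t)" for t unfolding m'_def using prob_m by auto
  interpret P: product_prob_space m' "{..T}" by (rule product_prob_spaceI) (rule prob_m')
  have "PiM {..T} m' = PiM {..T} m" by (rule PiM_cong) (simp_all add: m'_def)
  then have Pi': "PiM {..T} m' = \<mu>" using prod by (rule trans[OF _ sym])
  define J where "J = {..T} - {t}"
  have J: "finite J" "t \<notin> J" "insert t J = {..T}" using t by (auto simp: J_def)
  interpret PJ: prob_space "PiM J m'" by (rule prob_space_PiM) (rule prob_m')
  let ?f = "\<lambda>s. ennreal \<bar>path_sum T x s\<bar>"
  have fm: "?f \<in> borel_measurable (PiM (insert t J) m')" unfolding J(3) Pi' using ip by measurable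
  have fin: "(\<integral>\<^sup>+s. ?f s \<partial>PiM (insert t J) m') < \<infinity>"
    unfolding J(3) Pi' using ip unfolding integrable_iff_bounded by simp
  have ins: "(\<integral>\<^sup>+s. ?f s \<partial>PiM (insert t J) m') = (\<integral>\<^sup>+r. (\<integral>\<^sup>+y. ?f (r(t := y)) \<partial>m' t) \<partial>PiM J m')"
    by (rule P.product_nn_integral_insert[OF J(1,2) fm])
  have "AE r in PiM J m'. (\<integral>\<^sup>+y. ?f (r(t := y)) \<partial>m' t) \<noteq> \<infinity>"
  proof (rule nn_integral_PInf_AE)
    show "(\<integral>\<^sup>+r. (\<integral>\<^sup>+y. ?f (r(t := y)) \<partial>m' t) \<partial>PiM J m') \<noteq> \<infinity>" using fin unfolding ins by simp
    have "(\<lambda>(r, y). r(t := y)) \<in> PiM J m' \<Otimes>\<^sub>M m' t \<rightarrow>\<^sub>M PiM (insert t J) m'" by (rule measurable_add_dim)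
    from measurable_compose[OF this fm]
    have "case_prod (\<lambda>r y. ?f (r(t := y))) \<in> borel_measurable (PiM J m' \<Otimes>\<^sub>M m' t)"
      by (simp only: case_prod_beta')
    then show "(\<lambda>r. \<integral>\<^sup>+y. ?f (r(t := y)) \<partial>m' t) \<in> borel_measurable (PiM J m')"
      by (rule sigma_finite_measure.borel_measurable_nn_integral[OF prob_space_imp_sigma_finite[OF prob_m']])
  qed
  then obtain r where r: "(\<integral>\<^sup>+y. ?f (r(t := y)) \<partial>m' t) \<noteq> \<infinity>"
    using PJ.AE_False eventually_mono by blast
  define c where "c = (\<Sum>i\<in>J. x i (r i))"
  have upd: "path_sum T x (r(t := y)) = x t y + c" for y
  proof -
    have "path_sum T x (r(t := y)) = x t y + (\<Sum>i\<in>J. x i ((r(t := y)) i))"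
      unfolding J(3)[symmetric] using J(1,2) by simp
    also have "(\<Sum>i\<in>J. x i ((r(t := y)) i)) = c" unfolding c_def by (rule sum.cong) (use J(2) in auto)
    finally show ?thesis .
  qed
  have mt: "m' t = m t" using t by (simp add: m'_def)
  have xt: "x t \<in> borel_measurable (m t)" using xm[OF t] m_cong_meas by blast
  interpret mt: prob_space "m t" by (rule prob_m[OF t])
  have "integrable (m t) (\<lambda>y. x t y + c)"
    by (rule integrableI_bounded) (use xt r[unfolded mt upd] in \<open>auto simp: less_top\<close>)
  then have "integrable (m t) (\<lambda>y. (x t y + c) - c)" by (intro Bochner_Integration.integrable_diff) auto
  then show ?thesis by simp
qed

text \<open>With two summands, clamping each of them at the levels \<open>\<plusminus>n\<close> keeps the sign of the sum and does not
  increase its absolute value. So Fatou's lemma and dominated convergence apply even if neither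
  summand is integrable.\<close>

lemma coupling_path_sum_two:
  fixes x :: "nat \<Rightarrow> 'a \<Rightarrow> real"
  assumes T: "T = 1" and M: "coupling M" and xm: "\<And>t. t \<le> T \<Longrightarrow> x t \<in> borel_measurable (borel_of (S t))"
    and ip: "integrable \<mu> (path_sum T x)" and neg: "integrable M (\<lambda>s. max 0 (- path_sum T x s))"
  shows "integrable M (path_sum T x)" "(\<integral>s. path_sum T x s \<partial>M) = (\<integral>s. path_sum T x s \<partial>\<mu>)"
proof -
  define clamp :: "nat \<Rightarrow> real \<Rightarrow> real" where "clamp n a = max (- real n) (min (real n) a)" for n a
  define p where "p = path_sum T x"
  \<comment> \<open>A majorant of the negative parts of all truncated sums; its integrability under
    \<open>M\<close> makes Fatou's lemma applicable there.\<close>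
  define q where "q s = max 0 (- p s)" for s
  define pn where "pn n s = path_sum T (\<lambda>t y. clamp n (x t y)) s" for n s
  have pn2: "pn n s = clamp n (x 0 (s 0)) + clamp n (x 1 (s 1))" for n s
    by (simp add: pn_def T)
  have p2: "p s = x 0 (s 0) + x 1 (s 1)" for s by (simp add: p_def T)
  \<comment> \<open>This is special to two summands: clamping \<open>2 * n, - n, - n\<close> at the
    levels \<open>n\<close> and \<open>- n\<close> turns the sum 0 into \<open>- n\<close>.\<close>
  have up: "clamp n a + clamp n b \<le> max 0 (a + b)" for n a b unfolding clamp_def by linarith
  have dn: "- (clamp n a + clamp n b) \<le> max 0 (- (a + b))" for n a b unfolding clamp_def by linarith
  have pabs: "\<bar>pn n s\<bar> \<le> \<bar>p s\<bar>" for n s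
    using up[of n "x 0 (s 0)" "x 1 (s 1)"] dn[of n "x 0 (s 0)" "x 1 (s 1)"] unfolding pn2 p2 by linarith
  have pq: "0 \<le> pn n s + q s" for n s
    using dn[of n "x 0 (s 0)" "x 1 (s 1)"] unfolding pn2 p2 q_def by linarith
  have clim: "(\<lambda>n. clamp n a) \<longlonglongrightarrow> a" for a
  proof (rule tendsto_eventually)
    show "\<forall>\<^sub>F n in sequentially. clamp n a = a"
      using eventually_ge_at_top[of "nat \<lceil>\<bar>a\<bar>\<rceil>"]
    proof eventually_elim
      case (elim n)
      then have "\<bar>a\<bar> \<le> real n" by linarith
      then show ?case unfolding clamp_def by linarith
    qed
  qed
  have plim: "(\<lambda>n. pn n s) \<longlonglongrightarrow> p s" for s unfolding pn2 p2 by (intro tendsto_add clim)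
  have ci: "integrable (m t) (\<lambda>y. clamp n (x t y))" if t: "t \<le> T" for t n
  proof -
    interpret mt: prob_space "m t" by (rule prob_m[OF t])
    have [measurable]: "x t \<in> borel_measurable (m t)" using xm[OF t] m_cong_meas by blast
    show ?thesis
      by (rule mt.integrable_const_bound[of _ "real n"]) (auto simp: clamp_def)
  qed
  have pint: "integrable N (pn n)" "(\<integral>s. pn n s \<partial>N) = (\<Sum>t\<le>T. \<integral>y. clamp n (x t y) \<partial>m t)" if N: "coupling N" for N n
  proof -
    have i: "integrable N (\<lambda>s. clamp n (x t (s t)))" if "t \<in> {..T}" for t
      using coupling_integrable(1)[OF N _ ci] that by simp
    show "integrable N (pn n)" unfolding pn_def by (rule Bochner_Integration.integrable_sum) (rule i)
    have "(\<integral>s. pn n s \<partial>N) = (\<Sum>t\<le>T. \<integral>s. clamp n (x t (s t)) \<partial>N)"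
      unfolding pn_def by (rule Bochner_Integration.integral_sum) (rule i)
    also have "\<dots> = (\<Sum>t\<le>T. \<integral>y. clamp n (x t y) \<partial>m t)"
      by (rule sum.cong) (use coupling_integrable(2)[OF N _ ci] in auto)
    finally show "(\<integral>s. pn n s \<partial>N) = (\<Sum>t\<le>T. \<integral>y. clamp n (x t y) \<partial>m t)" .
  qed
  \<comment> \<open>Bounded summands are integrable, so these integrals depend on the marginals
    alone.\<close>
  have eqI: "(\<integral>s. pn n s \<partial>M) = (\<integral>s. pn n s \<partial>\<mu>)" for n using pint(2)[OF M] pint(2)[OF coupling_mu] by simp
  have ip': "integrable \<mu> p" using ip by (simp add: p_def)
  have qi: "integrable M q" unfolding q_def p_def by (rule neg)
  have pnm: "pn n \<in> borel_measurable M" for n using pint(1)[OF M] by simp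
  have pM: "p \<in> borel_measurable M" using pnm plim by (rule borel_measurable_LIMSEQ_real[rotated])
  have pmu: "p \<in> borel_measurable \<mu>" using ip' by simp
  define K where "K = (\<integral>s. \<bar>p s\<bar> \<partial>\<mu>) + (\<integral>s. q s \<partial>M)"
  have In: "(\<integral>s. pn n s + q s \<partial>M) \<le> K" for n
  proof -
    have "(\<integral>s. pn n s \<partial>\<mu>) \<le> (\<integral>s. \<bar>p s\<bar> \<partial>\<mu>)"
      by (rule integral_mono) (use pint(1)[OF coupling_mu] ip' pabs in \<open>auto intro: order_trans[OF abs_ge_self]\<close>)
    then show ?thesis using pint(1)[OF M] qi eqI by (simp add: K_def)
  qed
  have "(\<integral>\<^sup>+s. ennreal (p s + q s) \<partial>M) \<le> ennreal K"
  proof -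
    have "ennreal (p s + q s) = liminf (\<lambda>n. ennreal (pn n s + q s))" for s
      by (rule lim_imp_Liminf[symmetric]) (auto intro!: tendsto_intros plim)
    then have "(\<integral>\<^sup>+s. ennreal (p s + q s) \<partial>M) = (\<integral>\<^sup>+s. liminf (\<lambda>n. ennreal (pn n s + q s)) \<partial>M)" by simp
    also have "\<dots> \<le> liminf (\<lambda>n. \<integral>\<^sup>+s. ennreal (pn n s + q s) \<partial>M)"
      by (rule nn_integral_liminf) (use pnm qi in measurable)
    also have "\<dots> \<le> ennreal K"
    proof -
      have "(\<integral>\<^sup>+s. ennreal (pn n s + q s) \<partial>M) \<le> ennreal K" for n
      proof -
        have "(\<integral>\<^sup>+s. ennreal (pn n s + q s) \<partial>M) = ennreal (\<integral>s. pn n s + q s \<partial>M)"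
          by (rule nn_integral_eq_integral) (use pint(1)[OF M] qi pq in auto)
        then show ?thesis using In[of n] by (simp add: ennreal_leI)
      qed
      then have "limsup (\<lambda>n. \<integral>\<^sup>+s. ennreal (pn n s + q s) \<partial>M) \<le> ennreal K"
        by (intro Limsup_bounded) simp
      then show ?thesis by (rule order_trans[OF Liminf_le_Limsup[OF sequentially_bot]])
    qed
    finally show ?thesis .
  qed
  then have "(\<integral>\<^sup>+s. ennreal (p s + q s) \<partial>M) < \<infinity>" by (rule le_less_trans) simp
  then have "integrable M (\<lambda>s. p s + q s)"
    by (intro integrableI_nonneg) (use pM qi in \<open>auto simp: q_def\<close>)
  from Bochner_Integration.integrable_diff[OF this qi] have pi: "integrable M p" by simp
  then show "integrable M (path_sum T x)" by (simp add: p_def)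
  \<comment> \<open>Once \<open>p\<close> is known to be integrable under both measures, its
    absolute value dominates the truncated sums.\<close>
  have conv: "(\<lambda>n. \<integral>s. pn n s \<partial>N) \<longlonglongrightarrow> (\<integral>s. p s \<partial>N)" if N: "coupling N" and i: "integrable N p" for N
    by (rule integral_dominated_convergence[where w = "\<lambda>s. \<bar>p s\<bar>"])
       (use pint(1)[OF N] i pabs plim in auto)
  have "(\<integral>s. p s \<partial>M) = (\<integral>s. p s \<partial>\<mu>)"
    by (rule LIMSEQ_unique[OF conv[OF M pi]]) (use conv[OF coupling_mu ip'] eqI in simp)
  then show "(\<integral>s. path_sum T x s \<partial>M) = (\<integral>s. path_sum T x s \<partial>\<mu>)" by (simp add: p_def)
qed

lemma coupling_path_sum_integrable_summands:
  assumes M: "coupling M" and i: "\<And>t. t \<le> T \<Longrightarrow> integrable (m t) (x t)"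
  shows "integrable M (path_sum T x)" "(\<integral>s. path_sum T x s \<partial>M) = (\<Sum>t\<le>T. \<integral>y. x t y \<partial>m t)"
proof -
  have c: "integrable M (\<lambda>s. x t (s t))" "(\<integral>s. x t (s t) \<partial>M) = (\<integral>y. x t y \<partial>m t)" if "t \<in> {..T}" for t
    using coupling_integrable[OF M _ i] that by auto
  show "integrable M (path_sum T x)" by (rule Bochner_Integration.integrable_sum) (rule c)
  have "(\<integral>s. path_sum T x s \<partial>M) = (\<Sum>t\<le>T. \<integral>s. x t (s t) \<partial>M)"
    by (rule Bochner_Integration.integral_sum) (rule c)
  also have "\<dots> = (\<Sum>t\<le>T. \<integral>y. x t y \<partial>m t)" by (rule sum.cong[OF refl c(2)])
  finally show "(\<integral>s. path_sum T x s \<partial>M) = (\<Sum>t\<le>T. \<integral>y. x t y \<partial>m t)" .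
qed

text \<open>In the product case the summands are integrable one by one; for \<open>T = 1\<close> the
  one-sided integrability under \<open>M\<close> feeds the truncation argument.\<close>

lemma coupling_path_sum:
  assumes cases: "\<mu> = PiM {..T} m \<or> T = 1"
    and M: "coupling M" and xm: "\<And>t. t \<le> T \<Longrightarrow> x t \<in> borel_measurable (borel_of (S t))"
    and ip: "integrable \<mu> (path_sum T x)" and neg: "integrable M (\<lambda>s. max 0 (- path_sum T x s))"
  shows "integrable M (path_sum T x) \<and> (\<integral>s. path_sum T x s \<partial>M) = (\<integral>s. path_sum T x s \<partial>\<mu>)"
  using cases
proof
  assume "\<mu> = PiM {..T} m"
  from product_summands_integrable[OF this xm ip]
  have i: "\<And>t. t \<le> T \<Longrightarrow> integrable (m t) (x t)" by simp
  show ?thesis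
    using coupling_path_sum_integrable_summands[OF M i] coupling_path_sum_integrable_summands[OF coupling_mu i] by simp
next
  assume T: "T = 1"
  show ?thesis using coupling_path_sum_two[OF T M xm ip neg] by simp
qed

text \<open>The Fenchel-Young inequality with its case of equality, stated for finite values so that
  the gap is a real number.\<close>

lemma conj_eq_iff_subdiff:
  assumes hw: "h w s = ereal a" and k: "integrand_conj h y s = ereal b"
  shows "y * w \<le> a + b" "y \<in> integrand_subdiff h w s \<longleftrightarrow> a + b - y * w = 0"
proof -
  have "ereal (w * y) - h w s \<le> integrand_conj h y s" unfolding integrand_conj_def by (rule SUP_upper) simp
  then show le: "y * w \<le> a + b" unfolding hw k by (simp add: mult.commute)
  have "y \<in> integrand_subdiff h w s \<longleftrightarrow> (\<forall>u. ereal (u * y) - h u s \<le> ereal (y * w - a))"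
  proof -
    have "h w s + ereal (y * (u - w)) \<le> h u s \<longleftrightarrow> ereal (u * y) - h u s \<le> ereal (y * w - a)" for u
      unfolding hw by (cases "h u s") (auto simp: algebra_simps)
    then show ?thesis unfolding integrand_subdiff_def by simp
  qed
  also have "\<dots> \<longleftrightarrow> integrand_conj h y s \<le> ereal (y * w - a)" unfolding integrand_conj_def by (simp add: SUP_le_iff)
  also have "\<dots> \<longleftrightarrow> a + b - y * w = 0" unfolding k using le by auto
  finally show "y \<in> integrand_subdiff h w s \<longleftrightarrow> a + b - y * w = 0" .
qed

text \<open>The value of (A) is identified first: \<open>conj_lower\<close> with \<open>c\<close>
  equal to that value gives one inequality, and Fenchel's inequality integrated along continuous
  \<open>u\<close> gives the other. The same finiteness supplies the integrable bounds needed before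
  the sum can be integrated under \<open>M\<close>.\<close>

lemma pair_gap:
  assumes cases: "\<mu> = PiM {..T} m \<or> T = 1"
    and x: "feasible (constrB T S \<mu> h) (objB T \<mu> h) x"
    and M: "coupling M" and fin: "objA X wt \<mu> h (measure M) < \<infinity>" and dec: "decomp M y N"
  shows "\<exists>c G. objA X wt \<mu> h (measure M) = ereal c \<and> objB T \<mu> h x = ereal (G - c) \<and> 0 \<le> G \<and>
    (G = 0 \<longleftrightarrow> (AE s in \<mu>. y s \<in> integrand_subdiff h (- path_sum T x s) s) \<and>
      (AE s in M. s \<in> N \<longrightarrow> ereal (- path_sum T x s) = d s))"
proof -
  define w where "w s = - path_sum T x s" for s
  define dr where "dr s = real_of_ereal (d s)" for s
  have sM: "sets M = sets \<mu>" by (rule coupling_sets_mu[OF M])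
  have N: "N \<in> null_sets \<mu>" and ym: "y \<in> borel_measurable \<mu>" and y0: "\<And>s. 0 \<le> y s"
    using dec by (auto simp: decomp_def)
  have NM: "N \<in> sets M" using N sM by auto
  obtain c0 where c0: "objA X wt \<mu> h (measure M) = ereal c0"
    using fin objA_gt_MInf[OF M] by (cases "objA X wt \<mu> h (measure M)") auto
  have bound: "(\<integral>s. u s \<partial>M) - real_of_ereal (H u) \<le> c0" if "u \<in> C" "H u < \<infinity>" for u
    using objA_le_iff[OF M, of c0] c0 that by simp
  have cl: "AE s in \<mu>. integrand_conj h (y s) s = ereal (kap (y s) s)" "integrable \<mu> (\<lambda>s. kap (y s) s)"
    "AE s in M. s \<in> N \<longrightarrow> d s = ereal (dr s)" "integrable M (\<lambda>s. indicator N s * dr s)"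
    "(\<integral>s. kap (y s) s \<partial>\<mu>) + (\<integral>s. indicator N s * dr s \<partial>M) \<le> c0"
    unfolding dr_def by (rule conj_lower[OF M dec]; rule bound; assumption)+
  define I where "I = (\<integral>s. kap (y s) s \<partial>\<mu>) + (\<integral>s. indicator N s * dr s \<partial>M)"
  note fB = feasible_B[OF x, folded w_def]
  have pi: "integrable \<mu> (path_sum T x)" by (rule fB(3))
  have wi: "integrable \<mu> w" unfolding w_def using pi by simp
  have wmeas: "w \<in> borel_measurable \<mu>" using wi by simp
  have "objA X wt \<mu> h (measure M) \<le> ereal I"
    unfolding objA_le_iff[OF M]
  proof (intro ballI impI)
    fix u assume u: "u \<in> C" "H u < \<infinity>"
    have um: "u \<in> borel_measurable \<mu>" and uM: "integrable M u"
      by (rule cont_meas[OF C_D(1)[OF u(1)] mu_sets], rule C_integrable[OF u(1) coupling_sets[OF M] coupling_wt[OF M]])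
    note di = decomp_integrable[OF M dec um]
    have i1: "integrable \<mu> (\<lambda>s. y s * u s)" and i2: "integrable M (\<lambda>s. indicator N s * u s)" using di(1) uM by auto
    note hf = H_fin[OF u]
    have "(\<integral>s. y s * u s - hr (u s) s \<partial>\<mu>) \<le> (\<integral>s. kap (y s) s \<partial>\<mu>)"
    proof (rule integral_mono_AE)
      show "AE s in \<mu>. y s * u s - hr (u s) s \<le> kap (y s) s"
        using cl(1) hf(1)
      proof eventually_elim
        case (elim s)
        from conj_eq_iff_subdiff(1)[OF elim(2) elim(1)] show ?case by simp
      qed
    qed (use i1 hf(2) cl(2) in auto)
    moreover have "(\<integral>s. indicator N s * u s \<partial>M) \<le> (\<integral>s. indicator N s * dr s \<partial>M)"
    proof (rule integral_mono_AE[OF i2 cl(4)])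
      show "AE s in M. indicator N s * u s \<le> indicator N s * dr s"
        using cl(3) AE_space
      proof eventually_elim
        case (elim s)
        have s: "s \<in> \<Omega>" using elim(2) coupling_space[OF M] by simp
        have "ereal (u s) \<le> d s" using CD_D[OF H_less_D[OF u(2)] s] by (simp only: D_iff[OF s])
        then show ?case using elim(1) by (cases "s \<in> N") auto
      qed
    qed
    ultimately show "(\<integral>s. u s \<partial>M) - real_of_ereal (H u) \<le> I"
      using di(2)[OF uM] i1 hf(2) by (simp add: I_def hf(3))
  qed
  moreover have "ereal I \<le> objA X wt \<mu> h (measure M)" unfolding c0 I_def using cl(5) by simp
  ultimately have A: "objA X wt \<mu> h (measure M) = ereal I" by (rule antisym)
  have fy: "AE s in \<mu>. y s * w s \<le> hr (w s) s + kap (y s) s"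
    using cl(1) fB(4)
  proof eventually_elim
    case (elim s)
    show ?case by (rule conj_eq_iff_subdiff(1)[OF elim(2) elim(1)])
  qed
  have wd: "AE s in M. s \<in> N \<longrightarrow> w s \<le> dr s \<and> d s = ereal (dr s)"
    using fB(2)[OF M] cl(3)
  proof eventually_elim
    case (elim s)
    show ?case
    proof
      assume "s \<in> N"
      then have e: "d s = ereal (dr s)" using elim(2) by simp
      show "w s \<le> dr s \<and> d s = ereal (dr s)" using elim(1) e by simp
    qed
  qed
  \<comment> \<open>At this point only the positive part of \<open>w\<close> is under control: off
    \<open>N\<close> through \<open>y * w \<le> h(w) + h\<^sup>*(y)\<close>, on \<open>N\<close>
    through \<open>w \<le> d\<close>. This is the one-sided condition of
    \<open>coupling_path_sum\<close>.\<close>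
  let ?wp = "\<lambda>s. max 0 (w s)"
  have wpm: "?wp \<in> borel_measurable \<mu>" using wmeas by measurable
  have wpM: "integrable M ?wp"
    unfolding decomp_integrable(1)[OF M dec wpm]
  proof
    show "integrable \<mu> (\<lambda>s. y s * ?wp s)"
    proof (rule Bochner_Integration.integrable_bound)
      show "integrable \<mu> (\<lambda>s. hr (w s) s + kap (y s) s)" using fB(5) cl(2) by simp
      show "AE s in \<mu>. norm (y s * ?wp s) \<le> norm (hr (w s) s + kap (y s) s)"
        using fy
      proof eventually_elim
        case (elim s)
        have "y s * ?wp s = max 0 (y s * w s)" using y0[of s] by (simp add: max_mult_distrib_left)
        then show ?case using elim by simp
      qed
    qed (use ym wpm in measurable)
    show "integrable M (\<lambda>s. indicator N s * ?wp s)"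
    proof (rule Bochner_Integration.integrable_bound[OF cl(4)])
      show "AE s in M. norm (indicator N s * ?wp s) \<le> norm (indicator N s * dr s)"
        using wd by eventually_elim (auto simp: indicator_def)
      have [measurable]: "N \<in> sets M" by (rule NM)
      have [measurable]: "w \<in> borel_measurable M" using wmeas measurable_cong_sets[OF sM refl] by blast
      show "(\<lambda>s. indicator N s * ?wp s) \<in> borel_measurable M" by measurable
    qed
  qed
  have ps: "integrable M (path_sum T x) \<and> (\<integral>s. path_sum T x s \<partial>M) = (\<integral>s. path_sum T x s \<partial>\<mu>)"
    by (rule coupling_path_sum[OF cases M fB(1) pi]) (use wpM in \<open>simp_all add: w_def\<close>)
  have wM: "integrable M w" unfolding w_def using ps by simp
  note di = decomp_integrable[OF M dec wmeas]
  have i1: "integrable \<mu> (\<lambda>s. y s * w s)" and i2: "integrable M (\<lambda>s. indicator N s * w s)" using di(1) wM by auto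
  define G1 where "G1 s = hr (w s) s + kap (y s) s - y s * w s" for s
  define G2 where "G2 s = indicator N s * dr s - indicator N s * w s" for s
  have g1: "integrable \<mu> G1" unfolding G1_def using fB(5) cl(2) i1 by simp
  have g2: "integrable M G2" unfolding G2_def using cl(4) i2 by simp
  have n1: "AE s in \<mu>. 0 \<le> G1 s" using fy by eventually_elim (simp add: G1_def)
  have n2: "AE s in M. 0 \<le> G2 s" using wd by eventually_elim (auto simp: G2_def indicator_def)
  define G where "G = (\<integral>s. G1 s \<partial>\<mu>) + (\<integral>s. G2 s \<partial>M)"
  have p1: "0 \<le> (\<integral>s. G1 s \<partial>\<mu>)" by (rule integral_nonneg_AE[OF n1])
  have p2: "0 \<le> (\<integral>s. G2 s \<partial>M)" by (rule integral_nonneg_AE[OF n2])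
  have e1: "(\<integral>s. G1 s \<partial>\<mu>) = (\<integral>s. hr (w s) s \<partial>\<mu>) + (\<integral>s. kap (y s) s \<partial>\<mu>) - (\<integral>s. y s * w s \<partial>\<mu>)"
    unfolding G1_def using fB(5) cl(2) i1 by simp
  have e2: "(\<integral>s. G2 s \<partial>M) = (\<integral>s. indicator N s * dr s \<partial>M) - (\<integral>s. indicator N s * w s \<partial>M)"
    unfolding G2_def using cl(4) i2 by simp
  have wsum: "(\<integral>s. w s \<partial>M) = - (\<integral>s. path_sum T x s \<partial>\<mu>)" unfolding w_def using ps by simp
  have B: "objB T \<mu> h x = ereal (G - I)"
  proof -
    have "(\<integral>s. path_sum T x s + hr (w s) s \<partial>\<mu>) = (\<integral>s. path_sum T x s \<partial>\<mu>) + (\<integral>s. hr (w s) s \<partial>\<mu>)"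
      by (rule Bochner_Integration.integral_add[OF pi fB(5)])
    \<comment> \<open>The terms linear in \<open>w\<close> cancel: together they form the integral
      of \<open>w\<close> under \<open>M\<close>, which is minus the integral of the path sum under
      \<open>\<mu>\<close>.\<close>
    also have "\<dots> = G - I" unfolding G_def I_def e1 e2 using wsum di(2)[OF wM] by simp
    finally show ?thesis unfolding fB(6) by simp
  qed
  have z1: "(\<integral>s. G1 s \<partial>\<mu>) = 0 \<longleftrightarrow> (AE s in \<mu>. y s \<in> integrand_subdiff h (w s) s)"
    unfolding integral_nonneg_eq_0_iff_AE[OF g1 n1]
  proof -
    have "AE s in \<mu>. G1 s = 0 \<longleftrightarrow> y s \<in> integrand_subdiff h (w s) s"
      using cl(1) fB(4)
    proof eventually_elim
      case (elim s)
      show ?case unfolding G1_def conj_eq_iff_subdiff(2)[OF elim(2) elim(1)] by (rule refl)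
    qed
    then show "(AE s in \<mu>. G1 s = 0) \<longleftrightarrow> (AE s in \<mu>. y s \<in> integrand_subdiff h (w s) s)" by (rule eventually_cong)
  qed
  have z2: "(\<integral>s. G2 s \<partial>M) = 0 \<longleftrightarrow> (AE s in M. s \<in> N \<longrightarrow> ereal (w s) = d s)"
    unfolding integral_nonneg_eq_0_iff_AE[OF g2 n2]
  proof -
    have "AE s in M. G2 s = 0 \<longleftrightarrow> (s \<in> N \<longrightarrow> ereal (w s) = d s)"
      using wd by eventually_elim (auto simp: G2_def indicator_def)
    then show "(AE s in M. G2 s = 0) \<longleftrightarrow> (AE s in M. s \<in> N \<longrightarrow> ereal (w s) = d s)" by (rule eventually_cong)
  qed
  have "G = 0 \<longleftrightarrow> (\<integral>s. G1 s \<partial>\<mu>) = 0 \<and> (\<integral>s. G2 s \<partial>M) = 0" unfolding G_def using p1 p2 by linarith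
  then have "G = 0 \<longleftrightarrow> (AE s in \<mu>. y s \<in> integrand_subdiff h (w s) s) \<and> (AE s in M. s \<in> N \<longrightarrow> ereal (w s) = d s)"
    unfolding z1 z2 .
  moreover have "0 \<le> G" unfolding G_def using p1 p2 by simp
  ultimately show ?thesis using A B unfolding w_def by blast
qed

text \<open>\<open>pair_gap\<close> is phrased with the witnesses \<open>y\<close> and
  \<open>N\<close>; here it is carried over to the parts and chosen densities of the signed
  measure.\<close>

lemma optimality_condition:
  assumes cases: "\<mu> = PiM {..T} m \<or> T = 1"
    and x: "feasible (constrB T S \<mu> h) (objB T \<mu> h) x"
    and \<nu>: "feasible (constrA T S \<psi> \<mu>) (objA X wt \<mu> h) \<nu>"
  shows "\<exists>c G. objA X wt \<mu> h \<nu> = ereal c \<and> objB T \<mu> h x = ereal (G - c) \<and> 0 \<le> G \<and>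
    (G = 0 \<longleftrightarrow> (AE s in \<mu>. signed_density \<mu> (ac_part \<mu> \<nu>) s \<in> integrand_subdiff h (- path_sum T x s) s) \<and>
      (AE s in total_var \<mu> (sing_part \<mu> \<nu>).
        signed_density (total_var \<mu> (sing_part \<mu> \<nu>)) (sing_part \<mu> \<nu>) s \<in> ncone (D s) (- path_sum T x s)))"
proof -
  have \<nu>': "\<nu> \<in> constrA T S \<psi> \<mu>" "objA X wt \<mu> h \<nu> < \<infinity>" using \<nu> by (simp_all add: feasible_def)
  obtain M where M: "coupling M" and eq: "\<nu> = measure M" using feasible_A_coupling[OF \<nu>'] by (elim exE conjE)
  obtain y N where dec: "decomp M y N" using decomp_exists[OF M] by (elim exE)
  have ac: "(AE s in \<mu>. signed_density \<mu> (ac_part \<mu> \<nu>) s \<in> integrand_subdiff h (- path_sum T x s) s) \<longleftrightarrow>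
      (AE s in \<mu>. y s \<in> integrand_subdiff h (- path_sum T x s) s)"
  proof (rule eventually_cong)
    show "AE s in \<mu>. (signed_density \<mu> (ac_part \<mu> \<nu>) s \<in> integrand_subdiff h (- path_sum T x s) s) =
        (y s \<in> integrand_subdiff h (- path_sum T x s) s)"
      using decomp_parts(4)[OF M dec] unfolding eq by eventually_elim simp
  qed
  show ?thesis
    using pair_gap[OF cases x M \<nu>'(2)[unfolded eq] dec]
    unfolding ac unfolding eq singular_condition[OF M dec] .
qed

lemma dual_exists: "\<exists>\<nu>\<in>constrA T S \<psi> \<mu>. objA X wt \<mu> h \<nu> \<le> ereal (- p0)"
proof (rule dual_measure)
  fix M assume M: "sets M = sets (borel_of X)" "finite_measure M"
    "\<And>t. t \<le> T \<Longrightarrow> distr M (borel_of (S t)) (\<lambda>s. s t) = m t"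
    and b: "\<And>u. u \<in> C \<Longrightarrow> H u < \<infinity> \<Longrightarrow> (\<integral>s. u s \<partial>M) - real_of_ereal (H u) \<le> - p0"
  have c: "coupling M" using M by (simp add: coupling_def)
  have "objA X wt \<mu> h (measure M) \<le> ereal (- p0)" unfolding objA_le_iff[OF c] using b by simp
  then show "\<exists>\<nu>\<in>constrA T S \<psi> \<mu>. objA X wt \<mu> h \<nu> \<le> ereal (- p0)" using constrA_I[OF c] by (rule bexI)
qed

end

theorem theorem19:
  fixes T :: nat
    and S :: "nat \<Rightarrow> 'a topology"
    and \<psi> :: "nat \<Rightarrow> 'a \<Rightarrow> real"
    and \<mu> :: "(nat \<Rightarrow> 'a) measure"
    and h :: "real \<Rightarrow> (nat \<Rightarrow> 'a) \<Rightarrow> ereal"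
  assumes polish: "\<And>t. t \<le> T \<Longrightarrow> polish_topology (S t)"
    and psi_cont: "\<And>t. t \<le> T \<Longrightarrow> continuous_map (S t) euclideanreal (\<psi> t)"
    and psi_ge1: "\<And>t y. t \<le> T \<Longrightarrow> y \<in> topspace (S t) \<Longrightarrow> 1 \<le> \<psi> t y"
    and mu_prob: "prob_space \<mu>"
    and mu_sets: "sets \<mu> = sets (borel_of (prod_top T S))"
    and mu_marg: "\<And>t. t \<le> T \<Longrightarrow> integrable (marg S \<mu> t) (\<psi> t)"
    and h_normal: "convex_normal_integrand (borel_of (prod_top T S)) h"
    and h_mono: "\<And>s. s \<in> topspace (prod_top T S) \<Longrightarrow> mono (\<lambda>u. h u s)"
    and D_isc: "inner_semicontinuous (prod_top T S) (cl_dom h)"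
    and cl_dom_H:
      "wC_top (prod_top T S) (weight T \<psi>) closure_of
         {u \<in> wC (prod_top T S) (weight T \<psi>). H_fun (prod_top T S) (weight T \<psi>) \<mu> h u < \<infinity>}
       = wC_sel (prod_top T S) (weight T \<psi>) (cl_dom h)"
    and H_cont:
      "\<exists>u \<in> wC (prod_top T S) (weight T \<psi>).
         \<bar>H_fun (prod_top T S) (weight T \<psi>) \<mu> h u\<bar> \<noteq> \<infinity> \<and>
         topcontinuous_at (wC_top (prod_top T S) (weight T \<psi>)) euclidean
           (H_fun (prod_top T S) (weight T \<psi>) \<mu> h) u"
    and h_conj: "\<forall>\<^sub>F v in nhds 1. ext_integrable \<mu> (integrand_conj h v)"
    and mu_prod: "\<mu> = PiM {..T} (marg S \<mu>) \<or>
      T = 1 \<and> absolutely_continuous \<mu> (PiM {..T} (marg S \<mu>))"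
  shows
    "(\<exists>\<nu>. optimal (constrA T S \<psi> \<mu>) (objA (prod_top T S) (weight T \<psi>) \<mu> h) \<nu>) \<and>
     (\<exists>x. optimal (constrB T S \<mu> h) (objB T \<mu> h) x) \<and>
     (INF x\<in>constrB T S \<mu> h. objB T \<mu> h x) =
       - (INF \<nu>\<in>constrA T S \<psi> \<mu>. objA (prod_top T S) (weight T \<psi>) \<mu> h \<nu>) \<and>
     (\<forall>x \<nu>. feasible (constrB T S \<mu> h) (objB T \<mu> h) x \<longrightarrow>
        feasible (constrA T S \<psi> \<mu>) (objA (prod_top T S) (weight T \<psi>) \<mu> h) \<nu> \<longrightarrow>
        (optimal (constrB T S \<mu> h) (objB T \<mu> h) x \<and>
         optimal (constrA T S \<psi> \<mu>) (objA (prod_top T S) (weight T \<psi>) \<mu> h) \<nu>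
         \<longleftrightarrow>
         (AE s in \<mu>. signed_density \<mu> (ac_part \<mu> \<nu>) s
            \<in> integrand_subdiff h (- path_sum T x s) s) \<and>
         (AE s in total_var \<mu> (sing_part \<mu> \<nu>).
            signed_density (total_var \<mu> (sing_part \<mu> \<nu>)) (sing_part \<mu> \<nu>) s
            \<in> ncone (cl_dom h s) (- path_sum T x s)))) \<and>
     (\<mu> = PiM {..T} (marg S \<mu>) \<longrightarrow>
        (\<forall>x. feasible (constrB T S \<mu> h) (objB T \<mu> h) x \<longrightarrow>
           (\<forall>t\<le>T. integrable (marg S \<mu> t) (x t))))"
proof -
  interpret ot_setup T S \<psi> \<mu> h
  proof (rule ot_setup.intro)
    show "\<exists>u \<in> wC (prod_top T S) (weight T \<psi>). H_fun (prod_top T S) (weight T \<psi>) \<mu> h u < \<infinity>"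
      using H_cont by (elim bexE conjE) (rule bexI, auto)
  qed (rule polish psi_cont psi_ge1 mu_prob mu_sets mu_marg h_normal h_mono D_isc cl_dom_H h_conj; assumption)+
  let ?FA = "constrA T S \<psi> \<mu>" and ?A = "objA (prod_top T S) (weight T \<psi>) \<mu> h"
    and ?FB = "constrB T S \<mu> h" and ?B = "objB T \<mu> h"
  have cases: "\<mu> = PiM {..T} (marg S \<mu>) \<or> T = 1" using mu_prod by auto
  have ac: "absolutely_continuous \<mu> (PiM {..T} (marg S \<mu>))"
    using mu_prod
  proof
    assume e: "\<mu> = PiM {..T} (marg S \<mu>)"
    have "absolutely_continuous \<mu> \<mu>" by (simp add: absolutely_continuous_def)
    then show ?thesis using arg_cong[OF e, of "absolutely_continuous \<mu>"] by simp
  qed (rule conjunct2)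
  obtain \<nu>0 where \<nu>0: "\<nu>0 \<in> ?FA" "?A \<nu>0 \<le> ereal (- p0)" using dual_exists by (elim bexE)
  obtain x0 where x0: "x0 \<in> ?FB" "?B x0 \<le> ereal p0" using primal_exists[OF ac] by (elim bexE)
  have fx0: "feasible ?FB ?B x0" using x0 by (auto simp: feasible_def intro: le_less_trans)
  have f\<nu>0: "feasible ?FA ?A \<nu>0" using \<nu>0 by (auto simp: feasible_def intro: le_less_trans)
  have gap: "\<exists>c G. ?A \<nu> = ereal c \<and> ?B x = ereal (G - c) \<and> 0 \<le> G"
    if "feasible ?FB ?B x" "feasible ?FA ?A \<nu>" for x \<nu>
    using optimality_condition[OF cases that] by blast
  \<comment> \<open>Since \<open>G \<ge> 0\<close>, the two values add up to at least 0, so neither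
    can lie strictly below its upper bound.\<close>
  have A0: "?A \<nu>0 = ereal (- p0)" and B0: "?B x0 = ereal p0"
    using gap[OF fx0 f\<nu>0] x0(2) \<nu>0(2) by auto
  have optA: "?A \<nu>0 \<le> ?A \<nu>" if "\<nu> \<in> ?FA" for \<nu>
  proof (cases "?A \<nu> < \<infinity>")
    case True
    then have "feasible ?FA ?A \<nu>" using that by (simp add: feasible_def)
    from gap[OF fx0 this] show ?thesis unfolding A0 B0 by auto
  next
    case False
    then show ?thesis by (simp add: not_less)
  qed
  have optB: "?B x0 \<le> ?B x" if "x \<in> ?FB" for x
  proof (cases "?B x < \<infinity>")
    case True
    then have "feasible ?FB ?B x" using that by (simp add: feasible_def)
    from gap[OF this f\<nu>0] show ?thesis unfolding A0 B0 by auto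
  next
    case False
    then show ?thesis by (simp add: not_less)
  qed
  have infA: "(INF \<nu>\<in>?FA. ?A \<nu>) = ereal (- p0)"
    unfolding A0[symmetric] by (rule antisym[OF INF_lower[OF \<nu>0(1)] INF_greatest]) (rule optA)
  have infB: "(INF x\<in>?FB. ?B x) = ereal p0"
    unfolding B0[symmetric] by (rule antisym[OF INF_lower[OF x0(1)] INF_greatest]) (rule optB)
  have optimal_A: "optimal ?FA ?A \<nu> \<longleftrightarrow> ?A \<nu> = ereal (- p0)" if f: "feasible ?FA ?A \<nu>" for \<nu>
  proof
    assume "optimal ?FA ?A \<nu>"
    then have "?A \<nu> \<le> ?A \<nu>0" using \<nu>0(1) by (simp add: optimal_def)
    then show "?A \<nu> = ereal (- p0)" using optA[of \<nu>] f unfolding A0 feasible_def by (intro antisym) auto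
  next
    assume "?A \<nu> = ereal (- p0)"
    then show "optimal ?FA ?A \<nu>" using f optA unfolding optimal_def A0 by simp
  qed
  have optimal_B: "optimal ?FB ?B x \<longleftrightarrow> ?B x = ereal p0" if f: "feasible ?FB ?B x" for x
  proof
    assume "optimal ?FB ?B x"
    then have "?B x \<le> ?B x0" using x0(1) by (simp add: optimal_def)
    then show "?B x = ereal p0" using optB[of x] f unfolding B0 feasible_def by (intro antisym) auto
  next
    assume "?B x = ereal p0"
    then show "optimal ?FB ?B x" using f optB unfolding optimal_def B0 by simp
  qed
  show ?thesis
  proof (intro conjI allI impI)
    show "\<exists>\<nu>. optimal ?FA ?A \<nu>" using optimal_A[OF f\<nu>0] A0 by (intro exI[of _ \<nu>0]) simp
    show "\<exists>x. optimal ?FB ?B x" using optimal_B[OF fx0] B0 by (intro exI[of _ x0]) simp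
    show "(INF x\<in>?FB. ?B x) = - (INF \<nu>\<in>?FA. ?A \<nu>)" unfolding infA infB by simp
  next
    fix x \<nu> assume x: "feasible ?FB ?B x" and \<nu>: "feasible ?FA ?A \<nu>"
    let ?cond = "(AE s in \<mu>. signed_density \<mu> (ac_part \<mu> \<nu>) s \<in> integrand_subdiff h (- path_sum T x s) s) \<and>
      (AE s in total_var \<mu> (sing_part \<mu> \<nu>).
        signed_density (total_var \<mu> (sing_part \<mu> \<nu>)) (sing_part \<mu> \<nu>) s \<in> ncone (cl_dom h s) (- path_sum T x s))"
    obtain c G where c: "?A \<nu> = ereal c" "?B x = ereal (G - c)" and iff: "G = 0 \<longleftrightarrow> ?cond"
      using optimality_condition[OF cases x \<nu>] by (elim exE conjE)
    \<comment> \<open>The gap is the sum of the excess of \<open>c\<close> over \<open>- p0\<close>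
      and that of \<open>G - c\<close> over \<open>p0\<close>, both nonnegative; it vanishes exactly
      when both points are optimal.\<close>
    have "- p0 \<le> c" using optA[of \<nu>] \<nu> unfolding A0 c feasible_def by simp
    moreover have "p0 \<le> G - c" using optB[of x] x unfolding B0 c feasible_def by simp
    ultimately show "(optimal ?FB ?B x \<and> optimal ?FA ?A \<nu>) = ?cond"
      unfolding iff[symmetric] optimal_A[OF \<nu>] optimal_B[OF x] c by auto
  next
    fix x t assume e: "\<mu> = PiM {..T} (marg S \<mu>)" and x: "feasible ?FB ?B x" and t: "t \<le> T"
    show "integrable (marg S \<mu> t) (x t)"
      by (rule product_summands_integrable[OF e feasible_B(1)[OF x] feasible_B(3)[OF x] t])
  qed
qed

end
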